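(* Let $\eta$ be a stationary Poisson hyperplane process in $\mathbb{R}^d$ with intensity parameter $\gamma>0$ and directional distribution $\mathbb{Q}$ (an even probability measure on $\mathbb{S}^{d-1}$ not concentrated on a great subsphere). Let $m\in\{1,\ldots,d\}$, let $\Phi_m$ be the random measure on $\mathbb{R}^d$ given by $$\Phi_m(C)=\frac{1}{m!}\sum_{H_1,\ldots,H_m\in\eta\ \text{pairwise distinct}}\mathcal{H}^{d-m}(C\cap H_1\cap\cdots\cap H_m),\qquad C\subset\mathbb{R}^d\text{ Borel},$$ and let $B\subset\mathbb{R}^d$ be a bounded Borel set. Then there exists a $\Phi_m$-stopping set $Z$ with $Z\subset B^c$ and such that $(\Phi_m)_B$ is almost surely determined by $(\Phi_m)_Z$. Moreover, there exist constants $c_1,c_2>0$ such that $$\mathbb{P}(R(Z)>s)\le c_1e^{-c_2 s},\qquad s\ge 1.$$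
   Context: All random objects are defined on a fixed probability space $(\Omega,\mathcal{F},\mathbb{P})$, and $\mathbb{R}^d$ is the $d$-dimensional Euclidean space. Hyperplanes: $\mathbb{H}^{d-1}$ is the space of all (affine) hyperplanes in $\mathbb{R}^d$; each is of the form $H_{u,s}=\{y\in\mathbb{R}^d:\langle y,u\rangle=s\}$ with $u\in\mathbb{S}^{d-1}$ (unit sphere), $s\in\mathbb{R}$. For compact $K\subset\mathbb{R}^d$ put $[K]:=\{H\in\mathbb{H}^{d-1}:H\cap K\neq\emptyset\}$; $\mathbb{H}^{d-1}$ carries the smallest $\sigma$-field containing all sets $[K]$, $K$ compact. Poisson hyperplane process: $\eta$ is a Poisson process on $\mathbb{H}^{d-1}$ with intensity measure $\lambda=\gamma\int_{\mathbb{S}^{d-1}}\int_{\mathbb{R}}\mathbf{1}\{H_{u,s}\in\cdot\}\,ds\,\mathbb{Q}(du)$, where $\gamma>0$ and $\mathbb{Q}$ is an even probability measure on $\mathbb{S}^{d-1}$ not concentrated on a great subsphere (the intersection of $\mathbb{S}^{d-1}$ with a $(d-1)$-dimensional linear subspace). $\eta$ is regarded as a random discrete subset of $\mathbb{H}^{d-1}$, and it is assumed without loss of generality that $|\eta(\omega)\cap[K]|<\infty$ for all $\omega\in\Omega$ and all compact $K$. $\mathcal{H}^{k}$ is the $k$-dimensional Hausdorff measure on $\mathbb{R}^d$ ($\mathcal{H}^0$ is counting measure). The random measures $\Phi_1,\ldots,\Phi_d$ are almost surely locally finite (finite on bounded Borel sets). Stopping sets: for a random measure $\Psi$ on $\mathbb{R}^d$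 and a Borel set $B$, $\Psi_B:=\Psi(\cdot\cap B)$ is the restriction of $\Psi$ to $B$. A mapping $Z$ from $\Omega$ into the space of non-empty closed subsets of $\mathbb{R}^d$ is a $\Psi$-stopping set if for each closed $F\subset\mathbb{R}^d$ the event $\{Z\subset F\}:=\{\omega:Z(\omega)\subset F\}$ belongs to the $\sigma$-field $\sigma(\Psi_F)$ generated by $\Psi_F$. $\Psi_Z$ is the random measure $\omega\mapsto\Psi(\omega)_{Z(\omega)}$. For a $\Psi$-stopping set $Z$, a random object $X$ (here $X=(\Phi_m)_B$) is almost surely determined by $\Psi_Z$ if there is a measurable mapping $f$ (with suitable domain) such that $X=f(\Psi_Z)$ almost surely. Size: for closed $F\subset\mathbb{R}^d$, $R(F)$ is the radius of the smallest ball centred at the origin containing $F$, with $R(F):=\infty$ if $F$ is unbounded. $B^c$ denotes the complement $\mathbb{R}^d\setminus B$.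
   Formalization: The dimension is assumed to satisfy d ≥ 2; for d = 1 and B = [0,1] the claim is false, since Φ_1 is a Poisson process on the line and its restriction to B is independent of what any stopping set in the complement of B can observe. *)

theory Defs
  imports "HOL-Probability.Probability"
begin

section \<open>Hausdorff measure\<close>

text \<open>Contribution of one covering set, normalised by the volume of the unit ball of
  \<open>\<real>\<^sup>k\<close>. The empty set is singled out because \<open>0 ^ 0 = 1\<close>: it must contribute nothing
  also for \<open>k = 0\<close>, where the construction then yields the counting measure.\<close>

definition hausdorff_gauge :: "nat \<Rightarrow> 'a::metric_space set \<Rightarrow> ennreal" where
  "hausdorff_gauge k U =
     (if U = {} then 0 else ennreal (unit_ball_vol (real k) * (diameter U / 2) ^ k))"

definition hausdorff_premeasure :: "nat \<Rightarrow> real \<Rightarrow> 'a::metric_space set \<Rightarrow> ennreal" where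
  "hausdorff_premeasure k \<delta> A =
     (INF U\<in>{U :: nat \<Rightarrow> 'a set. A \<subseteq> (\<Union>i. U i) \<and> (\<forall>i. bounded (U i) \<and> diameter (U i) \<le> \<delta>)}.
        \<Sum>i. hausdorff_gauge k (U i))"

definition hausdorff_measure :: "nat \<Rightarrow> 'a::metric_space set \<Rightarrow> ennreal" where
  "hausdorff_measure k A = (SUP \<delta>\<in>{0<..}. hausdorff_premeasure k \<delta> A)"

section \<open>Hyperplanes and the Poisson hyperplane process\<close>

definition hyperplane :: "'a::euclidean_space \<Rightarrow> real \<Rightarrow> 'a set" where
  "hyperplane u s = {y. y \<bullet> u = s}"

definition hyperplanes :: "'a::euclidean_space set set" where
  "hyperplanes = {hyperplane u s | u s. u \<in> sphere 0 1}"

definition hitting :: "'a::euclidean_space set \<Rightarrow> 'a set set" where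
  "hitting K = {H \<in> hyperplanes. H \<inter> K \<noteq> {}}"

definition hyperplane_space :: "'a::euclidean_space set measure" where
  "hyperplane_space = sigma hyperplanes {hitting K | K. compact K}"

text \<open>\<open>Q\<close> is an even probability measure on the unit sphere, carrying the Borel sets of
  the sphere, that is not concentrated on a great subsphere.\<close>

definition directional_distribution :: "'a::euclidean_space measure \<Rightarrow> bool" where
  "directional_distribution Q \<longleftrightarrow>
     prob_space Q \<and>
     sets Q = sets (restrict_space borel (sphere 0 1)) \<and>
     (\<forall>A\<in>sets Q. emeasure Q (uminus ` A) = emeasure Q A) \<and>
     (\<forall>L. subspace L \<and> dim L = DIM('a) - 1 \<longrightarrow> emeasure Q (sphere 0 1 \<inter> L) \<noteq> 1)"

definition hyperplane_intensity :: "real \<Rightarrow> 'a::euclidean_space measure \<Rightarrow> 'a set measure" where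
  "hyperplane_intensity \<gamma> Q =
     scale_measure (ennreal \<gamma>)
       (distr (Q \<Otimes>\<^sub>M lborel) hyperplane_space (\<lambda>(u, s). hyperplane u s))"

definition point_count :: "'b set \<Rightarrow> 'b set \<Rightarrow> ennreal" where
  "point_count X A = emeasure (count_space UNIV) (X \<inter> A)"

text \<open>A Poisson process with intensity measure \<open>\<Lambda>\<close>, regarded as a random set of points.
  Measurability of the counts is part of \<open>indep_vars\<close> (take \<open>n = 1\<close>). The Poisson
  distribution with parameter \<open>\<infinity>\<close> is the point mass at \<open>\<infinity>\<close>.\<close>

definition poisson_process :: "'w measure \<Rightarrow> 'b measure \<Rightarrow> ('w \<Rightarrow> 'b set) \<Rightarrow> bool" where
  "poisson_process M \<Lambda> \<eta> \<longleftrightarrow>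
     (\<forall>\<omega>\<in>space M. \<eta> \<omega> \<subseteq> space \<Lambda>) \<and>
     (\<forall>A\<in>sets \<Lambda>. emeasure \<Lambda> A < \<infinity> \<longrightarrow>
        (\<forall>k::nat. measure M {\<omega>\<in>space M. point_count (\<eta> \<omega>) A = of_nat k} =
           measure \<Lambda> A ^ k / fact k * exp (- measure \<Lambda> A))) \<and>
     (\<forall>A\<in>sets \<Lambda>. emeasure \<Lambda> A = \<infinity> \<longrightarrow> (AE \<omega> in M. point_count (\<eta> \<omega>) A = \<infinity>)) \<and>
     (\<forall>(n::nat) A. (\<forall>i<n. A i \<in> sets \<Lambda>) \<and> disjoint_family_on A {..<n} \<longrightarrow>
        prob_space.indep_vars M (\<lambda>_. borel) (\<lambda>i \<omega>. point_count (\<eta> \<omega>) (A i)) {..<n})"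

definition poisson_hyperplane_process ::
    "'w measure \<Rightarrow> real \<Rightarrow> 'a::euclidean_space measure \<Rightarrow> ('w \<Rightarrow> 'a set set) \<Rightarrow> bool" where
  "poisson_hyperplane_process M \<gamma> Q \<eta> \<longleftrightarrow>
     poisson_process M (hyperplane_intensity \<gamma> Q) \<eta> \<and>
     (\<forall>\<omega>\<in>space M. \<forall>K. compact K \<longrightarrow> finite (\<eta> \<omega> \<inter> hitting K))"

text \<open>For \<open>X = \<eta> \<omega>\<close> this is the measure \<open>\<Phi>\<^sub>m(\<omega>)\<close>. The sum over \<open>m\<close>-tuples of pairwise
  distinct hyperplanes is the integral over the counting measure on the distinct lists
  of length \<open>m\<close>. The set function is countably additive because
  \<open>hausdorff_measure k\<close> is so on Borel sets.\<close>

definition intersection_measure :: "nat \<Rightarrow> 'a::euclidean_space set set \<Rightarrow> 'a measure" where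
  "intersection_measure m X =
     measure_of UNIV (sets borel) (\<lambda>C. ennreal (1 / fact m) *
       (\<integral>\<^sup>+ Hs. hausdorff_measure (DIM('a) - m) (C \<inter> \<Inter>(set Hs))
          \<partial>count_space {Hs. length Hs = m \<and> distinct Hs \<and> set Hs \<subseteq> X}))"

section \<open>Random measures and stopping sets\<close>

text \<open>All Borel measures, with the \<open>\<sigma>\<close>-field generated by the evaluations on Borel sets.
  Measures that are not locally finite are included, since the random measures
  considered here are locally finite only almost surely.\<close>

definition borel_measures :: "'a::topological_space measure measure" where
  "borel_measures =
     (SUP C\<in>sets borel. vimage_algebra {\<mu>. sets \<mu> = sets borel} (\<lambda>\<mu>. emeasure \<mu> C) borel)"

text \<open>For Borel \<open>B\<close> this is \<open>\<mu>(\<cdot> \<inter> B)\<close> as a measure on the whole space.\<close>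

definition meas_restr :: "'a measure \<Rightarrow> 'a set \<Rightarrow> 'a measure" where
  "meas_restr \<mu> B = density \<mu> (indicator B)"

definition sigma_restr ::
    "'w measure \<Rightarrow> ('w \<Rightarrow> 'a::topological_space measure) \<Rightarrow> 'a set \<Rightarrow> 'w measure" where
  "sigma_restr M \<Psi> F = vimage_algebra (space M) (\<lambda>\<omega>. meas_restr (\<Psi> \<omega>) F) borel_measures"

definition stopping_set ::
    "'w measure \<Rightarrow> ('w \<Rightarrow> 'a::topological_space measure) \<Rightarrow> ('w \<Rightarrow> 'a set) \<Rightarrow> bool" where
  "stopping_set M \<Psi> Z \<longleftrightarrow>
     (\<forall>\<omega>\<in>space M. closed (Z \<omega>) \<and> Z \<omega> \<noteq> {}) \<and>
     (\<forall>F. closed F \<longrightarrow> {\<omega>\<in>space M. Z \<omega> \<subseteq> F} \<in> sets (sigma_restr M \<Psi> F))"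

definition as_determined ::
    "'w measure \<Rightarrow> 'x measure \<Rightarrow> ('w \<Rightarrow> 'x) \<Rightarrow> 'y measure \<Rightarrow> ('w \<Rightarrow> 'y) \<Rightarrow> bool" where
  "as_determined M N X L Y \<longleftrightarrow> (\<exists>f\<in>measurable L N. AE \<omega> in M. X \<omega> = f (Y \<omega>))"

text \<open>The infimum over the empty set is \<open>\<infinity>\<close>, which covers unbounded \<open>F\<close>.\<close>

definition origin_radius :: "'a::real_normed_vector set \<Rightarrow> ereal" where
  "origin_radius F = (INF r\<in>{r::real. 0 \<le> r \<and> F \<subseteq> cball 0 r}. ereal r)"

end

theory Submission
  imports Defs
begin

text \<open>Almost surely the hyperplanes are in general position. For \<open>m < d\<close> the \<open>(d-m)\<close>-flats are
  unbounded and therefore determined by their traces in a fixed shell around \<open>B\<close>, so a constant \<open>Z\<close>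
  suffices. For \<open>m = d\<close> only the vertices of the tessellation are seen. A line through \<open>B\<close> cut out by
  \<open>d - 1\<close> hyperplanes can be read off from any three of its vertices outside \<open>B\<close>, because in general
  position three collinear vertices lie on such a line, and the vertices in \<open>B\<close> are the points in
  which two such lines cross. \<open>Z\<close> is the first annulus whose vertices exhibit, near
  the points of a finite grid scaled by its radius, hyperplanes that are almost orthogonal to the vectors of
  a fixed basis \<open>U\<close> in the support of \<open>Q\<close>: every line meeting \<open>B\<close> crosses
  at least three of these inside the annulus. The hyperplanes needed at scale \<open>n\<close> come from finitely
  many sets of intensity at least \<open>\<kappa> n\<close>, whence the exponential tail.\<close>

section \<open>Hausdorff measure on flats\<close>

text \<open>Two demands shape the proof. First, \<open>Z\<close> must be decided for every
  \<open>\<omega>\<close> by a restricted measure alone, also where the hyperplanes are not in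
  general position, and its radius must give events of \<open>M\<close>, although
  \<open>\<Phi>\<close> is not given as a measurable map into measures. Hence goodness of an annulus
  is phrased by countably many conditions that small balls carry mass. Such a condition is
  measurable in the restricted measure by definition, and in \<open>M\<close> because it can be
  expressed by counts of hyperplanes hitting balls. General position enters only when the
  reconstruction is evaluated and when good annuli are shown to be likely. Second, the determination
  needs a measurable map. Instead of selecting points or flats, the reconstructions are nested
  integrals of the observed measure against itself, so that measurability reduces to kernels of
  finite measures. Tolerances are spent in two halves: cells give frames of accuracy
  \<open>eps / 2\<close>, dense points then see accuracy below \<open>eps\<close>, and limits give
  at most \<open>eps\<close>, which the certificate uses.\<close>

lemma hausdorff_gauge_mono:
  assumes "A \<subseteq> U" "bounded U"
  shows "hausdorff_gauge k A \<le> hausdorff_gauge k U"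
proof (cases "A = {}")
  case False
  then have "U \<noteq> {}" using assms by auto
  have "diameter A \<le> diameter U" using assms by (rule diameter_subset)
  moreover have "0 \<le> diameter A" using assms bounded_subset by (auto intro: diameter_ge_0)
  ultimately have "(diameter A / 2) ^ k \<le> (diameter U / 2) ^ k"
    by (intro power_mono) auto
  then show ?thesis using False \<open>U \<noteq> {}\<close>
    by (auto simp: hausdorff_gauge_def intro!: ennreal_leI mult_left_mono)
qed (simp add: hausdorff_gauge_def)

lemma hausdorff_gauge_empty [simp]: "hausdorff_gauge k {} = 0"
  by (simp add: hausdorff_gauge_def)

lemma hausdorff_premeasure_le:
  assumes "A \<subseteq> (\<Union>i. U i)" "\<And>i. bounded (U i)" "\<And>i. diameter (U i) \<le> \<delta>"
  shows "hausdorff_premeasure k \<delta> A \<le> (\<Sum>i. hausdorff_gauge k (U i))"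
  unfolding hausdorff_premeasure_def using assms by (intro INF_lower) auto

lemma hausdorff_premeasure_mono:
  "A \<subseteq> B \<Longrightarrow> hausdorff_premeasure k \<delta> A \<le> hausdorff_premeasure k \<delta> B"
  unfolding hausdorff_premeasure_def by (intro INF_superset_mono) auto

lemma hausdorff_premeasure_antimono:
  "\<delta> \<le> \<epsilon> \<Longrightarrow> hausdorff_premeasure k \<epsilon> A \<le> hausdorff_premeasure k \<delta> A"
  unfolding hausdorff_premeasure_def
proof (rule INF_superset_mono)
  assume "\<delta> \<le> \<epsilon>"
  then show "{U::nat \<Rightarrow> 'a set. A \<subseteq> (\<Union>i. U i) \<and> (\<forall>i. bounded (U i) \<and> diameter (U i) \<le> \<delta>)}
      \<subseteq> {U. A \<subseteq> (\<Union>i. U i) \<and> (\<forall>i. bounded (U i) \<and> diameter (U i) \<le> \<epsilon>)}"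
    by (simp add: subset_iff) (meson order_trans)
qed simp

lemma hausdorff_measure_mono:
  "A \<subseteq> B \<Longrightarrow> hausdorff_measure k A \<le> hausdorff_measure k B"
  unfolding hausdorff_measure_def by (intro SUP_subset_mono hausdorff_premeasure_mono subset_refl)

lemma hausdorff_premeasure_le_measure:
  "\<delta> > 0 \<Longrightarrow> hausdorff_premeasure k \<delta> A \<le> hausdorff_measure k A"
  unfolding hausdorff_measure_def by (intro SUP_upper) auto

lemma hausdorff_measure_empty [simp]: "hausdorff_measure k {} = 0"
proof -
  have "hausdorff_premeasure k \<delta> {} \<le> 0" if "\<delta> > 0" for \<delta>
    using hausdorff_premeasure_le[of "{}" "\<lambda>_. {}" \<delta> k] that by (simp add: hausdorff_gauge_def)
  then have "hausdorff_measure k {} \<le> 0"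
    unfolding hausdorff_measure_def by (intro SUP_least) simp
  then show ?thesis by simp
qed

lemma hausdorff_premeasure_countably_subadditive:
  "hausdorff_premeasure k \<delta> (\<Union>n::nat. A n) \<le> (\<Sum>n. hausdorff_premeasure k \<delta> (A n))"
proof (cases "(\<Sum>n. hausdorff_premeasure k \<delta> (A n)) = \<infinity>")
  case False
  show ?thesis
  proof (rule ennreal_le_epsilon)
    fix e :: real assume e: "0 < e"
    have "\<exists>U. A n \<subseteq> (\<Union>i::nat. U i) \<and> (\<forall>i. bounded (U i) \<and> diameter (U i) \<le> \<delta>) \<and>
        (\<Sum>i. hausdorff_gauge k (U i)) < hausdorff_premeasure k \<delta> (A n) + ennreal (e * (1/2) ^ Suc n)" for n
    proof -
      have "hausdorff_premeasure k \<delta> (A n) \<noteq> \<infinity>"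
        using False by (metis ennreal_suminf_lessD infinity_ennreal_def top.not_eq_extremum)
      then have "hausdorff_premeasure k \<delta> (A n) < hausdorff_premeasure k \<delta> (A n) + ennreal (e * (1/2) ^ Suc n)"
        using e by (simp add: ennreal_zero_less_mult_iff top.not_eq_extremum)
      then show ?thesis
        unfolding hausdorff_premeasure_def by (subst (asm) INF_less_iff) auto
    qed
    then obtain U where U: "\<And>n. A n \<subseteq> (\<Union>i::nat. U n i)" "\<And>n i. bounded (U n i)"
        "\<And>n i. diameter (U n i) \<le> \<delta>"
        "\<And>n. (\<Sum>i. hausdorff_gauge k (U n i)) < hausdorff_premeasure k \<delta> (A n) + ennreal (e * (1/2) ^ Suc n)"
      by metis
    define W where "W j = (case prod_decode j of (n, i) \<Rightarrow> U n i)" for j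
    have W: "W (prod_encode (n, i)) = U n i" for n i by (simp add: W_def)
    have "hausdorff_premeasure k \<delta> (\<Union>n. A n) \<le> (\<Sum>j. hausdorff_gauge k (W j))"
    proof (rule hausdorff_premeasure_le)
      show "(\<Union>n. A n) \<subseteq> (\<Union>j. W j)"
      proof (rule UN_least, rule subsetI)
        fix n x assume "x \<in> A n"
        then obtain i where "x \<in> U n i" using U(1)[of n] by auto
        then have "x \<in> W (prod_encode (n, i))" using W by simp
        then show "x \<in> (\<Union>j. W j)" by blast
      qed
    qed (auto simp: W_def U split: prod.split)
    also have "\<dots> = (\<Sum>n. \<Sum>i. hausdorff_gauge k (U n i))"
      using suminf_ennreal_2dimen[of "\<lambda>n. \<Sum>i. hausdorff_gauge k (U n i)" "\<lambda>(n, i). hausdorff_gauge k (U n i)"]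
      by (simp add: W_def split_beta)
    also have "\<dots> \<le> (\<Sum>n. hausdorff_premeasure k \<delta> (A n) + ennreal (e * (1/2) ^ Suc n))"
      using U(4) by (intro suminf_le) (auto intro: less_imp_le)
    also have "\<dots> = (\<Sum>n. hausdorff_premeasure k \<delta> (A n)) + (\<Sum>n. ennreal (e * (1/2) ^ Suc n))"
      by (intro suminf_add[symmetric]) auto
    also have "(\<Sum>n. ennreal (e * (1/2) ^ Suc n)) = ennreal e"
    proof (rule suminf_ennreal_eq)
      show "(\<lambda>n. e * (1/2) ^ Suc n) sums e"
        using sums_mult[OF power_half_series, of e] by simp
    qed (use e in simp)
    finally show "hausdorff_premeasure k \<delta> (\<Union>n. A n) \<le> (\<Sum>n. hausdorff_premeasure k \<delta> (A n)) + ennreal e" .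
  qed
qed simp

lemma hausdorff_measure_countably_subadditive:
  "hausdorff_measure k (\<Union>n::nat. A n) \<le> (\<Sum>n. hausdorff_measure k (A n))"
  unfolding hausdorff_measure_def[of k "\<Union>n. A n"]
proof (rule SUP_least)
  fix \<delta> :: real assume "\<delta> \<in> {0<..}"
  then have "(\<Sum>n. hausdorff_premeasure k \<delta> (A n)) \<le> (\<Sum>n. hausdorff_measure k (A n))"
    by (intro suminf_le) (auto intro: hausdorff_premeasure_le_measure)
  then show "hausdorff_premeasure k \<delta> (\<Union>n. A n) \<le> (\<Sum>n. hausdorff_measure k (A n))"
    by (rule order_trans[OF hausdorff_premeasure_countably_subadditive])
qed

section \<open>Borel sets are measurable for the outer Hausdorff measure\<close>

lemma hausdorff_outer_measure_space:
  "outer_measure_space UNIV (hausdorff_measure k)"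
  unfolding outer_measure_space_def positive_def increasing_def countably_subadditive_def
  by (simp add: hausdorff_measure_mono hausdorff_measure_countably_subadditive)

lemma hausdorff_measure_subadditive:
  "hausdorff_measure k (A \<union> B) \<le> hausdorff_measure k A + hausdorff_measure k B"
proof -
  have "hausdorff_measure k (\<Union>n. binaryset A B n) \<le> (\<Sum>n. hausdorff_measure k (binaryset A B n))"
    by (rule hausdorff_measure_countably_subadditive)
  also have "\<dots> = hausdorff_measure k A + hausdorff_measure k B"
    by (rule suminf_binaryset_eq) simp
  finally show ?thesis by (simp add: UN_binaryset_eq)
qed

text \<open>A covering set of diameter below \<open>r\<close> cannot meet both \<open>A\<close> and
  \<open>B\<close>, so a fine cover of the union splits into a cover of each.\<close>

lemma hausdorff_measure_metric_additive:
  assumes r: "0 < r" "\<And>x y. x \<in> A \<Longrightarrow> y \<in> B \<Longrightarrow> r \<le> dist x y"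
  shows "hausdorff_measure k A + hausdorff_measure k B \<le> hausdorff_measure k (A \<union> B)"
proof -
  have *: "hausdorff_premeasure k \<delta> A + hausdorff_premeasure k \<delta> B \<le> hausdorff_measure k (A \<union> B)"
    if \<delta>: "0 < \<delta>" "\<delta> < r" for \<delta>
  proof -
    have "hausdorff_premeasure k \<delta> A + hausdorff_premeasure k \<delta> B \<le> hausdorff_premeasure k \<delta> (A \<union> B)"
      unfolding hausdorff_premeasure_def[of k \<delta> "A \<union> B"]
    proof (rule INF_greatest, clarify)
      fix U :: "nat \<Rightarrow> 'a set"
      assume U: "A \<union> B \<subseteq> (\<Union>i. U i)" "\<forall>i. bounded (U i) \<and> diameter (U i) \<le> \<delta>"
      have le: "hausdorff_premeasure k \<delta> C \<le> (\<Sum>i. hausdorff_gauge k (U i \<inter> C))" if "C \<subseteq> A \<union> B" for C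
      proof (rule hausdorff_premeasure_le)
        show "diameter (U i \<inter> C) \<le> \<delta>" for i
          using U(2) diameter_subset[of "U i \<inter> C" "U i"] by (meson inf_le1 order_trans)
      qed (use U that in \<open>auto intro: bounded_subset\<close>)
      have disj: "U i \<inter> A = {} \<or> U i \<inter> B = {}" for i
      proof (rule ccontr)
        assume "\<not> ?thesis"
        then obtain x y where "x \<in> U i" "x \<in> A" "y \<in> U i" "y \<in> B" by auto
        then have "r \<le> dist x y" "dist x y \<le> diameter (U i)"
          using r U by (auto intro: diameter_bounded_bound)
        then show False using U(2) \<delta> by (meson less_le_trans not_less order_trans)
      qed
      have "hausdorff_premeasure k \<delta> A + hausdorff_premeasure k \<delta> B
          \<le> (\<Sum>i. hausdorff_gauge k (U i \<inter> A)) + (\<Sum>i. hausdorff_gauge k (U i \<inter> B))"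
        by (intro add_mono le) auto
      also have "\<dots> = (\<Sum>i. hausdorff_gauge k (U i \<inter> A) + hausdorff_gauge k (U i \<inter> B))"
        by (intro suminf_add) auto
      also have "\<dots> \<le> (\<Sum>i. hausdorff_gauge k (U i))"
      proof (rule suminf_le)
        fix i
        show "hausdorff_gauge k (U i \<inter> A) + hausdorff_gauge k (U i \<inter> B) \<le> hausdorff_gauge k (U i)"
          using disj[of i] hausdorff_gauge_mono[of _ "U i" k] U(2) by auto
      qed auto
      finally show "hausdorff_premeasure k \<delta> A + hausdorff_premeasure k \<delta> B \<le> (\<Sum>i. hausdorff_gauge k (U i))" .
    qed
    then show ?thesis using hausdorff_premeasure_le_measure[OF \<delta>(1)] order_trans by blast
  qed
  \<comment> \<open>Premeasures grow as \<open>\<delta>\<close> decreases, so the scales below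
    \<open>r\<close> already determine the measure; by the same monotonicity both suprema can be
    taken jointly.\<close>
  have sup: "hausdorff_measure k C = (SUP \<delta>\<in>{0<..<r}. hausdorff_premeasure k \<delta> C)" for C :: "'a set"
    unfolding hausdorff_measure_def
  proof (rule SUP_eq)
    fix \<delta> :: real assume "\<delta> \<in> {0<..}"
    then show "\<exists>\<epsilon>\<in>{0<..<r}. hausdorff_premeasure k \<delta> C \<le> hausdorff_premeasure k \<epsilon> C"
      using r by (intro bexI[of _ "min \<delta> (r/2)"] hausdorff_premeasure_antimono) auto
  qed auto
  have "hausdorff_measure k A + hausdorff_measure k B
      = (SUP \<delta>\<in>{0<..<r}. hausdorff_premeasure k \<delta> A + hausdorff_premeasure k \<delta> B)"
    unfolding sup
  proof (rule SUP_add_directed_ennreal[symmetric])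
    fix i j assume "i \<in> {0<..<r}" "j \<in> {0<..<r}"
    then show "\<exists>l\<in>{0<..<r}. hausdorff_premeasure k i A + hausdorff_premeasure k j B
        \<le> hausdorff_premeasure k l A + hausdorff_premeasure k l B"
      by (intro bexI[of _ "min i j"] add_mono hausdorff_premeasure_antimono) auto
  qed 
  also have "\<dots> \<le> hausdorff_measure k (A \<union> B)"
    using * by (intro SUP_least) auto
  finally show ?thesis .
qed

text \<open>The gaps may depend on the pair, as they do for the shells below; the finitely many gaps
  to a newly added set have a positive minimum.\<close>

lemma hausdorff_measure_finite_separated:
  assumes "finite J" "\<And>i j x y. i \<in> J \<Longrightarrow> j \<in> J \<Longrightarrow> i \<noteq> j \<Longrightarrow> x \<in> R i \<Longrightarrow> y \<in> R j \<Longrightarrow> r i j \<le> dist x y"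
    "\<And>i j. i \<in> J \<Longrightarrow> j \<in> J \<Longrightarrow> i \<noteq> j \<Longrightarrow> 0 < r i j"
  shows "(\<Sum>j\<in>J. hausdorff_measure k (R j)) \<le> hausdorff_measure k (\<Union>j\<in>J. R j)"
  using assms
proof (induction J rule: finite_induct)
  case (insert j J)
  \<comment> \<open>The entry 1 keeps \<open>Min\<close> defined for empty \<open>J\<close>.\<close>
  define s where "s = Min (insert 1 ((\<lambda>i. r j i) ` J))"
  have s: "0 < s" "\<And>i. i \<in> J \<Longrightarrow> s \<le> r j i"
  proof -
    have "j \<noteq> i" if "i \<in> J" for i using that insert.hyps by auto
    then show "0 < s" using insert.hyps insert.prems(2)[of j] by (auto simp: s_def)
    show "\<And>i. i \<in> J \<Longrightarrow> s \<le> r j i" using insert.hyps by (auto simp: s_def)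
  qed
  have "(\<Sum>j\<in>insert j J. hausdorff_measure k (R j)) = hausdorff_measure k (R j) + (\<Sum>j\<in>J. hausdorff_measure k (R j))"
    using insert by simp
  also have "\<dots> \<le> hausdorff_measure k (R j) + hausdorff_measure k (\<Union>j\<in>J. R j)"
    using insert by (intro add_left_mono insert.IH) auto
  also have "\<dots> \<le> hausdorff_measure k (R j \<union> (\<Union>j\<in>J. R j))"
  proof (rule hausdorff_measure_metric_additive[OF s(1)])
    fix x y assume "x \<in> R j" "y \<in> (\<Union>j\<in>J. R j)"
    then obtain i where "i \<in> J" "y \<in> R i" by auto
    then show "s \<le> dist x y"
      using insert.prems(1)[of j i x y] insert.hyps s(2)[of i] \<open>x \<in> R j\<close>
      by (cases "j = i") (auto intro: order_trans)
  qed
  finally show ?case by simp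
qed simp

text \<open>The shells at distance about \<open>1/j\<close> from the closed set are separated for
  indices of the same parity; hence their measures are summable and their tails vanish.\<close>

lemma closed_lambda_system_hausdorff:
  assumes F: "closed F"
  shows "F \<in> lambda_system UNIV UNIV (hausdorff_measure k)"
proof -
  let ?H = "hausdorff_measure k"
  have "?H (A \<inter> F) + ?H (A - F) \<le> ?H A" for A :: "'a set"
  \<comment> \<open>\<open>infdist\<close> to the empty set is 0 by convention, which would leave
    every \<open>B n\<close> empty, so empty \<open>F\<close> is split off together with the trivial
    infinite case.\<close>
  proof (cases "?H A = \<infinity> \<or> F = {}")
    case False
    then have fin: "?H A < \<infinity>" and ne: "F \<noteq> {}" by (auto simp: top.not_eq_extremum)
    define B where "B n = {x\<in>A. 1 / real (Suc n) \<le> infdist x F}" for n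
    define R where "R n = B (Suc n) - B n" for n
    have Bsub: "B n \<subseteq> B (Suc n)" for n
    proof -
      have "1 / real (Suc (Suc n)) \<le> 1 / real (Suc n)" by (simp add: field_simps)
      then show ?thesis by (auto simp: B_def)
    qed
    have sepR: "(1 / real (Suc i) - 1 / real (Suc (Suc i))) \<le> dist x y"
      if "x \<in> R (Suc (Suc j))" "y \<in> R i'" "i' \<le> j" "i = Suc j" for i i' j x y
    proof -
      have x: "infdist x F < 1 / real (Suc (Suc (Suc j)))" using that by (auto simp: R_def B_def)
      have "1 / real (Suc (Suc j)) \<le> 1 / real (Suc (Suc i'))"
        using that by (intro divide_left_mono) auto
      moreover have "1 / real (Suc (Suc i')) \<le> infdist y F" using that by (auto simp: R_def B_def)
      ultimately have "1 / real (Suc (Suc j)) \<le> infdist y F" by simp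
      moreover have "infdist y F \<le> infdist x F + dist y x" by (rule infdist_triangle)
      ultimately show ?thesis using x that by (simp add: dist_commute)
    qed
    have sum_le: "(\<Sum>n<N. ?H (R (2 * n + c))) \<le> ?H A" for N c
    proof -
      have "(\<Sum>n<N. ?H (R (2 * n + c))) \<le> ?H (\<Union>n<N. R (2 * n + c))"
      proof (rule hausdorff_measure_finite_separated)
        let ?q = "\<lambda>m. 1 / real m - 1 / real (Suc m)"
        let ?r = "\<lambda>i j. ?q (max (2 * i + c) (2 * j + c))"
        show "?r i j \<le> dist x y"
          if "i \<noteq> j" "x \<in> R (2 * i + c)" "y \<in> R (2 * j + c)" for i j x y
        proof -
          consider "i < j" | "j < i" using \<open>i \<noteq> j\<close> nat_neq_iff by blast
          then show ?thesis
          proof cases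
            case 1
            then obtain l where l: "2 * j + c = Suc (Suc l)" "2 * i + c \<le> l"
              by (intro that[of "2 * j + c - 2"]) auto
            then show ?thesis using sepR[of y l x "2 * i + c" "Suc l"] that by (simp add: max_def dist_commute)
          next
            case 2
            then obtain l where l: "2 * i + c = Suc (Suc l)" "2 * j + c \<le> l"
              by (intro that[of "2 * i + c - 2"]) auto
            then show ?thesis using sepR[of x l y "2 * j + c" "Suc l"] that by (simp add: max_def dist_commute)
          qed
        qed
        show "0 < ?r i j" if "i \<noteq> j" for i j
        proof -
          have "0 < max (2 * i + c) (2 * j + c)" using that by (auto simp: max_def)
          then show ?thesis by (simp add: field_simps del: max_less_iff_conj)
        qed
      qed auto
      also have "\<dots> \<le> ?H A" by (rule hausdorff_measure_mono) (auto simp: R_def B_def)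
      finally show ?thesis .
    qed
    have part: "(\<Sum>n<N. ?H (R n)) \<le> ?H A + ?H A" for N
    proof -
      have "(\<Sum>n<N. ?H (R n)) \<le> (\<Sum>n<2 * N. ?H (R n))" by (intro sum_mono2) auto
      also have "\<dots> = (\<Sum>n<N. ?H (R (2 * n + 0))) + (\<Sum>n<N. ?H (R (2 * n + 1)))"
        by (induction N) (auto simp: algebra_simps)
      also have "\<dots> \<le> ?H A + ?H A" by (intro add_mono sum_le)
      finally show ?thesis .
    qed
    have "(\<Sum>n. ?H (R n)) \<le> ?H A + ?H A"
      unfolding suminf_eq_SUP by (intro SUP_least part)
    then have fins: "(\<Sum>n. ?H (R n)) < \<infinity>"
      using fin by (auto simp: ennreal_add_less_top order_le_less_trans)
    have cover: "A - F \<subseteq> B n \<union> (\<Union>i. R (i + n))" for n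
    proof
      fix x assume x: "x \<in> A - F"
      then have "0 < infdist x F"
        using F ne by (metis DiffD2 in_closed_iff_infdist_zero infdist_nonneg order_less_le)
      then obtain m where m: "1 / real (Suc m) < infdist x F" using nat_approx_posE by blast
      then have "x \<in> B m" using x by (auto simp: B_def)
      define l where "l = (LEAST m. x \<in> B m)"
      have l: "x \<in> B l" unfolding l_def using \<open>x \<in> B m\<close> by (rule LeastI)
      show "x \<in> B n \<union> (\<Union>i. R (i + n))"
      proof (cases "l \<le> n")
        case True
        have "B l \<subseteq> B n" using True Bsub by (rule lift_Suc_mono_le[rotated])
        then show ?thesis using l by auto
      next
        case False
        then obtain l' where l': "l = Suc l'" "n \<le> l'" by (cases l) auto
        have "x \<notin> B l'" using not_less_Least[of l' "\<lambda>m. x \<in> B m"] l' by (auto simp: l_def)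
        then have "x \<in> R ((l' - n) + n)" using l l' by (simp add: R_def)
        then show ?thesis by blast
      qed
    qed
    \<comment> \<open>\<open>B n\<close> has distance at least \<open>1 / (n + 1)\<close> from
      \<open>F\<close>, so metric additivity applies to it; the tail of the shells covers the rest
      of \<open>A - F\<close>.\<close>
    have le: "?H (A \<inter> F) + ?H (A - F) \<le> ?H A + (\<Sum>i. ?H (R (i + n)))" for n
    proof -
      have "?H (A - F) \<le> ?H (B n) + ?H (\<Union>i. R (i + n))"
        using hausdorff_measure_mono[OF cover] hausdorff_measure_subadditive order_trans by blast
      also have "\<dots> \<le> ?H (B n) + (\<Sum>i. ?H (R (i + n)))"
        by (intro add_left_mono hausdorff_measure_countably_subadditive)
      finally have 1: "?H (A - F) \<le> ?H (B n) + (\<Sum>i. ?H (R (i + n)))" .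
      have "?H (A \<inter> F) + ?H (B n) \<le> ?H (A \<inter> F \<union> B n)"
      proof (rule hausdorff_measure_metric_additive)
        show "0 < 1 / real (Suc n)" by simp
        fix x y assume "x \<in> A \<inter> F" "y \<in> B n"
        then show "1 / real (Suc n) \<le> dist x y"
          using infdist_le[of x F y] by (auto simp: B_def dist_commute)
      qed
      also have "\<dots> \<le> ?H A" by (rule hausdorff_measure_mono) (auto simp: B_def)
      finally have 2: "?H (A \<inter> F) + ?H (B n) \<le> ?H A" .
      have "?H (A \<inter> F) + ?H (A - F) \<le> ?H (A \<inter> F) + (?H (B n) + (\<Sum>i. ?H (R (i + n))))"
        using 1 by (rule add_left_mono)
      also have "\<dots> = ?H (A \<inter> F) + ?H (B n) + (\<Sum>i. ?H (R (i + n)))" by (simp add: add.assoc)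
      also have "\<dots> \<le> ?H A + (\<Sum>i. ?H (R (i + n)))" using 2 by (rule add_right_mono)
      finally show ?thesis .
    qed
    define h where "h n = enn2real (?H (R n))" for n
    have hR: "?H (R n) = ennreal (h n)" for n
    proof -
      have "?H (R n) < \<infinity>" using fins ennreal_suminf_lessD by blast
      then show ?thesis by (simp add: h_def)
    qed
    have h0: "0 \<le> h n" for n by (simp add: h_def)
    have sm: "summable h"
      using fins h0 unfolding hR by (intro summable_suminf_not_top) (auto simp: less_top)
    have tails: "(\<Sum>i. ?H (R (i + n))) = ennreal (\<Sum>i. h (i + n))" for n
      unfolding hR using sm h0 by (intro suminf_ennreal2) (auto simp: summable_iff_shift)
    have "(\<lambda>n. \<Sum>i. h (i + n)) \<longlonglongrightarrow> 0"
      using suminf_exist_split2[OF sm] .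
    then have "(\<lambda>n. ennreal (\<Sum>i. h (i + n))) \<longlonglongrightarrow> ennreal 0"
      by (rule tendsto_ennrealI)
    then have "(\<lambda>n. ?H A + (\<Sum>i. ?H (R (i + n)))) \<longlonglongrightarrow> ?H A + 0"
      unfolding tails using fin by (intro tendsto_add tendsto_const) simp
    then show ?thesis using le by (intro LIMSEQ_le_const[of _ _ "_ + _"]) auto
  qed auto
  moreover have "?H A \<le> ?H (A \<inter> F) + ?H (A - F)" for A :: "'a set"
    using hausdorff_measure_subadditive[of k "A \<inter> F" "A - F"] by (simp add: Int_Diff_Un)
  ultimately show ?thesis
    by (auto simp: algebra.lambda_system_eq[OF sigma_algebra.axioms(1)[OF sigma_algebra_Pow, of UNIV, simplified]] intro: antisym)
qed

text \<open>Caratheodory's construction: the closed sets are among the measurable ones and generate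
  the Borel sets.\<close>

lemma measure_space_hausdorff: "measure_space UNIV (sets borel) (hausdorff_measure k)"
proof -
  let ?L = "lambda_system UNIV UNIV (hausdorff_measure k) :: 'a set set"
  have L: "measure_space UNIV ?L (hausdorff_measure k)"
    using sigma_algebra.caratheodory_lemma[OF sigma_algebra_Pow, of UNIV "hausdorff_measure k"]
    by (simp add: hausdorff_outer_measure_space)
  then have "sigma_algebra UNIV ?L" by (simp add: measure_space_def)
  then have "sigma_sets UNIV {F. closed F} \<subseteq> ?L"
    by (rule sigma_algebra.sigma_sets_subset) (auto intro: closed_lambda_system_hausdorff)
  moreover have "sets borel = sigma_sets (UNIV :: 'a set) {F. closed F}"
    by (simp add: borel_eq_closed)
  ultimately show ?thesis
    using measure_down[OF L, of "sets borel"] sets.sigma_algebra_axioms[of "borel :: 'a measure"] by simp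
qed

lemma hausdorff_measure_suminf:
  assumes "\<And>i::nat. A i \<in> sets borel" "disjoint_family A"
  shows "hausdorff_measure k (\<Union>i. A i) = (\<Sum>i. hausdorff_measure k (A i))"
proof -
  have "range A \<subseteq> sets borel" "(\<Union>i. A i) \<in> sets borel" using assms by auto
  then show ?thesis
    using measure_space_hausdorff[of k] assms(2) unfolding measure_space_def countably_additive_def
    by metis
qed

definition hausdorff :: "nat \<Rightarrow> 'a::metric_space measure" where
  "hausdorff k = measure_of UNIV (sets borel) (hausdorff_measure k)"

lemma sets_hausdorff [simp, measurable_cong]: "sets (hausdorff k) = sets borel"
  unfolding hausdorff_def using sets.sigma_sets_eq[of borel] by simp

lemma space_hausdorff [simp]: "space (hausdorff k) = UNIV"
  by (simp add: hausdorff_def space_measure_of_conv)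

lemma emeasure_hausdorff [simp]:
  "A \<in> sets borel \<Longrightarrow> emeasure (hausdorff k) A = hausdorff_measure k A"
  using measure_space_hausdorff[of k] unfolding hausdorff_def measure_space_def
  by (intro emeasure_measure_of_sigma) auto

section \<open>Translations, points and flats under the Hausdorff measure\<close>

lemma diameter_translation:
  fixes w :: "'a::real_normed_vector"
  shows "diameter ((+) w ` S) = diameter S"
proof -
  have "(\<lambda>(x, y). dist x y) ` ((+) w ` S \<times> (+) w ` S) = (\<lambda>(x, y). dist x y) ` (S \<times> S)"
    by (force simp: image_iff)
  then show ?thesis by (simp add: diameter_def)
qed

lemma hausdorff_measure_translation_le:
  fixes w :: "'a::real_normed_vector"
  shows "hausdorff_measure k ((+) w ` A) \<le> hausdorff_measure k A"
  unfolding hausdorff_measure_def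
proof (rule SUP_subset_mono[OF order_refl])
  fix \<delta> :: real
  show "hausdorff_premeasure k \<delta> ((+) w ` A) \<le> hausdorff_premeasure k \<delta> A"
    unfolding hausdorff_premeasure_def[of k \<delta> A]
  proof (rule INF_greatest, clarify)
    fix U :: "nat \<Rightarrow> 'a set"
    assume U: "A \<subseteq> (\<Union>i. U i)" "\<forall>i. bounded (U i) \<and> diameter (U i) \<le> \<delta>"
    have "hausdorff_premeasure k \<delta> ((+) w ` A) \<le> (\<Sum>i. hausdorff_gauge k ((+) w ` U i))"
    proof (intro hausdorff_premeasure_le)
      show "(+) w ` A \<subseteq> (\<Union>i. (+) w ` U i)" 
        unfolding image_UN[symmetric] using U(1) by (rule image_mono)
      show "bounded ((+) w ` U i)" for i using U(2) by (intro bounded_translation) auto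
      show "diameter ((+) w ` U i) \<le> \<delta>" for i using U(2) by (simp add: diameter_translation)
    qed
    also have "\<dots> = (\<Sum>i. hausdorff_gauge k (U i))"
      unfolding hausdorff_gauge_def diameter_translation by simp
    finally show "hausdorff_premeasure k \<delta> ((+) w ` A) \<le> (\<Sum>i. hausdorff_gauge k (U i))" .
  qed
qed

lemma hausdorff_measure_translation:
  fixes w :: "'a::real_normed_vector"
  shows "hausdorff_measure k ((+) w ` A) = hausdorff_measure k A"
proof (rule antisym[OF hausdorff_measure_translation_le])
  have "hausdorff_measure k ((+) (- w) ` (+) w ` A) \<le> hausdorff_measure k ((+) w ` A)"
    by (rule hausdorff_measure_translation_le)
  then show "hausdorff_measure k A \<le> hausdorff_measure k ((+) w ` A)"
    by (simp add: image_comp o_def)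
qed

text \<open>Every cover has a non-empty member, whose gauge in dimension 0 is the volume of the
  zero-dimensional unit ball, that is 1.\<close>

lemma hausdorff_measure_0_pos:
  assumes "x \<in> A"
  shows "1 \<le> hausdorff_measure 0 A"
proof -
  have "1 \<le> hausdorff_premeasure 0 1 A"
    unfolding hausdorff_premeasure_def
  proof (rule INF_greatest, clarify)
    fix U :: "nat \<Rightarrow> 'a set" assume "A \<subseteq> (\<Union>i. U i)"
    then obtain i where i: "x \<in> U i" using assms by auto
    have "1 = hausdorff_gauge 0 (U i)" using i by (auto simp: hausdorff_gauge_def)
    also have "\<dots> \<le> (\<Sum>i. hausdorff_gauge 0 (U i))"
      using sum_le_suminf[of "\<lambda>i. hausdorff_gauge 0 (U i)" "{i}"] by simp
    finally show "1 \<le> (\<Sum>i. hausdorff_gauge 0 (U i))" .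
  qed
  then show ?thesis using hausdorff_premeasure_le_measure[of 1 0 A] by simp
qed

lemma hausdorff_measure_0_singleton [simp]: "hausdorff_measure 0 {x} = 1"
proof (rule antisym)
  show "hausdorff_measure 0 {x} \<le> 1"
    unfolding hausdorff_measure_def
  proof (rule SUP_least)
    fix \<delta> :: real assume "\<delta> \<in> {0<..}"
    then have "hausdorff_premeasure 0 \<delta> {x} \<le> (\<Sum>i. hausdorff_gauge 0 (if i = 0 then {x} else {}))"
      by (intro hausdorff_premeasure_le) auto
    also have "\<dots> = (\<Sum>i\<in>{0::nat}. hausdorff_gauge 0 (if i = 0 then {x} else {}))"
      by (rule suminf_finite) auto
    finally show "hausdorff_premeasure 0 \<delta> {x} \<le> 1" by (simp add: hausdorff_gauge_def)
  qed
qed (simp add: hausdorff_measure_0_pos)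

text \<open>A finite cover is filled up to a sequence with empty sets, which cost nothing; their
  diameter 0 explains the requirement \<open>0 \<le> \<delta>\<close>.\<close>

lemma hausdorff_premeasure_le_finite:
  assumes P: "finite P" and cov: "A \<subseteq> (\<Union>p\<in>P. U p)" and d: "0 \<le> \<delta>"
    "\<And>p. p \<in> P \<Longrightarrow> bounded (U p)" "\<And>p. p \<in> P \<Longrightarrow> diameter (U p) \<le> \<delta>"
  shows "hausdorff_premeasure k \<delta> A \<le> (\<Sum>p\<in>P. hausdorff_gauge k (U p))"
proof -
  obtain h where h: "bij_betw h {0..<card P} P" using ex_bij_betw_nat_finite[OF P] by auto
  define W where "W i = (if i < card P then U (h i) else {})" for i
  have hP: "h i \<in> P" if "i < card P" for i using h that by (auto simp: bij_betw_def)
  have "hausdorff_premeasure k \<delta> A \<le> (\<Sum>i. hausdorff_gauge k (W i))"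
  proof (rule hausdorff_premeasure_le)
    show "A \<subseteq> (\<Union>i. W i)"
    proof
      fix x assume "x \<in> A"
      then obtain p where p: "p \<in> P" "x \<in> U p" using cov by auto
      moreover have "h ` {0..<card P} = P" using h by (simp add: bij_betw_def)
      ultimately obtain i where "i < card P" "h i = p" by force
      then have "x \<in> W i" using p by (simp add: W_def)
      then show "x \<in> (\<Union>i. W i)" by blast
    qed
  qed (use d hP in \<open>auto simp: W_def\<close>)
  also have "\<dots> = (\<Sum>i\<in>{0..<card P}. hausdorff_gauge k (W i))"
    by (rule suminf_finite) (auto simp: W_def)
  also have "\<dots> = (\<Sum>i\<in>{0..<card P}. hausdorff_gauge k (U (h i)))"
    by (rule sum.cong) (auto simp: W_def)
  also have "\<dots> = (\<Sum>p\<in>P. hausdorff_gauge k (U p))"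
    by (rule sum.reindex_bij_betw[OF h])
  finally show ?thesis .
qed

text \<open>In an orthonormal basis the ball is cut into \<open>N ^ j\<close> cells of edge
  \<open>2 * L / N\<close>, whose diameter is at most \<open>j\<close> times the edge. The exponent
  \<open>k\<close> is kept apart from the dimension \<open>j\<close>: equality gives local
  finiteness, and \<open>j < k\<close> gives measure zero as \<open>N\<close> grows.\<close>

lemma hausdorff_premeasure_flat_le:
  fixes E :: "'a::euclidean_space set"
  assumes E: "affine E" "aff_dim E = int j" and a: "a \<in> E" and L: "0 < L"
    and N: "0 < N" "2 * L * real j / real N \<le> \<delta>"
  shows "hausdorff_premeasure k \<delta> (E \<inter> cball a L)
    \<le> ennreal (unit_ball_vol (real k) * (L * real j) ^ k * (real N ^ j / real N ^ k))"
proof -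
  define V where "V = (\<lambda>x. x - a) ` E"
  have V: "subspace V" unfolding V_def using E(1) a by (simp add: affine_diffs_subspace_subtract)
  have "int (dim V) = aff_dim E"
    unfolding V_def using aff_dim_dim_affine_diffs[OF E(1) a] by simp
  then have dimV: "dim V = j" using E by simp
  obtain Bs where Bs: "Bs \<subseteq> V" "pairwise orthogonal Bs" "\<And>x. x \<in> Bs \<Longrightarrow> norm x = 1"
    "independent Bs" "card Bs = dim V" "span Bs = V"
    by (rule orthonormal_basis_subspace[OF V]) blast
  have fin: "finite Bs" using Bs(4) by (rule independent_imp_finite)
  have expand: "x = (\<Sum>b\<in>Bs. (x \<bullet> b) *\<^sub>R b)" if "x \<in> V" for x
  proof -
    define y where "y = x - (\<Sum>b\<in>Bs. (x \<bullet> b) *\<^sub>R b)"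
    have "(\<Sum>b\<in>Bs. (x \<bullet> b) *\<^sub>R b) \<in> span Bs" by (intro span_sum span_mul span_base)
    then have y: "y \<in> span Bs" unfolding y_def using that Bs(6) by (intro span_diff) auto
    have "orthogonal y c" if c: "c \<in> Bs" for c
    proof -
      have "(\<Sum>b\<in>Bs. (x \<bullet> b) * (b \<bullet> c)) = (\<Sum>b\<in>Bs. if b = c then x \<bullet> c else 0)"
        using Bs(2,3) c by (intro sum.cong) (auto simp: pairwise_def orthogonal_def norm_eq_1)
      then show ?thesis using c fin by (simp add: y_def orthogonal_def inner_diff_left inner_sum_left)
    qed
    then have "orthogonal y y" using y orthogonal_to_span by blast
    then show ?thesis by (simp add: orthogonal_self y_def)
  qed
  have norm_le: "norm x \<le> (\<Sum>b\<in>Bs. \<bar>x \<bullet> b\<bar>)" if "x \<in> V" for x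
  proof -
    have "norm x = norm (\<Sum>b\<in>Bs. (x \<bullet> b) *\<^sub>R b)" using expand[OF that] by simp
    also have "\<dots> \<le> (\<Sum>b\<in>Bs. norm ((x \<bullet> b) *\<^sub>R b))" by (rule norm_sum)
    also have "\<dots> = (\<Sum>b\<in>Bs. \<bar>x \<bullet> b\<bar>)" using Bs(3) by simp
    finally show ?thesis .
  qed
  define w where "w = 2 * L / real N"
  have w: "0 < w" using L N by (simp add: w_def)
  define P where "P = Bs \<rightarrow>\<^sub>E {..<N}"
  have finP: "finite P" "card P = N ^ j"
    unfolding P_def using fin Bs(5) dimV by (auto simp: card_PiE intro: finite_PiE)
  define U where "U f = {x \<in> E. \<forall>b\<in>Bs. w * real (f b) - L \<le> (x - a) \<bullet> b \<and> (x - a) \<bullet> b \<le> w * (real (f b) + 1) - L}"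
    for f :: "'a \<Rightarrow> nat"
  have dist_le: "dist x y \<le> w * real j" if "x \<in> U f" "y \<in> U f" for x y f
  proof -
    have "x - a \<in> V" "y - a \<in> V" using that by (auto simp: V_def U_def)
    then have "(x - a) - (y - a) \<in> V" by (rule subspace_diff[OF V])
    then have "x - y \<in> V" by simp
    then have "norm (x - y) \<le> (\<Sum>b\<in>Bs. \<bar>(x - y) \<bullet> b\<bar>)" by (rule norm_le)
    also have "\<dots> \<le> (\<Sum>b\<in>Bs. w)"
    proof (rule sum_mono)
      fix b assume b: "b \<in> Bs"
      have "w * real (f b) - L \<le> (x - a) \<bullet> b" "(x - a) \<bullet> b \<le> w * (real (f b) + 1) - L"
        "w * real (f b) - L \<le> (y - a) \<bullet> b" "(y - a) \<bullet> b \<le> w * (real (f b) + 1) - L"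
        using that b by (auto simp: U_def)
      then show "\<bar>(x - y) \<bullet> b\<bar> \<le> w" by (simp add: algebra_simps abs_le_iff)
    qed
    finally show ?thesis using Bs(5) dimV by (simp add: dist_norm mult.commute)
  qed
  have bdd: "bounded (U f)" for f
  proof (cases "U f = {}")
    case False
    then obtain z where "z \<in> U f" by auto
    then show ?thesis using dist_le unfolding bounded_def by blast
  qed simp
  have diam: "diameter (U f) \<le> w * real j" for f
    using w by (intro diameter_le) (auto simp: dist_norm[symmetric] intro: dist_le)
  have cover: "E \<inter> cball a L \<subseteq> (\<Union>f\<in>P. U f)"
  proof
    fix x assume x: "x \<in> E \<inter> cball a L"
    define q where "q b = ((x - a) \<bullet> b + L) / w" for b
    have q: "0 \<le> q b \<and> q b \<le> real N" if "b \<in> Bs" for b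
    proof -
      have "\<bar>(x - a) \<bullet> b\<bar> \<le> norm (x - a) * norm b" by (rule Cauchy_Schwarz_ineq2)
      also have "\<dots> \<le> L" using x Bs(3)[OF that] by (simp add: dist_norm norm_minus_commute)
      finally have "- L \<le> (x - a) \<bullet> b" "(x - a) \<bullet> b \<le> L" by auto
      then have "0 \<le> q b" "q b \<le> (2 * L) / w" unfolding q_def using w by (auto intro!: divide_right_mono)
      then show ?thesis using L N by (simp add: w_def)
    qed
    \<comment> \<open>Capping at \<open>N - 1\<close> puts the right end point
      \<open>q b = N\<close> into the last cell.\<close>
    define f where "f = (\<lambda>b\<in>Bs. min (nat \<lfloor>q b\<rfloor>) (N - 1))"
    have "f \<in> P" using N by (auto simp: P_def f_def)
    moreover have "x \<in> U f"
      unfolding U_def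
    proof (safe)
      show "x \<in> E" using x by auto
      fix b assume b: "b \<in> Bs"
      have "real (f b) \<le> q b" "q b \<le> real (f b) + 1"
        using b q[OF b] N by (auto simp: f_def min_def) linarith+
      then have "w * real (f b) \<le> w * q b" "w * q b \<le> w * (real (f b) + 1)"
        using w by (auto intro!: mult_left_mono)
      moreover have "w * q b = (x - a) \<bullet> b + L" using w by (simp add: q_def)
      ultimately show "w * real (f b) - L \<le> (x - a) \<bullet> b" "(x - a) \<bullet> b \<le> w * (real (f b) + 1) - L"
        by linarith+
    qed
    ultimately show "x \<in> (\<Union>f\<in>P. U f)" by blast
  qed
  have wj: "w * real j \<le> \<delta>" using N by (simp add: w_def)
  have "hausdorff_premeasure k \<delta> (E \<inter> cball a L) \<le> (\<Sum>f\<in>P. hausdorff_gauge k (U f))"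
    using finP cover bdd diam wj w
    by (intro hausdorff_premeasure_le_finite) (auto intro: order_trans[of _ "w * real j"] order_trans[of 0 "w * real j"])
  also have "\<dots> \<le> (\<Sum>f\<in>P. ennreal (unit_ball_vol (real k) * (L * real j / real N) ^ k))"
  proof (rule sum_mono)
    fix f
    have "diameter (U f) / 2 \<le> L * real j / real N" using diam[of f] by (simp add: w_def field_simps)
    moreover have "0 \<le> diameter (U f)" using bdd by (rule diameter_ge_0)
    ultimately show "hausdorff_gauge k (U f) \<le> ennreal (unit_ball_vol (real k) * (L * real j / real N) ^ k)"
      by (auto simp: hausdorff_gauge_def intro!: ennreal_leI mult_left_mono power_mono)
  qed
  also have "\<dots> = ennreal (real (N ^ j)) * ennreal (unit_ball_vol (real k) * (L * real j / real N) ^ k)"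
    using finP by (simp add: ennreal_of_nat_eq_real_of_nat)
  also have "\<dots> = ennreal (real (N ^ j) * (unit_ball_vol (real k) * (L * real j / real N) ^ k))"
    using L by (intro ennreal_mult[symmetric]) auto
  also have "real (N ^ j) * (unit_ball_vol (real k) * (L * real j / real N) ^ k)
      = unit_ball_vol (real k) * (L * real j) ^ k * (real N ^ j / real N ^ k)"
    by (simp add: power_divide)
  finally show ?thesis .
qed

lemma hausdorff_measure_flat_finite:
  fixes E :: "'a::euclidean_space set"
  assumes E: "affine E" "aff_dim E = int k" and S: "bounded S"
  shows "hausdorff_measure k (E \<inter> S) < \<infinity>"
proof -
  have "E \<noteq> {}" using E by auto
  then obtain a where a: "a \<in> E" by auto
  obtain L where L: "0 < L" "S \<subseteq> cball a L"
    using S bounded_subset_ballD[of S a] ball_subset_cball by blast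
  have "hausdorff_premeasure k \<delta> (E \<inter> cball a L) \<le> ennreal (unit_ball_vol (real k) * (L * real k) ^ k)"
    if "0 < \<delta>" for \<delta>
  proof -
    obtain N :: nat where N: "2 * L * real k / \<delta> < real N" using reals_Archimedean2 by blast
    then have "0 \<le> 2 * L * real k / \<delta>" using L that by simp
    then have "0 < N" using N by (metis less_le_trans not_gr_zero of_nat_0 not_less)
    moreover have "2 * L * real k / real N \<le> \<delta>" using N that \<open>0 < N\<close> by (simp add: field_simps)
    ultimately show ?thesis using hausdorff_premeasure_flat_le[OF E a L(1), of N \<delta> k] by simp
  qed
  then have "hausdorff_measure k (E \<inter> cball a L) \<le> ennreal (unit_ball_vol (real k) * (L * real k) ^ k)"
    unfolding hausdorff_measure_def by (intro SUP_least) auto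
  moreover have "hausdorff_measure k (E \<inter> S) \<le> hausdorff_measure k (E \<inter> cball a L)"
    using L by (intro hausdorff_measure_mono) auto
  ultimately show ?thesis by (metis ennreal_less_top infinity_ennreal_def order_le_less_trans)
qed

lemma hausdorff_measure_flat_zero:
  fixes E :: "'a::euclidean_space set"
  assumes E: "affine E" "aff_dim E < int k"
  shows "hausdorff_measure k E = 0"
proof (cases "E = {}")
  case False
  then obtain a where a: "a \<in> E" by auto
  define j where "j = nat (aff_dim E)"
  have j: "aff_dim E = int j" "j < k" using False E aff_dim_geq[of E] aff_dim_empty[of E] by (auto simp: j_def)
  have zero: "hausdorff_measure k (E \<inter> cball a L) = 0" if L: "0 < L" for L
  proof -
    have "hausdorff_premeasure k \<delta> (E \<inter> cball a L) = 0" if "0 < \<delta>" for \<delta>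
    proof -
      define C where "C = unit_ball_vol (real k) * (L * real j) ^ k"
      have C: "0 \<le> C" using L by (simp add: C_def)
      obtain N0 :: nat where N0: "2 * L * real j / \<delta> < real N0" using reals_Archimedean2 by blast
      have le: "hausdorff_premeasure k \<delta> (E \<inter> cball a L) \<le> ennreal (C / real (Suc n))" if "N0 \<le> n" for n
      proof -
        have "2 * L * real j / \<delta> \<le> real (Suc n)" using N0 that by linarith
        then have "2 * L * real j / real (Suc n) \<le> \<delta>" using \<open>0 < \<delta>\<close> by (simp add: field_simps)
        then have "hausdorff_premeasure k \<delta> (E \<inter> cball a L) \<le> ennreal (C * (real (Suc n) ^ j / real (Suc n) ^ k))"
          unfolding C_def using j by (intro hausdorff_premeasure_flat_le[OF E(1) _ a L]) auto
        also have "real (Suc n) ^ j / real (Suc n) ^ k \<le> 1 / real (Suc n)"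
        proof -
          have "real (Suc n) ^ (Suc j) \<le> real (Suc n) ^ k" using j by (intro power_increasing) auto
          then show ?thesis by (simp add: field_simps)
        qed
        finally show ?thesis using C by (simp add: mult_left_mono ennreal_leI)
      qed
      have "(\<lambda>n. ennreal (C / real (Suc n))) \<longlonglongrightarrow> ennreal 0"
        by (intro tendsto_ennrealI LIMSEQ_Suc lim_const_over_n)
      then have "hausdorff_premeasure k \<delta> (E \<inter> cball a L) \<le> ennreal 0"
        by (rule LIMSEQ_le_const) (use le in blast)
      then show ?thesis by simp
    qed
    then show ?thesis unfolding hausdorff_measure_def by (simp add: SUP_eq_const)
  qed
  have "E = (\<Union>n. E \<inter> cball a (real (Suc n)))"
  proof safe
    fix x assume "x \<in> E"
    obtain n :: nat where "dist a x < real n" using reals_Archimedean2 by blast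
    then show "x \<in> (\<Union>n. E \<inter> cball a (real (Suc n)))" using \<open>x \<in> E\<close> by (auto intro!: exI[of _ n])
  qed
  then have "hausdorff_measure k E \<le> (\<Sum>n. hausdorff_measure k (E \<inter> cball a (real (Suc n))))"
    using hausdorff_measure_countably_subadditive[of k "\<lambda>n. E \<inter> cball a (real (Suc n))"] by simp
  also have "\<dots> = 0" using zero by simp
  finally show ?thesis by simp
qed simp

text \<open>By translation invariance along the flat, one null relatively open part forces the
  whole flat to be null.\<close>

lemma hausdorff_measure_flat_null:
  fixes E :: "'a::euclidean_space set"
  assumes E: "affine E" and x: "x \<in> E" and r: "0 < r" and null: "hausdorff_measure k (E \<inter> ball x r) = 0"
  shows "hausdorff_measure k E = 0"
proof -
  have null': "hausdorff_measure k (E \<inter> ball y r) = 0" if y: "y \<in> E" for y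
  proof -
    have "E \<inter> ball y r = (+) (y - x) ` (E \<inter> ball x r)"
    proof safe
      fix z assume z: "z \<in> E" "z \<in> ball y r"
      have "z + 1 *\<^sub>R (x - y) \<in> E" using E z x y by (intro mem_affine_3_minus)
      then have "z - (y - x) \<in> E \<inter> ball x r" using z by (auto simp: dist_norm algebra_simps)
      then show "z \<in> (+) (y - x) ` (E \<inter> ball x r)"
        by (intro image_eqI[of _ _ "z - (y - x)"]) auto
    next
      fix z assume z: "z \<in> E" "z \<in> ball x r"
      have "z + 1 *\<^sub>R (y - x) \<in> E" using E z x y by (intro mem_affine_3_minus)
      then show "y - x + z \<in> E" "y - x + z \<in> ball y r" using z by (auto simp: dist_norm algebra_simps)
    qed
    then show ?thesis using null by (simp add: hausdorff_measure_translation)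
  qed
  obtain D where D: "countable D" "D \<subseteq> E" "E \<subseteq> closure D" by (rule separable)
  then have "D \<noteq> {}" using x by auto
  have "E \<subseteq> (\<Union>n. E \<inter> ball (from_nat_into D n) r)"
  proof
    fix z assume "z \<in> E"
    then have "z \<in> closure D" using D by auto
    then obtain y where "y \<in> D" "dist y z < r" using r by (auto simp: closure_approachable)
    then obtain n where "from_nat_into D n = y" using from_nat_into_surj[OF D(1)] by metis
    then show "z \<in> (\<Union>n. E \<inter> ball (from_nat_into D n) r)" using \<open>z \<in> E\<close> \<open>dist y z < r\<close> by auto
  qed
  then have "hausdorff_measure k E \<le> (\<Sum>n. hausdorff_measure k (E \<inter> ball (from_nat_into D n) r))"
    by (rule order_trans[OF hausdorff_measure_mono hausdorff_measure_countably_subadditive])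
  also have "\<dots> = 0" using null' from_nat_into[OF \<open>D \<noteq> {}\<close>] D(2) by (simp add: subset_iff)
  finally show ?thesis by simp
qed

section \<open>Kernels of Borel measures\<close>

lemma space_borel_measures: "space borel_measures = {\<mu>. sets \<mu> = sets borel}"
  by (auto simp: borel_measures_def space_Sup_eq_UN)

lemma measurable_emeasure_borel_measures [measurable]:
  "C \<in> sets borel \<Longrightarrow> (\<lambda>\<mu>. emeasure \<mu> C) \<in> borel_measurable borel_measures"
  by (auto intro!: measurable_Sup1 measurable_vimage_algebra1 simp: borel_measures_def)

lemma measurable_borel_measures:
  assumes "\<And>x. x \<in> space N \<Longrightarrow> sets (K x) = sets borel"
    "\<And>C. C \<in> sets borel \<Longrightarrow> (\<lambda>x. emeasure (K x) C) \<in> borel_measurable N"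
  shows "K \<in> measurable N borel_measures"
  using assms by (auto intro!: measurable_Sup2 measurable_vimage_algebra2 simp: borel_measures_def)

lemma measurable_borel_measuresD:
  assumes "K \<in> measurable N borel_measures"
  shows "x \<in> space N \<Longrightarrow> sets (K x) = sets borel" "x \<in> space N \<Longrightarrow> space (K x) = UNIV"
    "C \<in> sets borel \<Longrightarrow> (\<lambda>x. emeasure (K x) C) \<in> borel_measurable N"
proof -
  show *: "sets (K x) = sets borel" if "x \<in> space N" for x
    using measurable_space[OF assms that] by (simp add: space_borel_measures)
  show "space (K x) = UNIV" if "x \<in> space N" using sets_eq_imp_space_eq[OF *[OF that]] by simp
  show "(\<lambda>x. emeasure (K x) C) \<in> borel_measurable N" if "C \<in> sets borel"
    using measurable_compose[OF assms measurable_emeasure_borel_measures[OF that]] .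
qed

text \<open>The kernel is normalised to a subprobability kernel, for which measurability of the
  integral is known, and its total mass is multiplied back as a measurable factor.\<close>

lemma nn_integral_measurable_kernel:
  fixes K :: "'x \<Rightarrow> 'b::topological_space measure"
  assumes K: "K \<in> measurable N borel_measures" "\<And>x. x \<in> space N \<Longrightarrow> emeasure (K x) UNIV < \<infinity>"
    and g: "(\<lambda>(x, y). g x y) \<in> borel_measurable (N \<Otimes>\<^sub>M borel)"
  shows "(\<lambda>x. \<integral>\<^sup>+y. g x y \<partial>K x) \<in> borel_measurable N"
proof -
  \<comment> \<open>For mass 0 the factor is infinite, but scaling the null measure by it still
    gives the null measure.\<close>
  define \<kappa> where "\<kappa> x = scale_measure (inverse (emeasure (K x) UNIV)) (K x)" for x
  note KD = measurable_borel_measuresD[OF K(1)]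
  have "\<kappa> \<in> measurable N (subprob_algebra borel)"
  proof (rule measurable_subprob_algebra)
    fix x assume x: "x \<in> space N"
    show "subprob_space (\<kappa> x)"
    proof (rule subprob_spaceI)
      show "emeasure (\<kappa> x) (space (\<kappa> x)) \<le> 1"
        using K(2)[OF x] KD(2)[OF x] ennreal_divide_self[of "emeasure (K x) UNIV"]
        by (cases "emeasure (K x) UNIV = 0")
           (simp_all add: \<kappa>_def space_scale_measure less_top divide_ennreal_def mult.commute)
    qed (simp add: \<kappa>_def space_scale_measure KD x)
    show "sets (\<kappa> x) = sets borel" by (simp add: \<kappa>_def KD x)
  next
    fix A :: "'b set" assume A: "A \<in> sets borel"
    have [measurable]: "(\<lambda>x. emeasure (K x) C) \<in> borel_measurable N" if "C \<in> sets borel" for C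
      using KD(3)[OF that] .
    show "(\<lambda>x. emeasure (\<kappa> x) A) \<in> borel_measurable N"
      using A unfolding \<kappa>_def emeasure_scale_measure by measurable
  qed
  then have "(\<lambda>x. \<integral>\<^sup>+y. g x y \<partial>\<kappa> x) \<in> borel_measurable N"
    by (rule nn_integral_measurable_subprob_algebra2[OF g])
  moreover have "(\<lambda>x. emeasure (K x) UNIV) \<in> borel_measurable N" by (rule KD) simp
  ultimately have "(\<lambda>x. emeasure (K x) UNIV * (\<integral>\<^sup>+y. g x y \<partial>\<kappa> x)) \<in> borel_measurable N"
    by measurable
  also have "?this \<longleftrightarrow> ?thesis"
  proof (rule measurable_cong)
    fix x assume x: "x \<in> space N"
    have gx: "g x \<in> borel_measurable (K x)"
      using measurable_compose[OF measurable_Pair1'[OF x] g] KD(1)[OF x] by (simp cong: measurable_cong_sets)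
    show "emeasure (K x) UNIV * (\<integral>\<^sup>+y. g x y \<partial>\<kappa> x) = (\<integral>\<^sup>+y. g x y \<partial>K x)"
    proof (cases "emeasure (K x) UNIV = 0")
      case True
      then have "AE y in K x. False" using KD(2)[OF x] by (intro AE_I[of _ _ UNIV]) (auto simp: KD(1)[OF x])
      then have "(\<integral>\<^sup>+y. g x y \<partial>K x) = (\<integral>\<^sup>+y. 0 \<partial>K x)" by (intro nn_integral_cong_AE) auto
      then show ?thesis using True by simp
    next
      case False
      have "emeasure (K x) UNIV * (\<integral>\<^sup>+y. g x y \<partial>\<kappa> x)
        = (emeasure (K x) UNIV * inverse (emeasure (K x) UNIV)) * (\<integral>\<^sup>+y. g x y \<partial>K x)"
        unfolding \<kappa>_def using gx by (simp add: nn_integral_scale_measure mult.assoc)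
      also have "emeasure (K x) UNIV * inverse (emeasure (K x) UNIV) = 1"
        using False K(2)[OF x] ennreal_divide_self[unfolded divide_ennreal_def] by (simp add: less_top)
      finally show ?thesis by simp
    qed
  qed
  finally show ?thesis .
qed

lemma pair_kernel_measurable:
  fixes K :: "'x \<Rightarrow> 'b::second_countable_topology measure" and L :: "'x \<Rightarrow> 'c::second_countable_topology measure"
  assumes K: "K \<in> measurable N borel_measures" "\<And>x. x \<in> space N \<Longrightarrow> emeasure (K x) UNIV < \<infinity>"
    and L: "L \<in> measurable N borel_measures" "\<And>x. x \<in> space N \<Longrightarrow> emeasure (L x) UNIV < \<infinity>"
  shows "(\<lambda>x. K x \<Otimes>\<^sub>M L x) \<in> measurable N borel_measures"
    "\<And>x. x \<in> space N \<Longrightarrow> emeasure (K x \<Otimes>\<^sub>M L x) UNIV < \<infinity>"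
proof -
  note KD = measurable_borel_measuresD[OF K(1)]
  note LD = measurable_borel_measuresD[OF L(1)]
  have sets: "sets (K x \<Otimes>\<^sub>M L x) = sets borel" if "x \<in> space N" for x
    using KD(1)[OF that] LD(1)[OF that] by (simp add: borel_prod[symmetric] cong: sets_pair_measure_cong)
  have sf: "sigma_finite_measure (L x)" if "x \<in> space N" for x
    using L(2)[OF that] LD(2)[OF that]
    by (intro finite_measure.sigma_finite_measure finite_measureI) (auto simp: less_top)
  show "(\<lambda>x. K x \<Otimes>\<^sub>M L x) \<in> measurable N borel_measures"
  proof (rule measurable_borel_measures[OF sets])
    fix C :: "('b \<times> 'c) set" assume C: "C \<in> sets borel"
    then have C'[measurable]: "C \<in> sets (borel \<Otimes>\<^sub>M borel)" unfolding borel_prod .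
    have "(\<lambda>x. \<integral>\<^sup>+y. (\<integral>\<^sup>+z. indicator C (y, z) \<partial>L x) \<partial>K x) \<in> borel_measurable N"
    proof (rule nn_integral_measurable_kernel[OF K])
      have "(\<lambda>p. \<integral>\<^sup>+z. indicator C (snd p, z) \<partial>L (fst p)) \<in> borel_measurable (N \<Otimes>\<^sub>M borel)"
      proof (rule nn_integral_measurable_kernel)
        show "(\<lambda>p. L (fst p)) \<in> measurable (N \<Otimes>\<^sub>M borel) borel_measures"
          using L(1) by measurable
        show "(\<lambda>(p, z). indicator C (snd p, z)) \<in> borel_measurable ((N \<Otimes>\<^sub>M borel) \<Otimes>\<^sub>M borel)"
          by measurable
      qed (use L(2) in \<open>auto simp: space_pair_measure\<close>)
      then show "(\<lambda>(x, y). \<integral>\<^sup>+z. indicator C (y, z) \<partial>L x) \<in> borel_measurable (N \<Otimes>\<^sub>M borel)"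
        by (simp add: split_beta')
    qed
    also have "?this \<longleftrightarrow> (\<lambda>x. emeasure (K x \<Otimes>\<^sub>M L x) C) \<in> borel_measurable N"
    proof (rule measurable_cong)
      fix x assume x: "x \<in> space N"
      show "(\<integral>\<^sup>+y. (\<integral>\<^sup>+z. indicator C (y, z) \<partial>L x) \<partial>K x) = emeasure (K x \<Otimes>\<^sub>M L x) C"
        using sets[OF x] C by (intro sigma_finite_measure.emeasure_pair_measure[OF sf[OF x], symmetric]) simp
    qed
    finally show "(\<lambda>x. emeasure (K x \<Otimes>\<^sub>M L x) C) \<in> borel_measurable N" .
  qed
  show "emeasure (K x \<Otimes>\<^sub>M L x) UNIV < \<infinity>" if x: "x \<in> space N" for x
  proof -
    have "emeasure (K x \<Otimes>\<^sub>M L x) (UNIV \<times> UNIV) = emeasure (K x) UNIV * emeasure (L x) UNIV"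
      using KD(1)[OF x] LD(1)[OF x] by (intro sigma_finite_measure.emeasure_pair_measure_Times[OF sf[OF x]]) auto
    then show ?thesis using K(2)[OF x] L(2)[OF x] by (simp add: ennreal_mult_less_top)
  qed
qed

text \<open>Turns set functions depending on a parameter, such as the integral reconstructions
  below, into measurable maps to measures; with a one-point \<open>N\<close> it evaluates a single
  measure.\<close>

lemma measurable_measure_of_borel_measures:
  fixes G :: "'x \<Rightarrow> 'b::topological_space set \<Rightarrow> ennreal"
  assumes G: "\<And>x A. x \<in> space N \<Longrightarrow> (\<And>i::nat. A i \<in> sets borel) \<Longrightarrow> disjoint_family A \<Longrightarrow> (\<Sum>i. G x (A i)) = G x (\<Union>i. A i)"
    "\<And>x. x \<in> space N \<Longrightarrow> G x {} = 0"
    "\<And>C. C \<in> sets borel \<Longrightarrow> (\<lambda>x. G x C) \<in> borel_measurable N"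
  shows "(\<lambda>x. measure_of UNIV (sets borel) (G x)) \<in> measurable N borel_measures"
    "\<And>x C. x \<in> space N \<Longrightarrow> C \<in> sets borel \<Longrightarrow> emeasure (measure_of UNIV (sets borel) (G x)) C = G x C"
proof -
  have sets: "sets (measure_of UNIV (sets borel) (G x)) = sets borel" for x
    using sets.sigma_sets_eq[of borel] by simp
  show em: "emeasure (measure_of UNIV (sets borel) (G x)) C = G x C" if "x \<in> space N" "C \<in> sets borel" for x C
  proof (rule emeasure_measure_of_sigma)
    show "sigma_algebra UNIV (sets borel)" using sets.sigma_algebra_axioms[of borel] by simp
    show "positive (sets borel) (G x)" using G(2)[OF that(1)] by (simp add: positive_def)
    show "countably_additive (sets borel) (G x)"
      using G(1)[OF that(1)] by (auto simp: countably_additive_def)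
  qed fact
  show "(\<lambda>x. measure_of UNIV (sets borel) (G x)) \<in> measurable N borel_measures"
  proof (rule measurable_borel_measures[OF sets])
    fix C :: "'b set" assume C: "C \<in> sets borel"
    show "(\<lambda>x. emeasure (measure_of UNIV (sets borel) (G x)) C) \<in> borel_measurable N"
      using G(3)[OF C] by (rule measurable_cong[THEN iffD1, rotated]) (simp add: em C)
  qed
qed

lemma truncate_measure_measurable:
  "(\<lambda>\<mu>. if emeasure \<mu> UNIV < \<infinity> then \<mu> else null_measure borel) \<in> measurable borel_measures borel_measures"
proof (rule measurable_borel_measures)
  fix C :: "'a set" assume [measurable]: "C \<in> sets borel"
  have "(\<lambda>\<mu>::'a measure. if emeasure \<mu> UNIV < \<infinity> then emeasure \<mu> C else 0) \<in> borel_measurable borel_measures"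
    by measurable
  then show "(\<lambda>\<mu>::'a measure. emeasure (if emeasure \<mu> UNIV < \<infinity> then \<mu> else null_measure borel) C)
      \<in> borel_measurable borel_measures"
    by (rule measurable_cong[THEN iffD1, rotated]) simp
qed (auto simp: space_borel_measures)

lemma sets_meas_restr [simp]: "sets (meas_restr \<mu> F) = sets \<mu>"
  by (simp add: meas_restr_def)

lemma emeasure_meas_restr:
  assumes "sets \<mu> = sets borel" "F \<in> sets borel" "C \<in> sets borel"
  shows "emeasure (meas_restr \<mu> F) C = emeasure \<mu> (C \<inter> F)"
proof -
  have "emeasure (meas_restr \<mu> F) C = (\<integral>\<^sup>+x. indicator F x * indicator C x \<partial>\<mu>)"
    unfolding meas_restr_def using assms by (intro emeasure_density) auto
  also have "\<dots> = (\<integral>\<^sup>+x. indicator (C \<inter> F) x \<partial>\<mu>)"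
    by (intro nn_integral_cong) (auto split: split_indicator)
  also have "\<dots> = emeasure \<mu> (C \<inter> F)" using assms by (intro nn_integral_indicator) auto
  finally show ?thesis .
qed

section \<open>Hyperplanes, their tuples and the intersection measure on bounded sets\<close>

lemma hyperplane_eq: "hyperplane u s = {x. u \<bullet> x = s}"
  by (auto simp: hyperplane_def inner_commute)

lemma hyperplanesE:
  assumes "H \<in> hyperplanes"
  obtains u s where "norm u = 1" "H = {x. u \<bullet> x = s}"
  using assms by (auto simp: hyperplanes_def hyperplane_eq)

lemma hyperplanes_closed: "H \<in> hyperplanes \<Longrightarrow> closed H"
  by (auto elim!: hyperplanesE simp: closed_hyperplane)

lemma hyperplanes_affine: "H \<in> hyperplanes \<Longrightarrow> affine H"
  by (auto elim!: hyperplanesE simp: affine_hyperplane)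

definition tuples :: "nat \<Rightarrow> 'b set \<Rightarrow> 'b list set" where
  "tuples m X = {Hs. length Hs = m \<and> distinct Hs \<and> set Hs \<subseteq> X}"

lemma finite_tuples: "finite X \<Longrightarrow> finite (tuples m X)"
  unfolding tuples_def by (rule finite_subset[OF _ finite_lists_length_eq[of X m]]) auto

lemma closed_Inter_tuple:
  "Hs \<in> tuples m X \<Longrightarrow> X \<subseteq> hyperplanes \<Longrightarrow> closed (\<Inter>(set Hs))"
  unfolding tuples_def by (intro closed_Inter) (blast intro: hyperplanes_closed)

lemma affine_Inter_tuple:
  "Hs \<in> tuples m X \<Longrightarrow> X \<subseteq> hyperplanes \<Longrightarrow> affine (\<Inter>(set Hs))"
  unfolding tuples_def by (intro affine_Inter) (blast intro: hyperplanes_affine)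

lemma sets_intersection_measure [simp]: "sets (intersection_measure m X) = sets borel"
  unfolding intersection_measure_def using sets.sigma_sets_eq[of borel] by simp

lemma emeasure_intersection_measure:
  fixes X :: "'a::euclidean_space set set"
  assumes X: "X \<subseteq> hyperplanes" and C: "C \<in> sets borel"
  shows "emeasure (intersection_measure m X) C = ennreal (1 / fact m) *
    (\<integral>\<^sup>+Hs. hausdorff_measure (DIM('a) - m) (C \<inter> \<Inter>(set Hs)) \<partial>count_space (tuples m X))"
proof -
  let ?k = "DIM('a) - m"
  let ?G = "\<lambda>C. ennreal (1 / fact m) * (\<integral>\<^sup>+Hs. hausdorff_measure ?k (C \<inter> \<Inter>(set Hs)) \<partial>count_space (tuples m X))"
  have "(\<Sum>i. ?G (A i)) = ?G (\<Union>i. A i)" if A: "\<And>i::nat. A i \<in> sets borel" "disjoint_family A" for A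
  proof -
    have "(\<integral>\<^sup>+Hs. hausdorff_measure ?k ((\<Union>i. A i) \<inter> \<Inter>(set Hs)) \<partial>count_space (tuples m X))
      = (\<integral>\<^sup>+Hs. (\<Sum>i. hausdorff_measure ?k (A i \<inter> \<Inter>(set Hs))) \<partial>count_space (tuples m X))"
    proof (rule nn_integral_cong)
      fix Hs assume "Hs \<in> space (count_space (tuples m X))"
      then have cl: "closed (\<Inter>(set Hs))" using X closed_Inter_tuple by auto
      have "hausdorff_measure ?k (\<Union>i. A i \<inter> \<Inter>(set Hs)) = (\<Sum>i. hausdorff_measure ?k (A i \<inter> \<Inter>(set Hs)))"
        by (rule hausdorff_measure_suminf) (use A cl in \<open>auto simp: disjoint_family_on_def\<close>)
      then show "hausdorff_measure ?k ((\<Union>i. A i) \<inter> \<Inter>(set Hs)) = (\<Sum>i. hausdorff_measure ?k (A i \<inter> \<Inter>(set Hs)))"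
        by (simp only: UN_simps)
    qed
    also have "\<dots> = (\<Sum>i. \<integral>\<^sup>+Hs. hausdorff_measure ?k (A i \<inter> \<Inter>(set Hs)) \<partial>count_space (tuples m X))"
      by (rule nn_integral_suminf) simp
    finally show ?thesis by (simp add: ennreal_suminf_cmult)
  qed
  then show ?thesis
    using measurable_measure_of_borel_measures(2)[of "count_space {()}" "\<lambda>_. ?G" "()" C] C
    unfolding intersection_measure_def tuples_def by simp
qed

text \<open>A tuple containing a hyperplane that misses \<open>K\<close> contributes nothing to
  \<open>C\<close>, so the integral over all tuples becomes a finite sum.\<close>

lemma emeasure_intersection_measure_bounded:
  fixes X :: "'a::euclidean_space set set"
  assumes X: "X \<subseteq> hyperplanes" and C: "C \<in> sets borel" and K: "C \<subseteq> K" "finite (X \<inter> hitting K)"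
  shows "emeasure (intersection_measure m X) C = ennreal (1 / fact m) *
    (\<Sum>Hs\<in>tuples m (X \<inter> hitting K). hausdorff_measure (DIM('a) - m) (C \<inter> \<Inter>(set Hs)))"
proof -
  have "(\<integral>\<^sup>+Hs. hausdorff_measure (DIM('a) - m) (C \<inter> \<Inter>(set Hs)) \<partial>count_space (tuples m X))
    = (\<Sum>Hs\<in>tuples m (X \<inter> hitting K). hausdorff_measure (DIM('a) - m) (C \<inter> \<Inter>(set Hs)))"
  proof (rule nn_integral_count_space')
    show "finite (tuples m (X \<inter> hitting K))" using K by (intro finite_tuples)
    show "hausdorff_measure (DIM('a) - m) (C \<inter> \<Inter>(set Hs)) = 0"
      if Hs: "Hs \<in> tuples m X" "Hs \<notin> tuples m (X \<inter> hitting K)" for Hs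
    proof -
      obtain H where "H \<in> set Hs" "H \<in> X" "H \<notin> hitting K"
        using Hs unfolding tuples_def by blast
      then have "C \<inter> \<Inter>(set Hs) = {}" using X K by (auto simp: hitting_def)
      then show ?thesis by simp
    qed
  qed (auto simp: tuples_def)
  then show ?thesis by (simp add: emeasure_intersection_measure[OF X C])
qed

section \<open>Factorial moments of Poisson processes\<close>

locale finite_window_poisson = prob_space M for M :: "'w measure" +
  fixes \<Lambda> :: "'b measure" and \<eta> :: "'w \<Rightarrow> 'b set"
  assumes poisson: "poisson_process M \<Lambda> \<eta>"
begin

lemma eta_space: "\<omega> \<in> space M \<Longrightarrow> \<eta> \<omega> \<subseteq> space \<Lambda>"
  using poisson by (auto simp: poisson_process_def)

lemma indep_counts:
  "(\<And>i. i < (n::nat) \<Longrightarrow> A i \<in> sets \<Lambda>) \<Longrightarrow> disjoint_family_on A {..<n} \<Longrightarrow>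
    indep_vars (\<lambda>_. borel) (\<lambda>i \<omega>. point_count (\<eta> \<omega>) (A i)) {..<n}"
proof -
  assume A: "\<And>i. i < n \<Longrightarrow> A i \<in> sets \<Lambda>" "disjoint_family_on A {..<n}"
  have "\<forall>(n::nat) A. (\<forall>i<n. A i \<in> sets \<Lambda>) \<and> disjoint_family_on A {..<n} \<longrightarrow>
      indep_vars (\<lambda>_. borel) (\<lambda>i \<omega>. point_count (\<eta> \<omega>) (A i)) {..<n}"
    using poisson unfolding poisson_process_def by blast
  from this[rule_format, of n A] A show ?thesis by blast
qed

lemma measurable_point_count [measurable]:
  assumes "A \<in> sets \<Lambda>"
  shows "(\<lambda>\<omega>. point_count (\<eta> \<omega>) A) \<in> borel_measurable M"
  using indep_counts[of 1 "\<lambda>_. A"] assms by (auto simp: indep_vars_def2 disjoint_family_on_def)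

lemma prob_point_count:
  "A \<in> sets \<Lambda> \<Longrightarrow> emeasure \<Lambda> A < \<infinity> \<Longrightarrow>
    prob {\<omega>\<in>space M. point_count (\<eta> \<omega>) A = of_nat k} = measure \<Lambda> A ^ k / fact k * exp (- measure \<Lambda> A)"
  using poisson by (auto simp: poisson_process_def)

lemma nn_integral_point_count:
  assumes A[measurable]: "A \<in> sets \<Lambda>" and fin: "emeasure \<Lambda> A < \<infinity>"
    and finA: "\<And>\<omega>. \<omega> \<in> space M \<Longrightarrow> finite (\<eta> \<omega> \<inter> A)"
  shows "(\<integral>\<^sup>+\<omega>. point_count (\<eta> \<omega>) A \<partial>M) = emeasure \<Lambda> A"
proof -
  define l where "l = measure \<Lambda> A"
  have l: "0 \<le> l" by (simp add: l_def)
  define S where "S k = {\<omega>\<in>space M. point_count (\<eta> \<omega>) A = of_nat k}" for k :: nat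
  have [measurable]: "S k \<in> sets M" for k unfolding S_def by measurable
  have "(\<integral>\<^sup>+\<omega>. point_count (\<eta> \<omega>) A \<partial>M) = (\<integral>\<^sup>+\<omega>. (\<Sum>k. of_nat k * indicator (S k) \<omega>) \<partial>M)"
  proof (rule nn_integral_cong)
    fix \<omega> assume \<omega>: "\<omega> \<in> space M"
    define n where "n = card (\<eta> \<omega> \<inter> A)"
    have n: "point_count (\<eta> \<omega>) A = of_nat n"
      using finA[OF \<omega>] by (simp add: point_count_def n_def)
    have "(\<Sum>k. of_nat k * indicator (S k) \<omega> :: ennreal) = (\<Sum>k\<in>{n}. of_nat k * indicator (S k) \<omega>)"
      by (rule suminf_finite) (auto simp: S_def n \<omega> split: split_indicator)
    also have "\<dots> = of_nat n" using \<omega> by (simp add: S_def n)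
    finally show "point_count (\<eta> \<omega>) A = (\<Sum>k. of_nat k * indicator (S k) \<omega>)" by (simp add: n)
  qed
  also have "\<dots> = (\<Sum>k. of_nat k * emeasure M (S k))"
    by (simp add: nn_integral_suminf nn_integral_cmult)
  also have "\<dots> = (\<Sum>k. ennreal (real k * (l ^ k / fact k * exp (- l))))"
  proof (rule suminf_cong)
    fix k
    have "emeasure M (S k) = ennreal (l ^ k / fact k * exp (- l))"
      unfolding S_def l_def by (subst emeasure_eq_measure) (simp add: prob_point_count[OF A fin])
    then show "of_nat k * emeasure M (S k) = ennreal (real k * (l ^ k / fact k * exp (- l)))"
      by (simp only: ennreal_of_nat_eq_real_of_nat ennreal_mult'[OF of_nat_0_le_iff])
  qed
  also have "\<dots> = ennreal l"
  proof (rule suminf_ennreal_eq)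
    have "(\<lambda>k. l ^ k / fact k) sums exp l"
      using exp_converges[of l] by (simp add: divide_inverse_commute)
    then have "(\<lambda>k. (l * exp (- l)) * (l ^ k / fact k)) sums ((l * exp (- l)) * exp l)"
      by (rule sums_mult)
    moreover have "(l * exp (- l)) * exp l = l" by (simp add: exp_minus)
    \<comment> \<open>\<open>k\<close> times a Poisson weight is \<open>l\<close> times the
      preceding weight, so the series for the mean is the exponential series shifted by one.\<close>
    moreover have "(l * exp (- l)) * (l ^ k / fact k) = real (Suc k) * (l ^ Suc k / fact (Suc k) * exp (- l))" for k
      by (simp add: divide_simps del: of_nat_Suc)
    ultimately have "(\<lambda>k. real (Suc k) * (l ^ Suc k / fact (Suc k) * exp (- l))) sums l"
      by (simp only:)
    then have "(\<lambda>k. real (Suc k) * (l ^ Suc k / fact (Suc k) * exp (- l))) sums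
        (l - real 0 * (l ^ 0 / fact 0 * exp (- l)))" by simp
    then show "(\<lambda>k. real k * (l ^ k / fact k * exp (- l))) sums l"
      using sums_Suc_iff[of "\<lambda>k. real k * (l ^ k / fact k * exp (- l))" l] by simp
  qed (use l in simp)
  also have "\<dots> = emeasure \<Lambda> A" using fin by (simp add: l_def emeasure_eq_ennreal_measure)
  finally show ?thesis .
qed

text \<open>Factorial moment measure on products of disjoint sets: rectangles factor by independence
  of the counts, and finiteness of all masses lets the identity pass through a Dynkin system.
  Measurability of the count is part of the induction, since complements and unions need it.\<close>

lemma tuple_count_intensity:
  fixes A :: "nat \<Rightarrow> 'b set"
  assumes A: "\<And>i. i < n \<Longrightarrow> A i \<in> sets \<Lambda>" "disjoint_family_on A {..<n}"
    "\<And>i. i < n \<Longrightarrow> emeasure \<Lambda> (A i) < \<infinity>"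
    and finA: "\<And>\<omega> i. \<omega> \<in> space M \<Longrightarrow> i < n \<Longrightarrow> finite (\<eta> \<omega> \<inter> A i)"
    and D: "D \<in> sets (PiM {..<n} (\<lambda>_. \<Lambda>))"
  shows "(\<lambda>\<omega>. emeasure (count_space UNIV) ((\<Pi>\<^sub>E i\<in>{..<n}. \<eta> \<omega> \<inter> A i) \<inter> D)) \<in> borel_measurable M \<and>
    (\<integral>\<^sup>+\<omega>. emeasure (count_space UNIV) ((\<Pi>\<^sub>E i\<in>{..<n}. \<eta> \<omega> \<inter> A i) \<inter> D) \<partial>M)
      = emeasure (PiM {..<n} (\<lambda>i. density \<Lambda> (indicator (A i)))) D"
proof -
  let ?P = "PiM {..<n} (\<lambda>i. density \<Lambda> (indicator (A i)))"
  define T where "T \<omega> = (\<Pi>\<^sub>E i\<in>{..<n}. \<eta> \<omega> \<inter> A i)" for \<omega>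
  define N where "N D \<omega> = emeasure (count_space UNIV) (T \<omega> \<inter> D)" for D \<omega>
  have finT: "finite (T \<omega>)" if "\<omega> \<in> space M" for \<omega>
    unfolding T_def using finA[OF that] by (intro finite_PiE) auto
  \<comment> \<open>\<open>product_sigma_finite\<close> asks for sigma-finite factors at all
    indices, so \<open>A\<close> is continued by empty sets.\<close>
  define A' where "A' i = (if i < n then A i else {})" for i
  have A'_eq: "A' i = A i" if "i < n" for i using that by (simp add: A'_def)
  have densA: "density \<Lambda> (indicator (A i)) = density \<Lambda> (indicator (A' i))" if "i < n" for i
    using that by (simp add: A'_def)
  have P: "?P = PiM {..<n} (\<lambda>i. density \<Lambda> (indicator (A' i)))"
    by (rule PiM_cong) (auto simp: A'_def)
  have emd: "emeasure (density \<Lambda> (indicator (A' i))) B = emeasure \<Lambda> (A' i \<inter> B)" if "B \<in> sets \<Lambda>" for i B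
    using that A by (intro emeasure_restricted) (auto simp: A'_def)
  have sf: "sigma_finite_measure (density \<Lambda> (indicator (A' i)))" for i
  proof -
    have "emeasure \<Lambda> (A' i \<inter> space \<Lambda>) \<noteq> \<infinity>"
      using A sets.sets_into_space by (cases "i < n") (auto simp: A'_def Int_absorb2 dest: less_imp_neq)
    then show ?thesis
      by (intro finite_measure.sigma_finite_measure finite_measureI) (simp add: emd)
  qed
  interpret product_sigma_finite "\<lambda>i. density \<Lambda> (indicator (A' i))"
    using sf by (rule product_sigma_finite.intro)
  have sp: "space ?P = (\<Pi>\<^sub>E i\<in>{..<n}. space \<Lambda>)" by (simp add: space_PiM)
  have Tsp: "T \<omega> \<subseteq> (\<Pi>\<^sub>E i\<in>{..<n}. space \<Lambda>)" if "\<omega> \<in> space M" for \<omega>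
    using eta_space[OF that] by (auto simp: T_def PiE_iff)
  have rect: "N (Pi\<^sub>E {..<n} B) \<in> borel_measurable M \<and> (\<integral>\<^sup>+\<omega>. N (Pi\<^sub>E {..<n} B) \<omega> \<partial>M) = emeasure ?P (Pi\<^sub>E {..<n} B)"
    if B: "\<And>i. i < n \<Longrightarrow> B i \<in> sets \<Lambda>" for B
  proof -
    have N: "N (Pi\<^sub>E {..<n} B) \<omega> = (\<Prod>i<n. point_count (\<eta> \<omega>) (A i \<inter> B i))" if \<omega>: "\<omega> \<in> space M" for \<omega>
    proof -
      have "T \<omega> \<inter> Pi\<^sub>E {..<n} B = (\<Pi>\<^sub>E i\<in>{..<n}. \<eta> \<omega> \<inter> (A i \<inter> B i))"
        by (simp add: T_def PiE_Int Int_assoc)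
      moreover have fi: "\<And>i. i < n \<Longrightarrow> finite (\<eta> \<omega> \<inter> (A i \<inter> B i))"
      proof -
        fix i assume "i < n"
        then show "finite (\<eta> \<omega> \<inter> (A i \<inter> B i))"
          using finA[OF \<omega>, of i] by (rule_tac rev_finite_subset) auto
      qed
      then have "finite (\<Pi>\<^sub>E i\<in>{..<n}. \<eta> \<omega> \<inter> (A i \<inter> B i))" by (intro finite_PiE) auto
      ultimately have "N (Pi\<^sub>E {..<n} B) \<omega> = of_nat (card (\<Pi>\<^sub>E i\<in>{..<n}. \<eta> \<omega> \<inter> (A i \<inter> B i)))"
        unfolding N_def by (metis emeasure_count_space_finite subset_UNIV)
      also have "\<dots> = (\<Prod>i<n. of_nat (card (\<eta> \<omega> \<inter> (A i \<inter> B i))))" by (simp add: card_PiE)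
      also have "\<dots> = (\<Prod>i<n. point_count (\<eta> \<omega>) (A i \<inter> B i))"
        using fi by (intro prod.cong) (simp_all add: point_count_def)
      finally show ?thesis .
    qed
    have m: "(\<lambda>\<omega>. \<Prod>i<n. point_count (\<eta> \<omega>) (A i \<inter> B i)) \<in> borel_measurable M"
      using A B by (intro borel_measurable_prod_ennreal measurable_point_count) auto
    have "(\<integral>\<^sup>+\<omega>. N (Pi\<^sub>E {..<n} B) \<omega> \<partial>M) = (\<integral>\<^sup>+\<omega>. (\<Prod>i<n. point_count (\<eta> \<omega>) (A i \<inter> B i)) \<partial>M)"
      by (intro nn_integral_cong N)
    also have "\<dots> = (\<Prod>i<n. \<integral>\<^sup>+\<omega>. point_count (\<eta> \<omega>) (A i \<inter> B i) \<partial>M)"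
      by (intro indep_vars_nn_integral indep_counts)
        (use A B in \<open>auto simp: disjoint_family_on_def\<close>)
    also have "\<dots> = (\<Prod>i<n. emeasure \<Lambda> (A i \<inter> B i))"
    proof (rule prod.cong[OF refl])
      fix i assume "i \<in> {..<n}"
      then have i: "i < n" by simp
      have "emeasure \<Lambda> (A i \<inter> B i) \<le> emeasure \<Lambda> (A i)" using A i by (intro emeasure_mono) auto
      then show "(\<integral>\<^sup>+\<omega>. point_count (\<eta> \<omega>) (A i \<inter> B i) \<partial>M) = emeasure \<Lambda> (A i \<inter> B i)"
      proof (intro nn_integral_point_count)
        show "finite (\<eta> \<omega> \<inter> (A i \<inter> B i))" if "\<omega> \<in> space M" for \<omega>
          using finA[OF that i] by (rule rev_finite_subset) auto
      qed (use A B i in \<open>auto intro: order_le_less_trans\<close>)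
    qed
    also have "\<dots> = emeasure ?P (Pi\<^sub>E {..<n} B)"
      unfolding P using B by (subst emeasure_PiM) (auto simp: A'_eq emeasure_restricted A intro!: prod.cong)
    finally show ?thesis using m N by (simp cong: measurable_cong)
  qed
  have sets_eq: "sets (PiM {..<n} (\<lambda>_. \<Lambda>)) = sigma_sets (\<Pi>\<^sub>E i\<in>{..<n}. space \<Lambda>) (prod_algebra {..<n} (\<lambda>_. \<Lambda>))"
    by (rule sets_PiM)
  have setsP: "sets ?P = sets (PiM {..<n} (\<lambda>_. \<Lambda>))" by (rule sets_PiM_cong) auto
  have top: "N (\<Pi>\<^sub>E i\<in>{..<n}. space \<Lambda>) \<in> borel_measurable M \<and>
    (\<integral>\<^sup>+\<omega>. N (\<Pi>\<^sub>E i\<in>{..<n}. space \<Lambda>) \<omega> \<partial>M) = emeasure ?P (\<Pi>\<^sub>E i\<in>{..<n}. space \<Lambda>)"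
    by (rule rect) simp
  \<comment> \<open>Finite total mass is what allows subtraction in the complement case
    below.\<close>
  have Pfin: "emeasure ?P (\<Pi>\<^sub>E i\<in>{..<n}. space \<Lambda>) < \<infinity>"
  proof -
    have "emeasure (density \<Lambda> (indicator (A i))) (space \<Lambda>) = emeasure \<Lambda> (A i)" if "i < n" for i
      using A(1)[OF that] sets.sets_into_space[OF A(1)[OF that]] by (simp add: emeasure_restricted Int_absorb2)
    then show ?thesis unfolding P using A(3)
      by (subst emeasure_PiM) (auto simp: A'_eq ennreal_prod_eq_top less_top[symmetric] dest: less_imp_neq)
  qed
  have "N D \<in> borel_measurable M \<and> (\<integral>\<^sup>+\<omega>. N D \<omega> \<partial>M) = emeasure ?P D"
    using Int_stable_prod_algebra prod_algebra_sets_into_space D[unfolded sets_eq]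
  proof (induction rule: sigma_sets_induct_disjoint)
    case (basic E)
    then obtain B where "E = Pi\<^sub>E {..<n} B" "\<And>i. i < n \<Longrightarrow> B i \<in> sets \<Lambda>"
      by (auto simp: prod_algebra_eq_finite)
    then show ?case using rect by simp
  next
    case empty
    show ?case by (simp add: N_def)
  next
    case (compl E)
    have E: "E \<in> sets ?P" using compl(1) setsP sets_eq by auto
    have Nc: "N ((\<Pi>\<^sub>E i\<in>{..<n}. space \<Lambda>) - E) \<omega> = N (\<Pi>\<^sub>E i\<in>{..<n}. space \<Lambda>) \<omega> - N E \<omega>" if \<omega>: "\<omega> \<in> space M" for \<omega>
    proof -
      have "T \<omega> \<inter> ((\<Pi>\<^sub>E i\<in>{..<n}. space \<Lambda>) - E) = (T \<omega> \<inter> (\<Pi>\<^sub>E i\<in>{..<n}. space \<Lambda>)) - (T \<omega> \<inter> E)" by auto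
      then show ?thesis unfolding N_def using finT[OF \<omega>] Tsp[OF \<omega>]
        by (simp only:) (intro emeasure_Diff; auto)
    qed
    have "N E \<omega> \<le> N (\<Pi>\<^sub>E i\<in>{..<n}. space \<Lambda>) \<omega>" if "\<omega> \<in> space M" for \<omega>
      unfolding N_def using Tsp[OF that] by (intro emeasure_mono) auto
    moreover have "(\<integral>\<^sup>+\<omega>. N E \<omega> \<partial>M) < \<infinity>"
    proof -
      have "emeasure ?P E \<le> emeasure ?P (space ?P)" by (rule emeasure_space)
      then show ?thesis using compl(2) Pfin unfolding sp by auto
    qed
    ultimately have "(\<integral>\<^sup>+\<omega>. N (\<Pi>\<^sub>E i\<in>{..<n}. space \<Lambda>) \<omega> - N E \<omega> \<partial>M)
      = (\<integral>\<^sup>+\<omega>. N (\<Pi>\<^sub>E i\<in>{..<n}. space \<Lambda>) \<omega> \<partial>M) - (\<integral>\<^sup>+\<omega>. N E \<omega> \<partial>M)"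
      using top compl(2) by (intro nn_integral_diff) auto
    also have "\<dots> = emeasure ?P (space ?P) - emeasure ?P E"
      using top compl(2) sp by simp
    also have "\<dots> = emeasure ?P (space ?P - E)"
      using E compl(2) \<open>(\<integral>\<^sup>+\<omega>. N E \<omega> \<partial>M) < \<infinity>\<close> by (intro emeasure_compl[symmetric]) auto
    finally have "(\<integral>\<^sup>+\<omega>. N ((\<Pi>\<^sub>E i\<in>{..<n}. space \<Lambda>) - E) \<omega> \<partial>M) = emeasure ?P ((\<Pi>\<^sub>E i\<in>{..<n}. space \<Lambda>) - E)"
      using Nc by (simp add: sp cong: nn_integral_cong)
    moreover have "(\<lambda>\<omega>. N (\<Pi>\<^sub>E i\<in>{..<n}. space \<Lambda>) \<omega> - N E \<omega>) \<in> borel_measurable M"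
    proof -
      have [measurable]: "N (\<Pi>\<^sub>E i\<in>{..<n}. space \<Lambda>) \<in> borel_measurable M" "N E \<in> borel_measurable M"
        using top compl(2) by auto
      show ?thesis by measurable
    qed
    ultimately show ?case using Nc by (simp cong: measurable_cong)
  next
    case (union E)
    have E: "range E \<subseteq> sets ?P" using union(2) setsP sets_eq by auto
    have NU: "N (\<Union>i. E i) \<omega> = (\<Sum>i. N (E i) \<omega>)" for \<omega>
    proof -
      have "T \<omega> \<inter> (\<Union>i. E i) = (\<Union>i. T \<omega> \<inter> E i)" by auto
      moreover have "disjoint_family (\<lambda>i. T \<omega> \<inter> E i)" using union(1) by (auto simp: disjoint_family_on_def)
      ultimately show ?thesis unfolding N_def by (simp add: suminf_emeasure)
    qed
    have m: "N (E i) \<in> borel_measurable M" for i using union(3) by auto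
    have "(\<integral>\<^sup>+\<omega>. N (\<Union>i. E i) \<omega> \<partial>M) = (\<Sum>i. emeasure ?P (E i))"
      unfolding NU using m union(3) by (subst nn_integral_suminf) auto
    also have "\<dots> = emeasure ?P (\<Union>i. E i)" using E union(1) by (intro suminf_emeasure)
    moreover have "(\<lambda>\<omega>. \<Sum>i. N (E i) \<omega>) \<in> borel_measurable M" using m by measurable
    ultimately show ?case by (simp add: NU[abs_def])
  qed
  then show ?thesis unfolding N_def T_def .
qed

text \<open>The expected number of tuples in \<open>D\<close> is the product measure of
  \<open>D\<close>, and integrating over the last coordinate first gives 0.\<close>

lemma AE_no_tuple_disjoint:
  fixes A :: "nat \<Rightarrow> 'b set"
  assumes A: "\<And>i. i < Suc k \<Longrightarrow> A i \<in> sets \<Lambda>" "disjoint_family_on A {..<Suc k}"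
    "\<And>i. i < Suc k \<Longrightarrow> emeasure \<Lambda> (A i) < \<infinity>"
    and finA: "\<And>\<omega> i. \<omega> \<in> space M \<Longrightarrow> i < Suc k \<Longrightarrow> finite (\<eta> \<omega> \<inter> A i)"
    and D: "D \<in> sets (PiM {..<Suc k} (\<lambda>_. \<Lambda>))"
    and null: "\<And>h. h \<in> space (PiM {..<k} (\<lambda>_. \<Lambda>)) \<Longrightarrow> AE y in \<Lambda>. h(k := y) \<notin> D"
  shows "AE \<omega> in M. (\<Pi>\<^sub>E i\<in>{..<Suc k}. \<eta> \<omega> \<inter> A i) \<inter> D = {}"
proof -
  let ?d = "\<lambda>i. density \<Lambda> (indicator (if i < Suc k then A i else {}))"
  let ?P = "PiM {..<Suc k} (\<lambda>i. density \<Lambda> (indicator (A i)))"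
  let ?N = "\<lambda>\<omega>. emeasure (count_space UNIV) ((\<Pi>\<^sub>E i\<in>{..<Suc k}. \<eta> \<omega> \<inter> A i) \<inter> D)"
  have sf: "sigma_finite_measure (?d i)" for i
  proof -
    let ?A = "if i < Suc k then A i else {}"
    have A': "?A \<in> sets \<Lambda>" using A by auto
    have "emeasure \<Lambda> (?A \<inter> space \<Lambda>) \<noteq> \<infinity>"
      using A(3)[of i] sets.sets_into_space[OF A'] by (cases "i < Suc k") (auto simp: Int_absorb2 dest: less_imp_neq)
    then show ?thesis
      by (intro finite_measure.sigma_finite_measure finite_measureI) (simp add: emeasure_restricted[OF A'])
  qed
  interpret product_sigma_finite ?d using sf by (rule product_sigma_finite.intro)
  have P: "?P = PiM (insert k {..<k}) ?d"
    by (rule PiM_cong) auto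
  have setsP: "sets ?P = sets (PiM {..<Suc k} (\<lambda>_. \<Lambda>))" by (rule sets_PiM_cong) auto
  have D': "D \<in> sets (PiM (insert k {..<k}) ?d)" using D setsP P by simp
  have "emeasure ?P D = (\<integral>\<^sup>+h. indicator D h \<partial>PiM (insert k {..<k}) ?d)"
    unfolding P using D' by simp
  also have "\<dots> = (\<integral>\<^sup>+h. (\<integral>\<^sup>+y. indicator D (h(k := y)) \<partial>?d k) \<partial>PiM {..<k} ?d)"
    using D' by (intro product_nn_integral_insert) auto
  also have "\<dots> = (\<integral>\<^sup>+h. 0 \<partial>PiM {..<k} ?d)"
  proof (rule nn_integral_cong)
    fix h assume "h \<in> space (PiM {..<k} ?d)"
    then have "h \<in> space (PiM {..<k} (\<lambda>_. \<Lambda>))" by (simp add: space_PiM)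
    then have ae: "AE y in \<Lambda>. h(k := y) \<notin> D" by (rule null)
    have "AE y in ?d k. indicator D (h(k := y)) = (0 :: ennreal)"
      using ae A(1)[of k] by (subst AE_density) auto
    then have "(\<integral>\<^sup>+y. indicator D (h(k := y)) \<partial>?d k) = (\<integral>\<^sup>+y. 0 \<partial>?d k)"
      by (rule nn_integral_cong_AE)
    then show "(\<integral>\<^sup>+y. indicator D (h(k := y)) \<partial>?d k) = 0" by simp
  qed
  finally have "emeasure ?P D = 0" by simp
  then have "(\<integral>\<^sup>+\<omega>. ?N \<omega> \<partial>M) = 0" "?N \<in> borel_measurable M"
    using tuple_count_intensity[OF A finA D] by simp_all
  then have "AE \<omega> in M. ?N \<omega> = 0" by (subst (asm) nn_integral_0_iff_AE)
  then show ?thesis by eventually_elim (simp add: emeasure_count_space_eq_0)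
qed

text \<open>Any finite tuple of distinct points is split by finitely many of the sets \<open>c l\<close>, hence
  lies in one of countably many products of disjoint sets, to which the previous lemma applies.\<close>

lemma AE_no_tuple:
  fixes c W :: "nat \<Rightarrow> 'b set"
  assumes c: "\<And>l. c l \<in> sets \<Lambda>" "\<And>x y. x \<in> space \<Lambda> \<Longrightarrow> y \<in> space \<Lambda> \<Longrightarrow> x \<noteq> y \<Longrightarrow> \<exists>l. (x \<in> c l) \<noteq> (y \<in> c l)"
    and W: "\<And>n. W n \<in> sets \<Lambda>" "incseq W" "(\<Union>n. W n) = space \<Lambda>" "\<And>n. emeasure \<Lambda> (W n) < \<infinity>"
      "\<And>\<omega> n. \<omega> \<in> space M \<Longrightarrow> finite (\<eta> \<omega> \<inter> W n)"
    and D: "D \<in> sets (PiM {..<Suc k} (\<lambda>_. \<Lambda>))"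
    and null: "\<And>h. h \<in> space (PiM {..<k} (\<lambda>_. \<Lambda>)) \<Longrightarrow> AE y in \<Lambda>. h(k := y) \<notin> D"
  shows "AE \<omega> in M. \<forall>h\<in>(\<Pi>\<^sub>E i\<in>{..<Suc k}. \<eta> \<omega>). inj_on h {..<Suc k} \<longrightarrow> h \<notin> D"
proof -
  \<comment> \<open>The atom with membership pattern \<open>p\<close> for the first \<open>n\<close>
    separating sets, within the window \<open>W N\<close>; distinct patterns give disjoint
    atoms.\<close>
  define A where "A N n p = {x\<in>W N. \<forall>l<n. x \<in> c l \<longleftrightarrow> l \<in> p}" for N n :: nat and p :: "nat set"
  have A: "A N n p \<in> sets \<Lambda>" "A N n p \<subseteq> W N" for N n p
  proof -
    have "A N n p = W N \<inter> (\<Inter>l\<in>{..<n} \<inter> p. c l) - (\<Union>l\<in>{..<n} - p. c l)"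
      by (auto simp: A_def)
    moreover have "W N \<inter> (\<Inter>l\<in>{..<n} \<inter> p. c l) \<in> sets \<Lambda>"
      using c W by (cases "{..<n} \<inter> p = {}") (auto intro!: sets.Int sets.finite_INT)
    ultimately show "A N n p \<in> sets \<Lambda>" using c by (auto intro!: sets.Diff sets.finite_UN)
  qed (auto simp: A_def)
  have ae: "AE \<omega> in M. (\<Pi>\<^sub>E i\<in>{..<Suc k}. \<eta> \<omega> \<inter> A N n (p i)) \<inter> D = {}"
    if p: "p \<in> {..<Suc k} \<rightarrow>\<^sub>E Pow {..<n}" "inj_on p {..<Suc k}" for N n p
  proof (rule AE_no_tuple_disjoint[OF _ _ _ _ D null])
    show "disjoint_family_on (\<lambda>i. A N n (p i)) {..<Suc k}"
      unfolding disjoint_family_on_def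
    proof (intro ballI impI)
      fix i j assume ij: "i \<in> {..<Suc k}" "j \<in> {..<Suc k}" "i \<noteq> j"
      then have "p i \<noteq> p j" "p i \<subseteq> {..<n}" "p j \<subseteq> {..<n}" using p by (auto simp: inj_on_def PiE_iff)
      then obtain l where "l < n" "(l \<in> p i) \<noteq> (l \<in> p j)" by blast
      then show "A N n (p i) \<inter> A N n (p j) = {}" by (auto simp: A_def)
    qed
    show "emeasure \<Lambda> (A N n (p i)) < \<infinity>" for i
      using emeasure_mono[OF A(2) W(1), of N n "p i"] W(4)[of N] by (rule order_le_less_trans)
    show "finite (\<eta> \<omega> \<inter> A N n (p i))" if "\<omega> \<in> space M" for \<omega> i
      using W(5)[OF that, of N] A(2)[of N n "p i"] by (rule_tac rev_finite_subset) auto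
  qed (use A in auto)
  have "AE \<omega> in M. \<forall>N n. \<forall>p\<in>{p \<in> {..<Suc k} \<rightarrow>\<^sub>E Pow {..<n}. inj_on p {..<Suc k}}.
      (\<Pi>\<^sub>E i\<in>{..<Suc k}. \<eta> \<omega> \<inter> A N n (p i)) \<inter> D = {}"
  proof -
    have "countable {p \<in> {..<Suc k} \<rightarrow>\<^sub>E Pow {..<n}. inj_on p {..<Suc k}}" for n :: nat
      by (intro countable_finite finite_subset[OF _ finite_PiE[of "{..<Suc k}" "\<lambda>_. Pow {..<n}"]]) auto
    then show ?thesis
      unfolding AE_all_countable by (intro allI, subst AE_ball_countable) (use ae in auto)
  qed
  moreover have "AE \<omega> in M. \<omega> \<in> space M" by (rule AE_space)
  ultimately show ?thesis
  proof eventually_elim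
    fix \<omega>
    assume none: "\<forall>N n. \<forall>p\<in>{p \<in> {..<Suc k} \<rightarrow>\<^sub>E Pow {..<n}. inj_on p {..<Suc k}}.
      (\<Pi>\<^sub>E i\<in>{..<Suc k}. \<eta> \<omega> \<inter> A N n (p i)) \<inter> D = {}" and \<omega>: "\<omega> \<in> space M"
    show "\<forall>h\<in>(\<Pi>\<^sub>E i\<in>{..<Suc k}. \<eta> \<omega>). inj_on h {..<Suc k} \<longrightarrow> h \<notin> D"
    proof (intro ballI impI)
      fix h assume h: "h \<in> (\<Pi>\<^sub>E i\<in>{..<Suc k}. \<eta> \<omega>)" and inj: "inj_on h {..<Suc k}"
      have hsp: "h i \<in> space \<Lambda>" if "i < Suc k" for i using h eta_space[OF \<omega>] that by (auto simp: PiE_iff)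
      have "\<exists>N. h i \<in> W N" if "i < Suc k" for i using hsp[OF that] W(3) by auto
      then obtain Nf where Nf: "\<And>i. i < Suc k \<Longrightarrow> h i \<in> W (Nf i)" by metis
      define N where "N = Max (Nf ` {..<Suc k})"
      have hN: "h i \<in> W N" if "i < Suc k" for i
      proof -
        have "Nf i \<le> N" unfolding N_def using that by (intro Max_ge) auto
        then show ?thesis using Nf[OF that] W(2) by (auto simp: incseq_def)
      qed
      have "\<exists>l. (h i \<in> c l) \<noteq> (h j \<in> c l)" if "i < Suc k" "j < Suc k" "i \<noteq> j" for i j
        using that inj hsp by (intro c(2)) (auto simp: inj_on_def)
      then obtain s where s: "\<And>i j. i < Suc k \<Longrightarrow> j < Suc k \<Longrightarrow> i \<noteq> j \<Longrightarrow> (h i \<in> c (s i j)) \<noteq> (h j \<in> c (s i j))"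
        by metis
      define n where "n = Suc (Max ((\<lambda>(i, j). s i j) ` ({..<Suc k} \<times> {..<Suc k})))"
      have sn: "s i j < n" if "i < Suc k" "j < Suc k" for i j
        unfolding n_def less_Suc_eq_le using that by (intro Max_ge) auto
      define p where "p = (\<lambda>i\<in>{..<Suc k}. {l. l < n \<and> h i \<in> c l})"
      have "p \<in> {..<Suc k} \<rightarrow>\<^sub>E Pow {..<n}" by (auto simp: p_def)
      moreover have "inj_on p {..<Suc k}"
      proof (rule inj_onI, rule ccontr)
        fix i j assume ij: "i \<in> {..<Suc k}" "j \<in> {..<Suc k}" "p i = p j" "i \<noteq> j"
        then have "(s i j \<in> p i) \<noteq> (s i j \<in> p j)" using s[of i j] sn[of i j] by (auto simp: p_def)
        then show False using ij by simp
      qed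
      ultimately have "(\<Pi>\<^sub>E i\<in>{..<Suc k}. \<eta> \<omega> \<inter> A N n (p i)) \<inter> D = {}" using none by blast
      moreover have "h \<in> (\<Pi>\<^sub>E i\<in>{..<Suc k}. \<eta> \<omega> \<inter> A N n (p i))"
        using h hN by (auto simp: PiE_iff A_def p_def)
      ultimately show "h \<notin> D" by blast
    qed
  qed
qed

end

section \<open>The sigma-field on hyperplanes and its measurable functions\<close>

lemma space_hyperplane_space [simp]: "space hyperplane_space = hyperplanes"
  by (simp add: hyperplane_space_def space_measure_of_conv)

lemma hitting_in_sets [measurable]: "compact K \<Longrightarrow> hitting K \<in> sets hyperplane_space"
  unfolding hyperplane_space_def by (subst sets_measure_of) (auto simp: hitting_def)

lemma hyperplane_nonempty: "H \<in> hyperplanes \<Longrightarrow> H \<noteq> {}"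
proof (elim hyperplanesE)
  fix u :: 'a and s assume "norm u = 1" "H = {x. u \<bullet> x = s}"
  then have "s *\<^sub>R u \<in> H" by (simp add: norm_eq_1)
  then show "H \<noteq> {}" by auto
qed

text \<open>The distance is attained because hyperplanes are closed. This link between distances and
  the generating sets makes distances measurable on \<open>hyperplane_space\<close>.\<close>

lemma infdist_hyperplane_le_iff:
  assumes "H \<in> hyperplanes" "0 \<le> r"
  shows "infdist x H \<le> r \<longleftrightarrow> H \<in> hitting (cball x r)"
proof
  assume "infdist x H \<le> r"
  moreover obtain y where "y \<in> H" "infdist x H = dist x y"
    using infdist_attains_inf[OF hyperplanes_closed[OF assms(1)] hyperplane_nonempty[OF assms(1)]] by blast
  ultimately show "H \<in> hitting (cball x r)" using assms by (auto simp: hitting_def)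
next
  assume "H \<in> hitting (cball x r)"
  then obtain y where "y \<in> H" "dist x y \<le> r" by (auto simp: hitting_def)
  then show "infdist x H \<le> r" using infdist_le2 by blast
qed

lemma infdist_hyperplane_0_iff:
  "H \<in> hyperplanes \<Longrightarrow> infdist x H \<le> 0 \<longleftrightarrow> x \<in> H"
  by (subst infdist_hyperplane_le_iff) (auto simp: hitting_def)

lemma measurable_infdist_hyperplane [measurable]:
  "(\<lambda>H. infdist x H) \<in> borel_measurable hyperplane_space"
proof (rule borel_measurableI_le)
  fix a
  have "{H \<in> space hyperplane_space. infdist x H \<le> a} = (if 0 \<le> a then hitting (cball x a) else {})"
  proof (cases "0 \<le> a")
    case True
    have "hitting (cball x a) \<subseteq> hyperplanes" by (auto simp: hitting_def)
    then show ?thesis using True infdist_hyperplane_le_iff by auto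
  next
    case False
    have "\<not> infdist x H \<le> a" for H using False infdist_nonneg[of x H] by linarith
    then show ?thesis using False by simp
  qed
  then show "{H \<in> space hyperplane_space. infdist x H \<le> a} \<in> sets hyperplane_space" by auto
qed

lemma measurable_infdist_component [measurable]:
  assumes "i \<in> I"
  shows "(\<lambda>h. infdist x (h i)) \<in> borel_measurable (PiM I (\<lambda>_. hyperplane_space))"
proof (rule measurable_compose[where f="\<lambda>h. h i" and g="infdist x"])
  show "(\<lambda>h. h i) \<in> measurable (PiM I (\<lambda>_. hyperplane_space)) hyperplane_space"
    using assms by (rule measurable_component_singleton)
qed (rule measurable_infdist_hyperplane)

text \<open>A condition \<open>\<exists>x\<in>K. R x d \<le> 0\<close> over a compact set only involves countably many \<open>x\<close>.\<close>

lemma sets_Ex_compact: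
  fixes R :: "'b::{metric_space, second_countable_topology} \<Rightarrow> 'd \<Rightarrow> real"
  assumes K: "compact K" and cont: "\<And>d. d \<in> space N \<Longrightarrow> continuous_on K (\<lambda>x. R x d)"
    and meas: "\<And>x. x \<in> K \<Longrightarrow> R x \<in> borel_measurable N"
  shows "{d\<in>space N. \<exists>x\<in>K. R x d \<le> 0} \<in> sets N"
proof -
  obtain D where D: "countable D" "D \<subseteq> K" "K \<subseteq> closure D" by (rule separable)
  have "{d\<in>space N. \<exists>x\<in>K. R x d \<le> 0} = {d\<in>space N. \<forall>n. \<exists>q\<in>D. R q d < 1 / real (Suc n)}" (is "?L = ?R")
  proof (intro equalityI subsetI)
    fix d assume "d \<in> ?L"
    then obtain x where x: "d \<in> space N" "x \<in> K" "R x d \<le> 0" by auto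
    have "\<exists>q\<in>D. R q d < 1 / real (Suc n)" for n
    proof -
      obtain e where e: "0 < e" "\<And>y. y \<in> K \<Longrightarrow> dist y x < e \<Longrightarrow> dist (R y d) (R x d) < 1 / real (Suc n)"
        using cont[OF x(1)] x(2) unfolding continuous_on_iff by (metis of_nat_0_less_iff zero_less_Suc zero_less_divide_1_iff)
      obtain q where q: "q \<in> D" "dist q x < e" using D(3) x(2) e(1) by (meson closure_approachable subsetD)
      then have "dist (R q d) (R x d) < 1 / real (Suc n)" using D(2) e(2) by auto
      then have "R q d < 1 / real (Suc n)" using x(3) by (auto simp: dist_real_def)
      then show ?thesis using q by auto
    qed
    then show "d \<in> ?R" using x by auto
  next
    fix d assume d: "d \<in> ?R"
    then have dN: "d \<in> space N" by auto
    have "K \<noteq> {}" using d D by auto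
    then obtain x where x: "x \<in> K" "\<And>y. y \<in> K \<Longrightarrow> R x d \<le> R y d"
      using continuous_attains_inf[OF K _ cont[OF dN]] by auto
    have "R x d < 1 / real (Suc n)" for n
    proof -
      obtain q where "q \<in> D" "R q d < 1 / real (Suc n)" using d by auto
      then show ?thesis using x(2)[of q] D(2) by (auto intro: order_le_less_trans)
    qed
    then have "R x d \<le> 0" by (meson nat_approx_posE not_le order_less_asym)
    then show "d \<in> ?L" using x dN by auto
  qed
  moreover have "?R \<in> sets N"
  proof (intro sets.sets_Collect_countable_All sets.sets_Collect_countable_Ex'[OF _ D(1)])
    fix n q assume "q \<in> D"
    then have [measurable]: "R q \<in> borel_measurable N" using D meas by auto
    show "{d \<in> space N. R q d < 1 / real (Suc n)} \<in> sets N" by measurable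
  qed
  ultimately show ?thesis by simp
qed

text \<open>A hyperplane hits \<open>K\<close> if some \<open>y\<close> in \<open>K\<close> solves
  \<open>y \<bullet> u = s\<close>, an existential condition over a compact set.\<close>

lemma measurable_hyperplane:
  assumes Q: "sets Q = sets (restrict_space borel (sphere 0 1))"
  shows "(\<lambda>(u, s). hyperplane u s) \<in> measurable (Q \<Otimes>\<^sub>M lborel) hyperplane_space"
  unfolding hyperplane_space_def
proof (rule measurable_measure_of)
  have spQ: "space Q = sphere 0 1" using sets_eq_imp_space_eq[OF Q] by (simp add: space_restrict_space)
  show "{hitting K |K. compact K} \<subseteq> Pow hyperplanes" by (auto simp: hitting_def)
  show "(\<lambda>(u, s). hyperplane u s) \<in> space (Q \<Otimes>\<^sub>M lborel) \<rightarrow> hyperplanes"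
    by (auto simp: space_pair_measure spQ hyperplanes_def)
  fix A :: "'a set set" assume "A \<in> {hitting K |K. compact K}"
  then obtain K where K: "compact K" "A = hitting K" by auto
  have id: "(\<lambda>u. u) \<in> measurable Q borel"
    using Q by (simp add: measurable_cong_sets[OF Q refl] measurable_ident_sets measurable_restrict_space1)
  have "(\<lambda>(u, s). hyperplane u s) -` A \<inter> space (Q \<Otimes>\<^sub>M lborel)
    = {p \<in> space (Q \<Otimes>\<^sub>M lborel). \<exists>y\<in>K. \<bar>y \<bullet> fst p - snd p\<bar> \<le> 0}"
    unfolding K(2) by (auto simp: hitting_def hyperplane_def hyperplanes_def space_pair_measure spQ)
  also have "\<dots> \<in> sets (Q \<Otimes>\<^sub>M lborel)"
  proof (rule sets_Ex_compact[OF K(1)])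
    note id[measurable]
    have [measurable]: "fst \<in> measurable (Q \<Otimes>\<^sub>M lborel) borel"
      using measurable_compose[OF measurable_fst id] by simp
    show "(\<lambda>p. \<bar>x \<bullet> fst p - snd p\<bar>) \<in> borel_measurable (Q \<Otimes>\<^sub>M lborel)" for x by measurable
  qed (intro continuous_intros)
  finally show "(\<lambda>(u, s). hyperplane u s) -` A \<inter> space (Q \<Otimes>\<^sub>M lborel) \<in> sets (Q \<Otimes>\<^sub>M lborel)" .
qed

lemma emeasure_hyperplane_intensity:
  assumes Q: "sets Q = sets (restrict_space borel (sphere 0 1))" and A: "A \<in> sets hyperplane_space"
  shows "emeasure (hyperplane_intensity \<gamma> Q) A
    = ennreal \<gamma> * (\<integral>\<^sup>+u. emeasure lborel {s. hyperplane u s \<in> A} \<partial>Q)"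
proof -
  note m = measurable_hyperplane[OF Q]
  have "emeasure (hyperplane_intensity \<gamma> Q) A
      = ennreal \<gamma> * emeasure (Q \<Otimes>\<^sub>M lborel) ((\<lambda>(u, s). hyperplane u s) -` A \<inter> space (Q \<Otimes>\<^sub>M lborel))"
    unfolding hyperplane_intensity_def by (simp add: emeasure_distr[OF m A])
  also have "emeasure (Q \<Otimes>\<^sub>M lborel) ((\<lambda>(u, s). hyperplane u s) -` A \<inter> space (Q \<Otimes>\<^sub>M lborel))
      = (\<integral>\<^sup>+u. emeasure lborel (Pair u -` ((\<lambda>(u, s). hyperplane u s) -` A \<inter> space (Q \<Otimes>\<^sub>M lborel))) \<partial>Q)"
    using measurable_sets[OF m A] by (rule lborel.emeasure_pair_measure_alt)
  also have "\<dots> = (\<integral>\<^sup>+u. emeasure lborel {s. hyperplane u s \<in> A} \<partial>Q)"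
    by (intro nn_integral_cong arg_cong[where f="emeasure lborel"]) (auto simp: space_pair_measure)
  finally show ?thesis .
qed

lemma sets_hyperplane_intensity [simp]: "sets (hyperplane_intensity \<gamma> Q) = sets hyperplane_space"
  by (simp add: hyperplane_intensity_def)

lemma space_hyperplane_intensity [simp]: "space (hyperplane_intensity \<gamma> Q) = hyperplanes"
  using sets_eq_imp_space_eq[OF sets_hyperplane_intensity] by simp

section \<open>The Poisson hyperplane process and null sets of tuples\<close>

locale poisson_hyperplanes = prob_space M for M :: "'w measure" +
  fixes \<eta> :: "'w \<Rightarrow> 'a::euclidean_space set set" and Q :: "'a measure" and \<gamma> :: real
  assumes \<gamma>: "\<gamma> > 0" and Q: "directional_distribution Q" and eta: "poisson_hyperplane_process M \<gamma> Q \<eta>"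

sublocale poisson_hyperplanes \<subseteq> finite_window_poisson M "hyperplane_intensity \<gamma> Q" \<eta>
  using eta by unfold_locales (simp add: poisson_hyperplane_process_def)

context poisson_hyperplanes
begin

lemma sets_Q: "sets Q = sets (restrict_space borel (sphere 0 1))"
  using Q by (simp add: directional_distribution_def)

lemma space_Q: "space Q = sphere 0 1"
  using sets_eq_imp_space_eq[OF sets_Q] by (simp add: space_restrict_space)

lemma emeasure_Q [simp]: "emeasure Q (sphere 0 1) = 1"
  using Q prob_space.emeasure_space_1[of Q] by (simp add: directional_distribution_def space_Q)

lemma eta_hyperplanes: "\<omega> \<in> space M \<Longrightarrow> \<eta> \<omega> \<subseteq> hyperplanes"
  using eta_space by simp

lemma finite_hitting: "\<omega> \<in> space M \<Longrightarrow> compact K \<Longrightarrow> finite (\<eta> \<omega> \<inter> hitting K)"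
  using eta by (auto simp: poisson_hyperplane_process_def)

lemma intensity_cball_finite: "emeasure (hyperplane_intensity \<gamma> Q) (hitting (cball 0 r)) < \<infinity>"
proof -
  have "emeasure lborel {s. hyperplane u s \<in> hitting (cball 0 r)} \<le> ennreal (2 * \<bar>r\<bar>)" if "u \<in> space Q" for u
  proof -
    have "{s. hyperplane u s \<in> hitting (cball 0 r)} \<subseteq> {- \<bar>r\<bar>..\<bar>r\<bar>}"
    proof
      fix s assume "s \<in> {s. hyperplane u s \<in> hitting (cball 0 r)}"
      then have "\<exists>y. y \<bullet> u = s \<and> norm y \<le> r" by (force simp: hitting_def hyperplane_def)
      then obtain y where y: "y \<bullet> u = s" "norm y \<le> r" by blast
      have "\<bar>y \<bullet> u\<bar> \<le> norm y * norm u" by (rule Cauchy_Schwarz_ineq2)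
      then show "s \<in> {- \<bar>r\<bar>..\<bar>r\<bar>}" using y that by (auto simp: space_Q)
    qed
    then have "emeasure lborel {s. hyperplane u s \<in> hitting (cball 0 r)} \<le> emeasure lborel {- \<bar>r\<bar>..\<bar>r\<bar>}"
      by (intro emeasure_mono) auto
    then show ?thesis by simp
  qed
  then have "(\<integral>\<^sup>+u. emeasure lborel {s. hyperplane u s \<in> hitting (cball 0 r)} \<partial>Q) \<le> (\<integral>\<^sup>+u. ennreal (2 * \<bar>r\<bar>) \<partial>Q)"
    by (rule nn_integral_mono)
  also have "\<dots> = ennreal (2 * \<bar>r\<bar>)" using emeasure_Q by (simp add: space_Q)
  finally have "(\<integral>\<^sup>+u. emeasure lborel {s. hyperplane u s \<in> hitting (cball 0 r)} \<partial>Q) < \<infinity>"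
    by (rule order_le_less_trans) simp
  then show ?thesis
    by (subst emeasure_hyperplane_intensity[OF sets_Q]) (auto simp: ennreal_mult_less_top)
qed

text \<open>For each direction a single offset \<open>s\<close> gives a hyperplane through
  \<open>z\<close>. The statements on general position are all reduced to this null set.\<close>

lemma intensity_point_null: "emeasure (hyperplane_intensity \<gamma> Q) (hitting {z}) = 0"
proof -
  have "emeasure lborel {s. hyperplane u s \<in> hitting {z}} = 0" for u
  proof -
    have "emeasure lborel {s. hyperplane u s \<in> hitting {z}} \<le> emeasure lborel {z \<bullet> u}"
      by (intro emeasure_mono) (auto simp: hitting_def hyperplane_def)
    then show ?thesis by simp
  qed
  then show ?thesis by (subst emeasure_hyperplane_intensity[OF sets_Q]) auto
qed

text \<open>Hyperplanes are separated by the balls with dense centres and radii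
  \<open>1 / (n + 1)\<close> that they hit, and balls about the origin serve as windows of finite
  intensity. Given the first \<open>k\<close> hyperplanes, \<open>D\<close> leaves only a null set
  for the last one.\<close>

lemma AE_no_hyperplane_tuple:
  assumes D: "D \<in> sets (PiM {..<Suc k} (\<lambda>_. hyperplane_space))"
    and null: "\<And>h. h \<in> space (PiM {..<k} (\<lambda>_. hyperplane_space)) \<Longrightarrow> \<exists>z. \<forall>H\<in>hyperplanes. h(k := H) \<in> D \<longrightarrow> z \<in> H"
  shows "AE \<omega> in M. \<forall>h\<in>(\<Pi>\<^sub>E i\<in>{..<Suc k}. \<eta> \<omega>). inj_on h {..<Suc k} \<longrightarrow> h \<notin> D"
proof -
  obtain C :: "'a set" where C: "countable C" "\<And>X. open X \<Longrightarrow> X \<noteq> {} \<Longrightarrow> \<exists>d\<in>C. d \<in> X"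
    using countable_dense_exists by blast
  then have "C \<noteq> {}" using C(2)[of UNIV] by auto
  define c where "c l = (case prod_decode l of (i, n) \<Rightarrow> hitting (cball (from_nat_into C i) (1 / real (Suc n))))" for l
  define W where "W n = (hitting (cball 0 (real n)) :: 'a set set)" for n
  have sep: "\<exists>l. x \<in> c l \<and> y \<notin> c l" if xy: "x \<in> hyperplanes" "y \<in> hyperplanes" "p \<in> x" "p \<notin> y" for x y p
  proof -
    have "0 < infdist p y"
      using infdist_hyperplane_0_iff[OF xy(2), of p] xy by auto
    then obtain n where n: "1 / real (Suc n) < infdist p y / 2" using nat_approx_posE[of "infdist p y / 2"] by auto
    obtain q where q: "q \<in> C" "dist p q < 1 / real (Suc n)"
      using C(2)[of "ball p (1 / real (Suc n))"] by auto
    obtain i where i: "from_nat_into C i = q" using from_nat_into_surj[OF C(1) q(1)] by auto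
    have "x \<in> hitting (cball q (1 / real (Suc n)))"
      using xy q by (auto simp: hitting_def dist_commute intro!: exI[of _ p] less_imp_le)
    moreover have "y \<notin> hitting (cball q (1 / real (Suc n)))"
    proof
      assume "y \<in> hitting (cball q (1 / real (Suc n)))"
      then have "infdist q y \<le> 1 / real (Suc n)" using infdist_hyperplane_le_iff[OF xy(2), of "1 / real (Suc n)" q] by auto
      moreover have "infdist p y \<le> infdist q y + dist p q" by (rule infdist_triangle)
      ultimately show False using n q by auto
    qed
    ultimately show ?thesis by (intro exI[of _ "prod_encode (i, n)"]) (simp add: c_def i)
  qed
  show ?thesis
  proof (rule AE_no_tuple[of c W])
    show "c l \<in> sets (hyperplane_intensity \<gamma> Q)" for l by (auto simp: c_def split: prod.split)
    show "W n \<in> sets (hyperplane_intensity \<gamma> Q)" for n by (simp add: W_def)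
    show "incseq W" unfolding incseq_def W_def hitting_def
      by (auto intro: order_trans simp: disjoint_iff)
    show "(\<Union>n. W n) = space (hyperplane_intensity \<gamma> Q)"
    proof safe
      fix H :: "'a set" assume "H \<in> space (hyperplane_intensity \<gamma> Q)"
      then have H: "H \<in> hyperplanes" by simp
      then obtain y where "y \<in> H" using hyperplane_nonempty by blast
      moreover obtain n where "norm y \<le> real n" using real_arch_simple by blast
      ultimately show "H \<in> (\<Union>n. W n)" using H by (auto simp: W_def hitting_def intro!: exI[of _ n])
    qed (auto simp: W_def hitting_def)
    show "emeasure (hyperplane_intensity \<gamma> Q) (W n) < \<infinity>" for n unfolding W_def by (rule intensity_cball_finite)
    show "finite (\<eta> \<omega> \<inter> W n)" if "\<omega> \<in> space M" for \<omega> n unfolding W_def using that by (intro finite_hitting) auto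
    show "D \<in> sets (PiM {..<Suc k} (\<lambda>_. hyperplane_intensity \<gamma> Q))"
      using D by (simp cong: sets_PiM_cong)
    show "\<exists>l. (x \<in> c l) \<noteq> (y \<in> c l)"
      if "x \<in> space (hyperplane_intensity \<gamma> Q)" "y \<in> space (hyperplane_intensity \<gamma> Q)" "x \<noteq> y" for x y
    proof -
      obtain p where "p \<in> x \<and> p \<notin> y \<or> p \<in> y \<and> p \<notin> x" using \<open>x \<noteq> y\<close> by blast
      then show ?thesis using sep[of x y p] sep[of y x p] that by auto
    qed
    show "AE y in hyperplane_intensity \<gamma> Q. h(k := y) \<notin> D"
      if "h \<in> space (PiM {..<k} (\<lambda>_. hyperplane_intensity \<gamma> Q))" for h
    proof -
      have "h \<in> space (PiM {..<k} (\<lambda>_. hyperplane_space))" using that by (simp add: space_PiM)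
      then obtain z where "\<forall>H\<in>hyperplanes. h(k := H) \<in> D \<longrightarrow> z \<in> H" using null by blast
      then show ?thesis
      proof (intro AE_I[OF _ intensity_point_null[of z]])
        show "hitting {z} \<in> sets (hyperplane_intensity \<gamma> Q)" by simp
      qed (auto simp: hitting_def)
    qed
  qed
qed

text \<open>Conditions on a parameter \<open>z\<close> are encoded as residuals
  \<open>R z h \<le> 0\<close>, continuous in \<open>z\<close>, so that their projection along a
  compact ball of parameters is measurable. Given \<open>k\<close> hyperplanes, at most one point
  \<open>\<psi> z\<close> remains, and the next hyperplane misses it.\<close>

lemma AE_avoid:
  fixes R :: "'b::euclidean_space \<Rightarrow> (nat \<Rightarrow> 'a set) \<Rightarrow> real" and \<psi> :: "'b \<Rightarrow> 'a"
  assumes meas: "\<And>z. R z \<in> borel_measurable (PiM {..<k} (\<lambda>_. hyperplane_space))"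
    and cont: "\<And>h. h \<in> space (PiM {..<k} (\<lambda>_. hyperplane_space)) \<Longrightarrow> continuous_on UNIV (\<lambda>z. R z h)"
    and cont_\<psi>: "continuous_on UNIV \<psi>"
    and unique: "\<And>h z z'. h \<in> space (PiM {..<k} (\<lambda>_. hyperplane_space)) \<Longrightarrow> R z h \<le> 0 \<Longrightarrow> R z' h \<le> 0 \<Longrightarrow> \<psi> z = \<psi> z'"
  shows "AE \<omega> in M. \<forall>h\<in>(\<Pi>\<^sub>E i\<in>{..<Suc k}. \<eta> \<omega>). inj_on h {..<Suc k} \<longrightarrow>
    (\<forall>z. R z (restrict h {..<k}) \<le> 0 \<longrightarrow> \<psi> z \<notin> h k)"
proof -
  let ?N = "PiM {..<Suc k} (\<lambda>_. hyperplane_space) :: (nat \<Rightarrow> 'a set) measure"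
  \<comment> \<open>The maximum discards negative residuals, which could otherwise offset a positive
    distance in the sum.\<close>
  let ?R = "\<lambda>z h. max 0 (R z (restrict h {..<k})) + infdist (\<psi> z) (h k)"
  define D where "D n = {h\<in>space ?N. \<exists>z\<in>cball 0 (real n). ?R z h \<le> 0}" for n
  have restr: "(\<lambda>h. restrict h {..<k}) \<in> measurable ?N (PiM {..<k} (\<lambda>_. hyperplane_space))"
    by (rule measurable_restrict_subset) auto
  have iff: "?R z h \<le> 0 \<longleftrightarrow> R z (restrict h {..<k}) \<le> 0 \<and> \<psi> z \<in> h k" if "h k \<in> hyperplanes" for z h
    using infdist_hyperplane_0_iff[OF that, of "\<psi> z"] infdist_nonneg[of "\<psi> z" "h k"] by (auto simp: max_def)
  have "AE \<omega> in M. \<forall>h\<in>(\<Pi>\<^sub>E i\<in>{..<Suc k}. \<eta> \<omega>). inj_on h {..<Suc k} \<longrightarrow> h \<notin> D n" for n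
  proof (rule AE_no_hyperplane_tuple)
    show "D n \<in> sets ?N"
      unfolding D_def
    proof (rule sets_Ex_compact)
      fix h assume "h \<in> space ?N"
      then have "restrict h {..<k} \<in> space (PiM {..<k} (\<lambda>_. hyperplane_space))"
        using measurable_space[OF restr] by auto
      from cont[OF this] show "continuous_on (cball 0 (real n)) (\<lambda>z. ?R z h)"
        by (intro continuous_intros continuous_on_infdist continuous_on_subset[OF cont_\<psi>])
           (auto intro: continuous_on_subset)
    next
      fix z
      have [measurable]: "(\<lambda>h. R z (restrict h {..<k})) \<in> borel_measurable ?N"
        using measurable_compose[OF restr meas] .
      have [measurable]: "(\<lambda>h. infdist (\<psi> z) (h k)) \<in> borel_measurable ?N"
         by measurable
      show "?R z \<in> borel_measurable ?N" by measurable
    qed simp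
    fix h assume h: "h \<in> space (PiM {..<k} (\<lambda>_. hyperplane_space :: 'a set measure))"
    show "\<exists>z. \<forall>H\<in>hyperplanes. h(k := H) \<in> D n \<longrightarrow> z \<in> H"
    proof -
      have res: "restrict (h(k := H)) {..<k} = h" for H
        by (rule ext) (use h in \<open>auto simp: space_PiM PiE_def extensional_def\<close>)
      have D: "\<exists>z. R z h \<le> 0 \<and> \<psi> z \<in> H" if "H \<in> hyperplanes" "h(k := H) \<in> D n" for H
        using that iff[of "h(k := H)"] unfolding D_def mem_Collect_eq res by auto
      show ?thesis
      proof (cases "\<exists>z. R z h \<le> 0")
        case True
        then obtain z0 where z0: "R z0 h \<le> 0" by auto
        show ?thesis using D unique[OF h z0] by (intro exI[of _ "\<psi> z0"]) metis
      next
        case False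
        then show ?thesis using D by auto
      qed
    qed
  qed
  then have "AE \<omega> in M. \<forall>n. \<forall>h\<in>(\<Pi>\<^sub>E i\<in>{..<Suc k}. \<eta> \<omega>). inj_on h {..<Suc k} \<longrightarrow> h \<notin> D n"
    by (simp add: AE_all_countable)
  moreover have "AE \<omega> in M. \<omega> \<in> space M" by (rule AE_space)
  ultimately show ?thesis
  proof eventually_elim
    fix \<omega> assume none: "\<forall>n. \<forall>h\<in>(\<Pi>\<^sub>E i\<in>{..<Suc k}. \<eta> \<omega>). inj_on h {..<Suc k} \<longrightarrow> h \<notin> D n" and \<omega>: "\<omega> \<in> space M"
    show "\<forall>h\<in>(\<Pi>\<^sub>E i\<in>{..<Suc k}. \<eta> \<omega>). inj_on h {..<Suc k} \<longrightarrow> (\<forall>z. R z (restrict h {..<k}) \<le> 0 \<longrightarrow> \<psi> z \<notin> h k)"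
    proof (intro ballI impI allI notI)
      fix h z assume h: "h \<in> (\<Pi>\<^sub>E i\<in>{..<Suc k}. \<eta> \<omega>)" "inj_on h {..<Suc k}" "R z (restrict h {..<k}) \<le> 0" "\<psi> z \<in> h k"
      have hs: "h \<in> space ?N" using h(1) eta_hyperplanes[OF \<omega>] by (auto simp: space_PiM PiE_iff)
      have hk: "h k \<in> hyperplanes" using h(1) eta_hyperplanes[OF \<omega>] by (auto simp: PiE_iff)
      obtain n where "norm z \<le> real n" using real_arch_simple by blast
      then have "z \<in> cball 0 (real n)" by simp
      moreover have "?R z h \<le> 0" using iff[of h z, OF hk] h by simp
      ultimately have "h \<in> D n" unfolding D_def using hs by blast
      then show False using none h by blast
    qed
  qed
qed

end

section \<open>General position\<close>

text \<open>The point of the flat nearest to the origin is a canonical point depending on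
  \<open>S\<close> only. For a single-point intersection it is that point, so feet serve both flats
  and vertices; the foot of the empty family is the origin.\<close>

definition foot_of :: "'a::real_normed_vector set set \<Rightarrow> 'a \<Rightarrow> bool" where
  "foot_of S x \<longleftrightarrow> x \<in> \<Inter>S \<and> norm x = infdist 0 (\<Inter>S)"

lemma foot_of_unique:
  fixes x y :: "'a::euclidean_space"
  assumes "S \<subseteq> hyperplanes" "foot_of S x" "foot_of S y"
  shows "x = y"
proof (rule any_closest_point_unique[of "\<Inter>S" x y 0])
  show "convex (\<Inter>S)" using assms(1) by (intro convex_Inter) (auto dest: hyperplanes_affine affine_imp_convex)
  show "closed (\<Inter>S)" using assms(1) by (intro closed_Inter) (auto dest: hyperplanes_closed)
  show "\<forall>z\<in>\<Inter>S. dist 0 x \<le> dist 0 z" "\<forall>z\<in>\<Inter>S. dist 0 y \<le> dist 0 z"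
    using assms(2,3) by (auto simp: foot_of_def intro: infdist_le2)
qed (use assms in \<open>auto simp: foot_of_def\<close>)

lemma foot_of_exists:
  fixes S :: "'a::euclidean_space set set"
  assumes "S \<subseteq> hyperplanes" "\<Inter>S \<noteq> {}"
  obtains x where "foot_of S x"
proof -
  have "closed (\<Inter>S)" using assms(1) by (intro closed_Inter) (auto dest: hyperplanes_closed)
  then obtain x where "x \<in> \<Inter>S" "infdist 0 (\<Inter>S) = dist 0 x"
    using infdist_attains_inf assms(2) by blast
  then show ?thesis using that by (auto simp: foot_of_def)
qed

lemma foot_of_singleton: "\<Inter>S = {x} \<Longrightarrow> foot_of S x"
  by (simp add: foot_of_def)

text \<open>Residual form of \<open>foot_of\<close> in terms of distances, continuous in
  \<open>x\<close>, as \<open>AE_avoid\<close> requires.\<close>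

definition foot_defect :: "nat set \<Rightarrow> 'a::real_normed_vector \<Rightarrow> (nat \<Rightarrow> 'a set) \<Rightarrow> real" where
  "foot_defect I x h = (\<Sum>i\<in>I. infdist x (h i)) + \<bar>norm x - infdist 0 (\<Inter>i\<in>I. h i)\<bar>"

lemma foot_defect_nonneg: "0 \<le> foot_defect I x h"
  unfolding foot_defect_def by (intro add_nonneg_nonneg sum_nonneg infdist_nonneg) auto

lemma foot_defect_le_0_iff:
  assumes "finite I" "\<And>i. i \<in> I \<Longrightarrow> h i \<in> hyperplanes"
  shows "foot_defect I x h \<le> 0 \<longleftrightarrow> foot_of (h ` I) x"
proof -
  have "foot_defect I x h \<le> 0 \<longleftrightarrow> (\<Sum>i\<in>I. infdist x (h i)) = 0 \<and> norm x = infdist 0 (\<Inter>i\<in>I. h i)"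
    using sum_nonneg[of I "\<lambda>i. infdist x (h i)"] infdist_nonneg[of x] unfolding foot_defect_def by auto
  also have "(\<Sum>i\<in>I. infdist x (h i)) = 0 \<longleftrightarrow> (\<forall>i\<in>I. infdist x (h i) = 0)"
    using assms(1) by (intro sum_nonneg_eq_0_iff) (auto simp: infdist_nonneg)
  also have "\<dots> \<longleftrightarrow> (\<forall>i\<in>I. x \<in> h i)"
    using infdist_hyperplane_0_iff[OF assms(2)] infdist_nonneg by (metis order_antisym order_refl)
  finally show ?thesis by (auto simp: foot_of_def)
qed

text \<open>The distance is at most \<open>a \<ge> 0\<close> if the intersection meets
  \<open>cball 0 a\<close> or is empty: \<open>infdist\<close> to the empty set is 0, and emptiness
  means missing every ball of integer radius.\<close>

lemma measurable_infdist_Inter: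
  fixes I J :: "nat set"
  assumes "I \<subseteq> J" "finite I"
  shows "(\<lambda>h. infdist (0 :: 'a::euclidean_space) (\<Inter>i\<in>I. h i)) \<in> borel_measurable (PiM J (\<lambda>_. hyperplane_space))"
proof (rule borel_measurableI_le)
  let ?N = "PiM J (\<lambda>_. hyperplane_space) :: (nat \<Rightarrow> 'a set) measure"
  let ?R = "\<lambda>x h. \<Sum>i\<in>I. infdist x (h i)"
  fix a :: real
  have R: "?R x h \<le> 0 \<longleftrightarrow> x \<in> (\<Inter>i\<in>I. h i)" if "h \<in> space ?N" for x :: 'a and h
  proof -
    have h: "h i \<in> hyperplanes" if "i \<in> I" for i using \<open>h \<in> space ?N\<close> that assms by (auto simp: space_PiM PiE_iff)
    have "?R x h \<le> 0 \<longleftrightarrow> ?R x h = 0" using sum_nonneg[of I "\<lambda>i. infdist x (h i)"] infdist_nonneg[of x] by force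
    also have "\<dots> \<longleftrightarrow> (\<forall>i\<in>I. infdist x (h i) = 0)"
      using assms(2) by (intro sum_nonneg_eq_0_iff) (auto simp: infdist_nonneg)
    also have "\<dots> \<longleftrightarrow> (\<forall>i\<in>I. x \<in> h i)"
      using infdist_hyperplane_0_iff[OF h] infdist_nonneg by (metis order_antisym order_refl)
    finally show ?thesis by auto
  qed
  have meas: "{h\<in>space ?N. \<exists>x\<in>cball 0 r. ?R x h \<le> 0} \<in> sets ?N" for r
  proof (rule sets_Ex_compact)
    fix x :: 'a
    show "?R x \<in> borel_measurable ?N" using assms by (intro borel_measurable_sum measurable_infdist_component) auto
  qed (auto intro!: continuous_intros)
  show "{h \<in> space ?N. infdist (0::'a) (\<Inter>i\<in>I. h i) \<le> a} \<in> sets ?N"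
  proof (cases "0 \<le> a")
    case True
    have "{h \<in> space ?N. infdist (0::'a) (\<Inter>i\<in>I. h i) \<le> a}
      = {h\<in>space ?N. \<exists>x\<in>cball 0 a. ?R x h \<le> 0} \<union> {h\<in>space ?N. \<forall>n::nat. \<not> (\<exists>x\<in>cball 0 (real n). ?R x h \<le> 0)}"
    proof (intro set_eqI)
      fix h
      show "h \<in> {h \<in> space ?N. infdist (0::'a) (\<Inter>i\<in>I. h i) \<le> a} \<longleftrightarrow>
        h \<in> {h\<in>space ?N. \<exists>x\<in>cball 0 a. ?R x h \<le> 0} \<union> {h\<in>space ?N. \<forall>n::nat. \<not> (\<exists>x\<in>cball 0 (real n). ?R x h \<le> 0)}"
      proof (cases "h \<in> space ?N")
        case hN: True
        define F where "F = (\<Inter>i\<in>I. h i)"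
        have "closed F" unfolding F_def using hN assms
          by (intro closed_INT) (auto simp: space_PiM PiE_iff intro!: hyperplanes_closed)
        have "infdist 0 F \<le> a \<longleftrightarrow> (\<exists>x\<in>cball 0 a. x \<in> F) \<or> (\<forall>n::nat. \<not> (\<exists>x\<in>cball 0 (real n). x \<in> F))"
        proof (cases "F = {}")
          case True
          then show ?thesis using \<open>0 \<le> a\<close> by (simp add: infdist_def)
        next
          case False
          then obtain y where y: "y \<in> F" "infdist 0 F = dist 0 y" using infdist_attains_inf[OF \<open>closed F\<close>] by blast
          obtain n where "norm y \<le> real n" using real_arch_simple by blast
          then have ex: "\<exists>n::nat. \<exists>x\<in>cball 0 (real n). x \<in> F"
            using y by (intro exI[of _ n] bexI[of _ y]) auto
          have "infdist 0 F \<le> a \<longleftrightarrow> (\<exists>x\<in>cball 0 a. x \<in> F)"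
            using y infdist_le2[of _ F 0 a] by auto
          then show ?thesis using ex by blast
        qed
        then show ?thesis using hN R[OF hN] unfolding F_def by auto
      qed auto
    qed
    also have "\<dots> \<in> sets ?N"
    proof (intro sets.Un meas sets.sets_Collect_countable_All)
      fix n
      have "{h \<in> space ?N. \<not> (\<exists>x\<in>cball 0 (real n). ?R x h \<le> 0)} = space ?N - {h\<in>space ?N. \<exists>x\<in>cball 0 (real n). ?R x h \<le> 0}"
        by auto
      then show "{h \<in> space ?N. \<not> (\<exists>x\<in>cball 0 (real n). ?R x h \<le> 0)} \<in> sets ?N" using meas by auto
    qed
    finally show ?thesis .
  next
    case False
    have "\<not> infdist 0 (\<Inter>i\<in>I. h i) \<le> a" for h :: "nat \<Rightarrow> 'a set" using False infdist_nonneg[of 0 "\<Inter>i\<in>I. h i"] by linarith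
    then show ?thesis by simp
  qed
qed

lemma measurable_foot_defect:
  assumes "I \<subseteq> J" "finite I"
  shows "foot_defect I (x::'a::euclidean_space) \<in> borel_measurable (PiM J (\<lambda>_. hyperplane_space))"
proof -
  have "(\<lambda>h. \<Sum>i\<in>I. infdist x (h i)) \<in> borel_measurable (PiM J (\<lambda>_. hyperplane_space))"
    using assms by (intro borel_measurable_sum measurable_infdist_component) auto
  moreover have "(\<lambda>h. \<bar>norm x - infdist 0 (\<Inter>i\<in>I. h i)\<bar>) \<in> borel_measurable (PiM J (\<lambda>_. hyperplane_space))"
    by (intro borel_measurable_abs borel_measurable_diff borel_measurable_const measurable_infdist_Inter assms)
  ultimately show ?thesis
    unfolding foot_defect_def[abs_def] by (rule borel_measurable_add)
qed

lemma continuous_on_foot_defect [continuous_intros]: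
  "continuous_on UNIV f \<Longrightarrow> continuous_on UNIV (\<lambda>z. foot_defect I (f z) h)"
  unfolding foot_defect_def by (intro continuous_intros)

text \<open>The first clause makes every further hyperplane cut a flat properly, since it misses the
  foot. The second forbids accidental collinearity: where the line through two feet crosses a
  hyperplane \<open>G\<close> not containing the first foot, no other hyperplane outside
  \<open>S\<close> and \<open>T\<close> passes. The families \<open>S\<close> and \<open>T\<close>
  may overlap.\<close>

definition generic :: "'a::real_normed_vector set set \<Rightarrow> bool" where
  "generic X \<longleftrightarrow>
    (\<forall>S H x. finite S \<longrightarrow> S \<subseteq> X \<longrightarrow> H \<in> X - S \<longrightarrow> foot_of S x \<longrightarrow> x \<notin> H) \<and>
    (\<forall>S T G H x y t. finite S \<longrightarrow> finite T \<longrightarrow> S \<union> T \<subseteq> X \<longrightarrow> G \<in> X - (S \<union> T) \<longrightarrow> H \<in> X - (S \<union> T) \<longrightarrow> G \<noteq> H \<longrightarrow>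
      foot_of S x \<longrightarrow> foot_of T y \<longrightarrow> x \<notin> G \<longrightarrow> x + t *\<^sub>R (y - x) \<in> G \<longrightarrow> x + t *\<^sub>R (y - x) \<notin> H)"

context poisson_hyperplanes
begin

lemma AE_foot_avoid:
  "AE \<omega> in M. \<forall>h\<in>(\<Pi>\<^sub>E i\<in>{..<Suc k}. \<eta> \<omega>). inj_on h {..<Suc k} \<longrightarrow>
    (\<forall>x. foot_defect {..<k} x (restrict h {..<k}) \<le> 0 \<longrightarrow> x \<notin> h k)"
proof (rule AE_avoid[of "\<lambda>x h. foot_defect {..<k} x h" k "\<lambda>x. x"])
  fix h and z z' :: 'a
  assume h: "h \<in> space (PiM {..<k} (\<lambda>_. hyperplane_space))" and z: "foot_defect {..<k} z h \<le> 0" "foot_defect {..<k} z' h \<le> 0"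
  have h': "i < k \<Longrightarrow> h i \<in> hyperplanes" for i using h by (auto simp: space_PiM PiE_iff)
  then have "foot_of (h ` {..<k}) z" "foot_of (h ` {..<k}) z'" using z foot_defect_le_0_iff[of "{..<k}" h] by auto
  then show "z = z'" using h' by (intro foot_of_unique[of "h ` {..<k}"]) auto
qed (auto intro!: continuous_intros measurable_foot_defect)

text \<open>The feet are fixed by the first \<open>k\<close> hyperplanes, and the crossing with
  \<open>h k\<close> is then unique because \<open>x\<close> lies off \<open>h k\<close>. That last
  condition is open, so it is exhausted by the closed conditions
  \<open>1 / (n + 1) \<le> infdist x (h k)\<close>.\<close>

lemma AE_line_avoid:
  assumes I: "I \<subseteq> {..<k}" "J \<subseteq> {..<k}"
  shows "AE \<omega> in M. \<forall>h\<in>(\<Pi>\<^sub>E i\<in>{..<Suc (Suc k)}. \<eta> \<omega>). inj_on h {..<Suc (Suc k)} \<longrightarrow>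
    (\<forall>x y t. foot_defect I x (restrict h {..<Suc k}) \<le> 0 \<longrightarrow> foot_defect J y (restrict h {..<Suc k}) \<le> 0 \<longrightarrow>
      x + t *\<^sub>R (y - x) \<in> h k \<longrightarrow> x \<notin> h k \<longrightarrow> x + t *\<^sub>R (y - x) \<notin> h (Suc k))"
proof -
  have fin: "finite I" "finite J" using I finite_subset by auto
  let ?\<psi> = "\<lambda>(x, y, t). x + t *\<^sub>R (y - x) :: 'a"
  let ?R = "\<lambda>n (x, y, t) h. foot_defect I x h + foot_defect J y h + infdist (x + t *\<^sub>R (y - x)) (h k)
      + max 0 (1 / real (Suc n) - infdist (x::'a) (h k))"
  have R_iff: "?R n (x, y, t) h \<le> 0 \<longleftrightarrow> foot_of (h ` I) x \<and> foot_of (h ` J) y \<and> x + t *\<^sub>R (y - x) \<in> h k \<and> 1 / real (Suc n) \<le> infdist x (h k)"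
    if h: "h \<in> space (PiM {..<Suc k} (\<lambda>_. hyperplane_space))" for n x y t h
  proof -
    have h': "i < Suc k \<Longrightarrow> h i \<in> hyperplanes" for i using h by (auto simp: space_PiM PiE_iff)
    have "?R n (x, y, t) h \<le> 0 \<longleftrightarrow> foot_defect I x h \<le> 0 \<and> foot_defect J y h \<le> 0 \<and> infdist (x + t *\<^sub>R (y - x)) (h k) \<le> 0
        \<and> 1 / real (Suc n) - infdist x (h k) \<le> 0"
      using foot_defect_nonneg[of I x h] foot_defect_nonneg[of J y h] infdist_nonneg[of "x + t *\<^sub>R (y - x)" "h k"]
      unfolding prod.case by (simp only: max_def split: if_split) linarith
    moreover have "i \<in> I \<union> J \<Longrightarrow> i < Suc k" for i using I by auto
    then have "foot_defect I x h \<le> 0 \<longleftrightarrow> foot_of (h ` I) x" "foot_defect J y h \<le> 0 \<longleftrightarrow> foot_of (h ` J) y"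
      using h' fin by (intro foot_defect_le_0_iff; blast)+
    ultimately show ?thesis by (simp only: infdist_hyperplane_0_iff[OF h'[OF lessI]] diff_le_0_iff_le)
  qed
  have "AE \<omega> in M. \<forall>h\<in>(\<Pi>\<^sub>E i\<in>{..<Suc (Suc k)}. \<eta> \<omega>). inj_on h {..<Suc (Suc k)} \<longrightarrow>
    (\<forall>z. ?R n z (restrict h {..<Suc k}) \<le> 0 \<longrightarrow> ?\<psi> z \<notin> h (Suc k))" for n
  proof (rule AE_avoid)
    fix z :: "'a \<times> 'a \<times> real"
    obtain x y t where z: "z = (x, y, t)" by (cases z)
    have [measurable]: "foot_defect I x \<in> borel_measurable (PiM {..<Suc k} (\<lambda>_. hyperplane_space))"
        "foot_defect J y \<in> borel_measurable (PiM {..<Suc k} (\<lambda>_. hyperplane_space))"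
      using I fin by (auto intro!: measurable_foot_defect)
    show "?R n z \<in> borel_measurable (PiM {..<Suc k} (\<lambda>_. hyperplane_space))"
      unfolding z prod.case by measurable
  next
    fix h and z z' :: "'a \<times> 'a \<times> real"
    assume h: "h \<in> space (PiM {..<Suc k} (\<lambda>_. hyperplane_space))" and zz: "?R n z h \<le> 0" "?R n z' h \<le> 0"
    obtain x y t where z: "z = (x, y, t)" by (cases z)
    obtain x' y' t' where z': "z' = (x', y', t')" by (cases z')
    have h': "i < Suc k \<Longrightarrow> h i \<in> hyperplanes" for i using h by (auto simp: space_PiM PiE_iff)
    have hyp: "h ` I \<subseteq> hyperplanes" "h ` J \<subseteq> hyperplanes" using I h' by auto
    note 1 = zz(1)[unfolded z R_iff[OF h]] and 2 = zz(2)[unfolded z' R_iff[OF h]]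
    have eq: "x' = x" "y' = y" using 1 2 foot_of_unique[OF hyp(1)] foot_of_unique[OF hyp(2)] by auto
    have "x \<notin> h k" using 1 by (auto simp: infdist_zero intro: ccontr)
    moreover obtain u s where us: "h k = {x. u \<bullet> x = s}" using h'[of k] hyperplanesE by blast
    ultimately have "u \<bullet> x \<noteq> s" by simp
    moreover have "u \<bullet> x + t * (u \<bullet> (y - x)) = s" "u \<bullet> x + t' * (u \<bullet> (y - x)) = s"
      using 1 2 by (auto simp: us eq inner_add_right)
    \<comment> \<open>A line parallel to \<open>h k\<close> through a point off \<open>h k\<close>
      would not meet it.\<close>
    ultimately have "u \<bullet> (y - x) \<noteq> 0" "(t - t') * (u \<bullet> (y - x)) = 0" by (auto simp: left_diff_distrib)
    then show "?\<psi> z = ?\<psi> z'" by (simp add: z z' eq)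
  next
    show "continuous_on UNIV ?\<psi>" unfolding split_beta by (intro continuous_intros)
    show "continuous_on UNIV (\<lambda>z. ?R n z h)" for h unfolding split_beta by (intro continuous_intros)
  qed
  then have "AE \<omega> in M. \<forall>n. \<forall>h\<in>(\<Pi>\<^sub>E i\<in>{..<Suc (Suc k)}. \<eta> \<omega>). inj_on h {..<Suc (Suc k)} \<longrightarrow>
    (\<forall>z. ?R n z (restrict h {..<Suc k}) \<le> 0 \<longrightarrow> ?\<psi> z \<notin> h (Suc k))"
    by (simp only: AE_all_countable simp_thms)
  moreover have "AE \<omega> in M. \<omega> \<in> space M" by (rule AE_space)
  ultimately show ?thesis
  proof eventually_elim
    fix \<omega>
    assume av: "\<forall>n. \<forall>h\<in>(\<Pi>\<^sub>E i\<in>{..<Suc (Suc k)}. \<eta> \<omega>). inj_on h {..<Suc (Suc k)} \<longrightarrow>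
      (\<forall>z. ?R n z (restrict h {..<Suc k}) \<le> 0 \<longrightarrow> ?\<psi> z \<notin> h (Suc k))" and \<omega>: "\<omega> \<in> space M"
    show "\<forall>h\<in>(\<Pi>\<^sub>E i\<in>{..<Suc (Suc k)}. \<eta> \<omega>). inj_on h {..<Suc (Suc k)} \<longrightarrow>
    (\<forall>x y t. foot_defect I x (restrict h {..<Suc k}) \<le> 0 \<longrightarrow> foot_defect J y (restrict h {..<Suc k}) \<le> 0 \<longrightarrow>
      x + t *\<^sub>R (y - x) \<in> h k \<longrightarrow> x \<notin> h k \<longrightarrow> x + t *\<^sub>R (y - x) \<notin> h (Suc k))"
    proof (intro ballI impI allI)
      fix h x y t
      assume h: "h \<in> (\<Pi>\<^sub>E i\<in>{..<Suc (Suc k)}. \<eta> \<omega>)" "inj_on h {..<Suc (Suc k)}"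
        "foot_defect I x (restrict h {..<Suc k}) \<le> 0" "foot_defect J y (restrict h {..<Suc k}) \<le> 0"
        "x + t *\<^sub>R (y - x) \<in> h k" "x \<notin> h k"
      let ?h = "restrict h {..<Suc k}"
      have hk: "h k \<in> hyperplanes" using h(1) eta_hyperplanes[OF \<omega>] by (auto simp: PiE_iff)
      have "0 < infdist x (h k)" using h(6) infdist_hyperplane_0_iff[OF hk, of x] by auto
      then obtain n where "1 / real (Suc n) < infdist x (h k)" using nat_approx_posE by blast
      moreover have "infdist (x + t *\<^sub>R (y - x)) (h k) = 0" using h(5) by simp
      ultimately have "?R n (x, y, t) ?h \<le> 0" using h(3,4) by (simp add: max_def)
      then have "?\<psi> (x, y, t) \<notin> h (Suc k)" using av h(1,2) by blast
      then show "x + t *\<^sub>R (y - x) \<notin> h (Suc k)" by simp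
    qed
  qed
qed

lemma ex_enum: "finite S \<Longrightarrow> \<exists>g. inj_on g {..<card S} \<and> g ` {..<card S} = S"
  using ex_bij_betw_nat_finite[of S] by (simp add: bij_betw_def lessThan_atLeast0)

text \<open>Finite families are enumerated as tuples. For the second clause
  \<open>S \<union> T\<close> is enumerated once, and the index sets \<open>I\<close> and
  \<open>J\<close> pick out the possibly overlapping \<open>S\<close> and \<open>T\<close>.\<close>

lemma AE_generic: "AE \<omega> in M. generic (\<eta> \<omega>)"
proof -
  have 1: "AE \<omega> in M. \<forall>k. \<forall>h\<in>(\<Pi>\<^sub>E i\<in>{..<Suc k}. \<eta> \<omega>). inj_on h {..<Suc k} \<longrightarrow>
      (\<forall>x. foot_defect {..<k} x (restrict h {..<k}) \<le> 0 \<longrightarrow> x \<notin> h k)"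
    by (simp only: AE_all_countable AE_foot_avoid simp_thms)
  have cnt: "countable (Pow {..<k::nat})" for k by (intro countable_finite) auto
  have 2: "AE \<omega> in M. \<forall>k. \<forall>I\<in>Pow {..<k}. \<forall>J\<in>Pow {..<k}. \<forall>h\<in>(\<Pi>\<^sub>E i\<in>{..<Suc (Suc k)}. \<eta> \<omega>). inj_on h {..<Suc (Suc k)} \<longrightarrow>
    (\<forall>x y t. foot_defect I x (restrict h {..<Suc k}) \<le> 0 \<longrightarrow> foot_defect J y (restrict h {..<Suc k}) \<le> 0 \<longrightarrow>
      x + t *\<^sub>R (y - x) \<in> h k \<longrightarrow> x \<notin> h k \<longrightarrow> x + t *\<^sub>R (y - x) \<notin> h (Suc k))"
    unfolding AE_all_countable AE_ball_countable[OF cnt] by (intro allI ballI AE_line_avoid) auto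
  have 3: "AE \<omega> in M. \<omega> \<in> space M" by (rule AE_space)
  from 1 2 3 show ?thesis
  proof eventually_elim
    case (elim \<omega>)
    have hyp: "\<eta> \<omega> \<subseteq> hyperplanes" using elim(3) by (rule eta_hyperplanes)
    show ?case
      unfolding generic_def
    proof (intro conjI allI impI)
      fix S H x assume S: "finite S" "S \<subseteq> \<eta> \<omega>" "H \<in> \<eta> \<omega> - S" "foot_of S x"
      obtain g where gi: "inj_on g {..<card S}" "g ` {..<card S} = S" using ex_enum[OF S(1)] by blast
      define k where "k = card S"
      define h where "h = (\<lambda>i\<in>{..<Suc k}. if i < k then g i else H)"
      have gin: "g i \<in> S" "g i \<in> \<eta> \<omega>" if "i < k" for i using gi(2) S(2) that by (auto simp: k_def)
      have h: "h \<in> (\<Pi>\<^sub>E i\<in>{..<Suc k}. \<eta> \<omega>)" using gin S by (auto simp: h_def)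
      have inj: "inj_on h {..<Suc k}"
        using gi S(3) unfolding h_def k_def inj_on_def by (auto simp: less_Suc_eq)
      have img: "h ` {..<k} = S" using gi(2) by (auto simp: h_def k_def image_iff)
      have "foot_defect {..<k} x (restrict h {..<k}) \<le> 0"
        using S(4) hyp h by (subst foot_defect_le_0_iff) (auto simp: img)
      then have "x \<notin> h k" using elim(1) h inj by blast
      then show "x \<notin> H" by (simp add: h_def)
    next
      fix S T G H x y t
      assume S: "finite S" "finite T" "S \<union> T \<subseteq> \<eta> \<omega>" "G \<in> \<eta> \<omega> - (S \<union> T)" "H \<in> \<eta> \<omega> - (S \<union> T)" "G \<noteq> H"
        "foot_of S x" "foot_of T y" "x \<notin> G" "x + t *\<^sub>R (y - x) \<in> G"
      obtain g where gi: "inj_on g {..<card (S \<union> T)}" "g ` {..<card (S \<union> T)} = S \<union> T"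
        using ex_enum[OF finite_UnI[OF S(1,2)]] by blast
      define k where "k = card (S \<union> T)"
      define h where "h = (\<lambda>i\<in>{..<Suc (Suc k)}. if i < k then g i else if i = k then G else H)"
      have gin: "g i \<in> S \<union> T" if "i < k" for i using gi(2) that unfolding k_def by blast
      have gin': "g i \<in> \<eta> \<omega>" if "i < k" for i using gin[OF that] S(3) by blast
      have GH: "G \<in> \<eta> \<omega>" "H \<in> \<eta> \<omega>" using S(4,5) by auto
      have h: "h \<in> (\<Pi>\<^sub>E i\<in>{..<Suc (Suc k)}. \<eta> \<omega>)" using gin' GH by (auto simp: h_def)
      have inj: "inj_on h {..<Suc (Suc k)}"
      proof (rule inj_onI)
        fix i j assume ij: "i \<in> {..<Suc (Suc k)}" "j \<in> {..<Suc (Suc k)}" "h i = h j"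
        have "i < k \<or> i = k \<or> i = Suc k" "j < k \<or> j = k \<or> j = Suc k" using ij by auto
        moreover have "g i \<noteq> G" "g i \<noteq> H" if "i < k" for i using gin[OF that] S(4,5) by blast+
        moreover have "i = j" if "g i = g j" "i < k" "j < k"
          using gi(1) that by (simp add: inj_on_def k_def)
        ultimately show "i = j"
          using ij(3) S(6) by (elim disjE) (auto simp: h_def dest: sym[of _ "g _"])
      qed
      define I where "I = {i. i < k \<and> g i \<in> S}"
      define J where "J = {i. i < k \<and> g i \<in> T}"
      have img: "restrict h {..<Suc k} ` I = S" "restrict h {..<Suc k} ` J = T"
      proof -
        have "restrict h {..<Suc k} ` I = g ` I" "restrict h {..<Suc k} ` J = g ` J"
          by (intro image_cong; simp add: I_def J_def h_def)+
        moreover have "y \<in> g ` {..<k}" if "y \<in> S \<union> T" for y using gi(2) that by (simp add: k_def)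
        then have "S \<subseteq> g ` I" "T \<subseteq> g ` J" by (force simp: I_def J_def)+
        then have "g ` I = S" "g ` J = T" by (auto simp: I_def J_def)
        ultimately show "restrict h {..<Suc k} ` I = S" "restrict h {..<Suc k} ` J = T" by simp_all
      qed
      let ?h = "restrict h {..<Suc k}"
      have fd: "foot_defect I x (restrict h {..<Suc k}) \<le> 0" "foot_defect J y (restrict h {..<Suc k}) \<le> 0"
      proof -
        have "?h i \<in> hyperplanes" if "i \<in> I \<union> J" for i
          using that h hyp by (auto simp: I_def J_def)
        moreover have "finite I" "finite J" by (auto simp: I_def J_def)
        ultimately show "foot_defect I x ?h \<le> 0" "foot_defect J y ?h \<le> 0"
          using S(7,8) foot_defect_le_0_iff[of I ?h x] foot_defect_le_0_iff[of J ?h y] unfolding img by blast+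
      qed
      have hk: "h k = G" "h (Suc k) = H" by (auto simp: h_def)
      have "I \<in> Pow {..<k}" "J \<in> Pow {..<k}" by (auto simp: I_def J_def)
      then have "x + t *\<^sub>R (y - x) \<notin> h (Suc k)"
        using elim(2)[rule_format, OF _ _ h inj fd] S by (auto simp: hk)
      then show "x + t *\<^sub>R (y - x) \<notin> H" by (simp add: hk)
    qed
  qed
qed

end

text \<open>The foot of the smaller intersection lies off the added hyperplane, so the flat is not
  contained in it and, the new intersection being non-empty, loses exactly one dimension.\<close>

lemma generic_aff_dim:
  fixes X :: "'a::euclidean_space set set"
  assumes X: "X \<subseteq> hyperplanes" "generic X" and S: "finite S" "S \<subseteq> X" "\<Inter>S \<noteq> {}"
  shows "aff_dim (\<Inter>S) = int DIM('a) - int (card S)"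
  using S
proof (induction S rule: finite_induct)
  case (insert H S)
  have S: "S \<subseteq> X" "\<Inter>S \<noteq> {}" and H: "H \<in> X - S" using insert by auto
  have hyp: "S \<subseteq> hyperplanes" using S X by auto
  obtain x where x: "foot_of S x" using foot_of_exists[OF hyp S(2)] .
  have "x \<notin> H" using X(2) insert.hyps(1) S(1) H x unfolding generic_def by blast
  then have nsub: "\<not> \<Inter>S \<subseteq> H" using x by (auto simp: foot_of_def)
  have aff: "affine (\<Inter>S)" using hyp by (intro affine_Inter) (auto intro: hyperplanes_affine)
  obtain u s where us: "H = {x. u \<bullet> x = s}" using H X hyperplanesE by blast
  have "\<Inter>S \<inter> {x. u \<bullet> x = s} \<noteq> {}" using insert.prems(2) us by auto
  then have "aff_dim (\<Inter>S \<inter> {x. u \<bullet> x = s}) = aff_dim (\<Inter>S) - 1"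
    using aff_dim_affine_Int_hyperplane[OF aff, of u s] nsub us by auto
  moreover have "\<Inter>(insert H S) = \<Inter>S \<inter> {x. u \<bullet> x = s}" using us by auto
  ultimately show ?case using insert.IH S insert.hyps by simp
qed simp

lemma generic_card_le:
  fixes X :: "'a::euclidean_space set set"
  assumes "X \<subseteq> hyperplanes" "generic X" "finite S" "S \<subseteq> X" "\<Inter>S \<noteq> {}"
  shows "card S \<le> DIM('a)"
  using generic_aff_dim[OF assms] aff_dim_geq[of "\<Inter>S"] aff_dim_empty[of "\<Inter>S"] assms(5) by linarith

lemma generic_singleton:
  fixes X :: "'a::euclidean_space set set"
  assumes "X \<subseteq> hyperplanes" "generic X" "finite S" "S \<subseteq> X" "x \<in> \<Inter>S" "card S = DIM('a)"
  shows "\<Inter>S = {x}"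
proof -
  have "aff_dim (\<Inter>S) = 0" using generic_aff_dim[OF assms(1-4)] assms(5,6) by auto
  then obtain y where "\<Inter>S = {y}" using aff_dim_eq_0 by blast
  then show ?thesis using assms(5) by auto
qed

section \<open>Determination by a shell for flats of positive dimension\<close>

text \<open>The deterministic situation behind almost every realisation for \<open>m < d\<close>:
  finitely many flats seen only in a shell, where the weight \<open>c E\<close> is the number of
  tuples with intersection \<open>E\<close> divided by \<open>m!\<close>.\<close>

locale flat_family =
  fixes \<F> :: "'a::euclidean_space set set" and k :: nat and c :: "'a set \<Rightarrow> ennreal"
    and r :: real and \<mu> :: "'a measure"
  assumes fin: "finite \<F>" and k: "1 \<le> k" and r: "0 < r"
    and flat: "\<And>E. E \<in> \<F> \<Longrightarrow> affine E" "\<And>E. E \<in> \<F> \<Longrightarrow> aff_dim E = int k"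
    and c: "\<And>E. E \<in> \<F> \<Longrightarrow> 0 < c E" "\<And>E. E \<in> \<F> \<Longrightarrow> c E < \<infinity>"
    and sets_mu: "sets \<mu> = sets borel"
    and mu: "\<And>C. C \<in> sets borel \<Longrightarrow>
      emeasure \<mu> C = (\<Sum>E\<in>\<F>. c E * hausdorff_measure k (C \<inter> {x. r \<le> norm x \<and> norm x \<le> 5 * r} \<inter> E))"

text \<open>A shift of length \<open>3 * r\<close> carries \<open>ball 0 r\<close> to norms between
  \<open>2 * r\<close> and \<open>4 * r\<close>, hence into the interior of this shell.\<close>

definition shell :: "real \<Rightarrow> 'a::real_normed_vector set" where
  "shell r = {x. r \<le> norm x \<and> norm x \<le> 5 * r}"

definition open_shell :: "real \<Rightarrow> 'a::real_normed_vector set" where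
  "open_shell r = {x. r < norm x \<and> norm x < 5 * r}"

text \<open>Up to null sets, \<open>x\<close> and \<open>y\<close> lie on a common flat carrying the measure.\<close>

definition same_flat :: "real \<Rightarrow> 'a::real_normed_vector measure \<Rightarrow> 'a \<Rightarrow> 'a \<Rightarrow> bool" where
  "same_flat r \<mu> x y \<longleftrightarrow> x \<noteq> y \<and>
    (\<forall>t\<in>\<rat>. x + t *\<^sub>R (y - x) \<in> open_shell r \<longrightarrow> (\<forall>n. 0 < emeasure \<mu> (ball (x + t *\<^sub>R (y - x)) (1 / real (Suc n)))))"

definition shift_vec :: "real \<Rightarrow> 'a::real_normed_vector \<Rightarrow> 'a \<Rightarrow> 'a" where
  "shift_vec r x y = (3 * r / norm (y - x)) *\<^sub>R (y - x)"

lemma open_open_shell: "open (open_shell r)"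
  unfolding open_shell_def by (intro open_Collect_conj open_Collect_less continuous_intros)

lemma closed_shell: "closed (shell r)"
  unfolding shell_def by (intro closed_Collect_conj closed_Collect_le continuous_intros)

lemma line_reaches:
  fixes x v :: "'a::real_normed_vector"
  assumes "v \<noteq> 0" "norm x \<le> R"
  shows "\<exists>t. norm (x + t *\<^sub>R v) = R"
proof -
  define T where "T = (R + norm x) / norm v"
  have R: "0 \<le> R + norm x" using assms(2) norm_ge_zero[of x] by linarith
  then have "0 \<le> T" by (simp add: T_def)
  have "norm (T *\<^sub>R v) = R + norm x" using assms by (simp add: T_def abs_of_nonneg[OF R])
  then have "R \<le> norm (x + T *\<^sub>R v)" using norm_diff_ineq[of "T *\<^sub>R v" x] by (simp add: add.commute)
  moreover have "norm (x + 0 *\<^sub>R v) \<le> R" using assms by simp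
  ultimately obtain t where "norm (x + t *\<^sub>R v) = R"
    using IVT'[of "\<lambda>t. norm (x + t *\<^sub>R v)" 0 R T] \<open>0 \<le> T\<close> by (force intro!: continuous_intros)
  then show ?thesis by blast
qed

text \<open>The midpoint of two distinct points lies strictly inside the outer sphere by the
  parallelogram law; if it falls into the inner ball, the line through it still reaches norm
  \<open>3 * r\<close>.\<close>

lemma line_meets_open_shell:
  fixes x y :: "'a::real_inner"
  assumes "x \<in> shell r" "y \<in> shell r" "x \<noteq> y" "0 < r"
  shows "\<exists>t. x + t *\<^sub>R (y - x) \<in> open_shell r"
proof -
  define m where "m = x + (1/2) *\<^sub>R (y - x)"
  have "4 * (m \<bullet> m) + (x - y) \<bullet> (x - y) = 2 * (x \<bullet> x) + 2 * (y \<bullet> y)"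
    unfolding m_def by (simp add: inner_add_left inner_add_right inner_diff_left inner_diff_right inner_commute algebra_simps)
  then have "4 * (norm m)\<^sup>2 + (norm (x - y))\<^sup>2 = 2 * (norm x)\<^sup>2 + 2 * (norm y)\<^sup>2"
    by (simp add: power2_norm_eq_inner)
  moreover have "(norm x)\<^sup>2 \<le> (5 * r)\<^sup>2" "(norm y)\<^sup>2 \<le> (5 * r)\<^sup>2"
    using assms(1,2) power_mono[of "norm x" "5 * r" 2] power_mono[of "norm y" "5 * r" 2] by (auto simp: shell_def)
  moreover have "0 < (norm (x - y))\<^sup>2" using assms by simp
  ultimately have "(norm m)\<^sup>2 < (5 * r)\<^sup>2" by linarith
  then have m: "norm m < 5 * r" using assms(4) by (meson less_eq_real_def mult_pos_pos power2_less_imp_less zero_less_numeral)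
  show ?thesis
  proof (cases "r < norm m")
    case True
    then show ?thesis using m unfolding m_def open_shell_def by blast
  next
    case False
    then obtain t where "norm (m + t *\<^sub>R (y - x)) = 3 * r"
      using line_reaches[of "y - x" m "3 * r"] assms by auto
    moreover have "m + t *\<^sub>R (y - x) = x + (1/2 + t) *\<^sub>R (y - x)" by (simp add: m_def scaleR_add_left)
    ultimately have "x + (1/2 + t) *\<^sub>R (y - x) \<in> open_shell r" using assms by (simp add: open_shell_def)
    then show ?thesis by blast
  qed
qed

lemma affine_line_subset:
  assumes E: "affine E" and "x + s *\<^sub>R v \<in> E" "x + t *\<^sub>R v \<in> E" "s \<noteq> t"
  shows "x + u *\<^sub>R v \<in> E"
proof -
  define a where "a = (u - s) / (t - s)"
  have "(1 - a) *\<^sub>R (x + s *\<^sub>R v) + a *\<^sub>R (x + t *\<^sub>R v) \<in> E"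
    using assms by (intro mem_affine) auto
  moreover have "(1 - a) *\<^sub>R (x + s *\<^sub>R v) + a *\<^sub>R (x + t *\<^sub>R v) = x + (s + a * (t - s)) *\<^sub>R v"
    by (simp add: algebra_simps)
  moreover have "s + a * (t - s) = u" using assms(4) by (simp add: a_def)
  ultimately show ?thesis by simp
qed

context flat_family
begin

lemma borel_flat [measurable]: "E \<in> \<F> \<Longrightarrow> E \<in> sets borel"
  using flat(1) affine_closed by (blast intro: borel_closed)

lemma closed_flats: "closed (\<Union>\<F>)"
  using fin flat(1) affine_closed by (intro closed_Union) auto

lemma mu_shell: "C \<in> sets borel \<Longrightarrow> emeasure \<mu> C = (\<Sum>E\<in>\<F>. c E * hausdorff_measure k (C \<inter> shell r \<inter> E))"
  using mu by (simp add: shell_def)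

lemma mu_finite: "emeasure \<mu> C < \<infinity>"
proof -
  have "hausdorff_measure k (UNIV \<inter> shell r \<inter> E) < \<infinity>" if "E \<in> \<F>" for E
  proof -
    have "bounded (shell r :: 'a set)" unfolding shell_def bounded_iff by auto
    then show ?thesis using hausdorff_measure_flat_finite[OF flat[OF that], of "shell r"] by (simp add: Int_commute)
  qed
  then have "emeasure \<mu> UNIV < \<infinity>"
    using c fin by (subst mu_shell) (auto simp: ennreal_mult_less_top)
  moreover have "emeasure \<mu> C \<le> emeasure \<mu> UNIV"
    using emeasure_space[of \<mu> C] sets_eq_imp_space_eq[OF sets_mu] by simp
  ultimately show ?thesis by (rule order_le_less_trans[rotated])
qed

text \<open>A flat is either null or charges every ball about each of its points. Positivity is
  therefore carried along as a case distinction, and null flats contribute nothing anywhere.\<close>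

definition pos :: "'a set \<Rightarrow> bool" where "pos E \<longleftrightarrow> 0 < hausdorff_measure k E"

lemma null_part: "E \<in> \<F> \<Longrightarrow> \<not> pos E \<Longrightarrow> A \<subseteq> E \<Longrightarrow> hausdorff_measure k A = 0"
  using hausdorff_measure_mono[of A E k] by (auto simp: pos_def)

lemma flat_Int_null:
  assumes "E \<in> \<F>" "E' \<in> \<F>" "E \<noteq> E'" "A \<subseteq> E \<inter> E'"
  shows "hausdorff_measure k A = 0"
proof -
  have aff: "affine (E \<inter> E')" using assms flat(1) affine_Int by blast
  have "E \<inter> E' \<noteq> E \<or> E \<inter> E' \<noteq> E'" using assms(3) by blast
  then have "aff_dim (E \<inter> E') \<noteq> int k"
    using aff_dim_eq_full_gen[of "E \<inter> E'" E] aff_dim_eq_full_gen[of "E \<inter> E'" E'] aff flat assms(1,2)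
    by (auto simp: hull_same)
  moreover have "aff_dim (E \<inter> E') \<le> int k" using aff_dim_subset[of "E \<inter> E'" E] flat(2)[OF assms(1)] by simp
  ultimately have "hausdorff_measure k (E \<inter> E') = 0" using aff by (intro hausdorff_measure_flat_zero) auto
  then show ?thesis using hausdorff_measure_mono[OF assms(4), of k] by simp
qed

definition carrier_of :: "'a \<Rightarrow> 'a set \<Rightarrow> bool" where
  "carrier_of x E \<longleftrightarrow> x \<in> shell r \<and> E \<in> \<F> \<and> pos E \<and> x \<in> E \<and> (\<forall>E'\<in>\<F>. x \<in> E' \<longrightarrow> E' = E)"

text \<open>Exceptional are the points outside the shell, those on no charged flat, and those common
  to two flats, which form flats of lower dimension.\<close>

lemma AE_carrier: "AE x in \<mu>. \<exists>E. carrier_of x E"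
proof (rule AE_I)
  let ?N = "- (shell r) \<union> - (\<Union>{E\<in>\<F>. pos E}) \<union> (\<Union>(E, E')\<in>{(E, E'). E \<in> \<F> \<and> E' \<in> \<F> \<and> E \<noteq> E'}. E \<inter> E')"
  show "{x \<in> space \<mu>. \<not> (\<exists>E. carrier_of x E)} \<subseteq> ?N"
    by (auto simp: carrier_of_def)
  have finp: "finite {(E, E'). E \<in> \<F> \<and> E' \<in> \<F> \<and> E \<noteq> E'}"
    by (rule finite_subset[OF _ finite_cartesian_product[OF fin fin]]) auto
  have N: "?N \<in> sets borel"
    using fin borel_closed[OF closed_shell] finp by (intro sets.Un borel_comp sets.finite_Union sets.finite_UN) auto
  then show "?N \<in> sets \<mu>" by (simp add: sets_mu)
  have "hausdorff_measure k (?N \<inter> shell r \<inter> E) = 0" if E: "E \<in> \<F>" for E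
  proof (cases "pos E")
    case True
    have "?N \<inter> shell r \<inter> E \<subseteq> (\<Union>E'\<in>\<F> - {E}. E \<inter> E')" using True E by auto
    then have "hausdorff_measure k (?N \<inter> shell r \<inter> E) \<le> emeasure (hausdorff k) (\<Union>E'\<in>\<F> - {E}. E \<inter> E')"
    proof (subst emeasure_hausdorff)
      show "(\<Union>E'\<in>\<F> - {E}. E \<inter> E') \<in> sets borel" using fin E by (intro sets.finite_UN) auto
    qed (rule hausdorff_measure_mono)
    also have "\<dots> \<le> (\<Sum>E'\<in>\<F> - {E}. emeasure (hausdorff k) (E \<inter> E'))"
      using fin E by (intro emeasure_subadditive_finite) auto
    also have "\<dots> = 0"
    proof (rule sum.neutral, rule ballI)
      fix E' assume "E' \<in> \<F> - {E}"
      then show "emeasure (hausdorff k) (E \<inter> E') = 0" using E flat_Int_null[of E E' "E \<inter> E'"] by auto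
    qed
    finally show ?thesis by simp
  next
    case False
    then show ?thesis using null_part[OF E] by auto
  qed
  then show "emeasure \<mu> ?N = 0" using mu_shell[OF N] by simp
qed

lemma pos_ball:
  assumes E: "E \<in> \<F>" "pos E" and x: "x \<in> E" "x \<in> open_shell r" and e: "0 < e"
  shows "0 < emeasure \<mu> (E \<inter> ball x e)"
proof -
  obtain e' where e': "0 < e'" "ball x e' \<subseteq> open_shell r" using open_open_shell x(2) by (rule openE)
  define \<rho> where "\<rho> = min e e'"
  have "0 < hausdorff_measure k (E \<inter> ball x \<rho>)"
    using hausdorff_measure_flat_null[OF flat(1)[OF E(1)] x(1), of \<rho> k] E(2) e e'(1)
    by (auto simp: pos_def \<rho>_def zero_less_iff_neq_zero)
  also have "\<dots> \<le> hausdorff_measure k (E \<inter> ball x e \<inter> shell r \<inter> E)"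
  proof (rule hausdorff_measure_mono)
    have "ball x \<rho> \<subseteq> ball x e" "ball x \<rho> \<subseteq> ball x e'" by (auto simp: \<rho>_def)
    moreover have "open_shell r \<subseteq> shell r" by (auto simp: open_shell_def shell_def)
    ultimately show "E \<inter> ball x \<rho> \<subseteq> E \<inter> ball x e \<inter> shell r \<inter> E" using e'(2) by blast
  qed
  finally have "0 < c E * hausdorff_measure k (E \<inter> ball x e \<inter> shell r \<inter> E)"
    using c(1)[OF E(1)] by (simp add: ennreal_zero_less_mult_iff)
  also have "\<dots> \<le> emeasure \<mu> (E \<inter> ball x e)"
    using E(1) fin by (subst mu_shell) (auto intro!: member_le_sum)
  finally show ?thesis .
qed

text \<open>A line inside a charged flat meets the open shell only in points whose balls are
  charged. Conversely, charged rational points of the line lie in the closed finite union of the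
  flats; infinitely many of them are in the open shell, so two share a flat, which then contains the
  whole line and with it \<open>x\<close> and \<open>y\<close>.\<close>

lemma same_flat_iff:
  assumes x: "carrier_of x E" and y: "carrier_of y E'" and ne: "x \<noteq> y"
  shows "same_flat r \<mu> x y \<longleftrightarrow> E = E'"
proof
  assume eq: "E = E'"
  have E: "E \<in> \<F>" "pos E" "x \<in> E" "y \<in> E" using x y eq by (auto simp: carrier_of_def)
  show "same_flat r \<mu> x y"
    unfolding same_flat_def
  proof (intro conjI ballI impI allI ne)
    fix t n assume t: "x + t *\<^sub>R (y - x) \<in> open_shell r"
    have "x + t *\<^sub>R (y - x) \<in> E" using affine_line_subset[OF flat(1)[OF E(1)], of x 0 "y - x" 1 t] E by simp
    then have "0 < emeasure \<mu> (E \<inter> ball (x + t *\<^sub>R (y - x)) (1 / real (Suc n)))"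
      using E t by (intro pos_ball) auto
    also have "\<dots> \<le> emeasure \<mu> (ball (x + t *\<^sub>R (y - x)) (1 / real (Suc n)))"
      by (intro emeasure_mono) (auto simp: sets_mu)
    finally show "0 < emeasure \<mu> (ball (x + t *\<^sub>R (y - x)) (1 / real (Suc n)))" .
  qed
next
  assume sf: "same_flat r \<mu> x y"
  let ?z = "\<lambda>t. x + t *\<^sub>R (y - x)"
  have on: "?z t \<in> \<Union>\<F>" if t: "t \<in> \<rat>" "?z t \<in> open_shell r" for t
  proof (rule ccontr)
    assume "?z t \<notin> \<Union>\<F>"
    then obtain e where e: "0 < e" "ball (?z t) e \<subseteq> - \<Union>\<F>"
      using closed_flats by (metis ComplI open_Compl open_contains_ball)
    obtain n where n: "1 / real (Suc n) < e" using nat_approx_posE[OF e(1)] by blast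
    have "ball (?z t) (1 / real (Suc n)) \<subseteq> - \<Union>\<F>" using e(2) n subset_ball[of "1 / real (Suc n)" e] by force
    then have "ball (?z t) (1 / real (Suc n)) \<inter> shell r \<inter> E = {}" if "E \<in> \<F>" for E using that by blast
    then have "emeasure \<mu> (ball (?z t) (1 / real (Suc n))) = 0" by (subst mu_shell) auto
    then show False using sf t unfolding same_flat_def by (metis less_irrefl)
  qed
  obtain t0 where t0: "?z t0 \<in> open_shell r"
    using line_meets_open_shell[of x r y] x y ne r by (auto simp: carrier_of_def)
  have "open (?z -` open_shell r)"
    by (intro open_vimage open_open_shell continuous_intros)
  then obtain e where e: "0 < e" "ball t0 e \<subseteq> ?z -` open_shell r"
    using t0 by (elim openE[of _ t0]) auto
  obtain q where q: "q \<in> \<rat>" "t0 < q" "q < t0 + e" using Rats_dense_in_real[of t0 "t0 + e"] e(1) by auto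
  obtain q' where q': "q' \<in> \<rat>" "q < q'" "q' < t0 + e" using Rats_dense_in_real[of q "t0 + e"] q by auto
  \<comment> \<open>Infinitely many distinct rational parameters in one interval whose points stay
    in the open shell.\<close>
  define t where "t j = q + (q' - q) / real (Suc j)" for j :: nat
  have t: "t j \<in> \<rat>" "q < t j" "t j \<le> q'" for j
  proof -
    show "t j \<in> \<rat>" unfolding t_def using q q' by (intro Rats_add Rats_divide Rats_diff) auto
    show "q < t j" using q' by (simp add: t_def)
    have "(q' - q) / real (Suc j) \<le> (q' - q) / 1" using q' by (intro divide_left_mono) auto
    then show "t j \<le> q'" by (simp add: t_def)
  qed
  have inj: "inj t"
  proof (rule injI)
    fix i j assume "t i = t j"
    then have "(q' - q) / real (Suc i) = (q' - q) / real (Suc j)" by (simp add: t_def)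
    then show "i = j" using q' by (auto simp: frac_eq_eq)
  qed
  have "?z (t j) \<in> \<Union>\<F>" for j
  proof (rule on)
    have "t j \<in> ball t0 e" using t[of j] q q' by (auto simp: dist_real_def)
    then show "?z (t j) \<in> open_shell r" using e(2) by auto
  qed (rule t)
  then have "\<exists>g. \<forall>j. g j \<in> \<F> \<and> ?z (t j) \<in> g j" by (intro choice) blast
  then obtain g where g: "\<And>j. g j \<in> \<F>" "\<And>j. ?z (t j) \<in> g j" by blast
  have "\<not> inj g"
  proof
    assume "inj g"
    then have "infinite (range g)" using range_inj_infinite by blast
    moreover have "range g \<subseteq> \<F>" using g by auto
    ultimately show False using fin finite_subset by blast
  qed
  then obtain i j where ij: "i \<noteq> j" "g i = g j" by (auto simp: inj_def)
  have "t i \<noteq> t j" using inj ij by (auto simp: inj_def)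
  then have "?z u \<in> g i" for u
    using affine_line_subset[OF flat(1)[OF g(1)], of x "t i" "y - x" i "t j"] g(2)[of i] g(2)[of j] ij by auto
  from this[of 0] this[of 1] have "x \<in> g i" "y \<in> g i" by simp_all
  then show "E = E'" using x y g(1)[of i] by (auto simp: carrier_of_def)
qed

end

text \<open>The part of a flat inside \<open>B\<close> is seen outside \<open>B\<close> after a shift along the flat.\<close>

definition flat_recon :: "real \<Rightarrow> 'a::euclidean_space measure \<Rightarrow> 'a set \<Rightarrow> ennreal" where
  "flat_recon r \<mu> C = (\<integral>\<^sup>+x.
     (\<integral>\<^sup>+y. indicator {y. same_flat r \<mu> x y} y *
       (\<integral>\<^sup>+z. indicator {z. same_flat r \<mu> x z} z * indicator C (z - shift_vec r x y) \<partial>\<mu>) \<partial>\<mu>) /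
     (\<integral>\<^sup>+y. indicator {y. same_flat r \<mu> x y} y \<partial>\<mu>)\<^sup>2 \<partial>\<mu>)"

lemma norm_shift_vec: "x \<noteq> y \<Longrightarrow> 0 < r \<Longrightarrow> norm (shift_vec r x y) = 3 * r"
  by (simp add: shift_vec_def)

context flat_family
begin

text \<open>Singletons are null because \<open>k \<ge> 1\<close>; this keeps
  \<open>shift_vec\<close> away from the degenerate case \<open>x = y\<close>.\<close>

lemma AE_neq: "AE y in \<mu>. y \<noteq> x"
proof (rule AE_I)
  have "hausdorff_measure k {x} = 0" using k by (intro hausdorff_measure_flat_zero) auto
  moreover have "hausdorff_measure k ({x} \<inter> shell r \<inter> E) \<le> hausdorff_measure k {x}" for E
    by (rule hausdorff_measure_mono) auto
  ultimately show "emeasure \<mu> {x} = 0" by (subst mu_shell) auto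
qed (auto simp: sets_mu)

lemma AE_same_flat:
  assumes "carrier_of x E"
  shows "AE y in \<mu>. indicator {y. same_flat r \<mu> x y} y = (indicator E y :: ennreal)"
  using AE_carrier AE_neq[of x]
proof eventually_elim
  case (elim y)
  then obtain E' where E': "carrier_of y E'" by auto
  have "y \<in> E \<longleftrightarrow> E = E'" using assms E' by (auto simp: carrier_of_def)
  then show ?case using same_flat_iff[OF assms E'] elim by (auto split: split_indicator)
qed

definition content_in :: "'a set \<Rightarrow> 'a set \<Rightarrow> ennreal" where
  "content_in C E = c E * hausdorff_measure k (C \<inter> E)"

text \<open>The shift is parallel to \<open>E\<close> and takes \<open>C\<close> into the shell, so
  the integral measures a translate of \<open>C \<inter> E\<close>, whichever \<open>y\<close> on
  \<open>E\<close> gave the direction.\<close>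

lemma shifted_part:
  assumes E: "carrier_of x E" "carrier_of y E" "x \<noteq> y" and C: "C \<in> sets borel" "C \<subseteq> ball 0 r"
  shows "(\<integral>\<^sup>+z. indicator {z. same_flat r \<mu> x z} z * indicator C (z - shift_vec r x y) \<partial>\<mu>) = content_in C E"
proof -
  define w where "w = shift_vec r x y"
  have EF: "E \<in> \<F>" "x \<in> E" "y \<in> E" using E by (auto simp: carrier_of_def)
  have w: "norm w = 3 * r" unfolding w_def using E(3) r by (rule norm_shift_vec)
  define A where "A = {z. z \<in> E \<and> z - w \<in> C}"
  have sub: "(\<lambda>z. z - w) \<in> measurable borel borel" by measurable
  have A: "A \<in> sets borel"
    using borel_flat[OF EF(1)] measurable_sets_borel[OF sub C(1)]
    by (auto simp: A_def Collect_conj_eq vimage_def intro: sets.Int)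
  have shift: "p + s *\<^sub>R (y - x) \<in> E" if "p \<in> E" for p s
    using flat(1)[OF EF(1)] that EF(2,3) by (intro mem_affine_3_minus)
  have Aeq: "A = (+) w ` (C \<inter> E)"
  proof safe
    fix z assume "z \<in> A"
    then have z: "z \<in> E" "z - w \<in> C" by (auto simp: A_def)
    have "z - w \<in> E" using shift[OF z(1), of "- (3 * r / norm (y - x))"] by (simp add: w_def shift_vec_def)
    then show "z \<in> (+) w ` (C \<inter> E)" using z by (intro image_eqI[of _ _ "z - w"]) auto
  next
    fix z assume "z \<in> C" "z \<in> E"
    then show "w + z \<in> A"
      using shift[of z "3 * r / norm (y - x)"] by (auto simp: A_def w_def shift_vec_def add.commute)
  qed
  have Ash: "A \<subseteq> shell r"
  proof
    fix z assume "z \<in> A"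
    then have "norm (z - w) < r" using C(2) by (auto simp: A_def)
    moreover have "norm z \<le> norm (z - w) + norm w" "norm w \<le> norm (w - z) + norm z"
      using norm_triangle_ineq[of "z - w" w] norm_triangle_ineq[of "w - z" z] by auto
    ultimately show "z \<in> shell r" using w by (auto simp: shell_def norm_minus_commute)
  qed
  have "(\<integral>\<^sup>+z. indicator {z. same_flat r \<mu> x z} z * indicator C (z - w) \<partial>\<mu>) = (\<integral>\<^sup>+z. indicator A z \<partial>\<mu>)"
    using AE_same_flat[OF E(1)]
    by (intro nn_integral_cong_AE) (auto elim!: eventually_mono simp: A_def indicator_eq_1_iff split: split_indicator)
  also have "\<dots> = emeasure \<mu> A" using A by (simp add: sets_mu)
  also have "\<dots> = (\<Sum>E'\<in>\<F>. if E' = E then c E * hausdorff_measure k A else 0)"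
    unfolding mu_shell[OF A]
  proof (rule sum.cong[OF refl])
    fix E' assume E': "E' \<in> \<F>"
    show "c E' * hausdorff_measure k (A \<inter> shell r \<inter> E') = (if E' = E then c E * hausdorff_measure k A else 0)"
    proof (cases "E' = E")
      case True
      then have "A \<inter> shell r \<inter> E' = A" using Ash by (auto simp: A_def)
      then show ?thesis using True by simp
    next
      case False
      then have "hausdorff_measure k (A \<inter> shell r \<inter> E') = 0"
        using EF(1) E' by (intro flat_Int_null[of E E']) (auto simp: A_def)
      then show ?thesis using False by simp
    qed
  qed
  also have "\<dots> = c E * hausdorff_measure k A" using EF(1) fin by simp
  also have "\<dots> = content_in C E" unfolding Aeq content_in_def by (simp add: hausdorff_measure_translation)
  finally show ?thesis by (simp add: w_def)
qed

text \<open>A flat of positive dimension meeting \<open>ball 0 r\<close> reaches norm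
  \<open>3 * r\<close>, so a non-null flat that is not seen in the shell misses the ball. This
  settles the division by zero mass in the reconstruction.\<close>

lemma content_in_0:
  assumes E: "E \<in> \<F>" "emeasure \<mu> E = 0 \<or> \<not> pos E" and C: "C \<subseteq> ball 0 r"
  shows "content_in C E = 0"
proof (cases "pos E")
  case True
  then have 0: "emeasure \<mu> E = 0" using E by auto
  have none: "x \<notin> E" if "x \<in> open_shell r" for x
  proof
    assume "x \<in> E"
    then have "0 < emeasure \<mu> (E \<inter> ball x 1)" using pos_ball[OF E(1) True _ that] by simp
    also have "\<dots> \<le> emeasure \<mu> E" using E(1) by (intro emeasure_mono) (auto simp: sets_mu)
    finally show False using 0 by simp
  qed
  have "E \<inter> C = {}"
  proof (rule ccontr)
    assume "E \<inter> C \<noteq> {}"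
    then obtain p where p: "p \<in> E" "p \<in> C" by blast
    then have "norm p < r" using C by auto
    note p = p(1) this
    have "E \<noteq> {p}" using flat(2)[OF E(1)] k by auto
    then obtain q where q: "q \<in> E" "q \<noteq> p" using p by auto
    obtain t where t: "norm (p + t *\<^sub>R (q - p)) = 3 * r"
      using line_reaches[of "q - p" p "3 * r"] p q r by auto
    have "p + t *\<^sub>R (q - p) \<in> E"
      using affine_line_subset[OF flat(1)[OF E(1)], of p 0 "q - p" 1 t] p q by simp
    then show False using none t r by (auto simp: open_shell_def)
  qed
  then show ?thesis by (simp add: content_in_def Int_commute)
next
  case False
  then show ?thesis using null_part[OF E(1) False, of "C \<inter> E"] by (simp add: content_in_def)
qed

lemma flat_recon_eq:
  assumes C: "C \<in> sets borel" "C \<subseteq> ball 0 r"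
  shows "flat_recon r \<mu> C = (\<Sum>E\<in>\<F>. c E * hausdorff_measure k (C \<inter> E))"
proof -
  \<comment> \<open>At \<open>x\<close> on \<open>E\<close> the inner integrals give the content
    times the mass of \<open>E\<close>; the outer integral supplies the second factor that cancels
    the square.\<close>
  define v where "v E = content_in C E * emeasure \<mu> E / (emeasure \<mu> E)\<^sup>2" for E
  have EF: "E \<in> \<F>" if "carrier_of x E" for x E using that by (auto simp: carrier_of_def)
  have mid: "(\<integral>\<^sup>+y. indicator {y. same_flat r \<mu> x y} y *
       (\<integral>\<^sup>+z. indicator {z. same_flat r \<mu> x z} z * indicator C (z - shift_vec r x y) \<partial>\<mu>) \<partial>\<mu>) /
     (\<integral>\<^sup>+y. indicator {y. same_flat r \<mu> x y} y \<partial>\<mu>)\<^sup>2 = v E" if x: "carrier_of x E" for x E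
  proof -
    have "(\<integral>\<^sup>+y. indicator {y. same_flat r \<mu> x y} y *
       (\<integral>\<^sup>+z. indicator {z. same_flat r \<mu> x z} z * indicator C (z - shift_vec r x y) \<partial>\<mu>) \<partial>\<mu>)
      = (\<integral>\<^sup>+y. content_in C E * indicator E y \<partial>\<mu>)"
    proof (rule nn_integral_cong_AE)
      show "AE y in \<mu>. indicator {y. same_flat r \<mu> x y} y *
         (\<integral>\<^sup>+z. indicator {z. same_flat r \<mu> x z} z * indicator C (z - shift_vec r x y) \<partial>\<mu>)
        = content_in C E * indicator E y"
        using AE_same_flat[OF x] AE_carrier AE_neq[of x]
      proof eventually_elim
        case (elim y)
        then obtain E' where E': "carrier_of y E'" by auto
        show ?case
        proof (cases "y \<in> E")
          case True
          then have "E' = E" using E' EF[OF x] by (auto simp: carrier_of_def)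
          then show ?thesis using shifted_part[OF x _ _ C, of y] E' elim True by simp
        next
          case False
          then show ?thesis using elim(1) by (simp only: indicator_simps(2)) simp
        qed
      qed
    qed
    also have "\<dots> = content_in C E * emeasure \<mu> E"
      using borel_flat[OF EF[OF x]] by (simp add: nn_integral_cmult_indicator sets_mu)
    finally have 1: "(\<integral>\<^sup>+y. indicator {y. same_flat r \<mu> x y} y *
       (\<integral>\<^sup>+z. indicator {z. same_flat r \<mu> x z} z * indicator C (z - shift_vec r x y) \<partial>\<mu>) \<partial>\<mu>)
       = content_in C E * emeasure \<mu> E" .
    have "(\<integral>\<^sup>+y. indicator {y. same_flat r \<mu> x y} y \<partial>\<mu>) = (\<integral>\<^sup>+y. indicator E y \<partial>\<mu>)"
      by (rule nn_integral_cong_AE[OF AE_same_flat[OF x]])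
    also have "\<dots> = emeasure \<mu> E" using borel_flat[OF EF[OF x]] by (simp add: sets_mu)
    finally show ?thesis unfolding 1 by (simp add: v_def)
  qed
  have "flat_recon r \<mu> C = (\<integral>\<^sup>+x. (\<Sum>E\<in>{E\<in>\<F>. pos E}. v E * indicator E x) \<partial>\<mu>)"
    unfolding flat_recon_def
  proof (rule nn_integral_cong_AE)
    show "AE x in \<mu>. (\<integral>\<^sup>+y. indicator {y. same_flat r \<mu> x y} y *
       (\<integral>\<^sup>+z. indicator {z. same_flat r \<mu> x z} z * indicator C (z - shift_vec r x y) \<partial>\<mu>) \<partial>\<mu>) /
     (\<integral>\<^sup>+y. indicator {y. same_flat r \<mu> x y} y \<partial>\<mu>)\<^sup>2 = (\<Sum>E\<in>{E\<in>\<F>. pos E}. v E * indicator E x)"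
      using AE_carrier
    proof eventually_elim
      case (elim x)
      then obtain E where E: "carrier_of x E" by auto
      have "(\<Sum>E'\<in>{E\<in>\<F>. pos E}. v E' * indicator E' x) = (\<Sum>E'\<in>{E\<in>\<F>. pos E}. if E' = E then v E else 0)"
        using E by (intro sum.cong) (auto simp: carrier_of_def split: split_indicator)
      also have "\<dots> = v E" using E fin by (auto simp: carrier_of_def)
      finally show ?case using mid[OF E] by simp
    qed
  qed
  also have "\<dots> = (\<Sum>E\<in>{E\<in>\<F>. pos E}. v E * emeasure \<mu> E)"
  proof (subst nn_integral_sum)
    fix E assume "E \<in> {E\<in>\<F>. pos E}"
    then have [measurable]: "E \<in> sets \<mu>" using borel_flat sets_mu by auto
    show "(\<lambda>x. v E * indicator E x) \<in> borel_measurable \<mu>" by measurable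
  qed (use borel_flat in \<open>auto simp: nn_integral_cmult_indicator sets_mu intro!: sum.cong\<close>)
  also have "\<dots> = (\<Sum>E\<in>{E\<in>\<F>. pos E}. content_in C E)"
  proof (rule sum.cong[OF refl])
    fix E assume "E \<in> {E\<in>\<F>. pos E}"
    then have E: "E \<in> \<F>" by auto
    show "v E * emeasure \<mu> E = content_in C E"
    proof (cases "emeasure \<mu> E = 0")
      case True
      then show ?thesis using content_in_0[OF E _ C(2)] by simp
    next
      case False
      have top: "emeasure \<mu> E \<noteq> \<top>" using mu_finite[of E] by simp
      have "v E * emeasure \<mu> E = content_in C E * (emeasure \<mu> E * emeasure \<mu> E) / (emeasure \<mu> E * emeasure \<mu> E)"
        by (simp add: v_def power2_eq_square ennreal_times_divide mult_ac)
      also have "\<dots> = content_in C E"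
        using False top by (intro ennreal_mult_divide_eq) (auto simp: ennreal_mult_eq_top_iff)
      finally show ?thesis .
    qed
  qed
  also have "\<dots> = (\<Sum>E\<in>\<F>. content_in C E)"
    using fin content_in_0[OF _ _ C(2)] by (intro sum.mono_neutral_left) auto
  finally show ?thesis by (simp add: content_in_def)
qed

end

section \<open>Measurability of the reconstruction from flats\<close>

lemma sets_same_flat:
  fixes K :: "'x \<Rightarrow> 'a::euclidean_space measure"
  assumes K: "K \<in> measurable N borel_measures" "\<And>x. x \<in> space N \<Longrightarrow> emeasure (K x) UNIV < \<infinity>"
    and f[measurable]: "f \<in> measurable N borel" "g \<in> measurable N borel"
  shows "{x\<in>space N. same_flat r (K x) (f x) (g x)} \<in> sets N"
proof -
  have meas: "(\<lambda>x. emeasure (K x) (ball (h x) e)) \<in> borel_measurable N"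
    if h[measurable]: "h \<in> measurable N borel" for h e
  proof -
    have "(\<lambda>x. \<integral>\<^sup>+z. indicator {p. dist (fst p) (snd p) < e} (h x, z) \<partial>K x) \<in> borel_measurable N"
    proof (rule nn_integral_measurable_kernel[OF K])
      have [measurable]: "{p :: 'a \<times> 'a. dist (fst p) (snd p) < e} \<in> sets (borel \<Otimes>\<^sub>M borel)"
        unfolding borel_prod by (intro borel_open open_Collect_less continuous_intros)
      show "(\<lambda>(x, z). indicator {p. dist (fst p) (snd p) < e} (h x, z) :: ennreal) \<in> borel_measurable (N \<Otimes>\<^sub>M borel)"
        by measurable
    qed
    also have "?this \<longleftrightarrow> ?thesis"
    proof (rule measurable_cong)
      fix x assume x: "x \<in> space N"
      have "(\<integral>\<^sup>+z. indicator {p. dist (fst p) (snd p) < e} (h x, z) \<partial>K x) = (\<integral>\<^sup>+z. indicator (ball (h x) e) z \<partial>K x)"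
        by (intro nn_integral_cong) (auto split: split_indicator)
      also have "\<dots> = emeasure (K x) (ball (h x) e)"
        using measurable_borel_measuresD(1)[OF K(1) x] by simp
      finally show "(\<integral>\<^sup>+z. indicator {p. dist (fst p) (snd p) < e} (h x, z) \<partial>K x) = emeasure (K x) (ball (h x) e)" .
    qed
    finally show ?thesis .
  qed
  have "{x\<in>space N. \<forall>q::rat. f x + real_of_rat q *\<^sub>R (g x - f x) \<in> open_shell r \<longrightarrow>
      (\<forall>n. 0 < emeasure (K x) (ball (f x + real_of_rat q *\<^sub>R (g x - f x)) (1 / real (Suc n))))} \<in> sets N"
  proof (rule sets.sets_Collect_countable_All)
    fix q :: rat
    define t where "t = real_of_rat q"
    have [measurable]: "open_shell r \<in> sets (borel :: 'a measure)" using open_open_shell by (rule borel_open)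
    have h: "(\<lambda>x. f x + t *\<^sub>R (g x - f x)) \<in> measurable N borel" by measurable
    note meas[OF h, measurable]
    show "{x\<in>space N. f x + real_of_rat q *\<^sub>R (g x - f x) \<in> open_shell r \<longrightarrow>
      (\<forall>n. 0 < emeasure (K x) (ball (f x + real_of_rat q *\<^sub>R (g x - f x)) (1 / real (Suc n))))} \<in> sets N"
      unfolding t_def[symmetric] by measurable
  qed
  also have "{x\<in>space N. \<forall>q::rat. f x + real_of_rat q *\<^sub>R (g x - f x) \<in> open_shell r \<longrightarrow>
      (\<forall>n. 0 < emeasure (K x) (ball (f x + real_of_rat q *\<^sub>R (g x - f x)) (1 / real (Suc n))))}
    = {x\<in>space N. \<forall>t\<in>\<rat>. f x + t *\<^sub>R (g x - f x) \<in> open_shell r \<longrightarrow>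
      (\<forall>n. 0 < emeasure (K x) (ball (f x + t *\<^sub>R (g x - f x)) (1 / real (Suc n))))}"
    by (auto simp: Rats_def)
  finally have "{x\<in>space N. \<forall>t\<in>\<rat>. f x + t *\<^sub>R (g x - f x) \<in> open_shell r \<longrightarrow>
      (\<forall>n. 0 < emeasure (K x) (ball (f x + t *\<^sub>R (g x - f x)) (1 / real (Suc n))))} \<in> sets N" .
  moreover have "{x\<in>space N. f x \<noteq> g x} \<in> sets N" by measurable
  ultimately show ?thesis unfolding same_flat_def by (intro sets.sets_Collect_conj)
qed

text \<open>The kernel lemma asks for finite measures throughout \<open>borel_measures\<close>; the
  observed restrictions are almost surely finite and then unchanged.\<close>

definition truncate_measure :: "'a::topological_space measure \<Rightarrow> 'a measure" where
  "truncate_measure \<mu> = (if emeasure \<mu> UNIV < \<infinity> then \<mu> else null_measure borel)"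

lemma measurable_truncate_measure: "truncate_measure \<in> measurable borel_measures borel_measures"
  using truncate_measure_measurable by (simp add: truncate_measure_def[abs_def])

lemma truncate_measure_finite: "emeasure (truncate_measure \<mu>) UNIV < \<infinity>"
  by (simp add: truncate_measure_def)

lemma sets_truncate_measure: "sets \<mu> = sets borel \<Longrightarrow> sets (truncate_measure \<mu>) = sets borel"
  by (simp add: truncate_measure_def)

text \<open>There is one claim for each level of the nested integral, since every application of the
  kernel lemma needs joint measurability in all remaining variables.\<close>

lemma flat_recon_joint_measurable:
  fixes C :: "'a::euclidean_space set" and r :: real
  assumes C[measurable]: "C \<in> sets borel"
  defines "T \<equiv> truncate_measure :: 'a measure \<Rightarrow> 'a measure"
  defines "S \<equiv> \<lambda>\<mu> x y z. indicator {z. same_flat r (T \<mu>) x z} z * indicator C (z - shift_vec r x y) :: ennreal"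
  shows "(\<lambda>(((\<mu>, x), y), z). S \<mu> x y z) \<in> borel_measurable (((borel_measures \<Otimes>\<^sub>M borel) \<Otimes>\<^sub>M borel) \<Otimes>\<^sub>M borel)" (is ?A)
    "(\<lambda>((\<mu>, x), y). indicator {y. same_flat r (T \<mu>) x y} y * (\<integral>\<^sup>+z. S \<mu> x y z \<partial>T \<mu>)) \<in> borel_measurable ((borel_measures \<Otimes>\<^sub>M borel) \<Otimes>\<^sub>M borel)" (is ?B)
    "(\<lambda>(\<mu>, x). (\<integral>\<^sup>+y. indicator {y. same_flat r (T \<mu>) x y} y * (\<integral>\<^sup>+z. S \<mu> x y z \<partial>T \<mu>) \<partial>T \<mu>) /
      (\<integral>\<^sup>+y. indicator {y. same_flat r (T \<mu>) x y} y \<partial>T \<mu>)\<^sup>2) \<in> borel_measurable (borel_measures \<Otimes>\<^sub>M borel)" (is ?C)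
proof -
  let ?N1 = "borel_measures \<Otimes>\<^sub>M (borel :: 'a measure)"
  let ?N2 = "?N1 \<Otimes>\<^sub>M (borel :: 'a measure)"
  let ?N3 = "?N2 \<Otimes>\<^sub>M (borel :: 'a measure)"
  have T[measurable]: "T \<in> measurable borel_measures borel_measures"
    unfolding T_def by (rule measurable_truncate_measure)
  have fin: "emeasure (T \<mu>) UNIV < \<infinity>" for \<mu> unfolding T_def by (rule truncate_measure_finite)
  have sf2: "(\<lambda>((\<mu>, x), y). indicator {y. same_flat r (T \<mu>) x y} y :: ennreal) \<in> borel_measurable ?N2"
  proof -
    have "{p\<in>space ?N2. same_flat r (T (fst (fst p))) (snd (fst p)) (snd p)} \<in> sets ?N2"
      by (rule sets_same_flat) (measurable, auto intro: fin[simplified])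
    then have "indicator {p\<in>space ?N2. same_flat r (T (fst (fst p))) (snd (fst p)) (snd p)} \<in> borel_measurable ?N2"
      by (rule borel_measurable_indicator)
    then show ?thesis
      by (rule measurable_cong[THEN iffD1, rotated]) (auto split: split_indicator)
  qed
  have sf3: "(\<lambda>(((\<mu>, x), y), z). indicator {z. same_flat r (T \<mu>) x z} z :: ennreal) \<in> borel_measurable ?N3"
    using measurable_compose[of "\<lambda>(((\<mu>, x), y), z). ((\<mu>, x), z)" ?N3 ?N2, OF _ sf2] by (simp add: split_beta')
  have sv: "(\<lambda>(((\<mu>, x), y), z). z - shift_vec r x y) \<in> measurable ?N3 borel"
    unfolding shift_vec_def split_beta' by measurable
  have "(\<lambda>(((\<mu>, x), y), z). indicator C (z - shift_vec r x y) :: ennreal) \<in> borel_measurable ?N3"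
    using measurable_compose[OF sv borel_measurable_indicator[OF C]] by (simp add: split_beta')
  from borel_measurable_times_ennreal[OF sf3 this] show A: ?A
    unfolding S_def by (simp add: split_beta')
  have "(\<lambda>p. \<integral>\<^sup>+z. S (fst (fst p)) (snd (fst p)) (snd p) z \<partial>T (fst (fst p))) \<in> borel_measurable ?N2"
    by (rule nn_integral_measurable_kernel) (use A fin in \<open>measurable, auto simp: split_beta'\<close>)
  from borel_measurable_times_ennreal[OF sf2[unfolded split_beta'] this]
  show B: ?B by (simp add: split_beta')
  have 1: "(\<lambda>p. \<integral>\<^sup>+y. indicator {y. same_flat r (T (fst p)) (snd p) y} y * (\<integral>\<^sup>+z. S (fst p) (snd p) y z \<partial>T (fst p)) \<partial>T (fst p)) \<in> borel_measurable ?N1"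
  proof (rule nn_integral_measurable_kernel)
    show "(\<lambda>p. T (fst p)) \<in> measurable ?N1 borel_measures" by measurable
  qed (use B fin in \<open>simp_all add: split_beta'\<close>)
  have 2: "(\<lambda>p. \<integral>\<^sup>+y. indicator {y. same_flat r (T (fst p)) (snd p) y} y \<partial>T (fst p)) \<in> borel_measurable ?N1"
  proof (rule nn_integral_measurable_kernel)
    show "(\<lambda>p. T (fst p)) \<in> measurable ?N1 borel_measures" by measurable
  qed (use sf2 fin in \<open>simp_all add: split_beta'\<close>)
  have "(\<lambda>p. (\<integral>\<^sup>+y. indicator {y. same_flat r (T (fst p)) (snd p) y} y * (\<integral>\<^sup>+z. S (fst p) (snd p) y z \<partial>T (fst p)) \<partial>T (fst p)) /
      (\<integral>\<^sup>+y. indicator {y. same_flat r (T (fst p)) (snd p) y} y \<partial>T (fst p))\<^sup>2) \<in> borel_measurable ?N1"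
    using 1 2 by measurable
  then show ?C by (simp add: split_beta')
qed

lemma flat_recon_measurable:
  fixes C :: "'a::euclidean_space set"
  assumes C: "C \<in> sets borel"
  shows "(\<lambda>\<mu>. flat_recon r (truncate_measure \<mu>) C) \<in> borel_measurable borel_measures"
  unfolding flat_recon_def
  by (rule nn_integral_measurable_kernel[OF measurable_truncate_measure truncate_measure_finite flat_recon_joint_measurable(3)[OF C]])

text \<open>Additivity is shown at every \<open>\<mu>\<close> of the domain, not only at measures
  carried by flats, so that the reconstruction is a map into measures everywhere.\<close>

lemma flat_recon_suminf:
  fixes A :: "nat \<Rightarrow> 'a::euclidean_space set"
  assumes \<mu>: "\<mu> \<in> space borel_measures" and A: "\<And>i. A i \<in> sets borel" "disjoint_family A"
  shows "(\<Sum>i. flat_recon r (truncate_measure \<mu>) (A i)) = flat_recon r (truncate_measure \<mu>) (\<Union>i. A i)"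
proof -
  let ?T = "truncate_measure \<mu>"
  have sets: "sets ?T = sets borel" using \<mu> sets_truncate_measure by (auto simp: space_borel_measures)
  let ?S = "\<lambda>x y C z. indicator {z. same_flat r ?T x z} z * indicator C (z - shift_vec r x y) :: ennreal"
  let ?a = "\<lambda>x. (\<integral>\<^sup>+y. indicator {y. same_flat r ?T x y} y \<partial>?T)\<^sup>2"
  have m0: "?S x y (A i) \<in> borel_measurable ?T" for x y i
    using measurable_compose[of "\<lambda>z. (((\<mu>, x), y), z)" borel _ _ borel, OF _ flat_recon_joint_measurable(1)[OF A(1)[of i], of r]] \<mu>
    by (simp add: measurable_cong_sets[OF sets refl])
  have m1: "(\<lambda>y. indicator {y. same_flat r ?T x y} y * (\<integral>\<^sup>+z. ?S x y (A i) z \<partial>?T)) \<in> borel_measurable ?T" for x i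
    using measurable_compose[of "\<lambda>y. ((\<mu>, x), y)" borel _ _ borel, OF _ flat_recon_joint_measurable(2)[OF A(1)[of i], of r]] \<mu>
    by (simp add: measurable_cong_sets[OF sets refl])
  have m2: "(\<lambda>x. (\<integral>\<^sup>+y. indicator {y. same_flat r ?T x y} y * (\<integral>\<^sup>+z. ?S x y (A i) z \<partial>?T) \<partial>?T) / ?a x) \<in> borel_measurable ?T" for i
    using measurable_compose[of "\<lambda>x. (\<mu>, x)" borel _ _ borel, OF _ flat_recon_joint_measurable(3)[OF A(1)[of i], of r]] \<mu>
    by (simp add: measurable_cong_sets[OF sets refl])
  have ind: "indicator (\<Union>i. A i) z = (\<Sum>i. indicator (A i) z :: ennreal)" for z
    using suminf_indicator[OF A(2)] by simp
  have 0: "(\<integral>\<^sup>+z. ?S x y (\<Union>i. A i) z \<partial>?T) = (\<Sum>i. \<integral>\<^sup>+z. ?S x y (A i) z \<partial>?T)" for x y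
    unfolding ind ennreal_suminf_cmult[symmetric] by (rule nn_integral_suminf[OF m0])
  have 1: "(\<integral>\<^sup>+y. indicator {y. same_flat r ?T x y} y * (\<integral>\<^sup>+z. ?S x y (\<Union>i. A i) z \<partial>?T) \<partial>?T)
     = (\<Sum>i. \<integral>\<^sup>+y. indicator {y. same_flat r ?T x y} y * (\<integral>\<^sup>+z. ?S x y (A i) z \<partial>?T) \<partial>?T)" for x
    unfolding 0 ennreal_suminf_cmult[symmetric] by (rule nn_integral_suminf[OF m1])
  have "flat_recon r ?T (\<Union>i. A i)
    = (\<integral>\<^sup>+x. (\<Sum>i. (\<integral>\<^sup>+y. indicator {y. same_flat r ?T x y} y * (\<integral>\<^sup>+z. ?S x y (A i) z \<partial>?T) \<partial>?T) / ?a x) \<partial>?T)"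
    unfolding flat_recon_def 1 by (simp add: ennreal_suminf_divide)
  also have "\<dots> = (\<Sum>i. flat_recon r ?T (A i))"
    unfolding flat_recon_def by (rule nn_integral_suminf[OF m2])
  finally show ?thesis by simp
qed

definition recon_measure :: "real \<Rightarrow> 'a::euclidean_space set \<Rightarrow> 'a measure \<Rightarrow> 'a measure" where
  "recon_measure r B \<mu> = measure_of UNIV (sets borel) (\<lambda>C. flat_recon r (truncate_measure \<mu>) (C \<inter> B))"

lemma
  fixes B :: "'a::euclidean_space set"
  assumes B: "B \<in> sets borel"
  shows recon_measure_measurable: "recon_measure r B \<in> measurable borel_measures borel_measures"
    and emeasure_recon_measure: "\<mu> \<in> space borel_measures \<Longrightarrow> C \<in> sets borel \<Longrightarrow>
      emeasure (recon_measure r B \<mu>) C = flat_recon r (truncate_measure \<mu>) (C \<inter> B)"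
proof -
  let ?G = "\<lambda>\<mu> C. flat_recon r (truncate_measure \<mu>) (C \<inter> B)"
  have 1: "(\<Sum>i. ?G \<mu> (A i)) = ?G \<mu> (\<Union>i. A i)"
    if "\<mu> \<in> space borel_measures" "\<And>i::nat. A i \<in> sets borel" "disjoint_family A" for \<mu> A
  proof -
    have "(\<Sum>i. ?G \<mu> (A i)) = flat_recon r (truncate_measure \<mu>) (\<Union>i. A i \<inter> B)"
      by (rule flat_recon_suminf) (use that B in \<open>auto simp: disjoint_family_on_def\<close>)
    then show ?thesis by simp
  qed
  have 2: "?G \<mu> {} = 0" for \<mu> by (simp add: flat_recon_def)
  have 3: "(\<lambda>\<mu>. ?G \<mu> C) \<in> borel_measurable borel_measures" if "C \<in> sets borel" for C
    using that B by (intro flat_recon_measurable) auto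
  show "recon_measure r B \<in> measurable borel_measures borel_measures"
    unfolding recon_measure_def[abs_def]
    using measurable_measure_of_borel_measures(1)[of borel_measures ?G] 1 2 3 by blast
  show "emeasure (recon_measure r B \<mu>) C = ?G \<mu> C" if "\<mu> \<in> space borel_measures" "C \<in> sets borel"
    unfolding recon_measure_def
    using measurable_measure_of_borel_measures(2)[of borel_measures ?G] 1 2 3 that by blast
qed

context poisson_hyperplanes
begin

text \<open>Tuples are grouped by their common intersection, which turns the intersection measure
  near the origin into a weighted sum over finitely many flats; general position gives all of them
  dimension \<open>d - m\<close>.\<close>

lemma AE_flats_determined:
  assumes m: "m < DIM('a)" and r: "0 < r" and B: "B \<in> sets borel" "B \<subseteq> ball 0 r"
  shows "as_determined M borel_measures (\<lambda>\<omega>. meas_restr (intersection_measure m (\<eta> \<omega>)) B)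
    borel_measures (\<lambda>\<omega>. meas_restr (intersection_measure m (\<eta> \<omega>)) (shell r))"
  unfolding as_determined_def
proof (rule bexI[OF _ recon_measure_measurable[OF B(1), of r]])
  show "AE \<omega> in M. meas_restr (intersection_measure m (\<eta> \<omega>)) B
      = recon_measure r B (meas_restr (intersection_measure m (\<eta> \<omega>)) (shell r))"
    using AE_generic AE_space
  proof eventually_elim
    case (elim \<omega>)
    define X where "X = \<eta> \<omega>"
    define \<Phi> where "\<Phi> = intersection_measure m X"
    define k where "k = DIM('a) - m"
    define L where "L = {Hs \<in> tuples m (X \<inter> hitting (cball 0 (5 * r))). \<Inter>(set Hs) \<noteq> {}}"
    define \<F> where "\<F> = (\<lambda>Hs. \<Inter>(set Hs)) ` L"
    define c where "c E = ennreal (1 / fact m) * of_nat (card {Hs \<in> L. \<Inter>(set Hs) = E})" for E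
    have X: "X \<subseteq> hyperplanes" "generic X" using elim eta_hyperplanes by (auto simp: X_def)
    have finX: "finite (X \<inter> hitting (cball 0 (5 * r)))" using finite_hitting[OF elim(2)] by (simp add: X_def)
    then have finL: "finite L" unfolding L_def by (intro finite_subset[OF _ finite_tuples[of _ m]]) auto
    have \<Phi>: "emeasure \<Phi> C = (\<Sum>E\<in>\<F>. c E * hausdorff_measure k (C \<inter> E))"
      if C: "C \<in> sets borel" "C \<subseteq> cball 0 (5 * r)" for C
    proof -
      have "emeasure \<Phi> C = ennreal (1 / fact m) *
        (\<Sum>Hs\<in>tuples m (X \<inter> hitting (cball 0 (5 * r))). hausdorff_measure k (C \<inter> \<Inter>(set Hs)))"
        unfolding \<Phi>_def k_def using X(1) C finX by (intro emeasure_intersection_measure_bounded)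
      also have "(\<Sum>Hs\<in>tuples m (X \<inter> hitting (cball 0 (5 * r))). hausdorff_measure k (C \<inter> \<Inter>(set Hs)))
        = (\<Sum>Hs\<in>L. hausdorff_measure k (C \<inter> \<Inter>(set Hs)))"
        unfolding L_def using finite_tuples[OF finX] by (intro sum.mono_neutral_right) auto
      also have "\<dots> = (\<Sum>E\<in>\<F>. \<Sum>Hs\<in>{Hs\<in>L. \<Inter>(set Hs) = E}. hausdorff_measure k (C \<inter> \<Inter>(set Hs)))"
        unfolding \<F>_def using finL by (rule sum.image_gen)
      also have "\<dots> = (\<Sum>E\<in>\<F>. of_nat (card {Hs\<in>L. \<Inter>(set Hs) = E}) * hausdorff_measure k (C \<inter> E))"
        by (intro sum.cong refl) simp
      finally show ?thesis by (simp add: c_def sum_distrib_left mult.assoc)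
    qed
    have sets\<Phi>: "sets \<Phi> = sets borel" by (simp add: \<Phi>_def)
    have shell: "shell r \<in> sets (borel :: 'a measure)" using closed_shell by (rule borel_closed)
    have "shell r \<subseteq> (cball 0 (5 * r) :: 'a set)" by (auto simp: shell_def)
    define \<mu> where "\<mu> = meas_restr \<Phi> (shell r)"
    interpret flat_family \<F> k c r \<mu>
    proof
      show "finite \<F>" unfolding \<F>_def using finL by simp
      show "1 \<le> k" "0 < r" using m r by (auto simp: k_def)
      show "sets \<mu> = sets borel" by (simp add: \<mu>_def sets\<Phi>)
      show "emeasure \<mu> C = (\<Sum>E\<in>\<F>. c E * hausdorff_measure k (C \<inter> {x. r \<le> norm x \<and> norm x \<le> 5 * r} \<inter> E))"
        if C: "C \<in> sets borel" for C
      proof -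
        have "emeasure \<mu> C = emeasure \<Phi> (C \<inter> shell r)" unfolding \<mu>_def by (rule emeasure_meas_restr[OF sets\<Phi> shell C])
        also have "\<dots> = (\<Sum>E\<in>\<F>. c E * hausdorff_measure k (C \<inter> shell r \<inter> E))"
          by (rule \<Phi>) (use C shell in \<open>auto simp: shell_def\<close>)
        finally show ?thesis by (simp add: shell_def)
      qed
    next
      fix E assume "E \<in> \<F>"
      then obtain Hs where Hs: "Hs \<in> L" "E = \<Inter>(set Hs)" by (auto simp: \<F>_def)
      have tup: "Hs \<in> tuples m X" using Hs by (auto simp: L_def tuples_def)
      show "affine E" using affine_Inter_tuple[OF tup X(1)] Hs by simp
      have "card (set Hs) = m" "set Hs \<subseteq> X" using tup by (auto simp: tuples_def distinct_card)
      then show "aff_dim E = int k"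
        using generic_aff_dim[OF X, of "set Hs"] Hs m by (auto simp: L_def k_def)
      have "0 < card {Hs \<in> L. \<Inter>(set Hs) = E}" using Hs finL by (auto simp: card_gt_0_iff)
      then show "0 < c E" by (simp add: c_def ennreal_zero_less_mult_iff)
      show "c E < \<infinity>" by (simp add: c_def ennreal_mult_less_top of_nat_less_top)
    qed
    have tr: "truncate_measure \<mu> = \<mu>" using mu_finite by (simp add: truncate_measure_def)
    have \<mu>sp: "\<mu> \<in> space borel_measures" by (simp add: space_borel_measures sets_mu)
    have "meas_restr \<Phi> B = recon_measure r B \<mu>"
    proof (rule measure_eqI)
      show "sets (meas_restr \<Phi> B) = sets (recon_measure r B \<mu>)"
        using measurable_space[OF recon_measure_measurable[OF B(1)] \<mu>sp] by (simp add: sets\<Phi> space_borel_measures)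
      fix C assume "C \<in> sets (meas_restr \<Phi> B)"
      then have C: "C \<in> sets borel" by (simp add: sets\<Phi>)
      have "ball 0 r \<subseteq> (cball 0 (5 * r) :: 'a set)" using r by auto
      then have CB: "C \<inter> B \<in> sets borel" "C \<inter> B \<subseteq> ball 0 r" "C \<inter> B \<subseteq> cball 0 (5 * r)" using B C by auto
      have "emeasure (meas_restr \<Phi> B) C = emeasure \<Phi> (C \<inter> B)" by (rule emeasure_meas_restr[OF sets\<Phi> B(1) C])
      also have "\<dots> = (\<Sum>E\<in>\<F>. c E * hausdorff_measure k (C \<inter> B \<inter> E))" by (rule \<Phi>[OF CB(1,3)])
      also have "\<dots> = flat_recon r \<mu> (C \<inter> B)" by (rule flat_recon_eq[OF CB(1,2), symmetric])
      also have "\<dots> = emeasure (recon_measure r B \<mu>) C"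
        using emeasure_recon_measure[OF B(1) \<mu>sp C, of r] by (simp add: tr)
      finally show "emeasure (meas_restr \<Phi> B) C = emeasure (recon_measure r B \<mu>) C" .
    qed
    then show ?case by (simp add: \<mu>_def \<Phi>_def X_def)
  qed
qed

end

section \<open>Determination of vertices\<close>

locale generic_planes =
  fixes X :: "'a::euclidean_space set set"
  assumes hyp: "X \<subseteq> hyperplanes" and gen: "generic X"
    and fin_hit: "\<And>K. compact K \<Longrightarrow> finite (X \<inter> hitting K)"
begin

definition thru :: "'a \<Rightarrow> 'a set set" where
  "thru p = {H \<in> X. p \<in> H}"

definition verts :: "'a set" where
  "verts = {p. DIM('a) \<le> card (thru p)}"

lemma thru_subset: "thru p \<subseteq> X"
  by (auto simp: thru_def)

lemma finite_thru: "finite (thru p)"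
proof (rule finite_subset)
  show "thru p \<subseteq> X \<inter> hitting {p}" using hyp by (auto simp: thru_def hitting_def)
qed (simp add: fin_hit)

lemma card_thru_le: "card (thru p) \<le> DIM('a)"
  by (rule generic_card_le[OF hyp gen finite_thru thru_subset]) (auto simp: thru_def)

lemma card_thru: "p \<in> verts \<Longrightarrow> card (thru p) = DIM('a)"
  using card_thru_le[of p] by (simp add: verts_def)

lemma Inter_thru: "p \<in> verts \<Longrightarrow> \<Inter>(thru p) = {p}"
  by (rule generic_singleton[OF hyp gen finite_thru thru_subset _ card_thru]) (auto simp: thru_def)

lemma vertsI:
  assumes "S \<subseteq> X" "finite S" "DIM('a) \<le> card S" "p \<in> \<Inter>S"
  shows "p \<in> verts"
proof -
  have "S \<subseteq> thru p" using assms by (auto simp: thru_def)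
  then have "card S \<le> card (thru p)" by (rule card_mono[OF finite_thru])
  then show ?thesis using assms by (simp add: verts_def)
qed

text \<open>A vertex is recovered from the set of hyperplanes through it, all of which hit
  \<open>K\<close>.\<close>

lemma finite_verts:
  assumes "compact K"
  shows "finite (verts \<inter> K)"
proof -
  have "verts \<inter> K \<subseteq> (\<lambda>S. THE p. \<Inter>S = {p}) ` Pow (X \<inter> hitting K)"
  proof
    fix p assume p: "p \<in> verts \<inter> K"
    have "thru p \<in> Pow (X \<inter> hitting K)" using p hyp by (auto simp: thru_def hitting_def)
    moreover have "(THE q. \<Inter>(thru p) = {q}) = p" using Inter_thru p by (intro the_equality) auto
    ultimately show "p \<in> (\<lambda>S. THE p. \<Inter>S = {p}) ` Pow (X \<inter> hitting K)" by (intro image_eqI[of _ _ "thru p"]) auto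
  qed
  then show ?thesis by (rule finite_subset) (simp only: finite_imageI finite_Pow_iff fin_hit[OF assms])
qed

text \<open>Each vertex comes from the \<open>d!\<close> orderings of the exactly \<open>d\<close>
  hyperplanes through it, which the factor \<open>1 / d!\<close> cancels.\<close>

lemma emeasure_vertices:
  assumes C: "C \<in> sets borel" "C \<subseteq> K" and K: "compact K"
  shows "emeasure (intersection_measure (DIM('a)) X) C = of_nat (card (C \<inter> verts))"
proof -
  let ?d = "DIM('a)"
  let ?T = "tuples ?d (X \<inter> hitting K)"
  define L where "L p = {Hs. length Hs = ?d \<and> distinct Hs \<and> set Hs \<subseteq> thru p}" for p
  have finT: "finite ?T" using fin_hit[OF K] by (rule finite_tuples)
  have finV: "finite (C \<inter> verts)" using finite_verts[OF K] C(2) by (auto intro: finite_subset[rotated])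
  have cardL: "card (L p) = fact ?d" if "p \<in> verts" for p
  proof -
    have "card (L p) = \<Prod>{card (thru p) - ?d + 1..card (thru p)}"
      unfolding L_def using card_thru[OF that] by (intro card_lists_distinct_length_eq finite_thru) simp
    then show ?thesis using card_thru[OF that] by (simp add: fact_prod)
  qed
  have finL: "finite (L p)" for p
    unfolding L_def by (rule finite_subset[OF _ finite_lists_length_eq[OF finite_thru[of p], of ?d]]) auto
  have eq: "{Hs \<in> ?T. C \<inter> \<Inter>(set Hs) \<noteq> {}} = (\<Union>p\<in>C \<inter> verts. L p)"
  proof (intro equalityI subsetI)
    fix Hs assume "Hs \<in> {Hs \<in> ?T. C \<inter> \<Inter>(set Hs) \<noteq> {}}"
    then obtain p where Hs: "length Hs = ?d" "distinct Hs" "set Hs \<subseteq> X" and p: "p \<in> C" "p \<in> \<Inter>(set Hs)"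
      by (auto simp: tuples_def)
    have "p \<in> verts" using vertsI[of "set Hs" p] Hs p by (simp add: distinct_card)
    moreover have "Hs \<in> L p" using Hs p by (auto simp: L_def thru_def)
    ultimately show "Hs \<in> (\<Union>p\<in>C \<inter> verts. L p)" using p by auto
  next
    fix Hs assume "Hs \<in> (\<Union>p\<in>C \<inter> verts. L p)"
    then obtain p where p: "p \<in> C" and Hs: "length Hs = ?d" "distinct Hs" "set Hs \<subseteq> thru p"
      by (auto simp: L_def)
    have "set Hs \<subseteq> X \<inter> hitting K" using Hs(3) hyp p C(2) by (auto simp: thru_def hitting_def)
    moreover have "p \<in> C \<inter> \<Inter>(set Hs)" using Hs(3) p by (auto simp: thru_def)
    ultimately show "Hs \<in> {Hs \<in> ?T. C \<inter> \<Inter>(set Hs) \<noteq> {}}" using Hs by (auto simp: tuples_def)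
  qed
  have disj: "L p \<inter> L q = {}" if "p \<in> verts" "q \<in> verts" "p \<noteq> q" for p q
  proof (rule ccontr)
    assume "L p \<inter> L q \<noteq> {}"
    then obtain Hs where Hs: "length Hs = ?d" "distinct Hs" "set Hs \<subseteq> thru p" "set Hs \<subseteq> thru q" by (auto simp: L_def)
    then have "set Hs = thru p" "set Hs = thru q"
      using card_subset_eq[OF finite_thru Hs(3)] card_subset_eq[OF finite_thru Hs(4)] card_thru that
      by (auto simp: distinct_card)
    then show False using Inter_thru that by (metis singleton_inject)
  qed
  have H0: "hausdorff_measure (?d - ?d) (C \<inter> \<Inter>(set Hs)) = (if C \<inter> \<Inter>(set Hs) \<noteq> {} then 1 else 0)"
    if "Hs \<in> ?T" for Hs
  proof (cases "C \<inter> \<Inter>(set Hs) = {}")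
    case False
    then obtain p where p: "p \<in> C" "p \<in> \<Inter>(set Hs)" by auto
    have "\<Inter>(set Hs) = {p}"
      using that p by (intro generic_singleton[OF hyp gen]) (auto simp: tuples_def distinct_card)
    then have "C \<inter> \<Inter>(set Hs) = {p}" using p by auto
    then show ?thesis by simp
  qed simp
  have "(\<Sum>Hs\<in>?T. hausdorff_measure (?d - ?d) (C \<inter> \<Inter>(set Hs))) = (\<Sum>Hs\<in>?T. if C \<inter> \<Inter>(set Hs) \<noteq> {} then 1 else 0)"
    by (rule sum.cong[OF refl H0])
  also have "\<dots> = of_nat (card {Hs \<in> ?T. C \<inter> \<Inter>(set Hs) \<noteq> {}})"
    using finT by (simp add: sum.If_cases Int_def)
  also have "card {Hs \<in> ?T. C \<inter> \<Inter>(set Hs) \<noteq> {}} = (\<Sum>p\<in>C \<inter> verts. card (L p))"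
    unfolding eq using finV finL disj by (intro card_UN_disjoint) auto
  also have "\<dots> = card (C \<inter> verts) * fact ?d" using cardL by simp
  finally have "emeasure (intersection_measure ?d X) C
      = ennreal (1 / fact ?d) * of_nat (card (C \<inter> verts) * fact ?d)"
    using emeasure_intersection_measure_bounded[OF hyp C fin_hit[OF K], of ?d] by simp
  also have "\<dots> = ennreal (1 / fact ?d * real (card (C \<inter> verts) * fact ?d))"
    by (simp only: ennreal_of_nat_eq_real_of_nat) (rule ennreal_mult[symmetric], auto)
  also have "1 / fact ?d * real (card (C \<inter> verts) * fact ?d) = real (card (C \<inter> verts))" by simp
  finally show ?thesis by (simp add: ennreal_of_nat_eq_real_of_nat)
qed

text \<open>A hyperplane through \<open>z\<close> missing \<open>x\<close> also misses
  \<open>y\<close>, since otherwise it would contain the line. Two such hyperplanes would contradict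
  the second clause of \<open>generic\<close>, applied with the vertices \<open>x\<close> and
  \<open>y\<close> as feet.\<close>

lemma collinear_thru:
  assumes v: "x \<in> verts" "y \<in> verts" "z \<in> verts" and z: "z = x + t *\<^sub>R (y - x)" "z \<noteq> y"
  shows "card {H \<in> thru z. x \<notin> H} \<le> 1"
proof (rule ccontr)
  have fin: "finite {H \<in> thru z. x \<notin> H}" using finite_thru by simp
  assume "\<not> card {H \<in> thru z. x \<notin> H} \<le> 1"
  then have "\<exists>G\<in>{H \<in> thru z. x \<notin> H}. \<exists>H\<in>{H \<in> thru z. x \<notin> H}. G \<noteq> H"
    unfolding One_nat_def card_le_Suc0_iff_eq[OF fin] by simp
  then obtain G H where GH: "G \<in> thru z" "x \<notin> G" "H \<in> thru z" "x \<notin> H" "G \<noteq> H"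
    by blast
  have t: "t \<noteq> 1" using z by auto
  have notin: "y \<notin> I" if "I \<in> thru z" "x \<notin> I" for I
  proof
    assume "y \<in> I"
    have I: "affine I" "z \<in> I" using that(1) hyp hyperplanes_affine by (auto simp: thru_def)
    have "x + 0 *\<^sub>R (y - x) \<in> I"
    proof (rule affine_line_subset[OF I(1)])
      show "x + 1 *\<^sub>R (y - x) \<in> I" using \<open>y \<in> I\<close> by simp
      show "x + t *\<^sub>R (y - x) \<in> I" using I(2) by (simp only: z(1))
    qed (use t in simp)
    then show False using that(2) by simp
  qed
  have "x + t *\<^sub>R (y - x) \<notin> H"
  proof (rule gen[unfolded generic_def, THEN conjunct2, rule_format])
    show "finite (thru x)" "finite (thru y)" "thru x \<union> thru y \<subseteq> X" using finite_thru thru_subset by auto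
    show "G \<in> X - (thru x \<union> thru y)" "H \<in> X - (thru x \<union> thru y)"
      using GH(1-4) notin[of G] notin[of H] by (auto simp: thru_def)
    show "foot_of (thru x) x" "foot_of (thru y) y" using v by (simp_all add: foot_of_singleton Inter_thru)
    show "x + t *\<^sub>R (y - x) \<in> G" using GH(1) by (simp add: thru_def z(1)[symmetric])
    show "G \<noteq> H" "x \<notin> G" using GH by blast+
  qed
  then show False using GH(3) by (simp add: thru_def z(1)[symmetric])
qed

lemma line_eq:
  assumes S: "S \<subseteq> X" "finite S" "Suc (card S) = DIM('a)" and xy: "x \<in> \<Inter>S" "y \<in> \<Inter>S" "x \<noteq> y"
  shows "\<Inter>S = range (\<lambda>t. x + t *\<^sub>R (y - x))"
proof -
  have aff: "affine (\<Inter>S)" using S(1) hyp hyperplanes_affine by (intro affine_Inter) auto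
  have "int DIM('a) = int (Suc (card S))" using S(3) by simp
  then have "aff_dim (\<Inter>S) = 1" using generic_aff_dim[OF hyp gen S(2,1)] xy by auto
  moreover have "aff_dim {x, y} = 1" using xy(3) by (simp add: aff_dim_2)
  ultimately have "affine hull {x, y} = affine hull (\<Inter>S)"
    using xy by (intro aff_dim_eq_full_gen[THEN iffD1]) auto
  then show ?thesis using aff by (simp add: hull_same affine_hull_2_alt)
qed

text \<open>All but at most one of the \<open>d\<close> hyperplanes through \<open>z\<close> contain
  \<open>x\<close>, hence the whole line, and \<open>d - 1\<close> of them cut it out.\<close>

lemma collinear_line:
  assumes v: "x \<in> verts" "y \<in> verts" "z \<in> verts" and z: "z = x + t *\<^sub>R (y - x)" "z \<noteq> y" "z \<noteq> x"
  obtains S where "S \<subseteq> X" "finite S" "Suc (card S) = DIM('a)" "\<Inter>S = range (\<lambda>t. x + t *\<^sub>R (y - x))"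
proof -
  define S0 where "S0 = {H \<in> thru z. x \<in> H}"
  have S0: "S0 \<subseteq> X" "finite S0"
    using thru_subset[of z] finite_subset[OF _ finite_thru[of z]] by (auto simp: S0_def)
  have "thru z = S0 \<union> {H \<in> thru z. x \<notin> H}" by (auto simp: S0_def)
  then have "card (thru z) \<le> card S0 + card {H \<in> thru z. x \<notin> H}" by (metis card_Un_le)
  then have "DIM('a) \<le> Suc (card S0)" using card_thru[OF v(3)] collinear_thru[OF v z(1,2)] by linarith
  then have "DIM('a) - 1 \<le> card S0" by simp
  then obtain S where S: "S \<subseteq> S0" "card S = DIM('a) - 1" by (meson obtain_subset_with_card_n)
  have S': "S \<subseteq> X" "finite S" "Suc (card S) = DIM('a)" using S S0 finite_subset DIM_positive[where 'a='a] by auto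
  have xz: "x \<in> \<Inter>S" "z \<in> \<Inter>S" using S(1) by (auto simp: S0_def thru_def)
  have t: "t \<noteq> 0" using z by auto
  have "x + 1 *\<^sub>R (y - x) \<in> \<Inter>S"
  proof (rule affine_line_subset[of "\<Inter>S" x 0 "y - x" t])
    show "affine (\<Inter>S)" using S'(1) hyp hyperplanes_affine by (intro affine_Inter) auto
    show "x + 0 *\<^sub>R (y - x) \<in> \<Inter>S" using xz(1) by (simp only: scaleR_zero_left add_0_right)
    show "x + t *\<^sub>R (y - x) \<in> \<Inter>S" using xz(2) by (simp only: z(1))
  qed (use t in simp)
  then have y: "y \<in> \<Inter>S" by simp
  have "x \<noteq> y" using z by auto
  then show ?thesis using that[OF S'] line_eq[OF S' xz(1) y] by blast
qed

end

text \<open>A polynomial form without division; for \<open>x = y\<close> it holds for all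
  \<open>p\<close>, so triples demand \<open>x \<noteq> y\<close> besides.\<close>

definition on_line :: "'a::real_inner \<Rightarrow> 'a \<Rightarrow> 'a \<Rightarrow> bool" where
  "on_line x y p \<longleftrightarrow> ((y - x) \<bullet> (y - x)) *\<^sub>R (p - x) = ((p - x) \<bullet> (y - x)) *\<^sub>R (y - x)"

lemma on_line_iff:
  assumes "x \<noteq> y"
  shows "on_line x y p \<longleftrightarrow> (\<exists>t. p = x + t *\<^sub>R (y - x))"
proof
  have ne: "(y - x) \<bullet> (y - x) \<noteq> 0" using assms by simp
  assume "on_line x y p"
  then have "p - x = (((p - x) \<bullet> (y - x)) / ((y - x) \<bullet> (y - x))) *\<^sub>R (y - x)"
    unfolding on_line_def using ne by (metis (no_types) divide_inverse_commute inverse_scaleR_times real_vector_eq_affinity scaleR_scaleR vector_fraction_eq_iff)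
  then show "\<exists>t. p = x + t *\<^sub>R (y - x)" by (metis add.commute diff_add_cancel)
next
  assume "\<exists>t. p = x + t *\<^sub>R (y - x)"
  then show "on_line x y p" by (auto simp: on_line_def mult.commute)
qed

definition triple :: "'a::real_inner \<times> 'a \<times> 'a \<Rightarrow> bool" where
  "triple w \<longleftrightarrow> (case w of (x, y, z) \<Rightarrow> x \<noteq> y \<and> z \<noteq> x \<and> z \<noteq> y \<and> on_line x y z)"

text \<open>Gram determinant of the two directions; for non-zero directions it vanishes exactly if
  they are parallel.\<close>

definition gram :: "'a::real_inner \<times> 'a \<times> 'a \<Rightarrow> 'a \<times> 'a \<times> 'a \<Rightarrow> real" where
  "gram w w' = (case (w, w') of ((x, y, _), (x', y', _)) \<Rightarrow>
    ((y - x) \<bullet> (y - x)) * ((y' - x') \<bullet> (y' - x')) - ((y - x) \<bullet> (y' - x'))\<^sup>2)"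

text \<open>The normal equations of \<open>x + t (y - x) = x' + s (y' - x')\<close>, solved for \<open>t\<close>.\<close>

definition meet :: "('a::real_inner \<times> 'a \<times> 'a) \<times> ('a \<times> 'a \<times> 'a) \<Rightarrow> 'a" where
  "meet ww = (case ww of ((x, y, z), (x', y', z')) \<Rightarrow>
    x + ((((x' - x) \<bullet> (y - x)) * ((y' - x') \<bullet> (y' - x')) - ((y - x) \<bullet> (y' - x')) * ((x' - x) \<bullet> (y' - x')))
      / gram (x, y, z) (x', y', z')) *\<^sub>R (y - x))"

text \<open>For skew lines \<open>meet\<close> is the point of the first line nearest to the second,
  so incidence has to be tested separately.\<close>

definition crossing :: "('a::real_inner \<times> 'a \<times> 'a) \<times> ('a \<times> 'a \<times> 'a) \<Rightarrow> bool" where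
  "crossing ww \<longleftrightarrow> (case ww of (w, w') \<Rightarrow> triple w \<and> triple w' \<and> gram w w' \<noteq> 0 \<and>
    on_line (fst w) (fst (snd w)) (meet ww) \<and> on_line (fst w') (fst (snd w')) (meet ww))"

lemma meet_eqI:
  assumes p: "p = x + t *\<^sub>R (y - x)" "p = x' + s *\<^sub>R (y' - x')" and g: "gram (x, y, z) (x', y', z') \<noteq> 0"
  shows "meet ((x, y, z), (x', y', z')) = p"
proof -
  define a b c where "a = y - x" and "b = y' - x'" and "c = x' - x"
  have "c = t *\<^sub>R a - s *\<^sub>R b" using p by (simp add: a_def b_def c_def algebra_simps)
  then have "c \<bullet> a = t * (a \<bullet> a) - s * (a \<bullet> b)" "c \<bullet> b = t * (a \<bullet> b) - s * (b \<bullet> b)"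
    by (simp_all add: inner_diff_left inner_commute[of b a])
  then have "(c \<bullet> a) * (b \<bullet> b) - (a \<bullet> b) * (c \<bullet> b) = t * ((a \<bullet> a) * (b \<bullet> b) - (a \<bullet> b)\<^sup>2)"
    by (simp only:) (simp add: power2_eq_square algebra_simps)
  moreover have "(a \<bullet> a) * (b \<bullet> b) - (a \<bullet> b)\<^sup>2 \<noteq> 0" using g by (simp add: gram_def a_def b_def)
  ultimately have "((c \<bullet> a) * (b \<bullet> b) - (a \<bullet> b) * (c \<bullet> b)) / ((a \<bullet> a) * (b \<bullet> b) - (a \<bullet> b)\<^sup>2) = t"
    by simp
  then show ?thesis using p(1) by (simp add: meet_def gram_def a_def b_def c_def)
qed

lemma gram_zero_parallel:
  assumes "gram (x, y, z) (x', y', z') = 0" "x \<noteq> y" 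
  shows "\<exists>c. y' - x' = c *\<^sub>R (y - x)"
proof -
  define a b where "a = y - x" and "b = y' - x'"
  have a: "a \<bullet> a \<noteq> 0" using assms by (simp add: a_def)
  have g: "(a \<bullet> a) * (b \<bullet> b) = (a \<bullet> b)\<^sup>2" using assms by (simp add: gram_def a_def b_def)
  \<comment> \<open>Up to the factor \<open>a \<bullet> a\<close> this is the component of
    \<open>b\<close> orthogonal to \<open>a\<close>; its squared norm is
    \<open>a \<bullet> a\<close> times the Gram determinant.\<close>
  define e where "e = (a \<bullet> a) *\<^sub>R b - (a \<bullet> b) *\<^sub>R a"
  have "e \<bullet> e = (a \<bullet> a) * ((a \<bullet> a) * (b \<bullet> b) - (a \<bullet> b)\<^sup>2)"
    by (simp add: e_def inner_diff_left inner_diff_right inner_commute[of b a] power2_eq_square algebra_simps)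
  then have "e = 0" using g by simp
  then have "(a \<bullet> a) *\<^sub>R b = (a \<bullet> b) *\<^sub>R a" by (simp add: e_def)
  then have "(inverse (a \<bullet> a) * (a \<bullet> a)) *\<^sub>R b = (inverse (a \<bullet> a) * (a \<bullet> b)) *\<^sub>R a"
    by (simp only: scaleR_scaleR[symmetric])
  then have "b = (inverse (a \<bullet> a) * (a \<bullet> b)) *\<^sub>R a" using a by simp
  then show ?thesis unfolding a_def b_def by blast
qed

context generic_planes
begin

text \<open>The intersections of \<open>d - 1\<close> hyperplanes are the lines of the arrangement.
  Three vertices are asked for because any two vertices span some line, while a collinear triple
  identifies a line of the arrangement.\<close>

definition certified :: "real \<Rightarrow> 'a set \<Rightarrow> bool" where
  "certified r A \<longleftrightarrow> (\<forall>S. S \<subseteq> X \<longrightarrow> finite S \<longrightarrow> Suc (card S) = DIM('a) \<longrightarrow> \<Inter>S \<inter> ball 0 r \<noteq> {} \<longrightarrow>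
    (\<exists>x\<in>\<Inter>S \<inter> verts \<inter> A. \<exists>y\<in>\<Inter>S \<inter> verts \<inter> A. \<exists>z\<in>\<Inter>S \<inter> verts \<inter> A. x \<noteq> y \<and> z \<noteq> x \<and> z \<noteq> y))"

text \<open>Non-zero \<open>gram\<close> makes the two lines, and so the equally large families
  \<open>S\<close> and \<open>S'\<close>, different; hence their union has at least \<open>d\<close>
  members through the common point.\<close>

lemma crossing_verts:
  assumes w: "w \<in> verts \<times> verts \<times> verts" "w' \<in> verts \<times> verts \<times> verts" and c: "crossing (w, w')"
  shows "meet (w, w') \<in> verts"
proof -
  obtain x y z where xyz: "w = (x, y, z)" by (cases w)
  obtain x' y' z' where xyz': "w' = (x', y', z')" by (cases w')
  let ?p = "meet (w, w')"
  have ne: "x \<noteq> y" "z \<noteq> x" "z \<noteq> y" "x' \<noteq> y'" "z' \<noteq> x'" "z' \<noteq> y'"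
    and g: "gram (x, y, z) (x', y', z') \<noteq> 0"
    using c by (auto simp: crossing_def triple_def xyz xyz')
  obtain t t' where t: "z = x + t *\<^sub>R (y - x)" "z' = x' + t' *\<^sub>R (y' - x')"
    using c ne by (auto simp: crossing_def triple_def xyz xyz' on_line_iff)
  obtain S where S: "S \<subseteq> X" "finite S" "Suc (card S) = DIM('a)" "\<Inter>S = range (\<lambda>t. x + t *\<^sub>R (y - x))"
    using collinear_line[OF _ _ _ t(1)] w ne by (auto simp: xyz)
  obtain S' where S': "S' \<subseteq> X" "finite S'" "Suc (card S') = DIM('a)" "\<Inter>S' = range (\<lambda>t. x' + t *\<^sub>R (y' - x'))"
    using collinear_line[OF _ _ _ t(2)] w ne by (auto simp: xyz')
  have p: "?p \<in> \<Inter>S" "?p \<in> \<Inter>S'"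
    using c ne unfolding S(4) S'(4) by (auto simp: crossing_def xyz xyz' on_line_iff)
  have "S \<noteq> S'"
  proof
    assume "S = S'"
    then have "x' \<in> \<Inter>S" "y' \<in> \<Inter>S" using S'(4) by (auto intro: range_eqI[of _ _ 0] range_eqI[of _ _ 1])
    then obtain u v where uv: "x' = x + u *\<^sub>R (y - x)" "y' = x + v *\<^sub>R (y - x)" unfolding S(4) by auto
    then have "y' - x' = (v - u) *\<^sub>R (y - x)" by (simp only: scaleR_diff_left add_diff_cancel_left)
    then have "gram (x, y, z) (x', y', z') = 0" by (simp add: gram_def power2_eq_square)
    then show False using g by simp
  qed
  moreover have "card S = card S'" using S(3) S'(3) by simp
  ultimately have "\<not> S' \<subseteq> S" using card_subset_eq[OF S(2), of S'] by auto
  then have "S \<subset> S \<union> S'" by auto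
  then have "card S < card (S \<union> S')" using S(2) S'(2) by (intro psubset_card_mono) auto
  then show ?thesis using S S' p by (intro vertsI[of "S \<union> S'"]) auto
qed

text \<open>Omitting one or the other of two hyperplanes through \<open>p\<close> leaves two lines
  through \<open>p\<close>, each visible in \<open>A\<close> by a triple; \<open>d \<ge> 2\<close>
  provides the two hyperplanes.\<close>

lemma verts_crossing:
  assumes d: "2 \<le> DIM('a)" and cert: "certified r A" and p: "p \<in> verts" "p \<in> ball 0 r"
  shows "\<exists>w\<in>(verts \<inter> A) \<times> (verts \<inter> A) \<times> (verts \<inter> A). \<exists>w'\<in>(verts \<inter> A) \<times> (verts \<inter> A) \<times> (verts \<inter> A).
    crossing (w, w') \<and> meet (w, w') = p"
proof -
  have c: "card (thru p) = DIM('a)" using card_thru[OF p(1)] .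
  then have "\<not> card (thru p) \<le> Suc 0" using d by simp
  then obtain G H where GH: "G \<in> thru p" "H \<in> thru p" "G \<noteq> H"
    unfolding card_le_Suc0_iff_eq[OF finite_thru[of p]] by blast
  have tri: "\<exists>x y z. x \<in> verts \<inter> A \<and> y \<in> verts \<inter> A \<and> z \<in> verts \<inter> A \<and> triple (x, y, z) \<and> x \<noteq> y \<and>
      \<Inter>(thru p - {I}) = range (\<lambda>t. x + t *\<^sub>R (y - x))" if I: "I \<in> thru p" for I
  proof -
    define S where "S = thru p - {I}"
    have S: "S \<subseteq> X" "finite S" "Suc (card S) = DIM('a)"
      using thru_subset[of p] finite_thru[of p] I c by (auto simp: S_def card_Diff_singleton)
    have "p \<in> \<Inter>S" by (auto simp: S_def thru_def)
    then have "\<Inter>S \<inter> ball 0 r \<noteq> {}" using p(2) by blast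
    from cert[unfolded certified_def, rule_format, OF S this]
    obtain x y z where xyz: "x \<in> \<Inter>S \<inter> verts \<inter> A" "y \<in> \<Inter>S \<inter> verts \<inter> A" "z \<in> \<Inter>S \<inter> verts \<inter> A"
      "x \<noteq> y" "z \<noteq> x" "z \<noteq> y"
      by (elim bexE conjE)
    have line: "\<Inter>S = range (\<lambda>t. x + t *\<^sub>R (y - x))" using line_eq[OF S] xyz by auto
    have "z \<in> \<Inter>S" using xyz by auto
    then have "on_line x y z" unfolding on_line_iff[OF xyz(4)] line by auto
    then have "triple (x, y, z)" using xyz by (simp add: triple_def)
    then show ?thesis using xyz line by (auto simp: S_def)
  qed
  obtain x y z where w: "x \<in> verts \<inter> A" "y \<in> verts \<inter> A" "z \<in> verts \<inter> A" "triple (x, y, z)" "x \<noteq> y"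
    "\<Inter>(thru p - {G}) = range (\<lambda>t. x + t *\<^sub>R (y - x))" using tri[OF GH(1)] by blast
  obtain x' y' z' where w': "x' \<in> verts \<inter> A" "y' \<in> verts \<inter> A" "z' \<in> verts \<inter> A" "triple (x', y', z')" "x' \<noteq> y'"
    "\<Inter>(thru p - {H}) = range (\<lambda>t. x' + t *\<^sub>R (y' - x'))" using tri[OF GH(2)] by blast
  have "p \<in> \<Inter>(thru p - {G})" "p \<in> \<Inter>(thru p - {H})" by (auto simp: thru_def)
  then have "\<exists>t. p = x + t *\<^sub>R (y - x)" "\<exists>s. p = x' + s *\<^sub>R (y' - x')"
    unfolding w(6) w'(6) by (simp_all only: image_iff UNIV_I bex_UNIV)
  then obtain t s where ts: "p = x + t *\<^sub>R (y - x)" "p = x' + s *\<^sub>R (y' - x')" by (elim exE)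
  \<comment> \<open>Parallel lines through \<open>p\<close> would coincide, so their points would
    lie on all hyperplanes through \<open>p\<close>, which have only \<open>p\<close> in
    common.\<close>
  have g: "gram (x, y, z) (x', y', z') \<noteq> 0"
  proof
    assume "gram (x, y, z) (x', y', z') = 0"
    then obtain c where c: "y' - x' = c *\<^sub>R (y - x)" using gram_zero_parallel w(5) by blast
    define a where "a = y - x"
    have "x + t *\<^sub>R a = x' + (s * c) *\<^sub>R a" "y' = x' + c *\<^sub>R a"
      using ts c by (simp_all add: a_def algebra_simps)
    then have "x' = x + (t - s * c) *\<^sub>R a" "y' = x + (t - s * c + c) *\<^sub>R a"
      by (simp_all add: algebra_simps)
    then have "y' \<in> \<Inter>(thru p - {G})" "x' \<in> \<Inter>(thru p - {G})"
      unfolding w(6) a_def[symmetric] by blast+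
    moreover have "y' \<in> \<Inter>(thru p - {H})" "x' \<in> \<Inter>(thru p - {H})"
      unfolding w'(6) by (auto intro: range_eqI[of _ _ 0] range_eqI[of _ _ 1])
    ultimately have "y' \<in> \<Inter>(thru p)" "x' \<in> \<Inter>(thru p)" using GH(3) by blast+
    then show False using Inter_thru[OF p(1)] w'(5) by auto
  qed
  have m: "meet ((x, y, z), (x', y', z')) = p" using meet_eqI[OF ts g] .
  have "crossing ((x, y, z), (x', y', z'))"
  proof -
    have "on_line x y p" "on_line x' y' p" using ts on_line_iff w(5) w'(5) by blast+
    then show ?thesis using w(4) w'(4) g by (simp add: crossing_def m)
  qed
  then show ?thesis using m w(1-3) w'(1-3) by (intro bexI[of _ "(x, y, z)"] bexI[of _ "(x', y', z')"]) auto
qed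

lemma crossing_image:
  assumes d: "2 \<le> DIM('a)" and cert: "certified r A" and B: "B \<subseteq> ball 0 r"
  defines "T \<equiv> (verts \<inter> A) \<times> (verts \<inter> A) \<times> (verts \<inter> A)"
  shows "meet ` {ww \<in> T \<times> T. crossing ww} \<inter> B = verts \<inter> B"
proof (intro equalityI subsetI)
  fix p assume "p \<in> meet ` {ww \<in> T \<times> T. crossing ww} \<inter> B"
  then obtain w w' where "w \<in> T" "w' \<in> T" "crossing (w, w')" "p = meet (w, w')" "p \<in> B" by auto
  then show "p \<in> verts \<inter> B" using crossing_verts[of w w'] by (auto simp: T_def)
next
  fix p assume "p \<in> verts \<inter> B"
  then have "p \<in> verts" "p \<in> ball 0 r" using B by auto
  from verts_crossing[OF d cert this] obtain w w' where "w \<in> T" "w' \<in> T" "crossing (w, w')" "meet (w, w') = p"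
    unfolding T_def by (elim bexE conjE)
  then show "p \<in> meet ` {ww \<in> T \<times> T. crossing ww} \<inter> B" using \<open>p \<in> verts \<inter> B\<close> by (auto intro: rev_image_eqI)
qed

end

section \<open>The vertex reconstruction as a measurable map\<close>

lemma sum_indicator_card:
  assumes "finite A"
  shows "(\<Sum>x\<in>A. indicator B x :: ennreal) = of_nat (card (A \<inter> B))"
proof -
  have "(\<Sum>x\<in>A. indicator B x :: ennreal) = (\<Sum>x\<in>A \<inter> B. 1)"
    using assms by (intro sum.mono_neutral_cong_right) auto
  then show ?thesis by simp
qed

text \<open>The sum of unit masses at the points of \<open>V\<close>, which for finite
  \<open>V\<close> is the form of the observed vertex measure.\<close>

definition points :: "'b::topological_space set \<Rightarrow> 'b measure" where
  "points V = distr (count_space V) borel (\<lambda>x. x)"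

lemma sets_points [simp, measurable_cong]: "sets (points V) = sets borel"
  by (simp add: points_def)

lemma emeasure_points:
  "finite V \<Longrightarrow> C \<in> sets borel \<Longrightarrow> emeasure (points V) C = of_nat (card (C \<inter> V))"
  unfolding points_def by (subst emeasure_distr) auto

lemma nn_integral_points:
  assumes "finite V" "g \<in> borel_measurable borel"
  shows "(\<integral>\<^sup>+x. g x \<partial>points V) = (\<Sum>x\<in>V. g x)"
  unfolding points_def using assms by (subst nn_integral_distr) (auto simp: nn_integral_count_space_finite)

lemma eq_pointsI:
  assumes "finite V" "sets \<mu> = sets borel" "\<And>C. C \<in> sets borel \<Longrightarrow> emeasure \<mu> C = of_nat (card (C \<inter> V))"
  shows "\<mu> = points V"
  using assms by (intro measure_eqI) (auto simp: emeasure_points)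

lemma pair_points:
  fixes V :: "'b::second_countable_topology set" and W :: "'c::second_countable_topology set"
  assumes "finite V" "finite W"
  shows "points V \<Otimes>\<^sub>M points W = points (V \<times> W)"
proof (rule pair_measure_eqI)
  have "finite_measure (points U)" if "finite U" for U :: "'d::topological_space set"
    by (rule finite_measureI) (simp add: points_def emeasure_distr that)
  then show "sigma_finite_measure (points V)" "sigma_finite_measure (points W)"
    using assms by (auto intro: finite_measure.sigma_finite_measure)
  have "sets (points V \<Otimes>\<^sub>M points W) = sets (borel \<Otimes>\<^sub>M borel)" by (rule sets_pair_measure_cong) simp_all
  then show "sets (points V \<Otimes>\<^sub>M points W) = sets (points (V \<times> W))" unfolding borel_prod by simp
  fix A B assume "A \<in> sets (points V)" "B \<in> sets (points W)"
  then have A: "A \<in> sets borel" "B \<in> sets borel" by simp_all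
  then have AB: "A \<times> B \<in> sets borel" unfolding borel_prod[symmetric] by simp
  have "A \<times> B \<inter> V \<times> W = (A \<inter> V) \<times> (B \<inter> W)" by auto
  then show "emeasure (points V) A * emeasure (points W) B = emeasure (points (V \<times> W)) (A \<times> B)"
    using assms A AB by (simp add: emeasure_points card_cartesian_product)
qed

lemma measurable_gram:
  "(\<lambda>ww. gram (fst ww) (snd ww)) \<in> borel_measurable
    (((borel :: 'a::euclidean_space measure) \<Otimes>\<^sub>M (borel \<Otimes>\<^sub>M borel)) \<Otimes>\<^sub>M (borel \<Otimes>\<^sub>M (borel \<Otimes>\<^sub>M borel)))"
  unfolding gram_def split_beta' fst_conv snd_conv by measurable

lemma measurable_meet':
  "meet \<in> borel_measurable
    (((borel :: 'a::euclidean_space measure) \<Otimes>\<^sub>M (borel \<Otimes>\<^sub>M borel)) \<Otimes>\<^sub>M (borel \<Otimes>\<^sub>M (borel \<Otimes>\<^sub>M borel)))"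
proof -
  note measurable_gram[measurable]
  show ?thesis unfolding meet_def[abs_def] split_beta' prod.collapse by measurable
qed

lemma measurable_meet [measurable]: "meet \<in> borel_measurable (borel :: (('a::euclidean_space \<times> 'a \<times> 'a) \<times> ('a \<times> 'a \<times> 'a)) measure)"
  using measurable_meet' by (simp only: borel_prod)

lemma sets_crossing:
  "{ww. crossing ww} \<in> sets (borel :: (('a::euclidean_space \<times> 'a \<times> 'a) \<times> ('a \<times> 'a \<times> 'a)) measure)"
proof -
  let ?N = "((borel :: 'a measure) \<Otimes>\<^sub>M (borel \<Otimes>\<^sub>M borel)) \<Otimes>\<^sub>M (borel \<Otimes>\<^sub>M (borel \<Otimes>\<^sub>M borel))"
  note measurable_gram[measurable] measurable_meet'[measurable]
  have "{ww \<in> space ?N. crossing ww} \<in> sets ?N"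
    unfolding crossing_def triple_def on_line_def split_beta' prod.collapse by measurable
  then show ?thesis unfolding borel_prod by simp
qed

lemma pred_crossing [measurable]: "Measurable.pred borel (crossing :: ('a::euclidean_space \<times> 'a \<times> 'a) \<times> ('a \<times> 'a \<times> 'a) \<Rightarrow> bool)"
  using sets_crossing by (simp add: pred_def)

definition six_fold :: "'a::euclidean_space measure \<Rightarrow> (('a \<times> 'a \<times> 'a) \<times> ('a \<times> 'a \<times> 'a)) measure" where
  "six_fold \<mu> = (\<mu> \<Otimes>\<^sub>M (\<mu> \<Otimes>\<^sub>M \<mu>)) \<Otimes>\<^sub>M (\<mu> \<Otimes>\<^sub>M (\<mu> \<Otimes>\<^sub>M \<mu>))"

text \<open>Each crossing point is produced by several pairs of triples; the inner integral counts them.\<close>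

definition vertex_recon :: "'a::euclidean_space measure \<Rightarrow> 'a set \<Rightarrow> ennreal" where
  "vertex_recon \<mu> C = (\<integral>\<^sup>+ww. indicator {ww. crossing ww} ww * indicator C (meet ww) /
     (\<integral>\<^sup>+vv. indicator {vv. crossing vv \<and> meet vv = meet ww} vv \<partial>six_fold \<mu>) \<partial>six_fold \<mu>)"

text \<open>Crossing pairs of triples are grouped by their meeting point; a group of
  \<open>n p\<close> pairs contributes \<open>n p\<close> times \<open>1 / n p\<close>.\<close>

lemma vertex_recon_points:
  fixes V :: "'a::euclidean_space set"
  assumes V: "finite V" and C: "C \<in> sets borel"
  defines "T \<equiv> V \<times> V \<times> V"
  shows "vertex_recon (points V) C = of_nat (card (meet ` {ww \<in> T \<times> T. crossing ww} \<inter> C))"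
proof -
  define W where "W = {ww \<in> T \<times> T. crossing ww}"
  have finT: "finite (T \<times> T)" using V by (simp add: T_def)
  then have finW: "finite W" by (simp add: W_def)
  have six: "six_fold (points V) = points (T \<times> T)"
    using V by (simp add: six_fold_def pair_points T_def)
  define n where "n p = card {vv \<in> W. meet vv = p}" for p
  have inner: "(\<integral>\<^sup>+vv. indicator {vv. crossing vv \<and> meet vv = p} vv \<partial>points (T \<times> T)) = (of_nat (n p) :: ennreal)" for p
  proof -
    have [measurable]: "{vv. crossing vv \<and> meet vv = p} \<in> sets (borel :: (('a \<times> 'a \<times> 'a) \<times> ('a \<times> 'a \<times> 'a)) measure)"
    proof -
      have "{vv. crossing vv} \<inter> meet -` {p} \<in> sets (borel :: (('a \<times> 'a \<times> 'a) \<times> ('a \<times> 'a \<times> 'a)) measure)"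
        by (intro sets.Int sets_crossing measurable_sets_borel[OF measurable_meet]) simp
      then show ?thesis by (simp add: Int_def)
    qed
    have "(\<integral>\<^sup>+vv. indicator {vv. crossing vv \<and> meet vv = p} vv \<partial>points (T \<times> T))
        = (\<Sum>vv\<in>T \<times> T. indicator {vv. crossing vv \<and> meet vv = p} vv :: ennreal)"
      by (rule nn_integral_points[OF finT]) measurable
    also have "\<dots> = of_nat (card ((T \<times> T) \<inter> {vv. crossing vv \<and> meet vv = p}))"
      using finT by (simp add: sum_indicator_card)
    also have "(T \<times> T) \<inter> {vv. crossing vv \<and> meet vv = p} = {vv \<in> W. meet vv = p}" by (auto simp: W_def)
    finally show ?thesis by (simp add: n_def)
  qed
  have npos: "0 < n (meet ww)" if "ww \<in> W" for ww
  proof -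
    have "ww \<in> {vv \<in> W. meet vv = meet ww}" using that by simp
    moreover have "finite {vv \<in> W. meet vv = meet ww}" using finW by simp
    ultimately show ?thesis unfolding n_def card_gt_0_iff by blast
  qed
  have meas: "(\<lambda>ww. indicator {ww. crossing ww} ww * indicator C (meet ww) / of_nat (n (meet ww)) :: ennreal)
      \<in> borel_measurable (borel :: (('a \<times> 'a \<times> 'a) \<times> ('a \<times> 'a \<times> 'a)) measure)"
  proof -
    have [measurable]: "(\<lambda>p. of_nat (n p) :: ennreal) \<in> borel_measurable borel"
    proof -
      have "(\<lambda>p. of_nat (n p) :: ennreal) = (\<lambda>p. \<Sum>vv\<in>W. indicator {meet vv} p)"
      proof
        fix p
        have "(\<Sum>vv\<in>W. indicator {meet vv} p :: ennreal) = (\<Sum>vv\<in>W. indicator {vv. meet vv = p} vv)"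
          by (intro sum.cong) (auto split: split_indicator)
        also have "\<dots> = of_nat (card (W \<inter> {vv. meet vv = p}))" using finW by (simp add: sum_indicator_card)
        also have "W \<inter> {vv. meet vv = p} = {vv \<in> W. meet vv = p}" by auto
        finally show "of_nat (n p) = (\<Sum>vv\<in>W. indicator {meet vv} p :: ennreal)" by (simp add: n_def)
      qed
      then show ?thesis by simp
    qed
    note C[measurable]
    show ?thesis by measurable
  qed
  have "vertex_recon (points V) C
     = (\<Sum>ww\<in>T \<times> T. indicator {ww. crossing ww} ww * indicator C (meet ww) / of_nat (n (meet ww)))"
    unfolding vertex_recon_def six inner by (rule nn_integral_points[OF finT meas])
  \<comment> \<open>Outside \<open>W\<close> the numerator is 0, and \<open>0 / 0 = 0\<close> in
    \<open>ennreal\<close>.\<close>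
  also have "\<dots> = (\<Sum>ww\<in>W. indicator C (meet ww) / of_nat (n (meet ww)))"
    unfolding W_def using finT by (intro sum.mono_neutral_cong_right) auto
  also have "\<dots> = (\<Sum>p\<in>meet ` W. \<Sum>ww\<in>{ww\<in>W. meet ww = p}. indicator C (meet ww) / of_nat (n (meet ww)))"
    using finW by (rule sum.image_gen)
  also have "\<dots> = (\<Sum>p\<in>meet ` W. indicator C p)"
  proof (rule sum.cong[OF refl])
    fix p assume "p \<in> meet ` W"
    then have n: "0 < n p" using npos by auto
    have "(\<Sum>ww\<in>{ww\<in>W. meet ww = p}. indicator C (meet ww) / of_nat (n (meet ww)))
       = of_nat (n p) * (indicator C p / of_nat (n p) :: ennreal)" by (simp add: n_def)
    also have "\<dots> = (indicator C p * of_nat (n p)) / of_nat (n p)" by (simp add: ennreal_times_divide mult.commute)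
    also have "\<dots> = indicator C p" using n by (intro ennreal_mult_divide_eq) (auto simp: of_nat_eq_0_iff)
    finally show "(\<Sum>ww\<in>{ww\<in>W. meet ww = p}. indicator C (meet ww) / of_nat (n (meet ww))) = (indicator C p :: ennreal)" .
  qed
  also have "\<dots> = of_nat (card (meet ` W \<inter> C))" using finW by (simp add: sum_indicator_card)
  finally show ?thesis by (simp add: W_def)
qed

lemma
  shows six_fold_measurable: "(\<lambda>\<mu> :: 'a::euclidean_space measure. six_fold (truncate_measure \<mu>)) \<in> measurable borel_measures borel_measures"
    and six_fold_finite: "\<mu> \<in> space (borel_measures :: 'a::euclidean_space measure measure) \<Longrightarrow>
      emeasure (six_fold (truncate_measure \<mu>)) UNIV < \<infinity>"
proof -
  let ?T = "truncate_measure :: 'a measure \<Rightarrow> 'a measure"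
  have K: "?T \<in> measurable borel_measures borel_measures" "\<And>\<mu>. \<mu> \<in> space borel_measures \<Longrightarrow> emeasure (?T \<mu>) UNIV < \<infinity>"
    by (rule measurable_truncate_measure truncate_measure_finite)+
  have K2: "(\<lambda>\<mu>. ?T \<mu> \<Otimes>\<^sub>M ?T \<mu>) \<in> measurable borel_measures borel_measures"
    "\<And>\<mu>. \<mu> \<in> space borel_measures \<Longrightarrow> emeasure (?T \<mu> \<Otimes>\<^sub>M ?T \<mu>) UNIV < \<infinity>"
    using pair_kernel_measurable[OF K K] by blast+
  have K3: "(\<lambda>\<mu>. ?T \<mu> \<Otimes>\<^sub>M (?T \<mu> \<Otimes>\<^sub>M ?T \<mu>)) \<in> measurable borel_measures borel_measures"
    "\<And>\<mu>. \<mu> \<in> space borel_measures \<Longrightarrow> emeasure (?T \<mu> \<Otimes>\<^sub>M (?T \<mu> \<Otimes>\<^sub>M ?T \<mu>)) UNIV < \<infinity>"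
    using pair_kernel_measurable[OF K K2] by blast+
  show "(\<lambda>\<mu> :: 'a measure. six_fold (truncate_measure \<mu>)) \<in> measurable borel_measures borel_measures"
    "\<mu> \<in> space (borel_measures :: 'a measure measure) \<Longrightarrow> emeasure (six_fold (truncate_measure \<mu>)) UNIV < \<infinity>"
    unfolding six_fold_def using pair_kernel_measurable[OF K3 K3] by blast+
qed

lemma vertex_recon_joint:
  fixes C :: "'a::euclidean_space set"
  assumes C[measurable]: "C \<in> sets borel"
  shows "(\<lambda>(\<mu>, ww). indicator {ww. crossing ww} ww * indicator C (meet ww) /
     (\<integral>\<^sup>+vv. indicator {vv. crossing vv \<and> meet vv = meet ww} vv \<partial>six_fold (truncate_measure \<mu>)) :: ennreal)
    \<in> borel_measurable (borel_measures \<Otimes>\<^sub>M borel)"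
proof -
  let ?N = "borel_measures \<Otimes>\<^sub>M (borel :: (('a \<times> 'a \<times> 'a) \<times> ('a \<times> 'a \<times> 'a)) measure)"
  have [measurable]: "(\<lambda>p. \<integral>\<^sup>+vv. indicator {vv. crossing vv \<and> meet vv = meet (snd p)} vv \<partial>six_fold (truncate_measure (fst p)) :: ennreal)
    \<in> borel_measurable ?N"
  proof (rule nn_integral_measurable_kernel)
    show "(\<lambda>p. six_fold (truncate_measure (fst p))) \<in> measurable ?N borel_measures"
      by (rule measurable_compose[OF measurable_fst six_fold_measurable])
    show "emeasure (six_fold (truncate_measure (fst p))) UNIV < \<infinity>" if "p \<in> space ?N" for p
      using that by (intro six_fold_finite) (auto simp: space_pair_measure)
    have "{q \<in> space (?N \<Otimes>\<^sub>M borel). crossing (snd q) \<and> meet (snd q) = meet (snd (fst q))} \<in> sets (?N \<Otimes>\<^sub>M borel)"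
      by measurable
    from borel_measurable_indicator[OF this]
    show "(\<lambda>(p, vv). indicator {vv. crossing vv \<and> meet vv = meet (snd p)} vv :: ennreal) \<in> borel_measurable (?N \<Otimes>\<^sub>M borel)"
      by (rule measurable_cong[THEN iffD1, rotated]) (auto split: split_indicator)
  qed
  show ?thesis unfolding split_beta' by measurable
qed

definition vertex_measure :: "'a::euclidean_space set \<Rightarrow> 'a measure \<Rightarrow> 'a measure" where
  "vertex_measure B \<mu> = measure_of UNIV (sets borel) (\<lambda>C. vertex_recon (truncate_measure \<mu>) (C \<inter> B))"

lemma
  fixes B :: "'a::euclidean_space set"
  assumes B: "B \<in> sets borel"
  shows vertex_measure_measurable: "vertex_measure B \<in> measurable borel_measures borel_measures"
    and emeasure_vertex_measure: "\<mu> \<in> space borel_measures \<Longrightarrow> C \<in> sets borel \<Longrightarrow>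
      emeasure (vertex_measure B \<mu>) C = vertex_recon (truncate_measure \<mu>) (C \<inter> B)"
proof -
  let ?G = "\<lambda>\<mu> C. vertex_recon (truncate_measure \<mu>) (C \<inter> B)"
  have 1: "(\<Sum>i. ?G \<mu> (A i)) = ?G \<mu> (\<Union>i. A i)"
    if \<mu>: "\<mu> \<in> space borel_measures" and A: "\<And>i::nat. A i \<in> sets borel" "disjoint_family A" for \<mu> A
  proof -
    let ?S = "six_fold (truncate_measure \<mu>)"
    let ?n = "\<lambda>ww. \<integral>\<^sup>+vv. indicator {vv. crossing vv \<and> meet vv = meet ww} vv \<partial>?S :: ennreal"
    have sets: "sets ?S = sets borel" using measurable_space[OF six_fold_measurable \<mu>] unfolding space_borel_measures by simp
    have m: "(\<lambda>ww. indicator {ww. crossing ww} ww * indicator (A i \<inter> B) (meet ww) / ?n ww) \<in> borel_measurable ?S" for i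
      using measurable_compose[of "\<lambda>ww. (\<mu>, ww)" borel _ _ borel, OF _ vertex_recon_joint, of "A i \<inter> B"] \<mu> A(1) B
      by (simp add: measurable_cong_sets[OF sets refl])
    have "disjoint_family (\<lambda>i. A i \<inter> B)" using A(2) by (auto simp: disjoint_family_on_def)
    then have ind: "indicator ((\<Union>i. A i) \<inter> B) p = (\<Sum>i. indicator (A i \<inter> B) p :: ennreal)" for p
      using suminf_indicator[of "\<lambda>i. A i \<inter> B" p] by simp
    have "?G \<mu> (\<Union>i. A i) = (\<integral>\<^sup>+ww. (\<Sum>i. indicator {ww. crossing ww} ww * indicator (A i \<inter> B) (meet ww) / ?n ww) \<partial>?S)"
      unfolding vertex_recon_def ind by (simp only: ennreal_suminf_cmult ennreal_suminf_divide)
    also have "\<dots> = (\<Sum>i. ?G \<mu> (A i))"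
      unfolding vertex_recon_def by (rule nn_integral_suminf[OF m])
    finally show ?thesis by simp
  qed
  have 2: "?G \<mu> {} = 0" for \<mu> by (simp add: vertex_recon_def)
  have 3: "(\<lambda>\<mu>. ?G \<mu> C) \<in> borel_measurable borel_measures" if "C \<in> sets borel" for C
    unfolding vertex_recon_def using that B
    by (intro nn_integral_measurable_kernel[OF six_fold_measurable six_fold_finite] vertex_recon_joint) auto
  show "vertex_measure B \<in> measurable borel_measures borel_measures"
    unfolding vertex_measure_def[abs_def]
    using measurable_measure_of_borel_measures(1)[of borel_measures ?G] 1 2 3 by blast
  show "emeasure (vertex_measure B \<mu>) C = ?G \<mu> C" if "\<mu> \<in> space borel_measures" "C \<in> sets borel"
    unfolding vertex_measure_def
    using measurable_measure_of_borel_measures(2)[of borel_measures ?G] 1 2 3 that by blast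
qed

context generic_planes
begin

lemma meas_restr_vertices:
  assumes A: "A \<in> sets borel" "bounded A"
  shows "meas_restr (intersection_measure (DIM('a)) X) A = points (verts \<inter> A)" "finite (verts \<inter> A)"
proof -
  have K: "compact (closure A)" using A(2) by (simp add: compact_closure)
  show fin: "finite (verts \<inter> A)" 
    by (rule finite_subset[OF _ finite_verts[OF K]]) (use closure_subset in auto)
  show "meas_restr (intersection_measure (DIM('a)) X) A = points (verts \<inter> A)"
  proof (rule eq_pointsI[OF fin])
    fix C :: "'a set" assume C: "C \<in> sets borel"
    have "emeasure (meas_restr (intersection_measure (DIM('a)) X) A) C = emeasure (intersection_measure (DIM('a)) X) (C \<inter> A)"
      by (rule emeasure_meas_restr) (use A C in auto)
    also have "\<dots> = of_nat (card (C \<inter> A \<inter> verts))"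
      by (rule emeasure_vertices[OF _ _ K]) (use A C closure_subset in auto)
    finally show "emeasure (meas_restr (intersection_measure (DIM('a)) X) A) C = of_nat (card (C \<inter> (verts \<inter> A)))"
      by (simp add: Int_commute Int_left_commute Int_assoc)
  qed simp
qed

lemma vertex_measure_restr:
  assumes d: "2 \<le> DIM('a)" and cert: "certified r A" and A: "A \<in> sets borel" "bounded A"
    and B: "B \<in> sets borel" "B \<subseteq> ball 0 r"
  shows "vertex_measure B (meas_restr (intersection_measure (DIM('a)) X) A) = meas_restr (intersection_measure (DIM('a)) X) B"
proof -
  have "bounded B" using B(2) bounded_ball bounded_subset by blast
  note \<mu> = meas_restr_vertices[OF A] and \<nu> = meas_restr_vertices[OF B(1) this]
  have tr: "truncate_measure (points (verts \<inter> A)) = points (verts \<inter> A)"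
    using emeasure_points[OF \<mu>(2), of UNIV] by (simp add: truncate_measure_def of_nat_less_top)
  have sp: "points (verts \<inter> A) \<in> space borel_measures" by (simp add: space_borel_measures)
  show ?thesis
    unfolding \<mu>(1) \<nu>(1)
  proof (rule eq_pointsI[OF \<nu>(2)])
    show "sets (vertex_measure B (points (verts \<inter> A))) = sets borel"
      using measurable_space[OF vertex_measure_measurable[OF B(1)] sp] by (simp add: space_borel_measures)
    fix C :: "'a set" assume C: "C \<in> sets borel"
    let ?T = "(verts \<inter> A) \<times> (verts \<inter> A) \<times> (verts \<inter> A)"
    have "meet ` {ww \<in> ?T \<times> ?T. crossing ww} \<inter> (C \<inter> B) = C \<inter> (meet ` {ww \<in> ?T \<times> ?T. crossing ww} \<inter> B)" by auto
    also have "\<dots> = C \<inter> (verts \<inter> B)" by (simp only: crossing_image[OF d cert B(2)])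
    finally show "emeasure (vertex_measure B (points (verts \<inter> A))) C = of_nat (card (C \<inter> (verts \<inter> B)))"
      using emeasure_vertex_measure[OF B(1) sp C] vertex_recon_points[OF \<mu>(2), of "C \<inter> B"] B(1) C by (simp add: tr)
  qed
qed

end

section \<open>Frames of almost orthogonal hyperplanes\<close>

text \<open>\<open>U\<close> is a basis of unit vectors and \<open>e\<close> its dual basis; the two
  expansions are with respect to either of them.\<close>

locale frame =
  fixes U :: "'a::euclidean_space set" and e :: "'a \<Rightarrow> 'a"
  assumes finU: "finite U" and cardU: "card U = DIM('a)" and normU: "\<And>u. u \<in> U \<Longrightarrow> norm u = 1"
    and dual: "\<And>u v. u \<in> U \<Longrightarrow> v \<in> U \<Longrightarrow> e u \<bullet> v = (if u = v then 1 else 0)"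
    and expand: "\<And>x. (\<Sum>u\<in>U. (x \<bullet> u) *\<^sub>R e u) = x"
    and expand': "\<And>x. (\<Sum>u\<in>U. (x \<bullet> e u) *\<^sub>R u) = x"

lemma frame_exists:
  fixes U :: "'a::euclidean_space set"
  assumes U: "independent U" "span U = UNIV" "\<And>u. u \<in> U \<Longrightarrow> norm u = 1"
  shows "\<exists>e. frame U e"
proof -
  have fin: "finite U" using U(1) by (rule independent_imp_finite)
  have card: "card U = DIM('a)" using U(1,2) by (metis dim_UNIV dim_span_eq_card_independent)
  have "\<exists>w. \<forall>v\<in>U. w \<bullet> v = (if u = v then 1 else 0)" for u
  proof -
    obtain f :: "'a \<Rightarrow> real" where f: "linear f" "\<forall>v\<in>U. f v = (if u = v then 1 else 0)"
      using linear_independent_extend[OF U(1), of "\<lambda>v. if u = v then 1 else 0"] by blast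
    have "(\<Sum>b\<in>Basis. f b *\<^sub>R b) \<bullet> v = f v" for v
    proof -
      have "f v = f (\<Sum>b\<in>Basis. (v \<bullet> b) *\<^sub>R b)" by (simp add: euclidean_representation)
      also have "\<dots> = (\<Sum>b\<in>Basis. (v \<bullet> b) * f b)"
        using f(1) by (simp add: linear_sum linear_cmul)
      finally show ?thesis unfolding inner_sum_left inner_scaleR_left by (simp add: inner_commute mult.commute)
    qed
    then show ?thesis using f(2) by (intro exI[of _ "\<Sum>b\<in>Basis. f b *\<^sub>R b"]) simp
  qed
  then obtain e where e: "\<And>u v. v \<in> U \<Longrightarrow> e u \<bullet> v = (if u = v then 1 else 0)" by metis
  have 1: "(\<Sum>u\<in>U. (x \<bullet> u) *\<^sub>R e u) = x" for x
  proof -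
    define y where "y = x - (\<Sum>u\<in>U. (x \<bullet> u) *\<^sub>R e u)"
    have "orthogonal y v" if "v \<in> U" for v
    proof -
      have "(\<Sum>u\<in>U. (x \<bullet> u) * (e u \<bullet> v)) = (\<Sum>u\<in>U. if u = v then x \<bullet> v else 0)"
        using e that by (intro sum.cong) auto
      then show ?thesis using that fin by (simp add: y_def orthogonal_def inner_diff_left inner_sum_left)
    qed
    moreover have "y \<in> span U" using U(2) by simp
    ultimately have "orthogonal y y" using orthogonal_to_span by blast
    then show ?thesis by (simp add: orthogonal_self y_def)
  qed
  have 2: "(\<Sum>u\<in>U. (x \<bullet> e u) *\<^sub>R u) = x" for x
  proof -
    have "x \<in> span U" using U(2) by simp
    then obtain c where c: "x = (\<Sum>u\<in>U. c u *\<^sub>R u)" using span_finite[OF fin] by auto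
    have "x \<bullet> e u = c u" if "u \<in> U" for u
    proof -
      have "x \<bullet> e u = (\<Sum>v\<in>U. c v * (e u \<bullet> v))" unfolding c inner_sum_left inner_scaleR_left
        by (intro sum.cong refl arg_cong2[where f="(*)"] inner_commute)
      also have "\<dots> = (\<Sum>v\<in>U. if v = u then c u else 0)" using e by (intro sum.cong) auto
      finally show ?thesis using fin that by simp
    qed
    then show ?thesis using c by simp
  qed
  show ?thesis using fin card U(3) e 1 2 by (intro exI[of _ e]) (simp add: frame_def)
qed

context frame
begin

definition E where "E = (\<Sum>u\<in>U. norm (e u))"

lemma norm_le_E:
  assumes "\<And>u. u \<in> U \<Longrightarrow> \<bar>x \<bullet> u\<bar> \<le> c"
  shows "norm x \<le> c * E"
proof -
  have "norm x = norm (\<Sum>u\<in>U. (x \<bullet> u) *\<^sub>R e u)" by (simp add: expand)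
  also have "\<dots> \<le> (\<Sum>u\<in>U. \<bar>x \<bullet> u\<bar> * norm (e u))" by (rule order_trans[OF norm_sum]) simp
  also have "\<dots> \<le> (\<Sum>u\<in>U. c * norm (e u))" using assms by (intro sum_mono mult_right_mono) auto
  finally show ?thesis by (simp add: E_def sum_distrib_left)
qed

lemma inner_U_le: "u \<in> U \<Longrightarrow> \<bar>x \<bullet> u\<bar> \<le> norm x"
  using Cauchy_Schwarz_ineq2[of x u] normU by simp

lemma E_ge_1: "1 \<le> E"
proof -
  obtain x :: 'a where x: "norm x = 1" using norm_Basis nonempty_Basis by blast
  have "norm x \<le> 1 * E" using inner_U_le[of _ x] x by (intro norm_le_E) auto
  then show ?thesis using x by simp
qed

text \<open>If all products with \<open>U\<close> were smaller, the expansion in the dual basis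
  would make \<open>x\<close> shorter than 1. For a line direction, the vector found here selects
  the almost orthogonal hyperplanes that the line is going to cross.\<close>

lemma ex_transversal: 
  assumes "norm x = 1"
  shows "\<exists>u\<in>U. 1 / E \<le> \<bar>x \<bullet> u\<bar>"
proof (rule ccontr)
  assume neg: "\<not> ?thesis"
  have "U \<noteq> {}" using cardU DIM_positive[where 'a='a] by auto
  define c where "c = Max ((\<lambda>u. \<bar>x \<bullet> u\<bar>) ` U)"
  have "c \<in> (\<lambda>u. \<bar>x \<bullet> u\<bar>) ` U" unfolding c_def using finU \<open>U \<noteq> {}\<close> by (intro Max_in) auto
  then have "c < 1 / E" using neg by auto
  moreover have "norm x \<le> c * E" using finU by (intro norm_le_E) (auto simp: c_def)
  ultimately show False using assms E_ge_1 by (simp add: field_simps)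
qed

text \<open>The products with \<open>e\<close> are the coefficients of \<open>g\<close> in the basis
  \<open>U\<close>, so smallness of all but one puts \<open>g\<close> near a multiple of
  \<open>i\<close>.\<close>

lemma near_normal:
  fixes \<theta> \<delta> :: real
  assumes i: "i \<in> U" and g: "norm g = 1" and small: "\<And>j. j \<in> U - {i} \<Longrightarrow> \<bar>g \<bullet> e j\<bar> \<le> \<delta>" and \<delta>: "0 \<le> \<delta>"
  defines "\<theta> \<equiv> g \<bullet> e i"
  shows "norm (g - \<theta> *\<^sub>R i) \<le> DIM('a) * \<delta>" "1 - DIM('a) * \<delta> \<le> \<bar>\<theta>\<bar>"
proof -
  have "g - \<theta> *\<^sub>R i = (\<Sum>u\<in>U. (g \<bullet> e u) *\<^sub>R u) - \<theta> *\<^sub>R i" by (simp add: expand')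
  also have "\<dots> = (\<Sum>u\<in>U - {i}. (g \<bullet> e u) *\<^sub>R u)" using sum.remove[OF finU i, of "\<lambda>u. (g \<bullet> e u) *\<^sub>R u"] by (simp add: \<theta>_def)
  finally have "norm (g - \<theta> *\<^sub>R i) \<le> (\<Sum>u\<in>U - {i}. norm ((g \<bullet> e u) *\<^sub>R u))" using norm_sum by metis
  also have "\<dots> \<le> (\<Sum>u\<in>U - {i}. \<delta>)" using small normU by (intro sum_mono) auto
  also have "\<dots> \<le> (\<Sum>u\<in>U. \<delta>)" using finU \<delta> by (intro sum_mono2) auto
  finally show 1: "norm (g - \<theta> *\<^sub>R i) \<le> DIM('a) * \<delta>" by (simp add: cardU)
  have "norm g \<le> norm (g - \<theta> *\<^sub>R i) + norm (\<theta> *\<^sub>R i)" by (metis diff_add_cancel norm_triangle_ineq)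
  then show "1 - DIM('a) * \<delta> \<le> \<bar>\<theta>\<bar>" using 1 g normU[OF i] by simp
qed

text \<open>The point in which the hyperplanes \<open>x \<bullet> u = \<alpha> u\<close>
  meet.\<close>

definition grid :: "('a \<Rightarrow> real) \<Rightarrow> 'a" where
  "grid \<alpha> = (\<Sum>u\<in>U. \<alpha> u *\<^sub>R e u)"

lemma grid_inner: "u \<in> U \<Longrightarrow> grid \<alpha> \<bullet> u = \<alpha> u"
proof -
  assume u: "u \<in> U"
  have "grid \<alpha> \<bullet> u = (\<Sum>v\<in>U. if v = u then \<alpha> u else 0)"
    unfolding grid_def inner_sum_left using u dual by (intro sum.cong) auto
  then show ?thesis using finU u by simp
qed

lemma grid_upd: "u \<in> U \<Longrightarrow> grid (\<alpha>(u := c)) - grid \<alpha> = (c - \<alpha> u) *\<^sub>R e u"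
  unfolding grid_def sum_subtractf[symmetric]
  using finU by (subst sum.remove[of _ u]) (auto simp: scaleR_diff_left intro!: sum.neutral)

lemma norm_grid: "(\<And>u. u \<in> U \<Longrightarrow> \<bar>\<alpha> u\<bar> \<le> 3) \<Longrightarrow> norm (grid \<alpha>) \<le> 3 * E"
  by (rule norm_le_E) (simp add: grid_inner)

text \<open>All lengths scale with \<open>n\<close>. A vertex near a scaled grid point has norm at
  most \<open>n * (3 * E + 1)\<close> and the chosen point \<open>p\<close> of the line at most
  \<open>n\<close>, so their distance is at most \<open>n * A0\<close>. The line direction has
  product at least \<open>1 / (4 * E)\<close> in modulus with the normal of the hyperplane, which
  bounds the way from \<open>p\<close> to the crossing by \<open>n * (4 * A0 * E)\<close>; adding
  the norm of \<open>p\<close> gives \<open>R0\<close>. The value of \<open>eps\<close> keeps the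
  error of the crossing in direction \<open>i\<close> below \<open>5 / 16\<close>, less than half
  the spacing of the grid.\<close>

definition A0 where "A0 = 3 * E + 2"
definition R0 where "R0 = 1 + 4 * A0 * E"
definition eps where "eps = 1 / (16 * DIM('a) * (R0 + A0) * E)"

lemma A0_ge: "5 \<le> A0" using E_ge_1 by (simp add: A0_def)

lemma R0_ge: "A0 \<le> R0" "21 \<le> R0"
proof -
  have "A0 \<le> A0 * E" "5 * 1 \<le> A0 * E" 
    using mult_mono[of 5 A0 1 E] mult_left_mono[of 1 E A0] A0_ge E_ge_1 by auto
  then show "A0 \<le> R0" "21 \<le> R0"
    using A0_ge unfolding R0_def mult.assoc by linarith+
qed

lemma eps_bounds:
  shows "0 < eps" and "eps \<le> 1 / 16" and "2 * DIM('a) * eps \<le> 1 / 2" and "2 * DIM('a) * eps \<le> 1 / (4 * E)"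
    and "4 * DIM('a) * eps * (R0 + A0) + eps \<le> 5 / 16"
proof -
  have D: "1 \<le> real DIM('a)" using DIM_positive[where 'a='a] by (simp add: Suc_leI)
  have RA: "26 \<le> R0 + A0" using A0_ge R0_ge by linarith
  define P where "P = real DIM('a) * (R0 + A0) * E"
  have eps: "eps = 1 / (16 * P)" by (simp add: eps_def P_def mult.assoc)
  have P1: "real DIM('a) * 26 * E \<le> P"
    unfolding P_def using D RA E_ge_1 by (intro mult_right_mono mult_left_mono) auto
  have DE: "real DIM('a) * 1 \<le> real DIM('a) * E" "1 * E \<le> real DIM('a) * E"
    using D E_ge_1 by (auto intro!: mult_left_mono mult_right_mono)
  have P: "26 \<le> P" "26 * real DIM('a) \<le> P" using P1 DE D E_ge_1 by linarith+
  show "0 < eps" "eps \<le> 1 / 16" using P by (auto simp: eps field_simps)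
  show "2 * DIM('a) * eps \<le> 1 / 2" using P by (simp add: eps field_simps)
  show "2 * DIM('a) * eps \<le> 1 / (4 * E)" using P P1 E_ge_1 by (simp add: eps field_simps)
  have "real DIM('a) * (R0 + A0) * 1 \<le> P"
    unfolding P_def using D RA E_ge_1 by (intro mult_left_mono) auto
  then have "4 * DIM('a) * eps * (R0 + A0) \<le> 1 / 4" using P by (simp add: eps field_simps)
  then show "4 * DIM('a) * eps * (R0 + A0) + eps \<le> 5 / 16" using \<open>eps \<le> 1 / 16\<close> by linarith
qed

text \<open>The points \<open>v\<close> and \<open>w j\<close> of the hyperplane differ almost by
  multiples of \<open>e j\<close>, so its normal \<open>g\<close> is almost orthogonal to every
  \<open>e j\<close> with \<open>j \<noteq> i\<close>, hence almost parallel to \<open>i\<close>. A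
  line transversal to \<open>i\<close> then crosses it within a bounded multiple of
  \<open>n\<close>, at an \<open>i\<close>-coordinate close to that of \<open>v\<close>.\<close>

lemma crossing_far_plane:
  assumes n: "1 \<le> n" and i: "i \<in> U" and b: "b \<in> {1, 2, 3}"
    and g: "norm g = 1" and v: "v \<bullet> g = s" "norm (v - n *\<^sub>R grid (\<lambda>_. b)) \<le> n * eps"
    and w: "\<And>j. j \<in> U - {i} \<Longrightarrow> w j \<bullet> g = s \<and> norm (w j - n *\<^sub>R grid ((\<lambda>_. b)(j := c))) \<le> n * eps"
    and c: "1 \<le> \<bar>c - b\<bar>"
    and p: "norm p \<le> n" and f: "norm f = 1" "1 / E \<le> \<bar>f \<bullet> i\<bar>"
  shows "f \<bullet> g \<noteq> 0 \<and> (\<exists>t. (p + t *\<^sub>R f) \<bullet> g = s \<and> norm (p + t *\<^sub>R f) \<le> n * R0 \<and> \<bar>(p + t *\<^sub>R f) \<bullet> i - n * b\<bar> \<le> n * (5 / 16))"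
proof -
  note eps = eps_bounds
  define \<theta> where "\<theta> = g \<bullet> e i"
  define \<rho> where "\<rho> = g - \<theta> *\<^sub>R i"
  define h where "h = 2 * DIM('a) * eps"
  have small: "\<bar>g \<bullet> e j\<bar> \<le> 2 * eps" if j: "j \<in> U - {i}" for j
  proof -
    define q where "q = w j - n *\<^sub>R grid ((\<lambda>_. b)(j := c)) - (v - n *\<^sub>R grid (\<lambda>_. b))"
    have "norm q \<le> norm (w j - n *\<^sub>R grid ((\<lambda>_. b)(j := c))) + norm (v - n *\<^sub>R grid (\<lambda>_. b))"
      unfolding q_def by (rule norm_triangle_ineq4)
    then have "norm q \<le> n * eps + n * eps" using w[OF j] v(2) by linarith
    have "w j - v = n *\<^sub>R (grid ((\<lambda>_. b)(j := c)) - grid (\<lambda>_. b)) + q" by (simp add: q_def algebra_simps)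
    also have "grid ((\<lambda>_. b)(j := c)) - grid (\<lambda>_. b) = (c - b) *\<^sub>R e j" using grid_upd[of j "\<lambda>_. b" c] j by simp
    finally have "(w j - v) \<bullet> g = n * ((c - b) * (e j \<bullet> g)) + q \<bullet> g" by (simp add: inner_add_left)
    then have "n * ((c - b) * (e j \<bullet> g)) = - (q \<bullet> g)" using w[OF j] v(1) by (simp add: inner_diff_left)
    then have "n * (\<bar>c - b\<bar> * \<bar>e j \<bullet> g\<bar>) = \<bar>q \<bullet> g\<bar>" using n by (metis abs_minus_cancel abs_mult abs_of_nonneg order_trans zero_le_one)
    also have "\<dots> \<le> norm q" using Cauchy_Schwarz_ineq2[of q g] g by simp
    finally have 1: "n * (\<bar>c - b\<bar> * \<bar>e j \<bullet> g\<bar>) \<le> n * (2 * eps)" using \<open>norm q \<le> n * eps + n * eps\<close> by simp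
    have "1 * \<bar>e j \<bullet> g\<bar> \<le> \<bar>c - b\<bar> * \<bar>e j \<bullet> g\<bar>" using c by (intro mult_right_mono) auto
    also have "\<dots> \<le> 2 * eps" using 1 n by simp
    finally show ?thesis by (simp add: inner_commute)
  qed
  have rho: "norm \<rho> \<le> h" and theta: "1 / 2 \<le> \<bar>\<theta>\<bar>"
    using near_normal[OF i g small] eps unfolding \<rho>_def \<theta>_def h_def by (auto simp: mult_ac)
  have h: "0 \<le> h" "h \<le> 1 / (4 * E)" using eps by (auto simp: h_def)
  \<comment> \<open>The bound on \<open>\<theta>\<close> and transversality give
    \<open>1 / (2 * E)\<close>, of which the error \<open>h\<close> takes at most half.\<close>
  have fg: "1 / (4 * E) \<le> \<bar>f \<bullet> g\<bar>"
  proof -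
    have "f \<bullet> g = \<theta> * (f \<bullet> i) + f \<bullet> \<rho>" by (simp add: \<rho>_def inner_diff_right)
    moreover have "\<bar>f \<bullet> \<rho>\<bar> \<le> h" using Cauchy_Schwarz_ineq2[of f \<rho>] f rho by simp
    moreover have "1 / 2 * (1 / E) \<le> \<bar>\<theta>\<bar> * \<bar>f \<bullet> i\<bar>" using theta f E_ge_1 by (intro mult_mono) auto
    moreover have "\<bar>\<theta>\<bar> * \<bar>f \<bullet> i\<bar> = \<bar>\<theta> * (f \<bullet> i)\<bar>" by (simp add: abs_mult)
    moreover have "1 / 2 * (1 / E) - 1 / (4 * E) = 1 / (4 * E)" by (simp add: field_simps)
    ultimately show ?thesis using h by linarith
  qed
  have "0 < 1 / (4 * E)" using E_ge_1 by simp
  then have fg0: "0 < \<bar>f \<bullet> g\<bar>" using fg by linarith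
  define t where "t = (v - p) \<bullet> g / (f \<bullet> g)"
  define y where "y = p + t *\<^sub>R f"
  have yg: "y \<bullet> g = s" using fg0 v(1) by (simp add: y_def t_def inner_add_left inner_diff_left)
  have nv: "norm v \<le> n * (A0 - 1)"
  proof -
    have "norm v \<le> norm (v - n *\<^sub>R grid (\<lambda>_. b)) + norm (n *\<^sub>R grid (\<lambda>_. b))" by (metis diff_add_cancel norm_triangle_ineq)
    also have "\<dots> \<le> n * 1 + n * (3 * E)"
    proof (rule add_mono)
      show "norm (v - n *\<^sub>R grid (\<lambda>_. b)) \<le> n * 1" using v(2) eps(2) n by (elim order_trans) (auto intro!: mult_left_mono)
      show "norm (n *\<^sub>R grid (\<lambda>_. b)) \<le> n * (3 * E)" using n b norm_grid[of "\<lambda>_. b"] by (auto intro!: mult_left_mono)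
    qed
    finally show ?thesis by (simp add: A0_def algebra_simps)
  qed
  have "norm (v - p) \<le> n * A0" using norm_triangle_ineq4[of v p] nv p by (simp add: algebra_simps)
  then have vpg: "\<bar>(v - p) \<bullet> g\<bar> \<le> n * A0" using Cauchy_Schwarz_ineq2[of "v - p" g] g by simp
  have "\<bar>t\<bar> \<le> n * A0 / (1 / (4 * E))"
    unfolding t_def abs_divide using vpg fg E_ge_1 n A0_ge by (intro frac_le) auto
  then have "\<bar>t\<bar> \<le> n * (4 * A0 * E)" by (simp add: field_simps)
  then have ny: "norm y \<le> n * R0"
    unfolding y_def R0_def using norm_triangle_ineq[of p "t *\<^sub>R f"] p f by (simp add: algebra_simps)
  \<comment> \<open>The vector from \<open>v\<close> to \<open>y\<close> is orthogonal to
    \<open>g\<close>; as \<open>g\<close> is almost \<open>\<theta>\<close> times \<open>i\<close>,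
    its \<open>i\<close>-component is small.\<close>
  have "(y - v) \<bullet> g = 0" using yg v(1) by (simp add: inner_diff_left)
  then have "\<theta> * ((y - v) \<bullet> i) = - ((y - v) \<bullet> \<rho>)" by (simp add: \<rho>_def inner_diff_right)
  then have "\<bar>\<theta>\<bar> * \<bar>(y - v) \<bullet> i\<bar> = \<bar>(y - v) \<bullet> \<rho>\<bar>" by (metis abs_minus_cancel abs_mult)
  also have "\<dots> \<le> norm (y - v) * h"
    using rho by (intro order_trans[OF Cauchy_Schwarz_ineq2] mult_left_mono) auto
  also have "\<dots> \<le> (n * (R0 + A0)) * h"
    using norm_triangle_ineq4[of y v] ny nv h n by (intro mult_right_mono) (auto simp: algebra_simps)
  finally have "\<bar>\<theta>\<bar> * \<bar>(y - v) \<bullet> i\<bar> \<le> n * (R0 + A0) * h" .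
  moreover have "1 / 2 * \<bar>(y - v) \<bullet> i\<bar> \<le> \<bar>\<theta>\<bar> * \<bar>(y - v) \<bullet> i\<bar>" using theta by (intro mult_right_mono) auto
  ultimately have "\<bar>(y - v) \<bullet> i\<bar> \<le> 2 * (n * (R0 + A0) * h)" by linarith
  also have "\<dots> = n * (4 * DIM('a) * eps * (R0 + A0))" by (simp add: h_def)
  finally have 1: "\<bar>(y - v) \<bullet> i\<bar> \<le> n * (4 * DIM('a) * eps * (R0 + A0))" .
  have "\<bar>(v - n *\<^sub>R grid (\<lambda>_. b)) \<bullet> i\<bar> \<le> n * eps" using inner_U_le[OF i] v(2) order_trans by blast
  then have 2: "\<bar>v \<bullet> i - n * b\<bar> \<le> n * eps" by (simp add: inner_diff_left grid_inner[OF i])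
  have "\<bar>y \<bullet> i - n * b\<bar> \<le> \<bar>(y - v) \<bullet> i\<bar> + \<bar>v \<bullet> i - n * b\<bar>" by (simp add: inner_diff_left)
  also have "\<dots> \<le> n * (4 * DIM('a) * eps * (R0 + A0) + eps)" using 1 2 by (simp add: distrib_left)
  also have "\<dots> \<le> n * (5 / 16)" using eps(5) n by (intro mult_left_mono) auto
  finally show ?thesis using fg0 yg ny by (auto simp: y_def)
qed

end

text \<open>\<open>next1\<close> and \<open>next2\<close> give the two other elements of
  \<open>{1, 2, 3}\<close>, stepping forwards and backwards cyclically.\<close>

definition next1 :: "real \<Rightarrow> real" where "next1 b = (if b = 3 then 1 else b + 1)"
definition next2 :: "real \<Rightarrow> real" where "next2 b = (if b = 1 then 3 else b - 1)"

lemma next_in: "b \<in> {1, 2, 3} \<Longrightarrow> next1 b \<in> {1, 2, 3}" "b \<in> {1, 2, 3} \<Longrightarrow> next2 b \<in> {1, 2, 3}"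
  by (auto simp: next1_def next2_def)

lemma next_far: "b \<in> {1, 2, 3} \<Longrightarrow> 1 \<le> \<bar>next1 b - b\<bar>" "b \<in> {1, 2, 3} \<Longrightarrow> 1 \<le> \<bar>next2 b - b\<bar>"
  "b \<in> {1, 2, 3} \<Longrightarrow> 1 \<le> \<bar>next1 b - next2 b\<bar>"
  by (auto simp: next1_def next2_def)

context frame
begin

definition spot :: "real \<Rightarrow> real \<Rightarrow> 'a \<Rightarrow> real \<Rightarrow> 'a" where
  "spot n b u c = n *\<^sub>R grid ((\<lambda>_. b)(u := c))"

text \<open>Only vertices are visible, not hyperplanes. The collinear triples \<open>v\<close>,
  \<open>w\<close>, \<open>z\<close>, one for each \<open>u\<close>, stand in for the hyperplanes,
  because at most one hyperplane through \<open>v\<close> can then miss \<open>w\<close>.\<close>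

definition frame_at :: "'a set \<Rightarrow> real \<Rightarrow> real \<Rightarrow> real \<Rightarrow> bool" where
  "frame_at V n \<delta> b \<longleftrightarrow> (\<exists>v\<in>V. norm (v - n *\<^sub>R grid (\<lambda>_. b)) \<le> n * \<delta> \<and>
    (\<forall>u\<in>U. \<exists>w\<in>V. \<exists>z\<in>V. norm (w - spot n b u (next1 b)) \<le> n * \<delta> \<and> norm (z - spot n b u (next2 b)) \<le> n * \<delta> \<and>
      (\<exists>t. v = w + t *\<^sub>R (z - w))))"

definition annulus :: "real \<Rightarrow> real \<Rightarrow> 'a set" where
  "annulus r n = {x. r \<le> norm x \<and> norm x \<le> n * R0}"

lemma inner_spot: "u \<in> U \<Longrightarrow> spot n b u c \<bullet> u = n * c"
  by (simp add: spot_def grid_inner)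

lemma near_inner: "u \<in> U \<Longrightarrow> norm (x - y) \<le> \<delta> \<Longrightarrow> \<bar>x \<bullet> u - y \<bullet> u\<bar> \<le> \<delta>"
  using inner_U_le[of u "x - y"] by (simp add: inner_diff_left)

end

locale framed_planes = frame U e + generic_planes X
  for U :: "'a::euclidean_space set" and e and X :: "'a set set"
begin

text \<open>Each \<open>w j\<close> is missed by at most one of the \<open>d\<close> hyperplanes
  through \<open>v\<close>, and there are only \<open>d - 1\<close> indices
  \<open>j \<noteq> i\<close>, so some hyperplane contains all these \<open>w j\<close>.\<close>

lemma frame_plane:
  assumes n: "1 \<le> n" and b: "b \<in> {1, 2, 3}" and fr: "frame_at verts n eps b" and i: "i \<in> U"
  obtains v w G where "G \<in> X" "v \<in> G" "norm (v - n *\<^sub>R grid (\<lambda>_. b)) \<le> n * eps"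
    "\<And>j. j \<in> U - {i} \<Longrightarrow> w j \<in> G \<and> norm (w j - spot n b j (next1 b)) \<le> n * eps"
proof -
  obtain v where v: "v \<in> verts" "norm (v - n *\<^sub>R grid (\<lambda>_. b)) \<le> n * eps"
    and ex: "\<forall>u\<in>U. \<exists>w\<in>verts. \<exists>z\<in>verts. norm (w - spot n b u (next1 b)) \<le> n * eps \<and>
      norm (z - spot n b u (next2 b)) \<le> n * eps \<and> (\<exists>t. v = w + t *\<^sub>R (z - w))"
    using fr unfolding frame_at_def by blast
  have "\<forall>u\<in>U. \<exists>w z t. w \<in> verts \<and> z \<in> verts \<and> norm (w - spot n b u (next1 b)) \<le> n * eps \<and>
      norm (z - spot n b u (next2 b)) \<le> n * eps \<and> v = w + t *\<^sub>R (z - w)"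
    using ex by blast
  then obtain w z t where wz: "\<And>u. u \<in> U \<Longrightarrow> w u \<in> verts" "\<And>u. u \<in> U \<Longrightarrow> z u \<in> verts"
    "\<And>u. u \<in> U \<Longrightarrow> norm (w u - spot n b u (next1 b)) \<le> n * eps"
    "\<And>u. u \<in> U \<Longrightarrow> norm (z u - spot n b u (next2 b)) \<le> n * eps"
    "\<And>u. u \<in> U \<Longrightarrow> v = w u + t u *\<^sub>R (z u - w u)"
    by metis
  have bad: "card {H \<in> thru v. w j \<notin> H} \<le> 1" if j: "j \<in> U" for j
  proof (rule collinear_thru[OF wz(1)[OF j] wz(2)[OF j] v(1) wz(5)[OF j]])
    show "v \<noteq> z j"
    proof
      assume "v = z j"
      then have "\<bar>z j \<bullet> j - n * b\<bar> \<le> n * eps" using near_inner[OF j v(2)] by (simp add: grid_inner j)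
      moreover have "\<bar>z j \<bullet> j - n * next2 b\<bar> \<le> n * eps" using near_inner[OF j wz(4)[OF j]] by (simp add: inner_spot j)
      ultimately have "\<bar>n * next2 b - n * b\<bar> \<le> 2 * (n * eps)" by linarith
      moreover have "\<bar>n * next2 b - n * b\<bar> = n * \<bar>next2 b - b\<bar>" using n by (simp add: right_diff_distrib[symmetric] abs_mult)
      moreover have "n * 1 \<le> n * \<bar>next2 b - b\<bar>" using next_far(2)[OF b] n by (intro mult_left_mono) auto
      moreover have "n * eps \<le> n * (1 / 16)" using eps_bounds(2) n by (intro mult_left_mono) auto
      ultimately show False using n by linarith
    qed
  qed
  have "card (\<Union>j\<in>U - {i}. {H \<in> thru v. w j \<notin> H}) \<le> (\<Sum>j\<in>U - {i}. card {H \<in> thru v. w j \<notin> H})"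
    using finU by (intro card_UN_le) auto
  also have "\<dots> \<le> (\<Sum>j\<in>U - {i}. 1)" using bad by (intro sum_mono) auto
  also have "\<dots> = DIM('a) - 1" using finU i cardU by (simp add: card_Diff_singleton)
  also have "\<dots> < card (thru v)" using card_thru[OF v(1)] by simp
  finally have lt: "card (\<Union>j\<in>U - {i}. {H \<in> thru v. w j \<notin> H}) < card (thru v)" .
  have "\<not> thru v \<subseteq> (\<Union>j\<in>U - {i}. {H \<in> thru v. w j \<notin> H})"
  proof
    assume sub: "thru v \<subseteq> (\<Union>j\<in>U - {i}. {H \<in> thru v. w j \<notin> H})"
    have "finite (\<Union>j\<in>U - {i}. {H \<in> thru v. w j \<notin> H})"
      by (rule finite_subset[OF _ finite_thru[of v]]) auto
    from card_mono[OF this sub] show False using lt by simp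
  qed
  then obtain G where "G \<in> thru v" "\<And>j. j \<in> U - {i} \<Longrightarrow> w j \<in> G" by blast
  then show ?thesis using that[of G v w] v(2) wz(3) by (auto simp: thru_def)
qed

text \<open>For the vector \<open>i\<close> transversal to the line, the hyperplanes for
  \<open>b = 1, 2, 3\<close> cross it at \<open>i\<close>-coordinates within
  \<open>5 / 16 * n\<close> of \<open>n\<close>, \<open>2 * n\<close> and \<open>3 * n\<close>.
  These are three different vertices, all outside \<open>ball 0 r\<close> because
  \<open>2 * r \<le> n\<close>.\<close>

lemma framed_certified:
  assumes n: "1 \<le> n" "2 * r \<le> n" and r: "0 < r" and fr: "\<And>b. b \<in> {1, 2, 3} \<Longrightarrow> frame_at verts n eps b"
  shows "certified r (annulus r n)"
  unfolding certified_def
proof (intro allI impI)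
  fix S assume S: "S \<subseteq> X" "finite S" "Suc (card S) = DIM('a)" and ne: "\<Inter>S \<inter> ball 0 r \<noteq> {}"
  then obtain p where p: "p \<in> \<Inter>S" "norm p < r" by auto
  have "aff_dim (\<Inter>S) = int DIM('a) - int (card S)" using generic_aff_dim[OF hyp gen S(2,1)] p by blast
  then have "aff_dim (\<Inter>S) = 1" using S(3) by linarith
  then have "\<Inter>S \<noteq> {p}" by (metis aff_dim_sing zero_neq_one)
  then obtain q where q: "q \<in> \<Inter>S" "q \<noteq> p" using p by blast
  define f where "f = (1 / norm (q - p)) *\<^sub>R (q - p)"
  have f: "norm f = 1" using q by (simp add: f_def)
  obtain i where i: "i \<in> U" "1 / E \<le> \<bar>f \<bullet> i\<bar>" using ex_transversal[OF f] by blast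
  have aff: "affine (\<Inter>S)" using S(1) hyp hyperplanes_affine by (intro affine_Inter) auto
  have on: "p + t *\<^sub>R f \<in> \<Inter>S" for t
  proof -
    have "p + (t / norm (q - p)) *\<^sub>R (q - p) \<in> \<Inter>S"
      by (rule affine_line_subset[OF aff, of p 0 "q - p" 1]) (use p q in simp_all)
    then show ?thesis by (simp add: f_def)
  qed
  have pt: "\<exists>y\<in>\<Inter>S \<inter> verts \<inter> annulus r n. \<bar>y \<bullet> i - n * b\<bar> \<le> n * (5 / 16)" if b: "b \<in> {1, 2, 3}" for b
  proof -
    obtain v w G where G: "G \<in> X" "v \<in> G" "norm (v - n *\<^sub>R grid (\<lambda>_. b)) \<le> n * eps"
      "\<And>j. j \<in> U - {i} \<Longrightarrow> w j \<in> G \<and> norm (w j - spot n b j (next1 b)) \<le> n * eps"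
      using frame_plane[OF n(1) b fr[OF b] i(1)] by metis
    obtain g s where g: "norm g = 1" "G = {x. g \<bullet> x = s}" using G(1) hyp hyperplanesE by blast
    have vs: "v \<bullet> g = s" using G(2) g(2) by (simp add: inner_commute)
    have ws: "w j \<bullet> g = s \<and> norm (w j - n *\<^sub>R grid ((\<lambda>_. b)(j := next1 b))) \<le> n * eps" if "j \<in> U - {i}" for j
      using G(4)[OF that] g(2) by (simp add: inner_commute spot_def)
    have "norm p \<le> n" using p(2) n r by linarith
    from crossing_far_plane[OF n(1) i(1) b g(1) vs G(3) ws next_far(1)[OF b] this f i(2)]
    obtain t where t: "f \<bullet> g \<noteq> 0" "(p + t *\<^sub>R f) \<bullet> g = s" "norm (p + t *\<^sub>R f) \<le> n * R0"
      "\<bar>(p + t *\<^sub>R f) \<bullet> i - n * b\<bar> \<le> n * (5 / 16)" by blast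
    define y where "y = p + t *\<^sub>R f"
    \<comment> \<open>A member of \<open>S\<close> contains the line, so its normal would be
      orthogonal to \<open>f\<close>. Being new, \<open>G\<close> completes \<open>S\<close> to
      \<open>d\<close> hyperplanes.\<close>
    have "G \<notin> S"
    proof
      assume "G \<in> S"
      then have "p + 0 *\<^sub>R f \<in> G" "p + 1 *\<^sub>R f \<in> G" using on by blast+
      then have "g \<bullet> f = 0" by (simp add: g(2) inner_add_right)
      then show False using t(1) by (simp add: inner_commute)
    qed
    then have "card (insert G S) = DIM('a)" using S by simp
    moreover have "y \<in> \<Inter>(insert G S)" using on[of t] t(2) g(2) by (simp add: y_def inner_commute)
    ultimately have "y \<in> verts" using S G(1) by (intro vertsI[of "insert G S"]) auto
    moreover have "y \<in> annulus r n"
    proof -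
      have "n * 1 \<le> n * b" using b n by (intro mult_left_mono) auto
      then have "r \<le> \<bar>y \<bullet> i\<bar>" using t(4) n unfolding y_def by linarith
      then have "r \<le> norm y" using inner_U_le[OF i(1), of y] by linarith
      then show ?thesis using t(3) by (simp add: annulus_def y_def)
    qed
    ultimately show ?thesis using on[of t] t(4) by (intro bexI[of _ y]) (auto simp: y_def)
  qed
  obtain x where x: "x \<in> \<Inter>S \<inter> verts \<inter> annulus r n" "\<bar>x \<bullet> i - n * 1\<bar> \<le> n * (5 / 16)" using pt[of 1] by auto
  obtain y where y: "y \<in> \<Inter>S \<inter> verts \<inter> annulus r n" "\<bar>y \<bullet> i - n * 2\<bar> \<le> n * (5 / 16)" using pt[of 2] by auto
  obtain z where z: "z \<in> \<Inter>S \<inter> verts \<inter> annulus r n" "\<bar>z \<bullet> i - n * 3\<bar> \<le> n * (5 / 16)" using pt[of 3] by auto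
  have "x \<bullet> i < y \<bullet> i" "y \<bullet> i < z \<bullet> i" using x(2) y(2) z(2) n by linarith+
  then have "x \<noteq> y \<and> z \<noteq> x \<and> z \<noteq> y" by auto
  then show "\<exists>x\<in>\<Inter>S \<inter> verts \<inter> annulus r n. \<exists>y\<in>\<Inter>S \<inter> verts \<inter> annulus r n.
    \<exists>z\<in>\<Inter>S \<inter> verts \<inter> annulus r n. x \<noteq> y \<and> z \<noteq> x \<and> z \<noteq> y" using x(1) y(1) z(1) by blast
qed

end

context frame
begin

text \<open>Solving for the vertex of chosen cell hyperplanes turns their deviation
  \<open>n * eps0\<close> into at most \<open>4 * eps0 * E * n\<close>, which this choice makes
  \<open>n * (eps / 2)\<close>.\<close>

definition eps0 where "eps0 = eps / (8 * E)"

lemma eps0_bounds: "0 < eps0" "2 * DIM('a) * eps0 \<le> 1 / 2" "4 * DIM('a) * eps0 * E \<le> 1 / 2" "4 * eps0 * E = eps / 2"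
proof -
  note b = eps_bounds E_ge_1
  show 0: "0 < eps0" and eq: "4 * eps0 * E = eps / 2" using b by (auto simp: eps0_def field_simps)
  have "4 * DIM('a) * eps0 * E = DIM('a) * (4 * eps0 * E)" by simp
  also have "\<dots> = (2 * DIM('a) * eps) / 4" by (simp only: eq)
  finally show 1: "4 * DIM('a) * eps0 * E \<le> 1 / 2" using b(3) by linarith
  have "2 * DIM('a) * eps0 * 1 \<le> 4 * DIM('a) * eps0 * E" using 0 b(6) by (intro mult_mono) auto
  then show "2 * DIM('a) * eps0 \<le> 1 / 2" using 1 by linarith
qed

definition grids :: "('a \<Rightarrow> real) set" where
  "grids = U \<rightarrow>\<^sub>E {1, 2, 3}"

text \<open>Hyperplanes close to \<open>x \<bullet> u = n * b\<close> at the relevant grid points.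
  Phrasing this through balls that are hit keeps the set in the sigma-field and controls normal and
  offset at once.\<close>

definition cell :: "real \<Rightarrow> 'a \<Rightarrow> real \<Rightarrow> 'a set set" where
  "cell n u b = {H \<in> hyperplanes. \<forall>\<alpha>\<in>grids. \<alpha> u = b \<longrightarrow> H \<in> hitting (cball (n *\<^sub>R grid \<alpha>) (n * eps0))}"

lemma finite_grids: "finite grids"
  unfolding grids_def using finU by (intro finite_PiE) auto

lemma grid_restrict: "grid (restrict \<alpha> U) = grid \<alpha>"
  by (simp add: grid_def)

lemma cell_plane:
  assumes H: "H \<in> cell n u b" "H = {x. g \<bullet> x = s}" "norm g = 1" and \<alpha>: "\<alpha> \<in> grids" "\<alpha> u = b"
  shows "\<bar>(n *\<^sub>R grid \<alpha>) \<bullet> g - s\<bar> \<le> n * eps0"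
proof -
  have "H \<in> hitting (cball (n *\<^sub>R grid \<alpha>) (n * eps0))" using H(1) \<alpha> by (simp add: cell_def)
  then have "\<exists>y. y \<in> H \<and> dist (n *\<^sub>R grid \<alpha>) y \<le> n * eps0" by (auto simp: hitting_def)
  then obtain y where y: "y \<in> H" "dist (n *\<^sub>R grid \<alpha>) y \<le> n * eps0" by blast
  have "y \<bullet> g = s" using y(1) H(2) by (simp add: inner_commute)
  then have "\<bar>(n *\<^sub>R grid \<alpha>) \<bullet> g - s\<bar> = \<bar>(n *\<^sub>R grid \<alpha> - y) \<bullet> g\<bar>"
    by (simp add: inner_diff_left)
  also have "\<dots> \<le> norm (n *\<^sub>R grid \<alpha> - y)" using Cauchy_Schwarz_ineq2[of "n *\<^sub>R grid \<alpha> - y" g] H(3) by simp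
  finally show ?thesis using y(2) by (simp add: dist_norm)
qed

text \<open>Two scaled grid points with the same \<open>u\<close>-coordinate that differ by
  \<open>n\<close> times \<open>e j\<close> are both within \<open>n * eps0\<close> of the
  hyperplane.\<close>

lemma cell_normal:
  assumes n: "0 < n" and H: "H \<in> cell n u b" "H = {x. g \<bullet> x = s}" "norm g = 1"
    and u: "u \<in> U" "b \<in> {1, 2, 3}" and j: "j \<in> U - {u}"
  shows "\<bar>g \<bullet> e j\<bar> \<le> 2 * eps0"
proof -
  define \<alpha> where "\<alpha> = (\<lambda>v\<in>U. if v = u then b else 1)"
  have \<alpha>: "\<alpha> \<in> grids" "\<alpha> u = b" "\<alpha>(j := 2) \<in> grids" "(\<alpha>(j := 2)) u = b"
    using u j by (auto simp: \<alpha>_def grids_def split: if_splits)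
  have "\<alpha> j = 1" using j by (simp add: \<alpha>_def)
  then have "grid (\<alpha>(j := 2)) - grid \<alpha> = e j" using grid_upd[of j \<alpha> 2] j by simp
  then have "n * (e j \<bullet> g) = (n *\<^sub>R grid (\<alpha>(j := 2))) \<bullet> g - (n *\<^sub>R grid \<alpha>) \<bullet> g"
    by (metis inner_diff_left inner_scaleR_left scaleR_right_diff_distrib)
  then have "\<bar>n * (e j \<bullet> g)\<bar> \<le> n * eps0 + n * eps0"
    using cell_plane[OF H \<alpha>(1,2)] cell_plane[OF H \<alpha>(3,4)] by linarith
  then have "n * \<bar>g \<bullet> e j\<bar> \<le> n * (2 * eps0)" using n by (simp add: abs_mult inner_commute)
  then show ?thesis using n by simp
qed

text \<open>The equations of the chosen hyperplanes are a small perturbation of \<open>x \<bullet> u = n \<alpha> u\<close>.\<close>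

lemma perturbed_vertex:
  assumes n: "0 < n" and \<alpha>: "\<alpha> \<in> grids"
    and H: "\<And>u. u \<in> U \<Longrightarrow> H u \<in> cell n u (\<alpha> u)" "\<And>u. u \<in> U \<Longrightarrow> H u = {x. g u \<bullet> x = s u}" "\<And>u. u \<in> U \<Longrightarrow> norm (g u) = 1"
  shows "\<exists>x. (\<forall>u\<in>U. x \<in> H u) \<and> norm (x - n *\<^sub>R grid \<alpha>) \<le> n * (eps / 2)"
proof -
  define \<theta> where "\<theta> u = g u \<bullet> e u" for u
  have \<alpha>u: "\<alpha> u \<in> {1, 2, 3}" if "u \<in> U" for u using \<alpha> that by (auto simp: grids_def)
  have nn: "norm (g u - \<theta> u *\<^sub>R u) \<le> 2 * DIM('a) * eps0" "1 / 2 \<le> \<bar>\<theta> u\<bar>" if u: "u \<in> U" for u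
    using near_normal[OF u H(3)[OF u] cell_normal[OF n H(1)[OF u] H(2)[OF u] H(3)[OF u] u \<alpha>u[OF u]]] eps0_bounds
    unfolding \<theta>_def by (auto simp: mult_ac)
  \<comment> \<open>Rescaled so that the coefficient at \<open>u\<close> in the basis
    \<open>U\<close> becomes 1.\<close>
  define \<gamma> where "\<gamma> u = (1 / \<theta> u) *\<^sub>R g u" for u
  have gam: "norm (\<gamma> u - u) \<le> 4 * DIM('a) * eps0" if u: "u \<in> U" for u
  proof -
    have t: "\<theta> u \<noteq> 0" using nn(2)[OF u] by auto
    have "\<gamma> u - u = (1 / \<theta> u) *\<^sub>R (g u - \<theta> u *\<^sub>R u)" using t by (simp add: \<gamma>_def algebra_simps)
    then have "norm (\<gamma> u - u) = norm (g u - \<theta> u *\<^sub>R u) / \<bar>\<theta> u\<bar>" by simp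
    also have "\<dots> \<le> (2 * DIM('a) * eps0) / (1 / 2)" using nn[OF u] eps0_bounds(1) by (intro frac_le) auto
    finally show ?thesis by simp
  qed
  \<comment> \<open>\<open>T\<close> replaces the products with \<open>u\<close> by those with
    \<open>\<gamma> u\<close>. It differs from the identity by at most half the norm, so it is
    bijective and its inverse at most doubles lengths.\<close>
  define T where "T x = (\<Sum>u\<in>U. (x \<bullet> \<gamma> u) *\<^sub>R e u)" for x
  have lin: "linear T"
    unfolding T_def by (rule linearI) (simp_all add: inner_add_left scaleR_add_left sum.distrib scaleR_sum_right)
  have close: "norm x / 2 \<le> norm (T x)" for x
  proof -
    have "T x - x = (\<Sum>u\<in>U. (x \<bullet> \<gamma> u) *\<^sub>R e u) - (\<Sum>u\<in>U. (x \<bullet> u) *\<^sub>R e u)" by (simp add: T_def expand)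
    also have "\<dots> = (\<Sum>u\<in>U. (x \<bullet> (\<gamma> u - u)) *\<^sub>R e u)"
      by (simp add: sum_subtractf[symmetric] scaleR_diff_left[symmetric] inner_diff_right)
    finally have "norm (T x - x) \<le> (\<Sum>u\<in>U. norm ((x \<bullet> (\<gamma> u - u)) *\<^sub>R e u))" using norm_sum by metis
    also have "\<dots> \<le> (\<Sum>u\<in>U. (norm x * (4 * DIM('a) * eps0)) * norm (e u))"
    proof (rule sum_mono)
      fix u assume u: "u \<in> U"
      have "\<bar>x \<bullet> (\<gamma> u - u)\<bar> \<le> norm x * norm (\<gamma> u - u)" by (rule Cauchy_Schwarz_ineq2)
      also have "\<dots> \<le> norm x * (4 * DIM('a) * eps0)" using gam[OF u] by (intro mult_left_mono) auto
      finally show "norm ((x \<bullet> (\<gamma> u - u)) *\<^sub>R e u) \<le> (norm x * (4 * DIM('a) * eps0)) * norm (e u)"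
        by (simp add: mult_right_mono)
    qed
    also have "\<dots> = norm x * (4 * DIM('a) * eps0 * E)" by (simp add: E_def sum_distrib_left mult_ac)
    also have "\<dots> \<le> norm x * (1 / 2)" using eps0_bounds(3) by (intro mult_left_mono) auto
    finally have "norm (T x - x) \<le> norm x * (1 / 2)" .
    moreover have "norm x \<le> norm (T x) + norm (T x - x)" using norm_triangle_ineq4[of "T x" "T x - x"] by simp
    ultimately show ?thesis by linarith
  qed
  have "inj T"
    unfolding linear_injective_0[OF lin]
  proof (intro allI impI)
    fix x assume "T x = 0"
    then show "x = 0" using close[of x] by simp
  qed
  then have "surj T" using linear_injective_imp_surjective[OF lin] by blast
  then obtain x where x: "T x = (\<Sum>u\<in>U. (s u / \<theta> u) *\<^sub>R e u)" by (metis surjD)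
  have coeff: "x \<bullet> \<gamma> u = s u / \<theta> u" if u: "u \<in> U" for u
  proof -
    have ext: "(\<Sum>v\<in>U. c v *\<^sub>R e v) \<bullet> u = c u" for c
    proof -
      have "(\<Sum>v\<in>U. c v *\<^sub>R e v) \<bullet> u = (\<Sum>v\<in>U. if v = u then c u else 0)"
        unfolding inner_sum_left using u dual by (intro sum.cong) auto
      then show ?thesis using finU u by simp
    qed
    show ?thesis using x ext[of "\<lambda>v. x \<bullet> \<gamma> v"] ext[of "\<lambda>v. s v / \<theta> v"] by (simp add: T_def)
  qed
  have on: "x \<in> H u" if u: "u \<in> U" for u
  proof -
    have t: "\<theta> u \<noteq> 0" using nn(2)[OF u] by auto
    then have "x \<bullet> g u = s u" using coeff[OF u] by (simp add: \<gamma>_def)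
    then show ?thesis using H(2)[OF u] by (simp add: inner_commute)
  qed
  define y where "y = x - n *\<^sub>R grid \<alpha>"
  have "norm (T y) \<le> (\<Sum>u\<in>U. norm ((y \<bullet> \<gamma> u) *\<^sub>R e u))" unfolding T_def by (rule norm_sum)
  also have "\<dots> \<le> (\<Sum>u\<in>U. (2 * n * eps0) * norm (e u))"
  proof (rule sum_mono)
    fix u assume u: "u \<in> U"
    have "x \<bullet> g u = s u" using on[OF u] H(2)[OF u] by (simp add: inner_commute)
    then have "\<bar>y \<bullet> g u\<bar> \<le> n * eps0"
      using cell_plane[OF H(1)[OF u] H(2)[OF u] H(3)[OF u] \<alpha> refl] by (simp add: y_def inner_diff_left abs_minus_commute)
    then have "\<bar>y \<bullet> g u\<bar> / \<bar>\<theta> u\<bar> \<le> (n * eps0) / (1 / 2)" using nn(2)[OF u] n eps0_bounds(1) by (intro frac_le) auto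
    then have "\<bar>y \<bullet> \<gamma> u\<bar> \<le> 2 * n * eps0" by (simp add: \<gamma>_def abs_divide)
    then show "norm ((y \<bullet> \<gamma> u) *\<^sub>R e u) \<le> (2 * n * eps0) * norm (e u)" by (simp add: mult_right_mono)
  qed
  also have "\<dots> = 2 * n * eps0 * E" by (simp add: E_def sum_distrib_left)
  finally have "norm y \<le> 2 * (2 * n * eps0 * E)" using close[of y] by linarith
  also have "\<dots> = n * (4 * eps0 * E)" by simp
  also have "\<dots> = n * (eps / 2)" by (simp only: eps0_bounds(4))
  finally show ?thesis using on by (auto simp: y_def)
qed

end

context framed_planes
begin

text \<open>One hyperplane is chosen from each cell. Choices for different directions differ, since
  a common one would have all its coefficients in \<open>U\<close> small, against its unit normal.
  So each scaled grid point has a vertex nearby, and changing only the \<open>u\<close>-coordinate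
  keeps \<open>d - 1\<close> of its hyperplanes, which yields the collinear triples.\<close>

lemma cells_framed:
  assumes n: "1 \<le> n" and cells: "\<And>u b. u \<in> U \<Longrightarrow> b \<in> {1, 2, 3} \<Longrightarrow> X \<inter> cell n u b \<noteq> {}" and b: "b \<in> {1, 2, 3}"
  shows "frame_at verts n (eps / 2) b"
proof -
  have "\<forall>u\<in>U. \<forall>c\<in>{1, 2, 3}. \<exists>H. H \<in> X \<and> H \<in> cell n u c" using cells by blast
  then obtain H where H: "\<And>u c. u \<in> U \<Longrightarrow> c \<in> {1, 2, 3} \<Longrightarrow> H u c \<in> X" "\<And>u c. u \<in> U \<Longrightarrow> c \<in> {1, 2, 3} \<Longrightarrow> H u c \<in> cell n u c"
    by metis
  have "\<forall>G\<in>X. \<exists>g s. norm g = 1 \<and> G = {x. g \<bullet> x = s}" using hyp hyperplanesE by blast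
  then obtain g s where gs: "\<And>G. G \<in> X \<Longrightarrow> norm (g G) = 1" "\<And>G. G \<in> X \<Longrightarrow> G = {x. g G \<bullet> x = s G}"
    by metis
  have inj: "H u c \<noteq> H u' c'" if u: "u \<in> U" "u' \<in> U" "u \<noteq> u'" "c \<in> {1, 2, 3}" "c' \<in> {1, 2, 3}" for u u' c c'
  proof
    assume eq: "H u c = H u' c'"
    define G where "G = H u c"
    have GX: "G \<in> X" using H(1) u by (simp add: G_def)
    have "\<bar>g G \<bullet> e j\<bar> \<le> 2 * eps0" if j: "j \<in> U" for j
    proof (cases "j = u")
      case True
      then show ?thesis
        using cell_normal[OF _ H(2)[OF u(2,5)] _ _ u(2,5), of "g G" "s G" j] n u gs GX eq j by (auto simp: G_def)
    next
      case False
      then show ?thesis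
        using cell_normal[OF _ H(2)[OF u(1,4)] _ _ u(1,4), of "g G" "s G" j] n gs GX j by (auto simp: G_def)
    qed
    then have "(\<Sum>j\<in>U. norm ((g G \<bullet> e j) *\<^sub>R j)) \<le> (\<Sum>j\<in>U. 2 * eps0)" using normU by (intro sum_mono) auto
    moreover have "norm (g G) \<le> (\<Sum>j\<in>U. norm ((g G \<bullet> e j) *\<^sub>R j))"
      using norm_sum[of "\<lambda>j. (g G \<bullet> e j) *\<^sub>R j" U] by (simp add: expand')
    ultimately show False using gs(1)[OF GX] eps0_bounds(2) by (simp add: cardU mult_ac)
  qed
  define P where "P \<alpha> = (SOME x. (\<forall>u\<in>U. x \<in> H u (\<alpha> u)) \<and> norm (x - n *\<^sub>R grid \<alpha>) \<le> n * (eps / 2))" for \<alpha>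
  have P: "\<And>u. u \<in> U \<Longrightarrow> P \<alpha> \<in> H u (\<alpha> u)" "norm (P \<alpha> - n *\<^sub>R grid \<alpha>) \<le> n * (eps / 2)" "P \<alpha> \<in> verts"
    if \<alpha>: "\<alpha> \<in> grids" for \<alpha>
  proof -
    have \<alpha>u: "\<alpha> u \<in> {1, 2, 3}" if "u \<in> U" for u using \<alpha> that by (auto simp: grids_def)
    have "\<exists>x. (\<forall>u\<in>U. x \<in> H u (\<alpha> u)) \<and> norm (x - n *\<^sub>R grid \<alpha>) \<le> n * (eps / 2)"
    proof (rule perturbed_vertex[OF _ \<alpha>])
      fix u assume u: "u \<in> U"
      show "H u (\<alpha> u) \<in> cell n u (\<alpha> u)" using H(2)[OF u \<alpha>u[OF u]] .
      show "H u (\<alpha> u) = {x. g (H u (\<alpha> u)) \<bullet> x = s (H u (\<alpha> u))}" using gs(2)[OF H(1)[OF u \<alpha>u[OF u]]] .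
      show "norm (g (H u (\<alpha> u))) = 1" using gs(1)[OF H(1)[OF u \<alpha>u[OF u]]] .
    qed (use n in simp)
    from someI_ex[OF this] have *: "(\<forall>u\<in>U. P \<alpha> \<in> H u (\<alpha> u)) \<and> norm (P \<alpha> - n *\<^sub>R grid \<alpha>) \<le> n * (eps / 2)"
      unfolding P_def .
    then show on: "\<And>u. u \<in> U \<Longrightarrow> P \<alpha> \<in> H u (\<alpha> u)" and "norm (P \<alpha> - n *\<^sub>R grid \<alpha>) \<le> n * (eps / 2)" by auto
    have "inj_on (\<lambda>u. H u (\<alpha> u)) U" using inj \<alpha>u unfolding inj_on_def by blast
    then have "card ((\<lambda>u. H u (\<alpha> u)) ` U) = DIM('a)" by (simp add: card_image cardU)
    then show "P \<alpha> \<in> verts" using H(1) \<alpha>u on finU by (intro vertsI[of "(\<lambda>u. H u (\<alpha> u)) ` U"]) auto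
  qed
  define \<alpha> where "\<alpha> = (\<lambda>_\<in>U. b)"
  have \<alpha>: "\<alpha> \<in> grids" "grid \<alpha> = grid (\<lambda>_. b)" using b by (auto simp: \<alpha>_def grids_def grid_restrict)
  have upd: "\<alpha>(u := c) \<in> grids" "n *\<^sub>R grid (\<alpha>(u := c)) = spot n b u c" if "u \<in> U" "c \<in> {1, 2, 3}" for u c
  proof -
    have "\<alpha>(u := c) = restrict ((\<lambda>_. b)(u := c)) U" using that by (auto simp: \<alpha>_def)
    then show "n *\<^sub>R grid (\<alpha>(u := c)) = spot n b u c" by (simp add: grid_restrict spot_def)
    show "\<alpha>(u := c) \<in> grids" using that b by (auto simp: \<alpha>_def grids_def split: if_splits)
  qed
  show ?thesis
    unfolding frame_at_def
  proof (rule bexI[of _ "P \<alpha>"], intro conjI ballI)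
    show "norm (P \<alpha> - n *\<^sub>R grid (\<lambda>_. b)) \<le> n * (eps / 2)" "P \<alpha> \<in> verts" using P(2,3)[OF \<alpha>(1)] \<alpha>(2) by auto
    fix u assume u: "u \<in> U"
    note u1 = upd[OF u next_in(1)[OF b]] and u2 = upd[OF u next_in(2)[OF b]]
    define w z where "w = P (\<alpha>(u := next1 b))" and "z = P (\<alpha>(u := next2 b))"
    have w: "w \<in> verts" "norm (w - spot n b u (next1 b)) \<le> n * (eps / 2)" using P(2,3)[OF u1(1)] u1(2) by (auto simp: w_def)
    have z: "z \<in> verts" "norm (z - spot n b u (next2 b)) \<le> n * (eps / 2)" using P(2,3)[OF u2(1)] u2(2) by (auto simp: z_def)
    define S where "S = (\<lambda>j. H j b) ` (U - {u})"
    have "inj_on (\<lambda>j. H j b) (U - {u})" using inj b unfolding inj_on_def by blast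
    then have S: "S \<subseteq> X" "finite S" "Suc (card S) = DIM('a)"
      using H(1) b finU u cardU DIM_positive[where 'a='a] by (auto simp: S_def card_image card_Diff_singleton)
    have "w \<in> H j b" "z \<in> H j b" if "j \<in> U - {u}" for j
      using P(1)[OF u1(1), of j] P(1)[OF u2(1), of j] that by (simp_all add: w_def z_def \<alpha>_def)
    then have "w \<in> \<Inter>S" "z \<in> \<Inter>S" by (auto simp: S_def)
    moreover have "w \<noteq> z"
    proof
      assume "w = z"
      then have "\<bar>z \<bullet> u - n * next1 b\<bar> \<le> n * (eps / 2)" using near_inner[OF u w(2)] by (simp add: inner_spot u)
      moreover have "\<bar>z \<bullet> u - n * next2 b\<bar> \<le> n * (eps / 2)" using near_inner[OF u z(2)] by (simp add: inner_spot u)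
      ultimately have "\<bar>n * next1 b - n * next2 b\<bar> \<le> n * (eps / 2) + n * (eps / 2)" by linarith
      then have "\<bar>n * next1 b - n * next2 b\<bar> \<le> n * eps" by simp
      moreover have "\<bar>n * next1 b - n * next2 b\<bar> = n * \<bar>next1 b - next2 b\<bar>" using n by (simp add: right_diff_distrib[symmetric] abs_mult)
      moreover have "n * 1 \<le> n * \<bar>next1 b - next2 b\<bar>" using next_far(3)[OF b] n by (intro mult_left_mono) auto
      moreover have "n * eps \<le> n * (1 / 16)" using eps_bounds(2) n by (intro mult_left_mono) auto
      ultimately show False using n by linarith
    qed
    ultimately have "\<Inter>S = range (\<lambda>t. w + t *\<^sub>R (z - w))" by (rule line_eq[OF S])
    moreover have "P \<alpha> \<in> \<Inter>S" using P(1)[OF \<alpha>(1)] by (auto simp: S_def \<alpha>_def)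
    ultimately have "\<exists>t. P \<alpha> = w + t *\<^sub>R (z - w)" by auto
    then show "\<exists>w\<in>verts. \<exists>z\<in>verts. norm (w - spot n b u (next1 b)) \<le> n * (eps / 2) \<and>
        norm (z - spot n b u (next2 b)) \<le> n * (eps / 2) \<and> (\<exists>t. P \<alpha> = w + t *\<^sub>R (z - w))"
      using w z by blast
  qed
qed

end

text \<open>If every element failed from some index on, an index beyond all of these would have no
  witness. This lets limits use fixed vertices or hyperplanes out of finitely many.\<close>

lemma finite_antitone_witness:
  assumes "finite V" "\<And>N::nat. \<exists>x\<in>V. P N x" "\<And>N x. P (Suc N) x \<Longrightarrow> P N x"
  shows "\<exists>x\<in>V. \<forall>N. P N x"
proof (rule ccontr)
  assume "\<not> ?thesis"
  then obtain f where f: "\<And>x. x \<in> V \<Longrightarrow> \<not> P (f x) x" by metis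
  define N where "N = Max (f ` V)"
  obtain x where x: "x \<in> V" "P N x" using assms(2) by blast
  have "f x \<le> N" unfolding N_def using assms(1) x(1) by simp
  then have "P (f x) x" using x(2)
  proof (induction N)
    case (Suc N)
    then show ?case using assms(3) by (cases "f x = Suc N") auto
  qed simp
  then show False using f x(1) by blast
qed

text \<open>A polynomial collinearity test, hence continuous at every triple; different
  \<open>u\<close>-coordinates turn its vanishing into genuine collinearity.\<close>

definition resid :: "'a::real_inner \<Rightarrow> 'a \<Rightarrow> 'a \<Rightarrow> 'a \<Rightarrow> 'a" where
  "resid u v w z = ((w - v) \<bullet> u) *\<^sub>R (z - v) - ((z - v) \<bullet> u) *\<^sub>R (w - v)"

lemma resid_collinear: "v = w + t *\<^sub>R (z - w) \<Longrightarrow> resid u v w z = 0"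
proof -
  assume v: "v = w + t *\<^sub>R (z - w)"
  define a where "a = z - w"
  have "w - v = - t *\<^sub>R a" "z - v = (1 - t) *\<^sub>R a" by (simp_all add: v a_def algebra_simps)
  then show ?thesis by (simp add: resid_def)
qed

lemma collinear_resid:
  assumes "resid u v w z = 0" "w \<bullet> u \<noteq> v \<bullet> u" "w \<bullet> u \<noteq> z \<bullet> u"
  shows "\<exists>t. v = w + t *\<^sub>R (z - w)"
proof -
  define a b where "a = (w - v) \<bullet> u" and "b = (z - v) \<bullet> u"
  have ab: "a \<noteq> 0" "a \<noteq> b" using assms(2,3) by (auto simp: a_def b_def inner_diff_left)
  have "a *\<^sub>R (z - v) = b *\<^sub>R (w - v)" using assms(1) by (simp add: resid_def a_def b_def)
  then have "(a - b) *\<^sub>R v = (a - b) *\<^sub>R w + a *\<^sub>R (z - w)" by (simp add: algebra_simps)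
  then have "(1 / (a - b)) *\<^sub>R ((a - b) *\<^sub>R v) = (1 / (a - b)) *\<^sub>R ((a - b) *\<^sub>R w + a *\<^sub>R (z - w))" by simp
  then have "v = w + (a / (a - b)) *\<^sub>R (z - w)" using ab(2) by (simp add: scaleR_add_right)
  then show ?thesis by blast
qed

lemma resid_continuous:
  assumes "resid u v w z = 0" "0 < \<epsilon>"
  shows "\<exists>\<rho>>0. \<forall>v' w' z'. dist v' v < \<rho> \<longrightarrow> dist w' w < \<rho> \<longrightarrow> dist z' z < \<rho> \<longrightarrow> norm (resid u v' w' z') < \<epsilon>"
proof -
  have "continuous (at (v, w, z)) (\<lambda>x. resid u (fst x) (fst (snd x)) (snd (snd x)))"
    unfolding resid_def by (intro continuous_intros)
  then obtain d where d: "0 < d" "\<And>x. dist x (v, w, z) < d \<Longrightarrow>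
      dist (resid u (fst x) (fst (snd x)) (snd (snd x))) (resid u v w z) < \<epsilon>"
    unfolding continuous_at_eps_delta using assms(2) by force
  have "norm (resid u v' w' z') < \<epsilon>" if "dist v' v < d / 3" "dist w' w < d / 3" "dist z' z < d / 3" for v' w' z'
  proof -
    have "dist (v', w', z') (v, w, z) = norm (v' - v, w' - w, z' - z)" by (simp add: dist_norm)
    also have "\<dots> \<le> norm (v' - v) + (norm (w' - w) + norm (z' - z))"
      by (rule order_trans[OF norm_Pair_le add_left_mono[OF norm_Pair_le]])
    also have "\<dots> < d" using that by (simp add: dist_norm)
    finally show ?thesis using d(2)[of "(v', w', z')"] assms(1) by simp
  qed
  then show ?thesis using d(1) by (intro exI[of _ "d / 3"]) auto
qed

lemma shrinking_LIMSEQ: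
  fixes f :: "nat \<Rightarrow> 'a::real_normed_vector"
  assumes "\<And>N. dist (f N) x < 1 / real (Suc N)"
  shows "f \<longlonglongrightarrow> x"
proof (rule LIMSEQ_I)
  fix r :: real assume "0 < r"
  then obtain N where N: "1 / real (Suc N) < r" using nat_approx_posE by blast
  have "norm (f m - x) < r" if "N \<le> m" for m
  proof -
    have "1 / real (Suc m) \<le> 1 / real (Suc N)" using that by (intro divide_left_mono) auto
    then show ?thesis using assms[of m] N by (simp add: dist_norm)
  qed
  then show "\<exists>N. \<forall>m\<ge>N. norm (f m - x) < r" by blast
qed

context frame
begin

text \<open>A frame as seen through approximating points from a countable dense set \<open>D\<close>, where \<open>pos q N\<close>
  says that the ball of radius \<open>1 / (N + 1)\<close> about \<open>q\<close> is charged. Such a condition is measurable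
  without any measurability of \<open>\<Phi>\<close> beyond countably many balls.\<close>

definition obs :: "'a set \<Rightarrow> ('a \<Rightarrow> nat \<Rightarrow> bool) \<Rightarrow> real \<Rightarrow> real \<Rightarrow> bool" where
  "obs D pos n b \<longleftrightarrow> (\<forall>N. \<exists>v\<in>D. (norm (v - n *\<^sub>R grid (\<lambda>_. b)) < n * eps \<and> pos v N) \<and>
    (\<forall>u\<in>U. \<exists>w\<in>D. \<exists>z\<in>D. (norm (w - spot n b u (next1 b)) < n * eps \<and> pos w N) \<and>
      (norm (z - spot n b u (next2 b)) < n * eps \<and> pos z N) \<and> norm (resid u v w z) < 1 / real (Suc N)))"

text \<open>Dense points only approximate the points of \<open>V\<close>, better for larger
  \<open>N\<close>. As \<open>V\<close> is finite, one \<open>v'\<close> works for all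
  \<open>N\<close>, and then one pair for each \<open>u\<close>; in the limit the strict bounds
  become weak and the residual vanishes.\<close>

lemma obs_frame:
  assumes V: "finite V" and pos: "\<And>q N. pos q N \<Longrightarrow> \<exists>v\<in>V. dist q v < 1 / real (Suc N)"
    and n: "1 \<le> n" and b: "b \<in> {1, 2, 3}" and obs: "obs D pos n b"
  shows "frame_at V n eps b"
proof -
  let ?near = "\<lambda>x y. norm (x - y) < n * eps"
  define Q where "Q N v' u w' z' \<longleftrightarrow> (\<exists>v w z. dist v v' < 1 / real (Suc N) \<and> dist w w' < 1 / real (Suc N) \<and> dist z z' < 1 / real (Suc N) \<and>
      ?near v (n *\<^sub>R grid (\<lambda>_. b)) \<and> ?near w (spot n b u (next1 b)) \<and> ?near z (spot n b u (next2 b)) \<and>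
      norm (resid u v w z) < 1 / real (Suc N))" for N v' u w' z'
  \<comment> \<open>All directions are demanded inside \<open>P\<close>, so that the same
    \<open>v'\<close> serves every \<open>u\<close>.\<close>
  define P where "P N v' \<longleftrightarrow> (\<exists>v. dist v v' < 1 / real (Suc N) \<and> ?near v (n *\<^sub>R grid (\<lambda>_. b))) \<and>
      (\<forall>u\<in>U. \<exists>w'\<in>V. \<exists>z'\<in>V. Q N v' u w' z')" for N v'
  have less: "1 / real (Suc (Suc N)) \<le> 1 / real (Suc N)" for N by (intro divide_left_mono) auto
  have Q_mono: "Q N v' u w' z'" if "Q (Suc N) v' u w' z'" for N v' u w' z'
    using that less[of N] unfolding Q_def by (meson order_less_le_trans)
  have P_mono: "P N v'" if "P (Suc N) v'" for N v'
    using that less[of N] Q_mono unfolding P_def by (meson order_less_le_trans)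
  have "\<exists>v'\<in>V. P N v'" for N
  proof -
    obtain v where v: "?near v (n *\<^sub>R grid (\<lambda>_. b))" "pos v N"
      and ex: "\<forall>u\<in>U. \<exists>w\<in>D. \<exists>z\<in>D. (?near w (spot n b u (next1 b)) \<and> pos w N) \<and>
        (?near z (spot n b u (next2 b)) \<and> pos z N) \<and> norm (resid u v w z) < 1 / real (Suc N)"
      using obs unfolding obs_def by blast
    obtain v' where v': "v' \<in> V" "dist v v' < 1 / real (Suc N)" using pos[OF v(2)] by blast
    have "\<exists>w'\<in>V. \<exists>z'\<in>V. Q N v' u w' z'" if u: "u \<in> U" for u
    proof -
      obtain w z where wz: "?near w (spot n b u (next1 b))" "pos w N" "?near z (spot n b u (next2 b))" "pos z N"
        "norm (resid u v w z) < 1 / real (Suc N)" using ex u by blast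
      obtain w' where "w' \<in> V" "dist w w' < 1 / real (Suc N)" using pos[OF wz(2)] by blast
      moreover obtain z' where "z' \<in> V" "dist z z' < 1 / real (Suc N)" using pos[OF wz(4)] by blast
      ultimately show ?thesis using v v'(2) wz unfolding Q_def by blast
    qed
    then show ?thesis using v v' unfolding P_def by blast
  qed
  from finite_antitone_witness[of V P, OF V this P_mono]
  obtain v' where v': "v' \<in> V" "\<And>N. P N v'" by blast
  have clos: "norm (x' - y) \<le> n * eps"
    if "\<And>N. dist (x N) x' < 1 / real (Suc N)" "\<And>N::nat. ?near (x N) y" for x :: "nat \<Rightarrow> 'a" and x' y
  proof (rule LIMSEQ_le_const2)
    show "(\<lambda>N. norm (x N - y)) \<longlonglongrightarrow> norm (x' - y)"
      using shrinking_LIMSEQ[of x x'] that(1) by (intro tendsto_intros) auto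
  qed (use that(2) in \<open>auto intro: less_imp_le\<close>)
  show ?thesis
    unfolding frame_at_def
  proof (rule bexI[OF _ v'(1)], intro conjI ballI)
    have "\<forall>N. \<exists>v. dist v v' < 1 / real (Suc N) \<and> ?near v (n *\<^sub>R grid (\<lambda>_. b))" using v'(2) unfolding P_def by blast
    then obtain vs where "\<And>N. dist (vs N) v' < 1 / real (Suc N)" "\<And>N. ?near (vs N) (n *\<^sub>R grid (\<lambda>_. b))" by metis
    then show vb: "norm (v' - n *\<^sub>R grid (\<lambda>_. b)) \<le> n * eps" by (rule clos)
    fix u assume u: "u \<in> U"
    have "\<exists>p\<in>V \<times> V. Q N v' u (fst p) (snd p)" for N using v'(2)[of N] u unfolding P_def by force
    from finite_antitone_witness[of "V \<times> V" "\<lambda>N p. Q N v' u (fst p) (snd p)", OF finite_cartesian_product[OF V V] this Q_mono]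
    obtain w' z' where wz': "w' \<in> V" "z' \<in> V" "\<And>N. Q N v' u w' z'" by auto
    have "\<forall>N. \<exists>v w z. dist v v' < 1 / real (Suc N) \<and> dist w w' < 1 / real (Suc N) \<and> dist z z' < 1 / real (Suc N) \<and>
      ?near w (spot n b u (next1 b)) \<and> ?near z (spot n b u (next2 b)) \<and>
      norm (resid u v w z) < 1 / real (Suc N)" using wz'(3) unfolding Q_def by blast
    then obtain vs ws zs where s: "\<And>N. dist (vs N) v' < 1 / real (Suc N)" "\<And>N. dist (ws N) w' < 1 / real (Suc N)"
      "\<And>N. dist (zs N) z' < 1 / real (Suc N)" "\<And>N. ?near (ws N) (spot n b u (next1 b))" "\<And>N. ?near (zs N) (spot n b u (next2 b))"
      "\<And>N. norm (resid u (vs N) (ws N) (zs N)) < 1 / real (Suc N)" by metis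
    have w: "norm (w' - spot n b u (next1 b)) \<le> n * eps" using s(2,4) by (rule clos)
    have z: "norm (z' - spot n b u (next2 b)) \<le> n * eps" using s(3,5) by (rule clos)
    have "(\<lambda>N. resid u (vs N) (ws N) (zs N)) \<longlonglongrightarrow> resid u v' w' z'"
      unfolding resid_def by (intro tendsto_intros shrinking_LIMSEQ s)
    moreover have "(\<lambda>N. resid u (vs N) (ws N) (zs N)) \<longlonglongrightarrow> 0"
      using s(6) by (intro shrinking_LIMSEQ) (simp add: dist_norm)
    ultimately have res: "resid u v' w' z' = 0" by (rule LIMSEQ_unique)
    have bd: "\<bar>v' \<bullet> u - n * b\<bar> \<le> n * eps" "\<bar>w' \<bullet> u - n * next1 b\<bar> \<le> n * eps" "\<bar>z' \<bullet> u - n * next2 b\<bar> \<le> n * eps"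
      using near_inner[OF u vb] near_inner[OF u w] near_inner[OF u z] by (simp_all add: grid_inner inner_spot u)
    have e: "n * eps \<le> n * (1 / 16)" using eps_bounds(2) n by (intro mult_left_mono) auto
    have far: "n * 1 \<le> n * \<bar>x - y\<bar>" "n * \<bar>x - y\<bar> = \<bar>n * x - n * y\<bar>" if "1 \<le> \<bar>x - y\<bar>" for x y
    proof -
      show "n * 1 \<le> n * \<bar>x - y\<bar>" using that n by (intro mult_left_mono) auto
      show "n * \<bar>x - y\<bar> = \<bar>n * x - n * y\<bar>" using n by (simp add: right_diff_distrib[symmetric] abs_mult)
    qed
    \<comment> \<open>The ideal coordinates are at least \<open>n\<close> apart and each is met up
      to \<open>n / 16\<close>, which excludes the degenerate solutions of the residual
      equation.\<close>
    have "w' \<bullet> u \<noteq> v' \<bullet> u" using bd(1,2) far[OF next_far(1)[OF b]] e n by linarith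
    moreover have "w' \<bullet> u \<noteq> z' \<bullet> u" using bd(2,3) far[OF next_far(3)[OF b]] e n by linarith
    ultimately have "\<exists>t. v' = w' + t *\<^sub>R (z' - w')" using collinear_resid[OF res] by blast
    then show "\<exists>w\<in>V. \<exists>z\<in>V. norm (w - spot n b u (next1 b)) \<le> n * eps \<and> norm (z - spot n b u (next2 b)) \<le> n * eps \<and>
        (\<exists>t. v' = w + t *\<^sub>R (z - w))" using wz'(1,2) w z by blast
  qed
qed

text \<open>The accuracy \<open>eps / 2\<close> leaves a margin of \<open>n * (eps / 2)\<close> in
  which nearby dense points still satisfy the strict bounds, and continuity keeps the residual small
  near an exact triple.\<close>

lemma frame_obs:
  assumes D: "\<And>O'. open O' \<Longrightarrow> O' \<noteq> {} \<Longrightarrow> \<exists>d\<in>D. d \<in> O'"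
    and pos: "\<And>q N v. v \<in> V \<Longrightarrow> dist q v < 1 / real (Suc N) \<Longrightarrow> pos q N"
    and n: "1 \<le> n" and fr: "frame_at V n (eps / 2) b"
  shows "obs D pos n b"
  unfolding obs_def
proof
  fix N
  obtain v where v: "v \<in> V" "norm (v - n *\<^sub>R grid (\<lambda>_. b)) \<le> n * (eps / 2)"
    and ex: "\<forall>u\<in>U. \<exists>w\<in>V. \<exists>z\<in>V. norm (w - spot n b u (next1 b)) \<le> n * (eps / 2) \<and>
      norm (z - spot n b u (next2 b)) \<le> n * (eps / 2) \<and> (\<exists>t. v = w + t *\<^sub>R (z - w))"
    using fr unfolding frame_at_def by blast
  have "\<forall>u\<in>U. \<exists>w z \<rho>. (w \<in> V \<and> z \<in> V \<and> norm (w - spot n b u (next1 b)) \<le> n * (eps / 2) \<and>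
      norm (z - spot n b u (next2 b)) \<le> n * (eps / 2)) \<and> 0 < \<rho> \<and>
      (\<forall>v' w' z'. dist v' v < \<rho> \<longrightarrow> dist w' w < \<rho> \<longrightarrow> dist z' z < \<rho> \<longrightarrow> norm (resid u v' w' z') < 1 / real (Suc N))"
  proof
    fix u assume "u \<in> U"
    then obtain w z t where wz: "w \<in> V" "z \<in> V" "norm (w - spot n b u (next1 b)) \<le> n * (eps / 2)"
      "norm (z - spot n b u (next2 b)) \<le> n * (eps / 2)" "v = w + t *\<^sub>R (z - w)" using ex by blast
    obtain \<rho> where "\<rho> > 0" "\<forall>v' w' z'. dist v' v < \<rho> \<longrightarrow> dist w' w < \<rho> \<longrightarrow> dist z' z < \<rho> \<longrightarrow> norm (resid u v' w' z') < 1 / real (Suc N)"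
      using resid_continuous[OF resid_collinear[OF wz(5)], of "1 / real (Suc N)" u] by auto
    then show "\<exists>w z \<rho>. (w \<in> V \<and> z \<in> V \<and> norm (w - spot n b u (next1 b)) \<le> n * (eps / 2) \<and>
      norm (z - spot n b u (next2 b)) \<le> n * (eps / 2)) \<and> 0 < \<rho> \<and>
      (\<forall>v' w' z'. dist v' v < \<rho> \<longrightarrow> dist w' w < \<rho> \<longrightarrow> dist z' z < \<rho> \<longrightarrow> norm (resid u v' w' z') < 1 / real (Suc N))"
      using wz by blast
  qed
  then obtain w z \<rho> where wz: "\<And>u. u \<in> U \<Longrightarrow> w u \<in> V \<and> z u \<in> V \<and> norm (w u - spot n b u (next1 b)) \<le> n * (eps / 2) \<and>
      norm (z u - spot n b u (next2 b)) \<le> n * (eps / 2)"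
    and \<rho>: "\<And>u. u \<in> U \<Longrightarrow> 0 < \<rho> u"
      "\<And>u v' w' z'. u \<in> U \<Longrightarrow> dist v' v < \<rho> u \<Longrightarrow> dist w' (w u) < \<rho> u \<Longrightarrow> dist z' (z u) < \<rho> u \<Longrightarrow> norm (resid u v' w' z') < 1 / real (Suc N)"
    by metis
  \<comment> \<open>Below all tolerances at once: the radius of the charged balls, the margin, and
    the moduli of continuity for the finitely many \<open>u\<close>.\<close>
  define \<sigma> where "\<sigma> = Min (insert (1 / real (Suc N)) (insert (n * (eps / 2)) (\<rho> ` U)))"
  have ne: "0 < n * (eps / 2)" using n eps_bounds(1) by simp
  have \<sigma>: "0 < \<sigma>" "\<sigma> \<le> 1 / real (Suc N)" "\<sigma> \<le> n * (eps / 2)" "\<And>u. u \<in> U \<Longrightarrow> \<sigma> \<le> \<rho> u"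
  proof -
    have fin: "finite (insert (1 / real (Suc N)) (insert (n * (eps / 2)) (\<rho> ` U)))" using finU by simp
    show "0 < \<sigma>" unfolding \<sigma>_def by (subst Min_gr_iff[OF fin]) (use \<rho>(1) ne in auto)
    show "\<sigma> \<le> 1 / real (Suc N)" "\<sigma> \<le> n * (eps / 2)" "\<And>u. u \<in> U \<Longrightarrow> \<sigma> \<le> \<rho> u"
      unfolding \<sigma>_def by (rule Min_le[OF fin]; blast)+
  qed
  have apx: "\<exists>q\<in>D. dist q x < \<sigma> \<and> (norm (q - y) < n * eps \<and> pos q N)"
    if x: "x \<in> V" "norm (x - y) \<le> n * (eps / 2)" for x y
  proof -
    have "open (ball x \<sigma>)" "ball x \<sigma> \<noteq> {}" using \<sigma>(1) by auto
    then obtain q where q: "q \<in> D" "dist q x < \<sigma>" using D[of "ball x \<sigma>"] by (auto simp: dist_commute)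
    have "norm (q - y) \<le> norm (q - x) + norm (x - y)" using norm_triangle_ineq[of "q - x" "x - y"] by simp
    then have "norm (q - y) < n * eps" using q(2) \<sigma>(3) x(2) by (simp add: dist_norm)
    moreover have "pos q N" using pos[OF x(1), of q N] q(2) \<sigma>(2) by simp
    ultimately show ?thesis using q by blast
  qed
  obtain v0 where v0: "v0 \<in> D" "dist v0 v < \<sigma>" "norm (v0 - n *\<^sub>R grid (\<lambda>_. b)) < n * eps \<and> pos v0 N"
    using apx[OF v] by blast
  have "\<exists>w0\<in>D. \<exists>z0\<in>D. (norm (w0 - spot n b u (next1 b)) < n * eps \<and> pos w0 N) \<and>
      (norm (z0 - spot n b u (next2 b)) < n * eps \<and> pos z0 N) \<and> norm (resid u v0 w0 z0) < 1 / real (Suc N)"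
    if u: "u \<in> U" for u
  proof -
    obtain w0 where w0: "w0 \<in> D" "dist w0 (w u) < \<sigma>" "norm (w0 - spot n b u (next1 b)) < n * eps \<and> pos w0 N"
      using apx[of "w u" "spot n b u (next1 b)"] wz[OF u] by blast
    obtain z0 where z0: "z0 \<in> D" "dist z0 (z u) < \<sigma>" "norm (z0 - spot n b u (next2 b)) < n * eps \<and> pos z0 N"
      using apx[of "z u" "spot n b u (next2 b)"] wz[OF u] by blast
    have "norm (resid u v0 w0 z0) < 1 / real (Suc N)"
      using \<sigma>(4)[OF u] v0(2) w0(2) z0(2) by (intro \<rho>(2)[OF u]) auto
    then show ?thesis using w0 z0 by blast
  qed
  then show "\<exists>v\<in>D. (norm (v - n *\<^sub>R grid (\<lambda>_. b)) < n * eps \<and> pos v N) \<and>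
    (\<forall>u\<in>U. \<exists>w\<in>D. \<exists>z\<in>D. (norm (w - spot n b u (next1 b)) < n * eps \<and> pos w N) \<and>
      (norm (z - spot n b u (next2 b)) < n * eps \<and> pos z N) \<and> norm (resid u v w z) < 1 / real (Suc N))"
    using v0 by blast
qed

text \<open>Describes the only centres that \<open>obs\<close> tests for \<open>b\<close> in
  \<open>{1, 2, 3}\<close>, so that their balls can be kept within the annulus.\<close>

definition near_grid :: "real \<Rightarrow> 'a \<Rightarrow> bool" where
  "near_grid n q \<longleftrightarrow> (\<exists>\<alpha>. (\<forall>u\<in>U. \<alpha> u \<in> {1, 2, 3}) \<and> norm (q - n *\<^sub>R grid \<alpha>) \<le> n * eps)"

lemma near_gridI:
  assumes b: "b \<in> {1, 2, 3}"
  shows "norm (q - n *\<^sub>R grid (\<lambda>_. b)) \<le> n * eps \<Longrightarrow> near_grid n q"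
    "norm (q - spot n b u (next1 b)) \<le> n * eps \<Longrightarrow> near_grid n q"
    "norm (q - spot n b u (next2 b)) \<le> n * eps \<Longrightarrow> near_grid n q"
proof -
  have *: "norm (q - n *\<^sub>R grid \<alpha>) \<le> n * eps \<Longrightarrow> near_grid n q" if "\<And>u. \<alpha> u \<in> {1, 2, 3}" for \<alpha>
    using that unfolding near_grid_def by blast
  show "norm (q - n *\<^sub>R grid (\<lambda>_. b)) \<le> n * eps \<Longrightarrow> near_grid n q"
    "norm (q - spot n b u (next1 b)) \<le> n * eps \<Longrightarrow> near_grid n q"
    "norm (q - spot n b u (next2 b)) \<le> n * eps \<Longrightarrow> near_grid n q"
    unfolding spot_def by (rule *; use b next_in[OF b] in simp)+
qed

text \<open>For \<open>n \<ge> 2 * (r + 1)\<close> a coordinate of \<open>y\<close> is at least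
  \<open>n - 1 - n / 16\<close>, which exceeds \<open>r\<close>, while the norm is at most
  \<open>n * A0\<close>, within the outer radius. The unit bound on \<open>y - q\<close> covers all
  ball radii \<open>1 / (k + 1)\<close>.\<close>

lemma near_grid_annulus:
  assumes q: "near_grid n q" and n: "2 * (r + 1) \<le> n" and r: "0 < r" and y: "norm (y - q) \<le> 1"
  shows "y \<in> annulus r n"
proof -
  obtain \<alpha> where \<alpha>: "\<And>u. u \<in> U \<Longrightarrow> \<alpha> u \<in> {1, 2, 3}" "norm (q - n *\<^sub>R grid \<alpha>) \<le> n * eps"
    using q by (auto simp: near_grid_def)
  have e: "n * eps \<le> n * (1 / 16)" using eps_bounds(2) n r by (intro mult_left_mono) auto
  have yd: "norm (y - n *\<^sub>R grid \<alpha>) \<le> 1 + n * (1 / 16)"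
    using norm_triangle_ineq[of "y - q" "q - n *\<^sub>R grid \<alpha>"] y \<alpha>(2) e by simp
  obtain u where u: "u \<in> U" using cardU DIM_positive[where 'a='a] by fastforce
  have ab: "\<bar>y \<bullet> u - n * \<alpha> u\<bar> \<le> 1 + n * (1 / 16)" using near_inner[OF u yd] by (simp add: grid_inner u)
  have "n * 1 \<le> n * \<alpha> u" using \<alpha>(1)[OF u] n r by (intro mult_left_mono) auto
  then have "n - (1 + n * (1 / 16)) \<le> y \<bullet> u" using abs_le_D2[OF ab] by simp
  then have "r \<le> \<bar>y \<bullet> u\<bar>" using n r by (simp add: field_simps)
  then have lo: "r \<le> norm y" using inner_U_le[OF u, of y] by linarith
  have "norm (grid \<alpha>) \<le> 3 * E" using \<alpha>(1) by (intro norm_grid) force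
  then have "norm (n *\<^sub>R grid \<alpha>) \<le> n * (3 * E)" using n r by (auto intro!: mult_left_mono)
  then have "norm y \<le> n * (3 * E) + (1 + n * (1 / 16))"
    using yd norm_triangle_ineq[of "y - n *\<^sub>R grid \<alpha>" "n *\<^sub>R grid \<alpha>"] by simp
  also have "\<dots> \<le> n * (3 * E) + n * 2" using n r by simp
  also have "\<dots> = n * A0" by (simp add: A0_def algebra_simps)
  also have "\<dots> \<le> n * R0" using R0_ge(1) n r by (intro mult_left_mono) auto
  finally show ?thesis using lo by (simp add: annulus_def)
qed

text \<open>Measurability of \<open>pos\<close> is asked for only at centres near the grid, because
  elsewhere the distance bound already fails.\<close>

lemma sets_obs:
  assumes D: "countable D" and b: "b \<in> {1, 2, 3}"
    and meas: "\<And>q k. near_grid n q \<Longrightarrow> {x\<in>space N. pos x q k} \<in> sets N"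
  shows "{x\<in>space N. obs D (pos x) n b} \<in> sets N"
proof -
  have conj: "{x\<in>space N. norm (q - y) < n * eps \<and> pos x q k} \<in> sets N"
    if "norm (q - y) \<le> n * eps \<Longrightarrow> near_grid n q" for q y k
    using meas[OF that] by (cases "norm (q - y) < n * eps") auto
  show ?thesis
    unfolding obs_def
    by (intro sets.sets_Collect_countable_All sets.sets_Collect_countable_Ex'[OF _ D] sets.sets_Collect_conj
        sets.sets_Collect_finite_All[OF _ finU] sets.sets_Collect_const conj near_gridI[OF b])
qed

end

section \<open>The stopping set\<close>

lemma meas_restr_meas_restr:
  assumes "sets \<mu> = sets borel" "A \<in> sets borel" "F \<in> sets borel" "A \<subseteq> F"
  shows "meas_restr (meas_restr \<mu> F) A = meas_restr \<mu> A"
proof (rule measure_eqI)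
  fix C assume "C \<in> sets (meas_restr (meas_restr \<mu> F) A)"
  then have C: "C \<in> sets borel" using assms(1) by simp
  have "C \<inter> A \<in> sets borel" "C \<inter> A \<inter> F = C \<inter> A" using C assms by auto
  then show "emeasure (meas_restr (meas_restr \<mu> F) A) C = emeasure (meas_restr \<mu> A) C"
    using assms C by (simp add: emeasure_meas_restr)
qed simp

lemma meas_restr_measurable:
  assumes "A \<in> sets borel"
  shows "(\<lambda>\<mu>. meas_restr \<mu> A) \<in> measurable borel_measures borel_measures"
proof (rule measurable_borel_measures)
  fix C :: "'a set" assume C: "C \<in> sets borel"
  then have "(\<lambda>\<mu>. emeasure \<mu> (C \<inter> A)) \<in> borel_measurable borel_measures" using assms by simp
  then show "(\<lambda>\<mu>. emeasure (meas_restr \<mu> A) C) \<in> borel_measurable borel_measures"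
    using assms C by (subst measurable_cong) (auto simp: space_borel_measures emeasure_meas_restr)
qed (simp add: space_borel_measures)

lemma sigma_restr_mono:
  assumes "\<And>\<omega>. \<omega> \<in> space M \<Longrightarrow> sets (\<Psi> \<omega>) = sets borel" "A \<in> sets borel" "F \<in> sets borel" "A \<subseteq> F"
  shows "sets (sigma_restr M \<Psi> A) \<subseteq> sets (sigma_restr M \<Psi> F)"
proof -
  have "(\<lambda>\<omega>. meas_restr (\<Psi> \<omega>) F) \<in> measurable (sigma_restr M \<Psi> F) borel_measures"
    unfolding sigma_restr_def using assms(1) by (intro measurable_vimage_algebra1) (auto simp: space_borel_measures)
  from measurable_compose[OF this meas_restr_measurable[OF assms(2)]]
  have meas: "(\<lambda>\<omega>. meas_restr (\<Psi> \<omega>) A) \<in> measurable (sigma_restr M \<Psi> F) borel_measures"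
    using assms by (subst measurable_cong[where g="\<lambda>\<omega>. meas_restr (meas_restr (\<Psi> \<omega>) F) A"])
      (auto simp: meas_restr_meas_restr sigma_restr_def)
  show ?thesis
  proof
    fix S assume "S \<in> sets (sigma_restr M \<Psi> A)"
    then obtain T where "T \<in> sets borel_measures" "S = (\<lambda>\<omega>. meas_restr (\<Psi> \<omega>) A) -` T \<inter> space M"
      unfolding sigma_restr_def using assms(1) by (subst (asm) sets_vimage_algebra2) (auto simp: space_borel_measures)
    then show "S \<in> sets (sigma_restr M \<Psi> F)" using measurable_sets[OF meas, of T] by (simp add: sigma_restr_def)
  qed
qed

text \<open>The default \<open>L\<close> will contain all \<open>A i\<close>, so that the
  non-occurrence of every event is observable in the revealed region as well.\<close>

definition first_of :: "(nat \<Rightarrow> 'w set) \<Rightarrow> (nat \<Rightarrow> 'b) \<Rightarrow> 'b \<Rightarrow> 'w \<Rightarrow> 'b" where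
  "first_of Ev A L \<omega> = (if \<exists>i. \<omega> \<in> Ev i then A (LEAST i. \<omega> \<in> Ev i) else L)"

lemma first_of_cases:
  obtains i where "\<omega> \<in> Ev i" "\<And>j. j < i \<Longrightarrow> \<omega> \<notin> Ev j" "first_of Ev A L \<omega> = A i"
  | "\<And>i. \<omega> \<notin> Ev i" "first_of Ev A L \<omega> = L"
proof (cases "\<exists>i. \<omega> \<in> Ev i")
  case True
  show ?thesis
  proof (rule that(1))
    show "\<omega> \<in> Ev (LEAST i. \<omega> \<in> Ev i)" using True by (rule LeastI_ex)
    show "\<omega> \<notin> Ev j" if "j < (LEAST i. \<omega> \<in> Ev i)" for j using not_less_Least[OF that] .
    show "first_of Ev A L \<omega> = A (LEAST i. \<omega> \<in> Ev i)" using True by (simp add: first_of_def)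
  qed
next
  case False
  show ?thesis by (rule that(2)) (use False in \<open>auto simp: first_of_def\<close>)
qed

lemma sets_first_of:
  assumes "\<And>i j. P (A i) \<Longrightarrow> j \<le> i \<Longrightarrow> Ev j \<in> sets N" "\<And>i. P L \<Longrightarrow> Ev i \<in> sets N"
  shows "{\<omega>\<in>space N. P (first_of Ev A L \<omega>)} \<in> sets N"
proof -
  have "{\<omega>\<in>space N. P (first_of Ev A L \<omega>)}
    = (\<Union>i\<in>{i. P (A i)}. space N \<inter> Ev i - (\<Union>j<i. Ev j)) \<union> (if P L then space N - (\<Union>i. Ev i) else {})" (is "?l = ?r")
  proof (intro equalityI subsetI)
    fix \<omega> assume "\<omega> \<in> ?l"
    then show "\<omega> \<in> ?r"
      by (cases rule: first_of_cases[of \<omega> Ev A L]) auto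
  next
    fix \<omega> assume r: "\<omega> \<in> ?r"
    show "\<omega> \<in> ?l"
    proof (cases rule: first_of_cases[of \<omega> Ev A L])
      case (1 i)
      then obtain k where k: "P (A k)" "\<omega> \<in> Ev k" "\<And>j. j < k \<Longrightarrow> \<omega> \<notin> Ev j" using r by (auto split: if_splits)
      then have "k = i" using 1 by (meson linorder_neqE_nat)
      then show ?thesis using k 1 r by (auto split: if_splits)
    qed (use r in \<open>auto split: if_splits\<close>)
  qed
  moreover have "(\<Union>i\<in>{i. P (A i)}. space N \<inter> Ev i - (\<Union>j<i. Ev j)) \<in> sets N"
    using assms(1) by (intro sets.countable_UN' sets.Diff sets.Int sets.finite_UN) auto
  moreover have "(if P L then space N - (\<Union>i. Ev i) else {}) \<in> sets N" using assms(2) by auto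
  ultimately show ?thesis by simp
qed

text \<open>If \<open>A i \<subseteq> F\<close>, deciding that \<open>i\<close> is the first index
  involves only events attached to smaller sets, all observable in \<open>F\<close>; if
  \<open>L \<subseteq> F\<close>, every event is observable.\<close>

lemma stopping_set_first_of:
  assumes \<Psi>: "\<And>\<omega>. \<omega> \<in> space M \<Longrightarrow> sets (\<Psi> \<omega>) = sets borel"
    and A: "\<And>i. closed (A i)" "\<And>i. A i \<noteq> {}" "incseq A" "\<And>i. A i \<subseteq> L" "closed L"
    and Ev: "\<And>i. Ev i \<in> sets (sigma_restr M \<Psi> (A i))"
  shows "stopping_set M \<Psi> (first_of Ev A L)"
  unfolding stopping_set_def
proof (intro conjI ballI allI impI)
  fix \<omega>
  show "closed (first_of Ev A L \<omega>)" "first_of Ev A L \<omega> \<noteq> {}"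
    using A(1,2,5) A(4)[of 0] A(2)[of 0] by (auto simp: first_of_def)
next
  fix F :: "'b set" assume F: "closed F"
  have ev: "Ev j \<in> sets (sigma_restr M \<Psi> F)" if "A j \<subseteq> F" for j
    using sigma_restr_mono[of M \<Psi>, OF \<Psi> borel_closed[OF A(1)[of j]] borel_closed[OF F] that] Ev[of j] by blast
  have "{\<omega>\<in>space (sigma_restr M \<Psi> F). first_of Ev A L \<omega> \<subseteq> F} \<in> sets (sigma_restr M \<Psi> F)"
  proof (rule sets_first_of)
    show "Ev j \<in> sets (sigma_restr M \<Psi> F)" if "A i \<subseteq> F" "j \<le> i" for i j
      using incseqD[OF A(3) that(2)] that(1) by (intro ev) (rule order_trans)
    show "Ev i \<in> sets (sigma_restr M \<Psi> F)" if "L \<subseteq> F" for i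
      using A(4) that by (intro ev) (rule order_trans)
  qed
  then show "{\<omega>\<in>space M. first_of Ev A L \<omega> \<subseteq> F} \<in> sets (sigma_restr M \<Psi> F)" by (simp add: sigma_restr_def)
qed

text \<open>Counts of hyperplanes hitting balls are the available random variables, so a common
  point is approximated by dense centres. For the converse, local finiteness fixes one
  \<open>S\<close> for all \<open>N\<close>, and a convergent subsequence of centres yields the
  point.\<close>

lemma common_point_iff:
  fixes X :: "'a::euclidean_space set set"
  assumes X: "X \<subseteq> hyperplanes" and fin: "\<And>K. compact K \<Longrightarrow> finite (X \<inter> hitting K)"
    and D: "\<And>O'. open O' \<Longrightarrow> O' \<noteq> {} \<Longrightarrow> \<exists>d\<in>D. d \<in> O'"
  shows "(\<exists>S\<subseteq>X. finite S \<and> card S = k \<and> \<Inter>S \<inter> cball q \<rho> \<noteq> {}) \<longleftrightarrow>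
    (\<forall>N. \<exists>c\<in>D. dist q c \<le> \<rho> + 1 / real (Suc N) \<and> of_nat k \<le> point_count X (hitting (cball c (1 / real (Suc N)))))"
    (is "?l \<longleftrightarrow> ?r")
proof
  assume ?l
  then obtain S where "S \<subseteq> X" "card S = k" "\<Inter>S \<inter> cball q \<rho> \<noteq> {}" by blast
  then obtain p where S: "S \<subseteq> X" "card S = k" "p \<in> \<Inter>S" "dist q p \<le> \<rho>" by fastforce
  show ?r
  proof
    fix N
    obtain c where c: "c \<in> D" "dist p c < 1 / real (Suc N)" using D[of "ball p (1 / real (Suc N))"] by auto
    have "S \<subseteq> X \<inter> hitting (cball c (1 / real (Suc N)))"
    proof
      fix H assume "H \<in> S"
      moreover have "p \<in> cball c (1 / real (Suc N))" using c(2) by (simp add: dist_commute)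
      ultimately have "H \<inter> cball c (1 / real (Suc N)) \<noteq> {}" using S(3) by blast
      then show "H \<in> X \<inter> hitting (cball c (1 / real (Suc N)))" using \<open>H \<in> S\<close> S(1) X by (auto simp: hitting_def)
    qed
    from card_mono[OF fin[OF compact_cball] this] have "k \<le> card (X \<inter> hitting (cball c (1 / real (Suc N))))"
      using S(2) by simp
    then have "of_nat k \<le> point_count X (hitting (cball c (1 / real (Suc N))))"
      using fin[OF compact_cball] by (simp add: point_count_def)
    moreover have "dist q c \<le> \<rho> + 1 / real (Suc N)" using dist_triangle[of q c p] c S(4) by linarith
    ultimately show "\<exists>c\<in>D. dist q c \<le> \<rho> + 1 / real (Suc N) \<and> of_nat k \<le> point_count X (hitting (cball c (1 / real (Suc N))))"
      using c(1) by blast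
  qed
next
  assume r: ?r
  \<comment> \<open>The radius \<open>\<rho> + 2\<close> allows 1 for the excess distance of the
    centre and 1 for the ball about it.\<close>
  define V where "V = {S. S \<subseteq> X \<inter> hitting (cball q (\<rho> + 2)) \<and> card S = k}"
  define P where "P N S \<longleftrightarrow> (\<exists>c. dist q c \<le> \<rho> + 1 / real (Suc N) \<and> S \<subseteq> hitting (cball c (1 / real (Suc N))))" for N S
  have le: "1 / real (Suc (Suc N)) \<le> 1 / real (Suc N)" "1 / real (Suc N) \<le> 1" for N by (simp_all add: field_simps)
  have sub: "hitting (cball c s) \<subseteq> hitting (cball c' t)" if "dist c c' + s \<le> t" for c c' :: 'a and s t
  proof -
    have "cball c s \<subseteq> cball c' t"
    proof
      fix x assume "x \<in> cball c s"
      then show "x \<in> cball c' t" using that dist_triangle[of c' x c] by (simp add: dist_commute)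
    qed
    then show ?thesis by (auto simp: hitting_def)
  qed
  have "\<exists>S\<in>V. \<forall>N. P N S"
  proof (rule finite_antitone_witness)
    show "finite V" unfolding V_def
      by (rule finite_subset[of _ "Pow (X \<inter> hitting (cball q (\<rho> + 2)))"])
        (blast, rule finite_Pow_iff[THEN iffD2, OF fin[OF compact_cball]])
    fix N
    obtain c where c: "dist q c \<le> \<rho> + 1 / real (Suc N)" "of_nat k \<le> point_count X (hitting (cball c (1 / real (Suc N))))"
      using r by blast
    have "k \<le> card (X \<inter> hitting (cball c (1 / real (Suc N))))"
      using c(2) fin[OF compact_cball, of c "1 / real (Suc N)"] by (simp add: point_count_def)
    then obtain S where S: "S \<subseteq> X \<inter> hitting (cball c (1 / real (Suc N)))" "card S = k" by (meson obtain_subset_with_card_n)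
    have "hitting (cball c (1 / real (Suc N))) \<subseteq> hitting (cball q (\<rho> + 2))"
      by (rule sub) (use c(1) le(2)[of N] dist_commute[of c q] in linarith)
    then show "\<exists>S\<in>V. P N S" using S c(1) unfolding V_def P_def by blast
  next
    fix N S assume "P (Suc N) S"
    then obtain c where c: "dist q c \<le> \<rho> + 1 / real (Suc (Suc N))" "S \<subseteq> hitting (cball c (1 / real (Suc (Suc N))))"
      unfolding P_def by blast
    have "hitting (cball c (1 / real (Suc (Suc N)))) \<subseteq> hitting (cball c (1 / real (Suc N)))"
      using le(1)[of N] by (intro sub) simp
    then show "P N S" unfolding P_def using c le(1)[of N] by (intro exI[of _ c]) auto
  qed
  then obtain S where S: "S \<in> V" "\<And>N. P N S" by blast
  then have "\<forall>N. \<exists>c. dist q c \<le> \<rho> + 1 / real (Suc N) \<and> S \<subseteq> hitting (cball c (1 / real (Suc N)))" unfolding P_def by blast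
  then obtain c where c: "\<And>N. dist q (c N) \<le> \<rho> + 1 / real (Suc N)" "\<And>N. S \<subseteq> hitting (cball (c N) (1 / real (Suc N)))"
    by metis
  have "c N \<in> cball q (\<rho> + 1)" for N unfolding mem_cball using c(1)[of N] le(2)[of N] by linarith
  then obtain p \<phi> where p: "strict_mono \<phi>" "(c \<circ> \<phi>) \<longlonglongrightarrow> p"
    using seq_compactE[OF compact_imp_seq_compact[OF compact_cball], of c q "\<rho> + 1"] by blast
  have lim0: "(\<lambda>N. 1 / real (Suc (\<phi> N))) \<longlonglongrightarrow> 0"
    using LIMSEQ_subseq_LIMSEQ[OF LIMSEQ_inverse_real_of_nat p(1)] by (simp add: o_def inverse_eq_divide)
  have "dist q p \<le> \<rho> + 0"
  proof (rule LIMSEQ_le)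
    show "(\<lambda>N. dist q ((c \<circ> \<phi>) N)) \<longlonglongrightarrow> dist q p" using p(2) by (intro tendsto_intros)
    show "(\<lambda>N. \<rho> + 1 / real (Suc (\<phi> N))) \<longlonglongrightarrow> \<rho> + 0" using lim0 by (intro tendsto_intros)
    show "\<exists>N. \<forall>n\<ge>N. dist q ((c \<circ> \<phi>) n) \<le> \<rho> + 1 / real (Suc (\<phi> n))" using c(1) by auto
  qed
  moreover have "p \<in> H" if H: "H \<in> S" for H
  proof -
    have Hh: "H \<in> hyperplanes" using H S(1) by (auto simp: V_def hitting_def)
    have "infdist p H \<le> 0"
    proof (rule LIMSEQ_le[OF _ lim0])
      show "(\<lambda>N. infdist ((c \<circ> \<phi>) N) H) \<longlonglongrightarrow> infdist p H" using p(2) by (intro tendsto_intros)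
      show "\<exists>N. \<forall>n\<ge>N. infdist ((c \<circ> \<phi>) n) H \<le> 1 / real (Suc (\<phi> n))"
        using c(2) H infdist_hyperplane_le_iff[OF Hh] by (intro exI[of _ 0]) auto
    qed
    then show ?thesis using infdist_hyperplane_0_iff[OF Hh] by simp
  qed
  ultimately have "p \<in> \<Inter>S \<inter> cball q \<rho>" by auto
  moreover have sub: "S \<subseteq> X \<inter> hitting (cball q (\<rho> + 2))" "card S = k" using S(1) by (auto simp: V_def)
  moreover have "finite S" by (rule finite_subset[OF sub(1) fin[OF compact_cball]])
  ultimately show ?l by blast
qed

lemma emeasure_vertices_pos_iff:
  fixes X :: "'a::euclidean_space set set"
  assumes X: "X \<subseteq> hyperplanes" and fin: "\<And>K. compact K \<Longrightarrow> finite (X \<inter> hitting K)"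
  shows "0 < emeasure (intersection_measure DIM('a) X) (ball q \<rho>) \<longleftrightarrow>
    (\<exists>S\<subseteq>X. finite S \<and> card S = DIM('a) \<and> \<Inter>S \<inter> ball q \<rho> \<noteq> {})"
proof -
  let ?F = "X \<inter> hitting (cball q \<rho>)"
  have eq: "emeasure (intersection_measure DIM('a) X) (ball q \<rho>) = ennreal (1 / fact DIM('a)) *
      (\<Sum>Hs\<in>tuples DIM('a) ?F. hausdorff_measure (DIM('a) - DIM('a)) (ball q \<rho> \<inter> \<Inter>(set Hs)))"
    by (rule emeasure_intersection_measure_bounded[OF X _ ball_subset_cball fin]) auto
  have finT: "finite (tuples DIM('a) ?F)" by (intro finite_tuples fin) simp
  have pos: "hausdorff_measure 0 A \<noteq> 0 \<longleftrightarrow> A \<noteq> {}" for A :: "'a set"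
  proof
    assume "A \<noteq> {}"
    then obtain x where "x \<in> A" by blast
    from hausdorff_measure_0_pos[OF this] show "hausdorff_measure 0 A \<noteq> 0" by auto
  qed auto
  have "0 < emeasure (intersection_measure DIM('a) X) (ball q \<rho>) \<longleftrightarrow>
      (\<exists>Hs\<in>tuples DIM('a) ?F. ball q \<rho> \<inter> \<Inter>(set Hs) \<noteq> {})"
    unfolding eq using finT by (simp add: zero_less_iff_neq_zero pos)
  also have "\<dots> \<longleftrightarrow> (\<exists>S\<subseteq>X. finite S \<and> card S = DIM('a) \<and> \<Inter>S \<inter> ball q \<rho> \<noteq> {})"
  proof
    assume "\<exists>Hs\<in>tuples DIM('a) ?F. ball q \<rho> \<inter> \<Inter>(set Hs) \<noteq> {}"
    then obtain Hs where "Hs \<in> tuples DIM('a) ?F" "ball q \<rho> \<inter> \<Inter>(set Hs) \<noteq> {}" by blast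
    then show "\<exists>S\<subseteq>X. finite S \<and> card S = DIM('a) \<and> \<Inter>S \<inter> ball q \<rho> \<noteq> {}"
      by (intro exI[of _ "set Hs"]) (auto simp: tuples_def distinct_card)
  next
    assume "\<exists>S\<subseteq>X. finite S \<and> card S = DIM('a) \<and> \<Inter>S \<inter> ball q \<rho> \<noteq> {}"
    then obtain S p where S: "S \<subseteq> X" "finite S" "card S = DIM('a)" and p: "p \<in> \<Inter>S" "p \<in> ball q \<rho>" by auto
    obtain Hs where Hs: "set Hs = S" "distinct Hs" using finite_distinct_list[OF S(2)] by blast
    have "S \<subseteq> hitting (cball q \<rho>)" using S(1) X p by (auto simp: hitting_def)
    then have "Hs \<in> tuples DIM('a) ?F" using S Hs by (auto simp: tuples_def distinct_card[symmetric])
    then show "\<exists>Hs\<in>tuples DIM('a) ?F. ball q \<rho> \<inter> \<Inter>(set Hs) \<noteq> {}" using p Hs by blast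
  qed
  finally show ?thesis .
qed

text \<open>The open ball is exhausted by closed balls, to which \<open>common_point_iff\<close>
  applies; thus counts alone place the event in \<open>sets M\<close>.\<close>

lemma (in poisson_hyperplanes) sets_charged:
  "{\<omega>\<in>space M. 0 < emeasure (intersection_measure DIM('a) (\<eta> \<omega>)) (ball q \<rho>)} \<in> sets M"
proof -
  obtain D :: "'a set" where D: "countable D" "\<And>O'. open O' \<Longrightarrow> O' \<noteq> {} \<Longrightarrow> \<exists>d\<in>D. d \<in> O'"
    using countable_dense_exists by blast
  have ball: "ball q \<rho> = (\<Union>j. cball q (\<rho> - 1 / real (Suc j)))"
  proof (intro equalityI subsetI)
    fix x assume "x \<in> ball q \<rho>"
    then obtain j where "1 / real (Suc j) < \<rho> - dist q x" using nat_approx_posE[of "\<rho> - dist q x"] by auto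
    then show "x \<in> (\<Union>j. cball q (\<rho> - 1 / real (Suc j)))" by (intro UN_I[of j]) auto
  next
    fix x assume "x \<in> (\<Union>j. cball q (\<rho> - 1 / real (Suc j)))"
    then obtain j where "dist q x \<le> \<rho> - 1 / real (Suc j)" by auto
    moreover have "0 < 1 / real (Suc j)" by simp
    ultimately have "dist q x < \<rho>" by linarith
    then show "x \<in> ball q \<rho>" by simp
  qed
  have "0 < emeasure (intersection_measure DIM('a) (\<eta> \<omega>)) (ball q \<rho>) \<longleftrightarrow>
      (\<exists>j. \<forall>N. \<exists>c\<in>D. dist q c \<le> \<rho> - 1 / real (Suc j) + 1 / real (Suc N) \<and>
        of_nat DIM('a) \<le> point_count (\<eta> \<omega>) (hitting (cball c (1 / real (Suc N)))))" (is "_ \<longleftrightarrow> ?R \<omega>")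
    if \<omega>: "\<omega> \<in> space M" for \<omega>
  proof -
    have "0 < emeasure (intersection_measure DIM('a) (\<eta> \<omega>)) (ball q \<rho>) \<longleftrightarrow>
      (\<exists>j. \<exists>S\<subseteq>\<eta> \<omega>. finite S \<and> card S = DIM('a) \<and> \<Inter>S \<inter> cball q (\<rho> - 1 / real (Suc j)) \<noteq> {})"
    proof -
      have "T \<inter> ball q \<rho> \<noteq> {} \<longleftrightarrow> (\<exists>j. T \<inter> cball q (\<rho> - 1 / real (Suc j)) \<noteq> {})" for T unfolding ball by auto
      then show ?thesis
        by (simp only: emeasure_vertices_pos_iff[OF eta_hyperplanes[OF \<omega>] finite_hitting[OF \<omega>]]) blast
    qed
    moreover have "(\<exists>S\<subseteq>\<eta> \<omega>. finite S \<and> card S = DIM('a) \<and> \<Inter>S \<inter> cball q s \<noteq> {}) \<longleftrightarrow>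
      (\<forall>N. \<exists>c\<in>D. dist q c \<le> s + 1 / real (Suc N) \<and>
        of_nat DIM('a) \<le> point_count (\<eta> \<omega>) (hitting (cball c (1 / real (Suc N)))))" for s
      by (rule common_point_iff[OF eta_hyperplanes[OF \<omega>] finite_hitting[OF \<omega>] D(2)])
    ultimately show ?thesis by simp
  qed
  then have eq: "{\<omega>\<in>space M. 0 < emeasure (intersection_measure DIM('a) (\<eta> \<omega>)) (ball q \<rho>)} = {\<omega>\<in>space M. ?R \<omega>}"
    by blast
  have m: "{\<omega>\<in>space M. of_nat DIM('a) \<le> point_count (\<eta> \<omega>) (hitting (cball c s))} \<in> sets M" for c s
  proof -
    have [measurable]: "(\<lambda>\<omega>. point_count (\<eta> \<omega>) (hitting (cball c s))) \<in> borel_measurable M"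
      by (intro measurable_point_count) simp
    show ?thesis by measurable
  qed
  show ?thesis unfolding eq
    by (intro sets.sets_Collect_countable_All sets.sets_Collect_countable_Ex sets.sets_Collect_countable_Ex'[OF _ D(1)]
        sets.sets_Collect_conj sets.sets_Collect_const m)
qed

locale framed_process = poisson_hyperplanes M \<eta> Q \<gamma> + frame U e
  for M :: "'w measure" and \<eta> :: "'w \<Rightarrow> 'a::euclidean_space set set" and Q :: "'a measure" and \<gamma> and U :: "'a set" and e +
  fixes D :: "'a set" and r :: real
  assumes D: "countable D" "\<And>O'. open O' \<Longrightarrow> O' \<noteq> {} \<Longrightarrow> \<exists>d\<in>D. d \<in> O'"
    and support: "\<And>u \<delta>. u \<in> U \<Longrightarrow> 0 < \<delta> \<Longrightarrow> 0 < measure Q (sphere 0 1 \<inter> ball u \<delta>)"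
    and r: "0 < r" and dim: "2 \<le> DIM('a)"
begin

abbreviation \<Phi> where "\<Phi> \<omega> \<equiv> intersection_measure DIM('a) (\<eta> \<omega>)"

definition charged :: "'a measure \<Rightarrow> 'a \<Rightarrow> nat \<Rightarrow> bool" where
  "charged \<mu> q k \<longleftrightarrow> 0 < emeasure \<mu> (ball q (1 / real (Suc k)))"

text \<open>Formulated for the restricted measure, so that it makes sense for every
  \<open>\<omega>\<close> and depends on the annulus only.\<close>

definition good :: "real \<Rightarrow> 'w set" where
  "good n = {\<omega>\<in>space M. \<forall>b\<in>{1, 2, 3}. obs D (charged (meas_restr (\<Phi> \<omega>) (annulus r n))) n b}"

lemma closed_annulus: "closed (annulus r n)"
proof -
  have "annulus r n = cball 0 (n * R0) - ball 0 r" by (auto simp: annulus_def)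
  then show ?thesis by (simp add: closed_Diff)
qed

text \<open>For \<open>n \<ge> 2 * (r + 1)\<close> the tested balls lie inside the annulus, so the
  restriction may be dropped and \<open>sets_charged\<close> applies. Probabilities need this; the
  stopping property needs the sigma-field of the restricted measure, treated next.\<close>

lemma sets_good: 
  assumes n: "2 * (r + 1) \<le> n"
  shows "good n \<in> sets M"
proof -
  have "{\<omega>\<in>space M. obs D (charged (meas_restr (\<Phi> \<omega>) (annulus r n))) n b} \<in> sets M" if b: "b \<in> {1, 2, 3}" for b
  proof (rule sets_obs[OF D(1) b])
    fix q k assume q: "near_grid n q"
    have "ball q (1 / real (Suc k)) \<subseteq> annulus r n"
    proof
      fix y assume y: "y \<in> ball q (1 / real (Suc k))"
      have "1 / real (Suc k) \<le> 1" by simp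
      moreover have "norm (y - q) < 1 / real (Suc k)" using y unfolding mem_ball by (simp only: dist_norm norm_minus_commute)
      ultimately have "norm (y - q) \<le> 1" by linarith
      then show "y \<in> annulus r n" by (rule near_grid_annulus[OF q n r])
    qed
    then have "ball q (1 / real (Suc k)) \<inter> annulus r n = ball q (1 / real (Suc k))" by blast
    then have "charged (meas_restr (\<Phi> \<omega>) (annulus r n)) q k \<longleftrightarrow> 0 < emeasure (\<Phi> \<omega>) (ball q (1 / real (Suc k)))" for \<omega>
      unfolding charged_def using closed_annulus by (simp add: emeasure_meas_restr)
    then show "{\<omega>\<in>space M. charged (meas_restr (\<Phi> \<omega>) (annulus r n)) q k} \<in> sets M"
      using sets_charged[of q "1 / real (Suc k)"] by simp
  qed
  then show ?thesis unfolding good_def by (intro sets.sets_Collect_finite_All) auto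
qed

lemma sets_good_restr: "good n \<in> sets (sigma_restr M \<Phi> (annulus r n))"
proof -
  have "{\<mu>\<in>space borel_measures. obs D (charged \<mu>) n b} \<in> sets borel_measures" if b: "b \<in> {1, 2, 3}" for b
  proof (rule sets_obs[OF D(1) b])
    fix q :: 'a and k
    have [measurable]: "(\<lambda>\<mu>. emeasure \<mu> (ball q (1 / real (Suc k)))) \<in> borel_measurable borel_measures" by simp
    show "{\<mu>\<in>space borel_measures. charged \<mu> q k} \<in> sets borel_measures" unfolding charged_def by measurable
  qed
  then have "{\<mu>\<in>space borel_measures. \<forall>b\<in>{1, 2, 3}. obs D (charged \<mu>) n b} \<in> sets borel_measures" (is "?S \<in> _")
    by (intro sets.sets_Collect_finite_All) auto
  then have "(\<lambda>\<omega>. meas_restr (\<Phi> \<omega>) (annulus r n)) -` ?S \<inter> space M \<in> sets (sigma_restr M \<Phi> (annulus r n))"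
    unfolding sigma_restr_def by (rule in_vimage_algebra)
  also have "(\<lambda>\<omega>. meas_restr (\<Phi> \<omega>) (annulus r n)) -` ?S \<inter> space M = good n"
    by (auto simp: good_def space_borel_measures)
  finally show ?thesis .
qed

lemma generic_planes_eta: "\<omega> \<in> space M \<Longrightarrow> generic (\<eta> \<omega>) \<Longrightarrow> generic_planes (\<eta> \<omega>)"
  using eta_hyperplanes finite_hitting by (simp add: generic_planes_def)

lemma framed_planes_eta: "\<omega> \<in> space M \<Longrightarrow> generic (\<eta> \<omega>) \<Longrightarrow> framed_planes U e (\<eta> \<omega>)"
  using generic_planes_eta frame_axioms by (simp add: framed_planes_def)

lemma bounded_annulus: "bounded (annulus r n)"
  unfolding bounded_iff annulus_def by blast

lemma emeasure_points_pos_iff: 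
  assumes "finite V" "C \<in> sets borel"
  shows "0 < emeasure (points V) C \<longleftrightarrow> V \<inter> C \<noteq> {}"
  using assms by (simp add: emeasure_points card_gt_0_iff zero_less_iff_neq_zero Int_commute)

lemma good_determined:
  assumes \<omega>: "\<omega> \<in> good n" "generic (\<eta> \<omega>)" and n: "1 \<le> n" "2 * r \<le> n" and B: "B \<in> sets borel" "B \<subseteq> ball 0 r"
  shows "vertex_measure B (meas_restr (\<Phi> \<omega>) (annulus r n)) = meas_restr (\<Phi> \<omega>) B"
proof -
  have \<omega>M: "\<omega> \<in> space M" using \<omega> by (simp add: good_def)
  interpret framed_planes U e "\<eta> \<omega>" by (rule framed_planes_eta[OF \<omega>M \<omega>(2)])
  have ann: "annulus r n \<in> sets borel" using closed_annulus by simp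
  note V = meas_restr_vertices[OF ann bounded_annulus]
  have "frame_at verts n eps b" if b: "b \<in> {1, 2, 3}" for b
  proof -
    have "frame_at (verts \<inter> annulus r n) n eps b"
    proof (rule obs_frame[OF V(2) _ n(1) b])
      show "obs D (charged (points (verts \<inter> annulus r n))) n b" using \<omega>(1) b V(1) unfolding good_def by auto
      fix q N assume "charged (points (verts \<inter> annulus r n)) q N"
      then show "\<exists>v\<in>verts \<inter> annulus r n. dist q v < 1 / real (Suc N)"
        unfolding charged_def using emeasure_points_pos_iff[OF V(2), of "ball q (1 / real (Suc N))"] by auto
    qed
    then show ?thesis unfolding frame_at_def by blast
  qed
  from framed_certified[OF n r this] have "certified r (annulus r n)" .
  moreover have "bounded B" using B(2) bounded_subset by blast
  ultimately show ?thesis using ann bounded_annulus B dim by (intro vertex_measure_restr) auto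
qed

text \<open>The frames obtained from cells use only vertices near the scaled grid, hence inside the
  annulus, so they survive the restriction.\<close>

lemma cells_good:
  assumes \<omega>: "\<omega> \<in> space M" "generic (\<eta> \<omega>)" and n: "2 * (r + 1) \<le> n"
    and cells: "\<And>u b. u \<in> U \<Longrightarrow> b \<in> {1, 2, 3} \<Longrightarrow> \<eta> \<omega> \<inter> cell n u b \<noteq> {}"
  shows "\<omega> \<in> good n"
proof -
  interpret framed_planes U e "\<eta> \<omega>" by (rule framed_planes_eta[OF \<omega>])
  have n1: "1 \<le> n" using n r by simp
  have ann: "annulus r n \<in> sets borel" using closed_annulus by simp
  note V = meas_restr_vertices[OF ann bounded_annulus]
  have "obs D (charged (points (verts \<inter> annulus r n))) n b" if b: "b \<in> {1, 2, 3}" for b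
  proof (rule frame_obs[OF D(2) _ n1])
    have half: "norm x \<le> n * (eps / 2) \<Longrightarrow> norm x \<le> n * eps" for x :: 'a
    proof -
      have "n * (eps / 2) \<le> n * eps" using n1 eps_bounds(1) by (intro mult_left_mono) auto
      then show "norm x \<le> n * (eps / 2) \<Longrightarrow> norm x \<le> n * eps" by linarith
    qed
    have near: "v \<in> annulus r n" if "near_grid n v" for v using near_grid_annulus[OF that n r, of v] by simp
    have "v \<in> annulus r n" if "norm (v - n *\<^sub>R grid (\<lambda>_. b)) \<le> n * (eps / 2)" for v
      by (rule near[OF near_gridI(1)[OF b half[OF that]]])
    moreover have "v \<in> annulus r n" if "norm (v - spot n b u (next1 b)) \<le> n * (eps / 2)" for u v
      by (rule near[OF near_gridI(2)[OF b half[OF that]]])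
    moreover have "v \<in> annulus r n" if "norm (v - spot n b u (next2 b)) \<le> n * (eps / 2)" for u v
      by (rule near[OF near_gridI(3)[OF b half[OF that]]])
    moreover have "frame_at verts n (eps / 2) b" by (rule cells_framed[OF n1 cells b])
    ultimately show "frame_at (verts \<inter> annulus r n) n (eps / 2) b" unfolding frame_at_def by fast
    fix q N v assume "v \<in> verts \<inter> annulus r n" "dist q v < 1 / real (Suc N)"
    then show "charged (points (verts \<inter> annulus r n)) q N"
      unfolding charged_def using emeasure_points_pos_iff[OF V(2), of "ball q (1 / real (Suc N))"] by auto
  qed
  then show ?thesis using V(1) \<omega>(1) by (simp add: good_def)
qed

section \<open>The probability that a scale fails\<close>

lemma sets_cell [measurable]: "cell n u b \<in> sets hyperplane_space"
proof -
  have "{H\<in>space hyperplane_space. \<alpha> u = b \<longrightarrow> H \<in> hitting (cball (n *\<^sub>R grid \<alpha>) (n * eps0))} \<in> sets hyperplane_space" for \<alpha>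
  proof (cases "\<alpha> u = b")
    case True
    have "{H\<in>space hyperplane_space. H \<in> hitting (cball (n *\<^sub>R grid \<alpha>) (n * eps0))} = hitting (cball (n *\<^sub>R grid \<alpha>) (n * eps0))"
      by (auto simp: hitting_def)
    then show ?thesis using True by simp
  next
    case False
    then show ?thesis using sets.top[of hyperplane_space] by simp
  qed
  then have "{H\<in>space hyperplane_space. \<forall>\<alpha>\<in>grids. \<alpha> u = b \<longrightarrow> H \<in> hitting (cball (n *\<^sub>R grid \<alpha>) (n * eps0))} \<in> sets hyperplane_space"
    by (intro sets.sets_Collect_finite_All finite_grids)
  then show ?thesis by (simp add: cell_def)
qed

lemma cell_finite:
  assumes "b \<in> {1, 2, 3}" "u \<in> U"
  shows "emeasure (hyperplane_intensity \<gamma> Q) (cell n u b) < \<infinity>"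
proof -
  define \<alpha> where "\<alpha> = (\<lambda>_\<in>U. b)"
  have \<alpha>: "\<alpha> \<in> grids" "\<alpha> u = b" using assms by (auto simp: \<alpha>_def grids_def)
  have "cball (n *\<^sub>R grid \<alpha>) (n * eps0) \<subseteq> cball 0 (norm (n *\<^sub>R grid \<alpha>) + n * eps0)"
  proof
    fix x assume "x \<in> cball (n *\<^sub>R grid \<alpha>) (n * eps0)"
    then show "x \<in> cball 0 (norm (n *\<^sub>R grid \<alpha>) + n * eps0)"
      using dist_triangle[of 0 x "n *\<^sub>R grid \<alpha>"] unfolding mem_cball dist_0_norm by linarith
  qed
  then have "cell n u b \<subseteq> hitting (cball 0 (norm (n *\<^sub>R grid \<alpha>) + n * eps0))"
    using \<alpha> by (auto simp: cell_def hitting_def)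
  then have "emeasure (hyperplane_intensity \<gamma> Q) (cell n u b)
      \<le> emeasure (hyperplane_intensity \<gamma> Q) (hitting (cball 0 (norm (n *\<^sub>R grid \<alpha>) + n * eps0)))"
    by (intro emeasure_mono) auto
  also have "\<dots> < \<infinity>" by (rule intensity_cball_finite)
  finally show ?thesis .
qed

text \<open>Turning \<open>u\<close> by at most \<open>tilt\<close> changes its product with a point
  of norm at most \<open>3 * E * n\<close> by at most \<open>n * eps0 / 2\<close>; the other half of
  the tolerance is left for the offset.\<close>

definition tilt where "tilt = eps0 / (6 * E)"

lemma hyperplane_in_cell:
  assumes n: "0 < n" and u: "u \<in> U" and w: "w \<in> sphere 0 1 \<inter> ball u tilt" and s: "\<bar>s - n * b\<bar> \<le> n * eps0 / 2"
  shows "hyperplane w s \<in> cell n u b"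
proof -
  have hyp: "hyperplane w s \<in> hyperplanes" using w by (auto simp: hyperplanes_def)
  have "hyperplane w s \<in> hitting (cball (n *\<^sub>R grid \<alpha>) (n * eps0))" if \<alpha>: "\<alpha> \<in> grids" "\<alpha> u = b" for \<alpha>
  proof -
    define p where "p = n *\<^sub>R grid \<alpha>"
    define y where "y = p + (s - p \<bullet> w) *\<^sub>R w"
    have w1: "norm w = 1" "norm (u - w) \<le> tilt" using w by (auto simp: dist_norm)
    have "w \<bullet> w = 1" using w1(1) by (simp add: dot_square_norm)
    then have "y \<in> hyperplane w s" by (simp add: y_def hyperplane_def inner_add_left)
    moreover have "dist p y \<le> n * eps0"
    proof -
      have "norm (grid \<alpha>) \<le> 3 * E" 
      proof (rule norm_grid)
        fix v assume "v \<in> U"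
        then have "\<alpha> v \<in> {1, 2, 3}" using \<alpha>(1) by (auto simp: grids_def)
        then show "\<bar>\<alpha> v\<bar> \<le> 3" by auto
      qed
      then have "norm p \<le> n * (3 * E)" using n by (simp add: p_def)
      then have "norm p * norm (u - w) \<le> n * (3 * E) * tilt" using w1(2) n E_ge_1 by (intro mult_mono) auto
      also have "\<dots> = n * eps0 / 2" using E_ge_1 by (simp add: tilt_def)
      finally have "\<bar>p \<bullet> (u - w)\<bar> \<le> n * eps0 / 2" using Cauchy_Schwarz_ineq2[of p "u - w"] by linarith
      moreover have "p \<bullet> u = n * b" using \<alpha>(2) u by (simp add: p_def grid_inner)
      ultimately have "\<bar>n * b - p \<bullet> w\<bar> \<le> n * eps0 / 2" by (simp add: inner_diff_right)
      then have "\<bar>s - p \<bullet> w\<bar> \<le> n * eps0" using s by linarith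
      moreover have "dist p y = \<bar>s - p \<bullet> w\<bar>" using w1(1) by (simp add: y_def dist_norm)
      ultimately show ?thesis by simp
    qed
    ultimately show ?thesis using hyp by (auto simp: hitting_def p_def)
  qed
  then show ?thesis using hyp by (simp add: cell_def)
qed

text \<open>Directions in a fixed neighbourhood of \<open>u\<close> and offsets in an interval of
  length \<open>n * eps0\<close> give hyperplanes of the cell. The growth is linear in
  \<open>n\<close> because the admissible tilt does not shrink.\<close>

lemma cell_intensity:
  assumes n: "0 < n" and u: "u \<in> U" and b: "b \<in> {1, 2, 3}"
  shows "\<gamma> * eps0 * measure Q (sphere 0 1 \<inter> ball u tilt) * n \<le> measure (hyperplane_intensity \<gamma> Q) (cell n u b)"
proof -
  interpret Q: prob_space Q using Q unfolding directional_distribution_def by blast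
  let ?A = "sphere 0 1 \<inter> ball u tilt"
  have A: "?A \<in> sets Q" unfolding sets_Q sets_restrict_space by (rule imageI) simp
  have "ennreal (n * eps0) * indicator ?A w \<le> emeasure lborel {s. hyperplane w s \<in> cell n u b}" if "w \<in> space Q" for w
  proof (cases "w \<in> ?A")
    case True
    have "{n * b - n * eps0 / 2..n * b + n * eps0 / 2} \<subseteq> {s. hyperplane w s \<in> cell n u b}"
    proof
      fix s assume "s \<in> {n * b - n * eps0 / 2..n * b + n * eps0 / 2}"
      then have "\<bar>s - n * b\<bar> \<le> n * eps0 / 2" unfolding atLeastAtMost_iff by linarith
      then show "s \<in> {s. hyperplane w s \<in> cell n u b}" using hyperplane_in_cell[OF n u True] by simp
    qed
    moreover have "{s. hyperplane w s \<in> cell n u b} \<in> sets lborel"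
    proof -
      have "(\<lambda>s. hyperplane w s) \<in> measurable lborel hyperplane_space"
        using measurable_compose[OF measurable_Pair1'[OF that] measurable_hyperplane[OF sets_Q]] by simp
      from measurable_sets[OF this sets_cell] show ?thesis by (simp add: vimage_def)
    qed
    ultimately have "emeasure lborel {n * b - n * eps0 / 2..n * b + n * eps0 / 2} \<le> emeasure lborel {s. hyperplane w s \<in> cell n u b}"
      by (rule emeasure_mono)
    then show ?thesis using True n eps0_bounds(1) by simp
  qed simp
  then have "(\<integral>\<^sup>+w. ennreal (n * eps0) * indicator ?A w \<partial>Q) \<le> (\<integral>\<^sup>+w. emeasure lborel {s. hyperplane w s \<in> cell n u b} \<partial>Q)"
    by (rule nn_integral_mono)
  then have "ennreal \<gamma> * (ennreal (n * eps0) * emeasure Q ?A) \<le> emeasure (hyperplane_intensity \<gamma> Q) (cell n u b)"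
    using A by (subst emeasure_hyperplane_intensity[OF sets_Q sets_cell])
      (simp add: nn_integral_cmult mult_left_mono)
  also have "\<dots> = ennreal (measure (hyperplane_intensity \<gamma> Q) (cell n u b))"
    using cell_finite[OF b u, of n] by (intro emeasure_eq_ennreal_measure) simp
  finally have "ennreal (\<gamma> * (n * eps0 * measure Q ?A)) \<le> ennreal (measure (hyperplane_intensity \<gamma> Q) (cell n u b))"
    using \<gamma> n eps0_bounds(1) by (simp add: Q.emeasure_eq_measure ennreal_mult[symmetric] del: ennreal_le_iff)
  then show ?thesis by (simp add: ennreal_le_iff mult_ac)
qed

lemma prob_cell_empty:
  assumes u: "u \<in> U" and b: "b \<in> {1, 2, 3}"
  shows "{\<omega>\<in>space M. \<eta> \<omega> \<inter> cell n u b = {}} \<in> sets M"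
    "prob {\<omega>\<in>space M. \<eta> \<omega> \<inter> cell n u b = {}} = exp (- measure (hyperplane_intensity \<gamma> Q) (cell n u b))"
proof -
  have c: "cell n u b \<in> sets (hyperplane_intensity \<gamma> Q)" by simp
  have "{\<omega>\<in>space M. \<eta> \<omega> \<inter> cell n u b = {}} = {\<omega>\<in>space M. point_count (\<eta> \<omega>) (cell n u b) = of_nat 0}"
    by (auto simp: point_count_def emeasure_count_space_eq_0)
  moreover have [measurable]: "(\<lambda>\<omega>. point_count (\<eta> \<omega>) (cell n u b)) \<in> borel_measurable M" using c by (rule measurable_point_count)
  moreover have "{\<omega>\<in>space M. point_count (\<eta> \<omega>) (cell n u b) = of_nat 0} \<in> sets M" by measurable
  ultimately show "{\<omega>\<in>space M. \<eta> \<omega> \<inter> cell n u b = {}} \<in> sets M"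
    "prob {\<omega>\<in>space M. \<eta> \<omega> \<inter> cell n u b = {}} = exp (- measure (hyperplane_intensity \<gamma> Q) (cell n u b))"
    using prob_point_count[OF c cell_finite[OF b u], of 0] by simp_all
qed

text \<open>Almost surely a scale fails only if one of the \<open>3 * d\<close> cells is empty, and
  an empty cell has probability \<open>exp\<close> of minus its intensity. The support condition
  makes \<open>\<kappa>\<close> positive.\<close>

lemma prob_not_good:
  "\<exists>\<kappa>>0. \<forall>n\<ge>2 * (r + 1). prob (space M - good n) \<le> 3 * DIM('a) * exp (- \<kappa> * n)"
proof -
  define k where "k u = \<gamma> * eps0 * measure Q (sphere 0 1 \<inter> ball u tilt)" for u
  define \<kappa> where "\<kappa> = Min (k ` U)"
  have tilt: "0 < tilt" using eps0_bounds(1) E_ge_1 by (simp add: tilt_def)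
  have kpos: "0 < k u" if "u \<in> U" for u using support[OF that tilt] \<gamma> eps0_bounds(1) by (simp add: k_def)
  have "U \<noteq> {}" using cardU DIM_positive[where 'a='a] by auto
  then have \<kappa>: "0 < \<kappa>" unfolding \<kappa>_def using kpos finU by (subst Min_gr_iff) auto
  have le: "\<kappa> \<le> k u" if "u \<in> U" for u unfolding \<kappa>_def using that finU by (intro Min_le) auto
  have "prob (space M - good n) \<le> 3 * DIM('a) * exp (- \<kappa> * n)" if n: "2 * (r + 1) \<le> n" for n
  proof -
    define F where "F p = {\<omega>\<in>space M. \<eta> \<omega> \<inter> cell n (fst p) (snd p) = {}}" for p
    let ?I = "U \<times> {1, 2, 3::real}"
    have n0: "0 < n" using n r by simp
    have F: "F p \<in> sets M" if "p \<in> ?I" for p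
      unfolding F_def using that by (intro prob_cell_empty(1)) auto
    have pF: "prob (F p) \<le> exp (- \<kappa> * n)" if p: "p \<in> ?I" for p
    proof -
      have up: "fst p \<in> U" "snd p \<in> {1, 2, 3}" using p by auto
      have "\<kappa> * n \<le> k (fst p) * n" using le[OF up(1)] n0 by (intro mult_right_mono) auto
      also have "\<dots> \<le> measure (hyperplane_intensity \<gamma> Q) (cell n (fst p) (snd p))"
        using cell_intensity[OF n0 up] by (simp add: k_def)
      finally show ?thesis unfolding F_def prob_cell_empty(2)[OF up] by simp
    qed
    have "AE \<omega> in M. \<omega> \<in> space M - good n \<longrightarrow> \<omega> \<in> (\<Union>p\<in>?I. F p)"
      using AE_generic
    proof (eventually_elim, intro impI)
      fix \<omega> assume g: "generic (\<eta> \<omega>)" and \<omega>: "\<omega> \<in> space M - good n"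
      then obtain u b where "u \<in> U" "b \<in> {1, 2, 3}" "\<eta> \<omega> \<inter> cell n u b = {}"
        using cells_good[of \<omega> n] n by auto
      then show "\<omega> \<in> (\<Union>p\<in>?I. F p)" using \<omega> by (intro UN_I[of "(u, b)"]) (auto simp: F_def)
    qed
    then have "prob (space M - good n) \<le> prob (\<Union>p\<in>?I. F p)"
      using F finU by (intro finite_measure_mono_AE sets.finite_UN) auto
    also have "\<dots> \<le> (\<Sum>p\<in>?I. prob (F p))"
      using F finU by (intro finite_measure_subadditive_finite) auto
    also have "\<dots> \<le> (\<Sum>p\<in>?I. exp (- \<kappa> * n))" using pF by (rule sum_mono)
    also have "\<dots> = 3 * DIM('a) * exp (- \<kappa> * n)" by (simp add: card_cartesian_product cardU)
    finally show ?thesis .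
  qed
  then show ?thesis using \<kappa> by blast
qed

end

text \<open>If the support lay in a linear hyperplane \<open>L\<close>, the rest of the sphere would
  be covered by countably many null balls by Lindelof's theorem, and \<open>Q\<close> would be
  concentrated on a great subsphere.\<close>

lemma (in poisson_hyperplanes) support_frame:
  "\<exists>U e. frame U e \<and> (\<forall>u\<in>U. \<forall>\<delta>>0. 0 < measure Q (sphere 0 1 \<inter> ball u \<delta>))"
proof -
  interpret Q: prob_space Q using Q unfolding directional_distribution_def by blast
  define S where "S = {u\<in>sphere 0 1. \<forall>\<delta>>0. 0 < measure Q (sphere 0 1 \<inter> ball u \<delta>)}"
  have borelQ: "sphere 0 1 \<inter> A \<in> sets Q" if "A \<in> sets borel" for A
    unfolding sets_Q sets_restrict_space using that by (rule imageI)
  have "dim S = DIM('a)"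
  proof (rule ccontr)
    assume "dim S \<noteq> DIM('a)"
    then have "dim S < DIM('a)" using dim_subset_UNIV[of S] by linarith
    then obtain a where a: "a \<noteq> 0" "span S \<subseteq> {x. a \<bullet> x = 0}" using lowdim_subset_hyperplane by blast
    define L where "L = {x. a \<bullet> x = 0}"
    have SL: "S \<subseteq> L" using a(2) span_superset[of S] by (auto simp: L_def)
    define F where "F = {ball u \<delta> | u \<delta>. measure Q (sphere 0 1 \<inter> ball u \<delta>) = 0}"
    have cov: "sphere 0 1 - L \<subseteq> sphere 0 1 \<inter> \<Union>F"
    proof
      fix u assume u: "u \<in> sphere 0 1 - L"
      then have "u \<notin> S" using SL by blast
      then obtain \<delta> where \<delta>: "0 < \<delta>" "\<not> 0 < measure Q (sphere 0 1 \<inter> ball u \<delta>)" using u by (auto simp: S_def)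
      then have "measure Q (sphere 0 1 \<inter> ball u \<delta>) = 0" using measure_nonneg[of Q "sphere 0 1 \<inter> ball u \<delta>"] by linarith
      then have "ball u \<delta> \<in> F" by (auto simp: F_def)
      moreover have "u \<in> ball u \<delta>" using \<delta> by simp
      ultimately show "u \<in> sphere 0 1 \<inter> \<Union>F" using u by blast
    qed
    have "\<And>A. A \<in> F \<Longrightarrow> open A" by (auto simp: F_def)
    then obtain F' where F': "F' \<subseteq> F" "countable F'" "\<Union>F' = \<Union>F" using Lindelof[of F] by blast
    have "sphere 0 1 \<inter> A \<in> null_sets Q" if A: "A \<in> F'" for A
    proof -
      obtain u \<delta> where A': "A = ball u \<delta>" "measure Q (sphere 0 1 \<inter> ball u \<delta>) = 0" using A F'(1) by (auto simp: F_def)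
      then have "emeasure Q (sphere 0 1 \<inter> A) = 0" by (simp add: Q.emeasure_eq_measure)
      then show ?thesis using borelQ[of A] A'(1) by (intro null_setsI) auto
    qed
    then have "(\<Union>A\<in>F'. sphere 0 1 \<inter> A) \<in> null_sets Q" using F'(2) by (intro null_sets_UN') auto
    moreover have "(\<Union>A\<in>F'. sphere 0 1 \<inter> A) = sphere 0 1 \<inter> \<Union>F" using F'(3) by blast
    ultimately have null: "sphere 0 1 \<inter> \<Union>F \<in> null_sets Q" by simp
    have L: "L \<in> sets borel" unfolding L_def by (intro borel_closed closed_hyperplane)
    have "sphere 0 1 - L = sphere 0 1 \<inter> - L" by blast
    then have "sphere 0 1 - L \<in> sets Q" using borelQ[of "- L"] L by (simp add: Compl_eq_Diff_UNIV)
    then have "sphere 0 1 - L \<in> null_sets Q" using null_sets_subset[OF null _ cov] by blast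
    then have "emeasure Q (sphere 0 1 \<inter> L \<union> (sphere 0 1 - L)) = emeasure Q (sphere 0 1 \<inter> L)"
      using borelQ[OF L] by (intro emeasure_Un_null_set)
    moreover have "sphere 0 1 \<inter> L \<union> (sphere 0 1 - L) = sphere 0 1" by blast
    ultimately have "emeasure Q (sphere 0 1 \<inter> L) = 1" using emeasure_Q by simp
    moreover have "subspace L" "dim L = DIM('a) - 1"
      unfolding L_def using subspace_hyperplane dim_hyperplane[OF a(1)] by auto
    ultimately show False using Q unfolding directional_distribution_def by blast
  qed
  then have "span S = UNIV" by (simp add: dim_eq_full)
  moreover obtain U where U: "U \<subseteq> S" "independent U" "S \<subseteq> span U" using maximal_independent_subset by metis
  ultimately have "span U = UNIV" by (metis span_mono span_span top.extremum_unique)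
  moreover have "norm u = 1" if "u \<in> U" for u using that U(1) by (auto simp: S_def)
  ultimately obtain e where "frame U e" using frame_exists[OF U(2)] by blast
  then show ?thesis using U(1) by (intro exI[of _ U] exI[of _ e]) (auto simp: S_def)
qed

lemma origin_radius_less: "ereal s < origin_radius F \<Longrightarrow> 0 \<le> t \<Longrightarrow> F \<subseteq> cball 0 t \<Longrightarrow> s < t"
  unfolding origin_radius_def
proof -
  assume s: "ereal s < (INF r\<in>{r. 0 \<le> r \<and> F \<subseteq> cball 0 r}. ereal r)" and t: "0 \<le> t" "F \<subseteq> cball 0 t"
  have "(INF r\<in>{r. 0 \<le> r \<and> F \<subseteq> cball 0 r}. ereal r) \<le> ereal t" using t by (intro INF_lower) auto
  then have "ereal s < ereal t" using s by (rule less_le_trans[rotated])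
  then show "s < t" by simp
qed

context framed_process
begin

text \<open>The scales start where \<open>near_grid_annulus\<close> applies; their unit spacing
  costs only a factor \<open>exp \<kappa>\<close> in the tail.\<close>

definition scale :: "nat \<Rightarrow> real" where "scale i = real (nat \<lceil>2 * (r + 1)\<rceil> + i)"

lemma scale_ge: "2 * (r + 1) \<le> scale i"
proof -
  have "2 * (r + 1) \<le> real (nat \<lceil>2 * (r + 1)\<rceil>)" by (rule of_nat_ceiling)
  then show ?thesis by (simp add: scale_def)
qed

lemma scale_ge_1: "1 \<le> scale i"
  using scale_ge[of i] r by simp

text \<open>All annuli share the inner radius \<open>r\<close>, so they increase with the scale, as
  \<open>stopping_set_first_of\<close> demands.\<close>

definition Z :: "'w \<Rightarrow> 'a set" where
  "Z = first_of (\<lambda>i. good (scale i)) (\<lambda>i. annulus r (scale i)) (- ball 0 r)"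

lemma annulus_sub: "annulus r n \<subseteq> - ball 0 r"
  by (auto simp: annulus_def)

lemma incseq_annulus: "incseq (\<lambda>i. annulus r (scale i))"
proof (rule incseq_SucI)
  fix i
  have "scale i * R0 \<le> scale (Suc i) * R0" using R0_ge(2) by (intro mult_right_mono) (auto simp: scale_def)
  then show "annulus r (scale i) \<subseteq> annulus r (scale (Suc i))" by (auto simp: annulus_def)
qed

lemma annulus_nonempty: "annulus r (scale i) \<noteq> {}"
proof -
  obtain x :: 'a where x: "norm x = r" using vector_choose_size[of r] r by auto
  have "scale i * 1 \<le> scale i * R0" using R0_ge(2) scale_ge_1[of i] by (intro mult_left_mono) auto
  moreover have "r \<le> scale i" using scale_ge[of i] r by simp
  ultimately have "r \<le> scale i * R0" by simp
  then have "x \<in> annulus r (scale i)" using x by (simp add: annulus_def)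
  then show ?thesis by blast
qed

lemma stopping_set_Z: "stopping_set M \<Phi> Z"
  unfolding Z_def
proof (rule stopping_set_first_of)
  show "good (scale i) \<in> sets (sigma_restr M \<Phi> (annulus r (scale i)))" for i by (rule sets_good_restr)
  show "annulus r (scale i) \<noteq> {}" for i by (rule annulus_nonempty)
  show "annulus r (scale i) \<subseteq> - ball 0 r" for i by (rule annulus_sub)
qed (simp_all add: closed_annulus incseq_annulus closed_Compl)

lemma Z_sub: "Z \<omega> \<subseteq> - ball 0 r"
  using annulus_sub by (auto simp: Z_def first_of_def split: if_splits)

lemma AE_good: "AE \<omega> in M. \<exists>i. \<omega> \<in> good (scale i)"
proof -
  obtain \<kappa> where \<kappa>: "0 < \<kappa>" "\<And>n. 2 * (r + 1) \<le> n \<Longrightarrow> prob (space M - good n) \<le> 3 * DIM('a) * exp (- \<kappa> * n)"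
    using prob_not_good by blast
  have sets: "good (scale i) \<in> sets M" for i by (rule sets_good[OF scale_ge])
  let ?N = "space M - (\<Union>i. good (scale i))"
  have N: "?N \<in> sets M" using sets by blast
  have "prob ?N \<le> 0"
  proof (rule field_le_epsilon)
    fix x :: real assume x: "0 < x"
    have "(\<lambda>i. exp (- \<kappa>) ^ i) \<longlonglongrightarrow> 0" using \<kappa>(1) by (intro LIMSEQ_power_zero) simp
    then have "(\<lambda>i. 3 * DIM('a) * exp (- \<kappa> * real i)) \<longlonglongrightarrow> 0"
      unfolding exp_of_nat2_mult by (rule tendsto_mult_right_zero)
    then have "\<forall>\<^sub>F i in sequentially. 3 * DIM('a) * exp (- \<kappa> * real i) < x" using x by (rule order_tendstoD)
    then obtain i where i: "3 * DIM('a) * exp (- \<kappa> * real i) < x" unfolding eventually_sequentially by blast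
    have "prob ?N \<le> prob (space M - good (scale i))" using sets by (intro finite_measure_mono) auto
    also have "\<dots> \<le> 3 * DIM('a) * exp (- \<kappa> * scale i)" by (rule \<kappa>(2)[OF scale_ge])
    also have "\<dots> \<le> 3 * DIM('a) * exp (- \<kappa> * real i)" using \<kappa>(1) by (simp add: scale_def)
    finally show "prob ?N \<le> 0 + x" using i by simp
  qed
  then have "emeasure M ?N = 0" using measure_nonneg[of M ?N] by (simp add: emeasure_eq_measure)
  then show ?thesis using N by (intro AE_I[of _ _ ?N]) auto
qed

lemma determined_Z:
  assumes B: "B \<in> sets borel" "B \<subseteq> ball 0 r"
  shows "as_determined M borel_measures (\<lambda>\<omega>. meas_restr (\<Phi> \<omega>) B) borel_measures (\<lambda>\<omega>. meas_restr (\<Phi> \<omega>) (Z \<omega>))"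
  unfolding as_determined_def
proof (rule bexI[OF _ vertex_measure_measurable[OF B(1)]])
  show "AE \<omega> in M. meas_restr (\<Phi> \<omega>) B = vertex_measure B (meas_restr (\<Phi> \<omega>) (Z \<omega>))"
    using AE_good AE_generic
  proof eventually_elim
    fix \<omega> assume ex: "\<exists>i. \<omega> \<in> good (scale i)" and g: "generic (\<eta> \<omega>)"
    show "meas_restr (\<Phi> \<omega>) B = vertex_measure B (meas_restr (\<Phi> \<omega>) (Z \<omega>))"
    proof (cases rule: first_of_cases[of \<omega> "\<lambda>i. good (scale i)" "\<lambda>i. annulus r (scale i)" "- ball 0 r"])
      case (1 i)
      have "2 * r \<le> scale i" using scale_ge[of i] by simp
      then show ?thesis using good_determined[OF 1(1) g scale_ge_1 _ B] 1(3) by (simp add: Z_def)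
    qed (use ex in blast)
  qed
qed

lemma tail_Z:
  "\<exists>c1>0. \<exists>c2>0. \<forall>s\<ge>1. {\<omega>\<in>space M. origin_radius (Z \<omega>) > ereal s} \<in> sets M \<and>
    prob {\<omega>\<in>space M. origin_radius (Z \<omega>) > ereal s} \<le> c1 * exp (- c2 * s)"
proof -
  obtain \<kappa> where \<kappa>: "0 < \<kappa>" "\<And>n. 2 * (r + 1) \<le> n \<Longrightarrow> prob (space M - good n) \<le> 3 * DIM('a) * exp (- \<kappa> * n)"
    using prob_not_good by blast
  have sets: "good (scale i) \<in> sets M" for i by (rule sets_good[OF scale_ge])
  let ?T = "\<lambda>s. {\<omega>\<in>space M. origin_radius (Z \<omega>) > ereal s}"
  have T: "?T s \<in> sets M" for s unfolding Z_def using sets by (intro sets_first_of)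
  have R: "0 < R0" using R0_ge(2) by linarith
  \<comment> \<open>The first summand covers radii below the outer radius of the first annulus, the
    second the rounding of \<open>s / R0\<close> down to a scale. The rate is
    \<open>\<kappa> / R0\<close> because the annulus at scale \<open>n\<close> ends at
    \<open>n * R0\<close>.\<close>
  define c where "c = exp (\<kappa> * scale 0) + 3 * DIM('a) * exp \<kappa>"
  have c: "0 < c" unfolding c_def by (intro add_pos_nonneg) auto
  have "prob (?T s) \<le> c * exp (- (\<kappa> / R0) * s)" for s
  proof (cases "s < scale 0 * R0")
    case True
    then have "\<kappa> * (s / R0) \<le> \<kappa> * scale 0" using \<kappa>(1) R by (intro mult_left_mono) (auto simp: field_simps)
    then have "1 \<le> exp (\<kappa> * scale 0) * exp (- (\<kappa> / R0) * s)" by (simp add: exp_add[symmetric])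
    also have "\<dots> \<le> c * exp (- (\<kappa> / R0) * s)" unfolding c_def by (intro mult_right_mono) auto
    finally show ?thesis using prob_le_1[of "?T s"] by linarith
  next
    case False
    define i where "i = nat \<lfloor>s / R0 - scale 0\<rfloor>"
    have "0 \<le> s / R0 - scale 0" using False R by (simp add: field_simps)
    then have i: "scale i \<le> s / R0" "s / R0 - 1 \<le> scale i" unfolding i_def scale_def by (simp_all) linarith+
    have "?T s \<subseteq> space M - good (scale i)"
    proof
      fix \<omega> assume \<omega>: "\<omega> \<in> ?T s"
      have "\<omega> \<notin> good (scale i)"
      proof
        assume g: "\<omega> \<in> good (scale i)"
        show False
        proof (cases rule: first_of_cases[of \<omega> "\<lambda>i. good (scale i)" "\<lambda>i. annulus r (scale i)" "- ball 0 r"])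
          case (1 j)
          then have "j \<le> i" using g by (meson not_le)
          then have "annulus r (scale j) \<subseteq> annulus r (scale i)" by (rule incseqD[OF incseq_annulus])
          also have "\<dots> \<subseteq> cball 0 (scale i * R0)" by (auto simp: annulus_def)
          finally have "Z \<omega> \<subseteq> cball 0 (scale i * R0)" using 1(3) by (simp add: Z_def)
          moreover have "0 \<le> scale i * R0" using R scale_ge_1[of i] by simp
          ultimately have "s < scale i * R0" using \<omega> origin_radius_less by blast
          moreover have "scale i * R0 \<le> s" using i(1) R by (simp add: field_simps)
          ultimately show False by simp
        qed (use g in blast)
      qed
      then show "\<omega> \<in> space M - good (scale i)" using \<omega> by blast
    qed
    then have "prob (?T s) \<le> prob (space M - good (scale i))" using sets by (intro finite_measure_mono) auto
    also have "\<dots> \<le> 3 * DIM('a) * exp (- \<kappa> * scale i)" by (rule \<kappa>(2)[OF scale_ge])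
    also have "\<dots> \<le> 3 * DIM('a) * exp (\<kappa> + - (\<kappa> / R0) * s)"
    proof -
      have "\<kappa> * (s / R0 - 1) \<le> \<kappa> * scale i" using i(2) \<kappa>(1) by (intro mult_left_mono) auto
      then show ?thesis by (simp add: algebra_simps)
    qed
    also have "\<dots> = (3 * DIM('a) * exp \<kappa>) * exp (- (\<kappa> / R0) * s)" by (simp only: exp_add mult.assoc)
    also have "\<dots> \<le> c * exp (- (\<kappa> / R0) * s)" unfolding c_def by (intro mult_right_mono) auto
    finally show ?thesis .
  qed
  then show ?thesis using T c \<kappa>(1) R by (intro exI[of _ c] exI[of _ "\<kappa> / R0"] conjI) auto
qed

end

lemma stopping_set_const:
  assumes "closed A" "A \<noteq> {}"
  shows "stopping_set M \<Psi> (\<lambda>_. A)"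
  unfolding stopping_set_def
proof (intro conjI ballI allI impI)
  fix F :: "'a set"
  have "{\<omega>\<in>space M. A \<subseteq> F} = (if A \<subseteq> F then space (sigma_restr M \<Psi> F) else {})"
    by (auto simp: sigma_restr_def)
  then show "{\<omega>\<in>space M. A \<subseteq> F} \<in> sets (sigma_restr M \<Psi> F)" by auto
qed (use assms in auto)

theorem theorem4p3:
  fixes M :: "'w measure"
    and \<eta> :: "'w \<Rightarrow> 'a::euclidean_space set set"
    and Q :: "'a measure" and \<gamma> :: real and m :: nat and B :: "'a set"
  assumes "prob_space M"
    and "DIM('a) \<ge> 2"
    and "\<gamma> > 0"
    and "directional_distribution Q"
    and "poisson_hyperplane_process M \<gamma> Q \<eta>"
    and "1 \<le> m" and "m \<le> DIM('a)"
    and "B \<in> sets borel" and "bounded B"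
  defines "\<Phi> \<equiv> \<lambda>\<omega>. intersection_measure m (\<eta> \<omega>)"
  shows "\<exists>Z. stopping_set M \<Phi> Z \<and>
           (\<forall>\<omega>\<in>space M. Z \<omega> \<subseteq> - B) \<and>
           as_determined M borel_measures (\<lambda>\<omega>. meas_restr (\<Phi> \<omega>) B)
             borel_measures (\<lambda>\<omega>. meas_restr (\<Phi> \<omega>) (Z \<omega>)) \<and>
           (\<exists>c1 > 0. \<exists>c2 > 0. \<forall>s \<ge> (1::real).
              {\<omega>\<in>space M. origin_radius (Z \<omega>) > ereal s} \<in> sets M \<and>
              measure M {\<omega>\<in>space M. origin_radius (Z \<omega>) > ereal s} \<le> c1 * exp (- c2 * s))"
proof -
  interpret poisson_hyperplanes M \<eta> Q \<gamma>
    using assms(1,3-5) by (intro poisson_hyperplanes.intro poisson_hyperplanes_axioms.intro)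
  obtain k where k: "\<And>x. x \<in> B \<Longrightarrow> norm x \<le> k" using assms(9) unfolding bounded_iff by blast
  \<comment> \<open>Adding 1 puts \<open>B\<close> into the open ball and keeps \<open>r\<close>
    positive.\<close>
  define r where "r = max k 0 + 1"
  have r: "0 < r" by (simp add: r_def)
  have "norm x < r" if "x \<in> B" for x using k[OF that] by (simp add: r_def)
  then have B: "B \<subseteq> ball 0 r" by auto
  show ?thesis
  proof (cases "m < DIM('a)")
    case True
    have sub: "shell r \<subseteq> - ball (0::'a) r" "shell r \<subseteq> cball (0::'a) (5 * r)" by (auto simp: shell_def)
    obtain x :: 'a where "norm x = r" using vector_choose_size[of r] r by auto
    then have "x \<in> shell r" using r by (simp add: shell_def)
    then have "stopping_set M \<Phi> (\<lambda>_. shell r)" using closed_shell by (intro stopping_set_const) auto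
    moreover have "\<forall>\<omega>\<in>space M. shell r \<subseteq> - B" using sub(1) B by blast
    moreover have "as_determined M borel_measures (\<lambda>\<omega>. meas_restr (\<Phi> \<omega>) B) borel_measures (\<lambda>\<omega>. meas_restr (\<Phi> \<omega>) (shell r))"
      unfolding \<Phi>_def by (rule AE_flats_determined[OF True r assms(8) B])
    \<comment> \<open>The radius of the shell is at most \<open>5 * r\<close>, so the probability
      vanishes beyond that and the bound is at least 1 before.\<close>
    moreover have "prob {\<omega>\<in>space M. origin_radius (shell r :: 'a set) > ereal s} \<le> exp (5 * r) * exp (- 1 * s)" for s
    proof (cases "origin_radius (shell r :: 'a set) > ereal s")
      case True
      then have "s < 5 * r" using origin_radius_less[OF True _ sub(2)] r by simp
      then have "1 \<le> exp (5 * r) * exp (- 1 * s)" by (simp add: exp_add[symmetric])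
      then show ?thesis using prob_le_1 order_trans by blast
    qed simp
    moreover have "{\<omega>\<in>space M. origin_radius (shell r :: 'a set) > ereal s} \<in> sets M" for s by simp
    ultimately show ?thesis
      by (intro exI[of _ "\<lambda>_. shell r"] conjI exI[of _ "exp (5 * r)"] exI[of _ "1::real"]) auto
  next
    case False
    then have m: "m = DIM('a)" using assms(7) by simp
    obtain U e where U: "frame U e" "\<forall>u\<in>U. \<forall>\<delta>>0. 0 < measure Q (sphere 0 1 \<inter> ball u \<delta>)"
      using support_frame by blast
    obtain D :: "'a set" where D: "countable D" "\<And>O'. open O' \<Longrightarrow> O' \<noteq> {} \<Longrightarrow> \<exists>d\<in>D. d \<in> O'"
      using countable_dense_exists by blast
    interpret framed_process M \<eta> Q \<gamma> U e D r
      using poisson_hyperplanes_axioms U D r assms(2)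
      by (intro framed_process.intro framed_process_axioms.intro) auto
    have "\<forall>\<omega>\<in>space M. Z \<omega> \<subseteq> - B" using Z_sub B by blast
    then show ?thesis
      using stopping_set_Z determined_Z[OF assms(8) B] tail_Z unfolding \<Phi>_def m by blast
  qed
qed

end
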